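(* Let Assumption U and Assumption P (stated in the context) hold. An admissible policy $(\underline{x}_*,\underline{C}_* )\in\mathcal{B}_w$, with $x_*:=\sum_{i=1}^nx^i_*$ and $C_*:=\sum_{i=1}^nC^i_*$, is optimal for the social planner problem $\sup_{(\underline{x},\underline{C})\in\mathcal{B}_w}\sum_{i=1}^n\gamma^iU^i(x^i,C^i;C^{-i})$ if and only if there exists a Lagrange multiplier $\lambda_*>0$ such that the following four conditions hold: $$E\Big[\int_0^T\psi_x(t)x_*(t)\,dt+\int_0^T\psi_c(t)\,dC_*(t)\Big]=w;$$ $$E\Big[\int_\tau^Te^{-\int_0^tr(s)ds}\sum_{i=1}^n\gamma^iu^i_c(x^i_*(t),C_*(t))\,dt\,\Big|\,\mathcal{F}_\tau\Big]\le\lambda_*\psi_c(\tau)\quad P\text{-a.s. for all }\tau\in\mathcal{T};$$ $$E\Big[\int_0^T\Big(E\Big[\int_t^Te^{-\int_0^sr(u)du}\sum_{i=1}^n\gamma^iu^i_c(x^i_*(s),C_*(s))\,ds\,\Big|\,\mathcal{F}_t\Big]-\lambda_*\psi_c(t)\Big)dC_*(t)\Big]=0;$$ $$\gamma^ie^{-\int_0^tr(s)ds}u^i_x(x^i_*(t),C_*(t))\le\lambda_*\psi_x(t)\quad P\otimes dt\text{-a.e., with equality on }\{x^i_*>0\},\ i=1,\dots,n.$$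
   Context: Setting. Fix $0<T\le\infty$, a number $n\ge1$ of agents, and a filtered probability space $(\Omega,\mathcal{F},\{\mathcal{F}_t\}_{t\in[0,T]},P)$ satisfying the usual conditions, with expectation $E$. $\mathcal{T}$ is the set of all $(\mathcal{F}_t)$-stopping times with values in $[0,T]$ a.s. Let $w^i>0$ be initial wealths, $\psi_x,\psi_c$ strictly positive price processes, $r$ a discount rate process. For nonnegative processes set $$\Psi(x^i,C^i):=E\Big[\int_0^T\psi_x(t)x^i(t)\,dt+\int_0^T\psi_c(t)\,dC^i(t)\Big].$$ For a nondecreasing right-continuous $C$, $\int_0^T(\cdot)\,dC(t)$ denotes the Lebesgue–Stieltjes integral over $[0,T]$, including a possible point mass $C(0)$ at $t=0$ (convention $C(0-)=0$). The budget sets are $$\mathcal{B}_{w^i}:=\{(x^i,C^i):\Omega\times[0,T]\to\mathbb{R}_+^2\text{ optional}:\ C^i\text{ right-continuous, nondecreasing},\ C^i(0-)=0\ P\text{-a.s.},\ \Psi(x^i,C^i)\le w^i\}.$$ Payoffs: with $C:=\sum_{j}C^j$, $C^{-i}:=\sum_{j\ne i}C^j$ and $u^i:\mathbb{R}_+^2\to\mathbb{R}_+$, $$U^i(x^i,C^i;C^{-i}):=E\Big[\int_0^T e^{-\int_0^t r(s)ds}u^i(x^i(t),C(t))\,dt\Big].$$ Subscripts on $u^i$ denote partial derivatives. Social planner. $w:=\sum_i w^i$; $(\underline{x},\underline{C})=(x^1,\dots,x^n,C^1,\dots,C^n)$; $$\mathcal{B}_w:=\{(\underline{x},\underline{C}):\Omega\times[0,T]\to\mathbb{R}_+^{2n}\text{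 optional}:\ C^i\text{ right-continuous, nondecreasing},\ C^i(0-)=0\ P\text{-a.s. for all }i,\ \sum_{i=1}^n\Psi(x^i,C^i)\le w\}.$$ A policy is admissible if it belongs to $\mathcal{B}_w$. The weights satisfy $\gamma^i>0$, $\sum_i\gamma^i=1$. Assumption U. (i) Each $u^i$ is increasing and strictly concave on $\mathbb{R}_+^2$ and twice continuously differentiable on $\mathbb{R}_{++}^2$ with negative definite Hessian; moreover $\lim_{x\downarrow0}u^i_x(x,c)=+\infty$ and $\lim_{x\uparrow\infty}u^i_x(x,c)=0$ for any $c>0$. (ii) For each $i$ the family $e^{-\int_0^t r(\omega,s)ds}u^i(x^i(\omega,t),C(\omega,t))$, indexed by $((x^j,C^j))_{j}\in\prod_{j=1}^n\mathcal{B}_{w^j}$ with $C=\sum_jC^j$, is $P\otimes dt$-uniformly integrable. Assumption P. (i) $\psi_c=\{\psi_c(t),t\in[0,T]\}$ is adapted, right-continuous, $\psi_c(t)=e^{-\int_0^t r_c(s)ds}\mathcal{E}_c(t)$ a.s. for every $t\in[0,T]$, with $r_c$ a uniformly bounded, strictly positive process and $\mathcal{E}_c=\{\mathcal{E}_c(t),t\in[0,T]\}$ an exponential martingale (strictly positive, mean one); if $T=\infty$ then $\psi_c(T)=0$ a.s. (ii) $\psi_x$ is adapted, right-continuous, $\psi_x(t)=e^{-\int_0^t r_x(s)ds}\mathcal{E}_x(t)$ a.s. for every $t\in[0,T]$, with $r_x$ uniformly bounded and strictly positive and $\mathcal{E}_x$ an exponential martingale. (iii) $r$ is optional, strictly positive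 and uniformly bounded.
   Formalization: Added assumption: for a.e. (ω,t) with C_*(t)=0, each u^i has a (one-sided, possibly infinite) gradient at (x^i_*(t),0). Assumption U gives derivatives only on the open quadrant, and the equivalence fails without this, e.g. if u^i(·,0) has a kink at x^i_*. *)

theory Defs
  imports "HOL-Probability.Probability"
begin

text \<open>
  Time is the type \<^typ>\<open>ennreal\<close>, so that a horizon \<open>T > 0\<close> is finite or infinite and \<open>[0,T]\<close> is
  \<^term>\<open>{..T :: ennreal}\<close>, including the endpoint \<open>\<infinity>\<close> if \<open>T = \<infinity>\<close>. Processes take the time argument
  first; their values after \<open>T\<close> and off the sample space play no role. A filtration is a family
  indexed by the whole time type; one on \<open>[0,T]\<close> is extended beyond \<open>T\<close> in any monotone way,
  for instance constantly.
\<close>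

type_synonym 'a process = "ennreal \<Rightarrow> 'a \<Rightarrow> real"

section \<open>Filtered probability spaces and processes\<close>

definition usual_conditions :: "ennreal \<Rightarrow> 'a measure \<Rightarrow> (ennreal \<Rightarrow> 'a measure) \<Rightarrow> bool" where
  "usual_conditions T M F \<longleftrightarrow>
     prob_space M \<and> filtration (space M) F \<and> (\<forall>t. subalgebra M (F t)) \<and>
     (\<forall>t<T. sets (F t) = (\<Inter>s\<in>{t<..T}. sets (F s))) \<and>
     (\<forall>N\<in>null_sets M. \<forall>A\<subseteq>N. A \<in> sets (F 0))"

definition stopping_times ::
  "ennreal \<Rightarrow> 'a measure \<Rightarrow> (ennreal \<Rightarrow> 'a measure) \<Rightarrow> ('a \<Rightarrow> ennreal) set" where
  "stopping_times T M F = {\<tau>. stopping_time F \<tau> \<and> (AE \<omega> in M. \<tau> \<omega> \<le> T)}"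

definition adapted :: "ennreal \<Rightarrow> (ennreal \<Rightarrow> 'a measure) \<Rightarrow> 'a process \<Rightarrow> bool" where
  "adapted T F X \<longleftrightarrow> (\<forall>t\<le>T. X t \<in> borel_measurable (F t))"

definition right_continuous_path :: "ennreal \<Rightarrow> (ennreal \<Rightarrow> real) \<Rightarrow> bool" where
  "right_continuous_path T f \<longleftrightarrow> (\<forall>t<T. continuous (at_right t) f)"

definition cadlag_path :: "ennreal \<Rightarrow> (ennreal \<Rightarrow> real) \<Rightarrow> bool" where
  "cadlag_path T f \<longleftrightarrow> right_continuous_path T f \<and>
     (\<forall>t\<le>T. 0 < t \<longrightarrow> (\<exists>l. (f \<longlongrightarrow> l) (at_left t)))"

text \<open>The optional sigma-algebra is generated by the adapted cadlag processes.\<close>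

definition optional_sigma ::
  "ennreal \<Rightarrow> 'a measure \<Rightarrow> (ennreal \<Rightarrow> 'a measure) \<Rightarrow> (ennreal \<times> 'a) measure" where
  "optional_sigma T M F = sigma ({..T} \<times> space M)
     {{(t, \<omega>) \<in> {..T} \<times> space M. X t \<omega> \<in> B} | X B.
        adapted T F X \<and> (\<forall>\<omega>\<in>space M. cadlag_path T (\<lambda>t. X t \<omega>)) \<and> B \<in> sets borel}"

definition optional :: "ennreal \<Rightarrow> 'a measure \<Rightarrow> (ennreal \<Rightarrow> 'a measure) \<Rightarrow> 'a process \<Rightarrow> bool" where
  "optional T M F X \<longleftrightarrow> (\<lambda>(t, \<omega>). X t \<omega>) \<in> borel_measurable (optional_sigma T M F)"

definition martingale :: "ennreal \<Rightarrow> 'a measure \<Rightarrow> (ennreal \<Rightarrow> 'a measure) \<Rightarrow> 'a process \<Rightarrow> bool" where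
  "martingale T M F X \<longleftrightarrow> adapted T F X \<and> (\<forall>t\<le>T. integrable M (X t)) \<and>
     (\<forall>s t. s \<le> t \<longrightarrow> t \<le> T \<longrightarrow> (AE \<omega> in M. real_cond_exp M (F s) (X t) \<omega> = X s \<omega>))"

definition exponential_martingale ::
  "ennreal \<Rightarrow> 'a measure \<Rightarrow> (ennreal \<Rightarrow> 'a measure) \<Rightarrow> 'a process \<Rightarrow> bool" where
  "exponential_martingale T M F X \<longleftrightarrow> martingale T M F X \<and>
     (\<forall>t\<le>T. (\<forall>\<omega>\<in>space M. 0 < X t \<omega>) \<and> (\<integral>\<omega>. X t \<omega> \<partial>M) = 1)"

section \<open>Integration in time\<close>

text \<open>Lebesgue measure \<open>dt\<close> on \<open>[0,T]\<close>; for \<open>T = \<infinity>\<close> the endpoint \<open>\<infinity>\<close> has measure zero.\<close>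

definition leb :: "ennreal \<Rightarrow> ennreal measure" where
  "leb T = distr (restrict_space lborel {s::real. 0 \<le> s \<and> ennreal s \<le> T})
             (restrict_space borel {..T}) ennreal"

text \<open>
  The Lebesgue--Stieltjes measure \<open>dC\<close> on \<open>[0,T]\<close>: the measure with \<open>dC([0,t]) = C(t)\<close> for
  \<open>t \<le> T\<close>. This is the convention \<open>C(0-) = 0\<close>, with a point mass \<open>C(0)\<close> at \<open>0\<close>.
\<close>

definition stieltjes :: "ennreal \<Rightarrow> (ennreal \<Rightarrow> real) \<Rightarrow> ennreal measure" where
  "stieltjes T C = extend_measure {..T} {..T} atMost (\<lambda>t. ennreal (C t))"

text \<open>
  \<open>exp (- \<integral>\<^sub>0\<^sup>t \<rho>(s) ds)\<close> for a nonnegative rate \<open>\<rho>\<close>, read as \<open>0\<close> if the integral diverges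
  (possible only at \<open>t = \<infinity>\<close> for bounded rates).
\<close>

definition discount :: "(ennreal \<Rightarrow> real) \<Rightarrow> ennreal \<Rightarrow> real" where
  "discount \<rho> t = (let I = (\<integral>\<^sup>+ s. ennreal (\<rho> s) \<partial>leb t) in if I = \<infinity> then 0 else exp (- enn2real I))"

text \<open>
  Uniform integrability over a possibly infinite sigma-finite measure; on a finite measure this is
  the usual notion, with constant bounds in place of \<open>g\<close>.
\<close>

definition uniformly_integrable :: "'b measure \<Rightarrow> ('b \<Rightarrow> real) set \<Rightarrow> bool" where
  "uniformly_integrable \<mu> H \<longleftrightarrow> (\<forall>f\<in>H. integrable \<mu> f) \<and>
     (\<forall>e>0. \<exists>g. integrable \<mu> g \<and> (\<forall>z\<in>space \<mu>. 0 \<le> g z) \<and>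
        (\<forall>f\<in>H. (\<integral>z. max 0 (\<bar>f z\<bar> - g z) \<partial>\<mu>) \<le> e))"

section \<open>Utility functions\<close>

definition nonneg_quadrant :: "(real \<times> real) set" where
  "nonneg_quadrant = {0..} \<times> {0..}"

definition pos_quadrant :: "(real \<times> real) set" where
  "pos_quadrant = {0<..} \<times> {0<..}"

text \<open>
  Partial derivatives of a function on the closed quadrant, with extended real values: difference
  quotients are formed within \<open>[0,\<infinity>)\<close>, so that they are one-sided where the argument vanishes.
\<close>

definition partial_x :: "(real \<times> real \<Rightarrow> real) \<Rightarrow> real \<Rightarrow> real \<Rightarrow> ereal" where
  "partial_x u x c = Lim (at x within {0..}) (\<lambda>y. ereal ((u (y, c) - u (x, c)) / (y - x)))"

definition partial_c :: "(real \<times> real \<Rightarrow> real) \<Rightarrow> real \<Rightarrow> real \<Rightarrow> ereal" where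
  "partial_c u x c = Lim (at c within {0..}) (\<lambda>k. ereal ((u (x, k) - u (x, c)) / (k - c)))"

text \<open>
  The partial derivatives exist at \<open>(x, c)\<close> and form a gradient of \<open>u\<close> relative to the closed
  quadrant: they represent all directional derivatives into it. For a concave function this is
  ordinary differentiability at interior points. At points \<open>(x, 0)\<close>, where smoothness on the open
  quadrant gives no information, a strictly concave increasing function may have a kink along the
  edge, and then no single value of the partial derivative satisfies the first-order conditions.
\<close>

definition has_gradient :: "(real \<times> real \<Rightarrow> real) \<Rightarrow> real \<Rightarrow> real \<Rightarrow> bool" where
  "has_gradient u x c \<longleftrightarrow> (\<forall>y\<ge>0. \<forall>k\<ge>0.
     ((\<lambda>e. ereal ((u (x + e * (y - x), c + e * (k - c)) - u (x, c)) / e))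
        \<longlongrightarrow> partial_x u x c * ereal (y - x) + partial_c u x c * ereal (k - c)) (at_right 0))"

definition strictly_concave_on :: "'b::real_vector set \<Rightarrow> ('b \<Rightarrow> real) \<Rightarrow> bool" where
  "strictly_concave_on S f \<longleftrightarrow> convex S \<and>
     (\<forall>p\<in>S. \<forall>q\<in>S. \<forall>a. p \<noteq> q \<longrightarrow> 0 < a \<longrightarrow> a < 1 \<longrightarrow>
        (1 - a) * f p + a * f q < f ((1 - a) *\<^sub>R p + a *\<^sub>R q))"

definition C2_negative_definite_on ::
  "'b::real_normed_vector set \<Rightarrow> ('b \<Rightarrow> real) \<Rightarrow> bool" where
  "C2_negative_definite_on S f \<longleftrightarrow>
     (\<exists>(f' :: 'b \<Rightarrow> 'b \<Rightarrow>\<^sub>L real) (f'' :: 'b \<Rightarrow> 'b \<Rightarrow>\<^sub>L 'b \<Rightarrow>\<^sub>L real).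
        (\<forall>z\<in>S. (f has_derivative blinfun_apply (f' z)) (at z)) \<and>
        (\<forall>z\<in>S. (f' has_derivative blinfun_apply (f'' z)) (at z)) \<and>
        continuous_on S f'' \<and>
        (\<forall>z\<in>S. \<forall>h. h \<noteq> 0 \<longrightarrow> blinfun_apply (blinfun_apply (f'' z) h) h < 0))"

definition utility :: "(real \<times> real \<Rightarrow> real) \<Rightarrow> bool" where
  "utility u \<longleftrightarrow>
     (\<forall>z\<in>nonneg_quadrant. 0 \<le> u z) \<and>
     (\<forall>x c y k. 0 \<le> x \<longrightarrow> x \<le> y \<longrightarrow> 0 \<le> c \<longrightarrow> c \<le> k \<longrightarrow> u (x, c) \<le> u (y, k)) \<and>
     strictly_concave_on nonneg_quadrant u \<and>
     C2_negative_definite_on pos_quadrant u \<and>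
     (\<forall>c>0. ((\<lambda>x. partial_x u x c) \<longlongrightarrow> \<infinity>) (at_right 0) \<and>
            ((\<lambda>x. partial_x u x c) \<longlongrightarrow> 0) at_top)"

section \<open>Consumption, contributions and payoffs\<close>

definition contribution_plan ::
  "ennreal \<Rightarrow> 'a measure \<Rightarrow> (ennreal \<Rightarrow> 'a measure) \<Rightarrow> 'a process \<Rightarrow> 'a process \<Rightarrow> bool" where
  "contribution_plan T M F x C \<longleftrightarrow>
     optional T M F x \<and> optional T M F C \<and>
     (\<forall>t\<le>T. \<forall>\<omega>\<in>space M. 0 \<le> x t \<omega> \<and> 0 \<le> C t \<omega>) \<and>
     (AE \<omega> in M. right_continuous_path T (\<lambda>t. C t \<omega>) \<and> mono_on {..T} (\<lambda>t. C t \<omega>))"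

definition cost ::
  "ennreal \<Rightarrow> 'a measure \<Rightarrow> 'a process \<Rightarrow> 'a process \<Rightarrow> 'a process \<Rightarrow> 'a process \<Rightarrow> ennreal" where
  "cost T M \<psi>x \<psi>c x C = (\<integral>\<^sup>+ \<omega>.
      ((\<integral>\<^sup>+ t. ennreal (\<psi>x t \<omega> * x t \<omega>) \<partial>leb T) +
       (\<integral>\<^sup>+ t. ennreal (\<psi>c t \<omega>) \<partial>stieltjes T (\<lambda>t. C t \<omega>))) \<partial>M)"

definition budget_set ::
  "ennreal \<Rightarrow> 'a measure \<Rightarrow> (ennreal \<Rightarrow> 'a measure) \<Rightarrow> 'a process \<Rightarrow> 'a process \<Rightarrow> real
    \<Rightarrow> ('a process \<times> 'a process) set" where
  "budget_set T M F \<psi>x \<psi>c w =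
     {(x, C). contribution_plan T M F x C \<and> cost T M \<psi>x \<psi>c x C \<le> ennreal w}"

text \<open>Agents are the indices \<open>i < n\<close>.\<close>

definition planner_set ::
  "nat \<Rightarrow> ennreal \<Rightarrow> 'a measure \<Rightarrow> (ennreal \<Rightarrow> 'a measure) \<Rightarrow> 'a process \<Rightarrow> 'a process \<Rightarrow> real
    \<Rightarrow> ((nat \<Rightarrow> 'a process) \<times> (nat \<Rightarrow> 'a process)) set" where
  "planner_set n T M F \<psi>x \<psi>c w =
     {(x, C). (\<forall>i<n. contribution_plan T M F (x i) (C i)) \<and>
              (\<Sum>i<n. cost T M \<psi>x \<psi>c (x i) (C i)) \<le> ennreal w}"

definition payoff ::
  "ennreal \<Rightarrow> 'a measure \<Rightarrow> 'a process \<Rightarrow> (real \<times> real \<Rightarrow> real)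
    \<Rightarrow> 'a process \<Rightarrow> 'a process \<Rightarrow> 'a process \<Rightarrow> ennreal" where
  "payoff T M r u x C C' = (\<integral>\<^sup>+ \<omega>. (\<integral>\<^sup>+ t.
      ennreal (discount (\<lambda>s. r s \<omega>) t * u (x t \<omega>, C t \<omega> + C' t \<omega>)) \<partial>leb T) \<partial>M)"

definition welfare ::
  "nat \<Rightarrow> ennreal \<Rightarrow> 'a measure \<Rightarrow> 'a process \<Rightarrow> (nat \<Rightarrow> real \<times> real \<Rightarrow> real) \<Rightarrow> (nat \<Rightarrow> real)
    \<Rightarrow> (nat \<Rightarrow> 'a process) \<Rightarrow> (nat \<Rightarrow> 'a process) \<Rightarrow> ennreal" where
  "welfare n T M r u \<gamma> x C = (\<Sum>i<n. ennreal (\<gamma> i) *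
      payoff T M r (u i) (x i) (C i) (\<lambda>t \<omega>. \<Sum>j\<in>{..<n} - {i}. C j t \<omega>))"

section \<open>Standing assumptions\<close>

definition assumption_U ::
  "nat \<Rightarrow> ennreal \<Rightarrow> 'a measure \<Rightarrow> (ennreal \<Rightarrow> 'a measure) \<Rightarrow> 'a process \<Rightarrow> 'a process \<Rightarrow> 'a process
    \<Rightarrow> (nat \<Rightarrow> real) \<Rightarrow> (nat \<Rightarrow> real \<times> real \<Rightarrow> real) \<Rightarrow> bool" where
  "assumption_U n T M F \<psi>x \<psi>c r w u \<longleftrightarrow>
     (\<forall>i<n. utility (u i)) \<and>
     (\<forall>i<n. uniformly_integrable (M \<Otimes>\<^sub>M leb T)
        {(\<lambda>(\<omega>, t). discount (\<lambda>s. r s \<omega>) t * u i (x i t \<omega>, \<Sum>j<n. C j t \<omega>)) | x C.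
           \<forall>j<n. (x j, C j) \<in> budget_set T M F \<psi>x \<psi>c (w j)})"

definition bounded_rate :: "ennreal \<Rightarrow> 'a measure \<Rightarrow> 'a process \<Rightarrow> bool" where
  "bounded_rate T M \<rho> \<longleftrightarrow>
     (\<lambda>(t, \<omega>). \<rho> t \<omega>) \<in> borel_measurable (restrict_space borel {..T} \<Otimes>\<^sub>M M) \<and>
     (\<exists>K. \<forall>t\<le>T. \<forall>\<omega>\<in>space M. 0 < \<rho> t \<omega> \<and> \<rho> t \<omega> \<le> K)"

text \<open>
  Strict positivity of the price is required at finite times only: over an infinite horizon the
  price of the public good vanishes at \<open>t = \<infinity>\<close>.
\<close>

definition price_process ::
  "ennreal \<Rightarrow> 'a measure \<Rightarrow> (ennreal \<Rightarrow> 'a measure) \<Rightarrow> 'a process \<Rightarrow> bool" where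
  "price_process T M F \<psi> \<longleftrightarrow>
     (\<forall>t\<le>T. t \<noteq> \<infinity> \<longrightarrow> (\<forall>\<omega>\<in>space M. 0 < \<psi> t \<omega>)) \<and>
     adapted T F \<psi> \<and> (\<forall>\<omega>\<in>space M. right_continuous_path T (\<lambda>t. \<psi> t \<omega>)) \<and>
     (\<exists>\<rho> E. bounded_rate T M \<rho> \<and> exponential_martingale T M F E \<and>
        (\<forall>t\<le>T. AE \<omega> in M. \<psi> t \<omega> = discount (\<lambda>s. \<rho> s \<omega>) t * E t \<omega>))"

definition assumption_P ::
  "ennreal \<Rightarrow> 'a measure \<Rightarrow> (ennreal \<Rightarrow> 'a measure) \<Rightarrow> 'a process \<Rightarrow> 'a process \<Rightarrow> 'a process \<Rightarrow> bool" where
  "assumption_P T M F \<psi>x \<psi>c r \<longleftrightarrow>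
     price_process T M F \<psi>c \<and> (T = \<infinity> \<longrightarrow> (AE \<omega> in M. \<psi>c T \<omega> = 0)) \<and>
     price_process T M F \<psi>x \<and>
     optional T M F r \<and> (\<exists>K. \<forall>t\<le>T. \<forall>\<omega>\<in>space M. 0 < r t \<omega> \<and> r t \<omega> \<le> K)"

section \<open>Marginal social utility of the public good\<close>

text \<open>The density \<open>exp (- \<integral>\<^sub>0\<^sup>t r ds) \<Sum>\<^sub>i \<gamma>\<^sup>i u\<^sup>i\<^sub>c(x\<^sup>i(t), C(t))\<close>, with \<open>C\<close> the total contribution.\<close>

definition marginal_density ::
  "nat \<Rightarrow> 'a process \<Rightarrow> (nat \<Rightarrow> real \<times> real \<Rightarrow> real) \<Rightarrow> (nat \<Rightarrow> real)
    \<Rightarrow> (nat \<Rightarrow> 'a process) \<Rightarrow> (nat \<Rightarrow> 'a process) \<Rightarrow> ennreal \<Rightarrow> 'a \<Rightarrow> ennreal" where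
  "marginal_density n r u \<gamma> x C t \<omega> = e2ennreal (ereal (discount (\<lambda>s. r s \<omega>) t) *
      (\<Sum>i<n. ereal (\<gamma> i) * partial_c (u i) (x i t \<omega>) (\<Sum>j<n. C j t \<omega>)))"

definition tail_integral ::
  "ennreal \<Rightarrow> (ennreal \<Rightarrow> 'a \<Rightarrow> ennreal) \<Rightarrow> ennreal \<Rightarrow> 'a \<Rightarrow> ennreal" where
  "tail_integral T \<phi> t \<omega> = (\<integral>\<^sup>+ s\<in>{t..}. \<phi> s \<omega> \<partial>leb T)"

text \<open>
  \<open>Y\<close> is the process \<open>t \<mapsto> E[X(t) | F\<^sub>t]\<close>. Conditional expectations at single times are defined only
  up to null sets depending on \<open>t\<close>, so, in order to integrate over time, this process is taken
  to be the optional projection of \<open>X\<close>, which is unique up to indistinguishability.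
\<close>

definition optional_projection ::
  "ennreal \<Rightarrow> 'a measure \<Rightarrow> (ennreal \<Rightarrow> 'a measure) \<Rightarrow> (ennreal \<Rightarrow> 'a \<Rightarrow> ennreal) \<Rightarrow> 'a process \<Rightarrow> bool" where
  "optional_projection T M F X Y \<longleftrightarrow>
     optional T M F Y \<and> (\<forall>t\<le>T. \<forall>\<omega>\<in>space M. 0 \<le> Y t \<omega>) \<and>
     (\<forall>\<tau>\<in>stopping_times T M F. AE \<omega> in M.
        nn_cond_exp M (filtration.pre_sigma (space M) F \<tau>) (\<lambda>\<omega>. X (\<tau> \<omega>) \<omega>) \<omega> = ennreal (Y (\<tau> \<omega>) \<omega>))"

end

theory Submission
  imports Defs
begin

text \<open>
  Fix a concave objective and an admissible policy. Along segments to other admissible policies the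
  difference quotients of the utilities are monotone, so Fatou's lemma turns optimality into
  optimality for the linearised payoff, whose density is given by the marginal utilities. The
  linearised payoff and the cost are both linear on the cone of all policies, so the multiplier is the
  ratio of their values at the optimum. Testing the linear inequality with consumption plans and with
  plans contributing one unit from a stopping time on gives the two inequalities; equality at the
  optimum gives the two complementary slackness conditions.

  Integrals with respect to \<open>dC\<close> are reduced to stopping times by the time change
  \<open>s \<mapsto> inf {t. s \<le> C t}\<close>. The optional projection of the tail integral of a density is obtained from
  bounded martingales, whose right-continuous versions exist by Dubins' upcrossing inequality.
  Conversely, the gradient inequality for concave functions bounds the gain of any competitor by the
  linearised gain, which the first-order conditions bound by the multiplier times the change in cost.
\<close>

section \<open>The time interval\<close>

text \<open>Marginal utilities may be infinite on the axes, and nothing but the welfare of the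
  policy is known to be finite in advance. The variational argument therefore forms no differences
  of integrals: difference quotients are shifted by the current utility, identities carry
  nonnegative terms on both sides in \<open>ennreal\<close>, and the finite welfare is what gets
  cancelled. That finiteness is itself indirect: uniform integrability is assumed for individually
  affordable plans only, while the planner may spend all wealth on one agent. Gradients are the
  second obstacle. Where the public good is absent they are a hypothesis; where it is present they
  exist once every agent consumes. The Inada condition supplies this in both directions of the
  equivalence, from finite welfare at an optimum and from the finite price in the first-order
  condition. Finally, a price is only right-continuous, so it is replaced by an optional process
  that agrees with it at almost every time before it is used to cut out a test plan.\<close>

abbreviation time :: "ennreal \<Rightarrow> ennreal measure" where
  "time T \<equiv> restrict_space borel {..T}"

lemma measurable_ennreal_time:
  "ennreal \<in> restrict_space lborel {s::real. 0 \<le> s \<and> ennreal s \<le> T} \<rightarrow>\<^sub>M time T"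
proof (rule measurable_restrict_space2)
  have "ennreal \<in> lborel \<rightarrow>\<^sub>M borel" by simp
  then show "ennreal \<in> restrict_space lborel {s::real. 0 \<le> s \<and> ennreal s \<le> T} \<rightarrow>\<^sub>M borel"
    by (rule measurable_restrict_space1)
  show "ennreal \<in> space (restrict_space lborel {s::real. 0 \<le> s \<and> ennreal s \<le> T}) \<rightarrow> {..T}"
    unfolding space_restrict_space by (rule funcsetI) blast
qed

lemma space_leb [simp]: "space (leb T) = {..T}"
  by (simp add: leb_def space_restrict_space)

lemma sets_leb [measurable_cong, simp]: "sets (leb T) = sets (time T)"
  by (simp add: leb_def)

lemma nn_integral_leb:
  assumes f[measurable]: "f \<in> borel_measurable (time T)"
  shows "(\<integral>\<^sup>+ t. f t \<partial>leb T) = (\<integral>\<^sup>+ s. f (ennreal s) * indicator {s. 0 \<le> s \<and> ennreal s \<le> T} s \<partial>lborel)"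
  unfolding leb_def
  by (simp add: nn_integral_distr[OF measurable_ennreal_time] nn_integral_restrict_space)

lemma measurable_time_mono:
  assumes "s \<le> t" "f \<in> time t \<rightarrow>\<^sub>M N" shows "f \<in> time s \<rightarrow>\<^sub>M N"
proof -
  have "f \<in> restrict_space (time t) {..s} \<rightarrow>\<^sub>M N"
    using assms(2) by (rule measurable_restrict_space1)
  moreover have "restrict_space (time t) {..s} = time s"
    using assms(1) by (auto simp: restrict_restrict_space Int_absorb1)
  ultimately show ?thesis by simp
qed

lemma nn_integral_leb_restrict:
  assumes "t \<le> T" and f[measurable]: "f \<in> borel_measurable (time T)"
  shows "(\<integral>\<^sup>+ s. f s \<partial>leb t) = (\<integral>\<^sup>+ s. f s * indicator {..t} s \<partial>leb T)"
proof -
  have 1: "f \<in> borel_measurable (time t)" using assms measurable_time_mono by blast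
  have 2: "(\<lambda>s. f s * indicator {..t} s) \<in> borel_measurable (time T)"
    by (intro borel_measurable_times_ennreal borel_measurable_indicator f)
      (use assms(1) in \<open>auto simp: sets_restrict_space intro!: image_eqI[of _ _ "{..t}"]\<close>)
  show ?thesis
    unfolding nn_integral_leb[OF 1] nn_integral_leb[OF 2]
    using assms(1) by (intro nn_integral_cong) (auto split: split_indicator)
qed

lemma sets_time_Int: "A \<in> sets borel \<Longrightarrow> A \<inter> {..T} \<in> sets (time T)"
  unfolding sets_restrict_space by blast

lemma AE_leb_neq: "AE t in leb T. t \<noteq> a"
proof (rule AE_I)
  have "ennreal -` ({a} \<inter> {..T}) \<inter> {s. 0 \<le> s \<and> ennreal s \<le> T} \<subseteq> {enn2real a}" by auto
  then have "finite (ennreal -` ({a} \<inter> {..T}) \<inter> {s. 0 \<le> s \<and> ennreal s \<le> T})"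
    by (rule finite_subset) simp
  then have "emeasure lborel (ennreal -` ({a} \<inter> {..T}) \<inter> {s. 0 \<le> s \<and> ennreal s \<le> T}) = 0"
    by (rule emeasure_lborel_countable[OF countable_finite])
  moreover have "{s \<in> space lborel. 0 \<le> s \<and> ennreal s \<le> T} \<in> sets lborel" by measurable
  then have "emeasure (restrict_space lborel {s. 0 \<le> s \<and> ennreal s \<le> T})
      (ennreal -` ({a} \<inter> {..T}) \<inter> {s. 0 \<le> s \<and> ennreal s \<le> T}) =
    emeasure lborel (ennreal -` ({a} \<inter> {..T}) \<inter> {s. 0 \<le> s \<and> ennreal s \<le> T})"
    by (intro emeasure_restrict_space) auto
  ultimately show "emeasure (leb T) ({a} \<inter> {..T}) = 0"
    unfolding leb_def
    by (subst emeasure_distr[OF measurable_ennreal_time sets_time_Int])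
      (simp_all add: space_restrict_space)
  show "{t \<in> space (leb T). \<not> t \<noteq> a} \<subseteq> {a} \<inter> {..T}" unfolding space_leb by blast
  show "{a} \<inter> {..T} \<in> sets (leb T)" unfolding sets_leb by (rule sets_time_Int) simp
qed

lemma AE_leb_finite: "AE t in leb T. t \<noteq> \<infinity>"
  by (rule AE_leb_neq)

lemma AE_leb_not_in: "countable A \<Longrightarrow> AE t in leb T. t \<notin> A"
proof -
  assume "countable A"
  then have "AE t in leb T. \<forall>a\<in>A. t \<noteq> a"
    by (subst AE_ball_countable) (auto intro: AE_leb_neq)
  then show ?thesis by eventually_elim auto
qed

lemma emeasure_leb_finite: "emeasure (leb T) ({..ennreal a} \<inter> {..T}) < \<infinity>"
proof -
  have *: "{..ennreal a} \<inter> {..T} \<in> sets (time T)" by (auto simp: sets_restrict_space)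
  have "emeasure (leb T) ({..ennreal a} \<inter> {..T}) = (\<integral>\<^sup>+ t. indicator ({..ennreal a} \<inter> {..T}) t \<partial>leb T)"
    using * by simp
  also have "\<dots> = (\<integral>\<^sup>+ s. indicator ({..ennreal a} \<inter> {..T}) (ennreal s)
       * indicator {s. 0 \<le> s \<and> ennreal s \<le> T} s \<partial>lborel)"
    by (rule nn_integral_leb) (use * in simp)
  also have "\<dots> \<le> (\<integral>\<^sup>+ s. indicator {0..max 0 a} s \<partial>lborel)"
    by (intro nn_integral_mono) (auto split: split_indicator simp: ennreal_le_iff2)
  also have "\<dots> < \<infinity>" by simp
  finally show ?thesis .
qed

lemma sigma_finite_leb: "sigma_finite_measure (leb T)"
proof
  \<comment> \<open>Bounded intervals exhaust the finite times; the point \<infinity> lies in none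
    of them and is added as a set of measure zero.\<close>
  let ?A = "insert ({\<infinity>} \<inter> {..T}) (range (\<lambda>n::nat. {..ennreal (real n)} \<inter> {..T}))"
  have "\<exists>n::nat. t \<le> ennreal (real n)" if "t \<noteq> \<infinity>" for t
    using that real_arch_simple by (cases t) (auto intro!: ennreal_leI)
  then have "\<Union>?A = space (leb T)" unfolding space_leb by blast
  moreover have "emeasure (leb T) a \<noteq> \<infinity>" if "a \<in> ?A" for a
  proof -
    have "emeasure (leb T) ({\<infinity>} \<inter> {..T}) = 0"
      using AE_leb_finite[of T] sets_time_Int[of "{\<infinity>}" T]
      by (subst (asm) AE_iff_measurable[of "{\<infinity>} \<inter> {..T}"]) auto
    then show ?thesis using that emeasure_leb_finite[of T]
      by (elim insertE imageE) (auto simp: less_top[symmetric])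
  qed
  moreover have "a \<in> sets (leb T)" if "a \<in> ?A" for a
  proof -
    have "a = a \<inter> {..T}" "a \<in> sets borel" using that by auto
    then show ?thesis unfolding sets_leb sets_restrict_space by blast
  qed
  moreover have "countable ?A" by simp
  ultimately show "\<exists>A. countable A \<and> A \<subseteq> sets (leb T) \<and> \<Union>A = space (leb T) \<and>
      (\<forall>a\<in>A. emeasure (leb T) a \<noteq> \<infinity>)"
    by (intro exI[of _ ?A] conjI subsetI ballI)
qed

text \<open>Excludes a degenerate horizon, so that a strictly positive integrand has a strictly
  positive integral in \<open>gain_pos\<close>.\<close>

lemma emeasure_leb_pos:
  assumes "0 < T" shows "emeasure (leb T) {..T} > 0"
proof -
  obtain a where a: "0 < a" "ennreal a \<le> T"
  proof (cases T)
    case (real r) then show ?thesis using assms that[of r] by simp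
  next
    case top then show ?thesis using that[of 1] by simp
  qed
  have *: "{..T} \<in> sets (time T)" by (auto simp: sets_restrict_space)
  have "0 < ennreal a" using a by simp
  also have "\<dots> = (\<integral>\<^sup>+ s. indicator {0..a} s \<partial>lborel)" using a by simp
  also have "\<dots> \<le> (\<integral>\<^sup>+ s. indicator {..T} (ennreal s)
       * indicator {s. 0 \<le> s \<and> ennreal s \<le> T} s \<partial>lborel)"
    using a by (intro nn_integral_mono) (auto split: split_indicator intro: order_trans[OF ennreal_leI])
  also have "\<dots> = (\<integral>\<^sup>+ t. indicator {..T} t \<partial>leb T)"
    by (rule nn_integral_leb[symmetric]) (use * in simp)
  also have "\<dots> = emeasure (leb T) {..T}" using * by simp
  finally show ?thesis .
qed

text \<open>Finite grids increasing to a countable dense set of times; \<open>grid_up\<close> approximates a time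
  strictly from the right (below the horizon), \<open>grid_down\<close> from the left.\<close>

definition grid :: "nat \<Rightarrow> ennreal set" where
  "grid m = from_nat_into (ennreal ` \<rat>) ` {..m}"

definition grid_up :: "nat \<Rightarrow> ennreal \<Rightarrow> ennreal \<Rightarrow> ennreal" where
  "grid_up m T s = Min (insert T {q \<in> grid m. s < q \<and> q < T})"

definition grid_down :: "nat \<Rightarrow> ennreal \<Rightarrow> ennreal" where
  "grid_down m s = Max (insert 0 {q \<in> grid m. q \<le> s})"

lemma finite_grid [simp]: "finite (grid m)"
  by (simp add: grid_def)

lemma grid_mono: "m \<le> k \<Longrightarrow> grid m \<subseteq> grid k"
  by (auto simp: grid_def)

lemma grid_dense:
  assumes "a < b" obtains m q where "q \<in> grid m" "a < q" "q < b"
proof -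
  obtain r :: rat where r: "a < ennreal (real_of_rat r)" "ennreal (real_of_rat r) < b"
    using ennreal_rat_dense[OF assms] by auto
  have "ennreal (real_of_rat r) \<in> ennreal ` \<rat>" by (intro imageI Rats_of_rat)
  moreover have "countable (ennreal ` \<rat>)" by (intro countable_image countable_rat)
  ultimately obtain m where "from_nat_into (ennreal ` \<rat>) m = ennreal (real_of_rat r)"
    using from_nat_into_surj by metis
  then have "ennreal (real_of_rat r) \<in> grid m" unfolding grid_def by (metis imageI atMost_iff order_refl)
  then show ?thesis using r that by blast
qed

lemma grid_up_le: "grid_up m T s \<le> T"
  unfolding grid_up_def by (intro Min_le) auto

lemma less_grid_up: "s < T \<Longrightarrow> s < grid_up m T s"
  unfolding grid_up_def by (subst Min_gr_iff) auto

lemma grid_up_eq [simp]: "T \<le> s \<Longrightarrow> grid_up m T s = T"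
  unfolding grid_up_def by (subst Min_eqI) auto

lemma grid_up_in: "grid_up m T s \<in> insert T (grid m)"
  using Min_in[of "insert T {q \<in> grid m. s < q \<and> q < T}"] unfolding grid_up_def by auto

lemma grid_up_tendsto:
  assumes "s < T" shows "filterlim (\<lambda>m. grid_up m T s) (at_right s) sequentially"
proof (rule filterlim_at_withinI)
  show "(\<lambda>m. grid_up m T s) \<longlonglongrightarrow> s"
  proof (rule order_tendstoI)
    fix a assume "a < s"
    then show "\<forall>\<^sub>F m in sequentially. a < grid_up m T s"
      using less_grid_up[OF assms] by (intro always_eventually) (auto intro: less_trans)
  next
    fix a assume "s < a"
    then obtain m q where q: "q \<in> grid m" "s < q" "q < min a T"
      using grid_dense[of s "min a T"] assms by (metis min_less_iff_conj)
    have "grid_up k T s < a" if "m \<le> k" for k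
    proof -
      have "grid_up k T s \<le> q"
        unfolding grid_up_def using q grid_mono[OF that] by (intro Min_le) auto
      then show ?thesis using q by auto
    qed
    then show "\<forall>\<^sub>F m in sequentially. grid_up m T s < a"
      unfolding eventually_sequentially by auto
  qed
  show "\<forall>\<^sub>F m in sequentially. grid_up m T s \<in> {s<..} - {s}"
    using less_grid_up[OF assms] by (intro always_eventually) auto
qed

lemma measurable_grid_up [measurable]: "grid_up m T \<in> borel \<rightarrow>\<^sub>M borel"
proof (rule borel_measurableI_greater)
  fix y
  \<comment> \<open>Contraposition: the minimum fails to exceed \<open>y\<close> exactly when some
    grid point at most \<open>y\<close> lies strictly to the right of \<open>s\<close>. This leaves
    finitely many closed conditions on \<open>s\<close>.\<close>
  have "y < grid_up m T s \<longleftrightarrow> y < T \<and> (\<forall>q\<in>{q \<in> grid m. q < T \<and> q \<le> y}. q \<le> s)" for s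
    unfolding grid_up_def by (subst Min_gr_iff) (simp_all, meson not_le)
  moreover have "{s \<in> space borel. \<forall>q\<in>{q \<in> grid m. q < T \<and> q \<le> y}. q \<le> s} \<in> sets borel"
    by (intro sets.sets_Collect_finite_All borel_measurable_le) simp_all
  ultimately show "{s \<in> space borel. y < grid_up m T s} \<in> sets borel"
    by (cases "y < T"; simp only: simp_thms; simp?)
qed

lemma grid_down_le: "grid_down m s \<le> s"
  unfolding grid_down_def by (subst Max_le_iff) auto

lemma grid_down_in: "grid_down m s \<in> insert 0 (grid m)"
  using Max_in[of "insert 0 {q \<in> grid m. q \<le> s}"] unfolding grid_down_def by auto

lemma grid_down_tendsto: "(\<lambda>m. grid_down m s) \<longlonglongrightarrow> s"
proof (rule order_tendstoI)
  fix a assume "a < s"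
  then obtain m q where q: "q \<in> grid m" "a < q" "q < s"
    using grid_dense by blast
  have "a < grid_down k s" if "m \<le> k" for k
  proof -
    have "q \<le> grid_down k s"
      unfolding grid_down_def using q grid_mono[OF that] by (intro Max_ge) auto
    then show ?thesis using q by auto
  qed
  then show "\<forall>\<^sub>F m in sequentially. a < grid_down m s"
    unfolding eventually_sequentially by auto
next
  fix a assume "s < a"
  then show "\<forall>\<^sub>F m in sequentially. grid_down m s < a"
    using grid_down_le by (intro always_eventually) (auto intro: le_less_trans)
qed

lemma measurable_grid_down [measurable]: "grid_down m \<in> borel \<rightarrow>\<^sub>M borel"
proof (rule borel_measurableI_less)
  fix y
  have "grid_down m s < y \<longleftrightarrow> 0 < y \<and> (\<forall>q\<in>{q \<in> grid m. y \<le> q}. s < q)" for s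
    unfolding grid_down_def by (subst Max_less_iff) (simp_all, meson not_le)
  moreover have "{s \<in> space borel. \<forall>q\<in>{q \<in> grid m. y \<le> q}. s < q} \<in> sets borel"
    by (intro sets.sets_Collect_finite_All borel_measurable_less) simp_all
  ultimately show "{s \<in> space borel. grid_down m s < y} \<in> sets borel"
    by (cases "0 < y"; simp only: simp_thms; simp?)
qed

text \<open>Lets a process evaluated at a random grid time be handled as a countable composition,
  one fixed time at a time.\<close>

lemma measurable_count_space_finite:
  fixes f :: "'b \<Rightarrow> 'c :: t2_space"
  assumes "f \<in> borel_measurable N" "finite I" "\<And>x. x \<in> space N \<Longrightarrow> f x \<in> I"
  shows "f \<in> N \<rightarrow>\<^sub>M count_space I"
proof (subst measurable_count_space_eq2[OF assms(2)], intro conjI ballI)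
  fix a assume "a \<in> I"
  show "f -` {a} \<inter> space N \<in> sets N"
    using assms(1) by (rule measurable_sets) simp
qed (use assms in auto)

section \<open>Lebesgue--Stieltjes integrals\<close>

definition good_path :: "ennreal \<Rightarrow> (ennreal \<Rightarrow> real) \<Rightarrow> bool" where
  "good_path T f \<longleftrightarrow> right_continuous_path T f \<and> mono_on {..T} f \<and> (\<forall>t\<le>T. 0 \<le> f t)"

text \<open>The generalised inverse of a nondecreasing path. Inserting \<open>T\<close> sends levels
  that are never reached to the horizon, so that all values stay in [0,T].\<close>

definition hit :: "ennreal \<Rightarrow> (ennreal \<Rightarrow> real) \<Rightarrow> real \<Rightarrow> ennreal" where
  "hit T f s = Inf (insert T {t. t \<le> T \<and> s \<le> f t})"

lemma hit_le: "hit T f s \<le> T"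
  unfolding hit_def by (rule Inf_lower) simp

text \<open>By right-continuity the set of times at which the level is exceeded contains its
  infimum. The bound \<open>t < T\<close> matters because \<open>T\<close> is also the value for
  levels that are never reached.\<close>

lemma hit_le_iff:
  assumes f: "good_path T f" and t: "t < T"
  shows "hit T f s \<le> t \<longleftrightarrow> s \<le> f t"
proof
  assume "s \<le> f t"
  then show "hit T f s \<le> t" unfolding hit_def using t by (intro Inf_lower) auto
next
  assume le: "hit T f s \<le> t"
  show "s \<le> f t"
  proof (rule ccontr)
    assume "\<not> s \<le> f t"
    moreover have "(f \<longlongrightarrow> f t) (at_right t)"
      using f t by (auto simp: good_path_def right_continuous_path_def continuous_within)
    ultimately have "\<forall>\<^sub>F y in at_right t. f y < s"
      by (intro order_tendstoD(2)) auto
    then obtain b where b: "t < b" "\<And>y. t < y \<Longrightarrow> y < b \<Longrightarrow> f y < s"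
      using eventually_at_right[OF t] by metis
    \<comment> \<open>The path stays below \<open>s\<close> on (t,b), and by monotonicity also up to
      \<open>t\<close>; so the level set cannot begin before \<open>b\<close>.\<close>
    have "min b T \<le> e" if "e \<in> insert T {t. t \<le> T \<and> s \<le> f t}" for e
    proof (cases "e = T")
      case False
      with that have e: "e \<le> T" "s \<le> f e" by auto
      have "t < e"
      proof (rule ccontr)
        assume "\<not> t < e"
        then have "f e \<le> f t" using f t e by (auto simp: good_path_def mono_on_def not_less)
        then show False using e \<open>\<not> s \<le> f t\<close> by simp
      qed
      then have "\<not> e < b" using b(2)[of e] e by auto
      then show ?thesis by (simp add: min_le_iff_disj not_less)
    qed simp
    then have "min b T \<le> hit T f s" unfolding hit_def by (intro Inf_greatest)
    moreover have "t < min b T" using b t by simp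
    ultimately show False using le by (meson leD order_trans)
  qed
qed

lemma hit_le_iff_final:
  assumes "good_path T f" "t \<le> T" "s \<le> f T"
  shows "hit T f s \<le> t \<longleftrightarrow> s \<le> f t"
  using assms hit_le_iff[OF assms(1), of t s] hit_le[of T f s] by (cases "t = T") auto

lemma measurable_hit: 
  assumes "good_path T f" shows "hit T f \<in> borel \<rightarrow>\<^sub>M time T"
proof (rule measurable_restrict_space2)
  show "hit T f \<in> borel_measurable borel"
  proof (rule borel_measurableI_le)
    fix y
    show "{s \<in> space borel. hit T f s \<le> y} \<in> sets borel"
    proof (cases "y < T")
      case True
      then have "{s \<in> space borel. hit T f s \<le> y} = {..f y}" using hit_le_iff[OF assms] by auto
      then show ?thesis by simp
    next
      case False
      then have "{s \<in> space borel. hit T f s \<le> y} = UNIV" by (auto simp: not_less intro: order_trans[OF hit_le])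
      then show ?thesis by simp
    qed
  qed
qed (simp add: hit_le)

text \<open>Ties the Borel sets to the intersection-stable generator on which
  \<open>extend_measure\<close> prescribes \<open>dC\<close>; uniqueness and linearity in the path
  are proved on this generator.\<close>

lemma sets_time: "sets (time T) = sigma_sets {..T} (atMost ` {..T})"
proof
  have "sigma_sets (space (time T)) (atMost ` {..T}) \<subseteq> sets (time T)"
  proof (rule sets.sigma_sets_subset, safe)
    fix t assume "t \<le> T"
    then have "{..t} = {..t} \<inter> {..T}" by auto
    then show "{..t} \<in> sets (time T)" using sets_time_Int[of "{..t}" T] by simp
  qed
  then show "sigma_sets {..T} (atMost ` {..T}) \<subseteq> sets (time T)"
    by (simp add: space_restrict_space)
next
  let ?N = "sigma {..T} (atMost ` {..T})"
  have sets: "sets ?N = sigma_sets {..T} (atMost ` {..T})" by (rule sets_measure_of) auto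
  have space: "space ?N = {..T}" by (rule space_measure_of) auto
  have "(\<lambda>x. x) \<in> borel_measurable ?N"
  proof (rule borel_measurableI_le)
    fix y
    have "{x \<in> space ?N. x \<le> y} = {..min y T}" unfolding space by auto
    moreover have "{..min y T} \<in> sets ?N" unfolding sets by (rule sigma_sets.Basic) simp
    ultimately show "{x \<in> space ?N. x \<le> y} \<in> sets ?N" by simp
  qed
  show "sets (time T) \<subseteq> sigma_sets {..T} (atMost ` {..T})"
  proof
    fix A assume "A \<in> sets (time T)"
    then obtain B where B: "B \<in> sets borel" "A = {..T} \<inter> B" unfolding sets_restrict_space by blast
    have "(\<lambda>x. x) -` B \<inter> space ?N \<in> sets ?N"
      using \<open>(\<lambda>x. x) \<in> borel_measurable ?N\<close> B(1) by (rule measurable_sets)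
    moreover have "(\<lambda>x. x) -` B \<inter> space ?N = A" unfolding space B(2) by auto
    ultimately show "A \<in> sigma_sets {..T} (atMost ` {..T})" unfolding sets by simp
  qed
qed

lemma space_stieltjes [simp]: "space (stieltjes T f) = {..T}"
  unfolding stieltjes_def by (rule space_extend_measure) auto

lemma sets_stieltjes [measurable_cong, simp]: "sets (stieltjes T f) = sets (time T)"
  unfolding stieltjes_def sets_time by (rule sets_extend_measure) auto

text \<open>\<open>extend_measure\<close> takes the prescribed values only if some measure has them.
  The image of Lebesgue measure on (0, f T] under the generalised inverse is such a measure, and the
  generator determines it. The levels in (0, f 0] are all sent to time 0, which is the point mass
  there.\<close>

lemma stieltjes_eq:
  assumes f: "good_path T f"
  shows "stieltjes T f = distr (restrict_space lborel {0<..f T}) (time T) (hit T f)"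
    and emeasure_stieltjes: "\<And>t. t \<le> T \<Longrightarrow> emeasure (stieltjes T f) {..t} = ennreal (f t)"
proof -
  let ?N = "distr (restrict_space lborel {0<..f T}) (time T) (hit T f)"
  have m: "hit T f \<in> restrict_space lborel {0<..f T} \<rightarrow>\<^sub>M time T"
    using measurable_hit[OF f] by (intro measurable_restrict_space1) simp
  have N: "emeasure ?N {..t} = ennreal (f t)" if "t \<le> T" for t
  proof -
    have mono: "f t \<le> f T" using f that by (auto simp: good_path_def mono_on_def)
    have "{..t} \<in> sets (time T)" using that unfolding sets_time by (intro sigma_sets.Basic) simp
    then have "emeasure ?N {..t} = emeasure (restrict_space lborel {0<..f T})
        (hit T f -` {..t} \<inter> space (restrict_space lborel {0<..f T}))"
      by (rule emeasure_distr[OF m])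
    also have "hit T f -` {..t} \<inter> space (restrict_space lborel {0<..f T}) = {0<..f t}"
      using hit_le_iff_final[OF f that] mono by (auto simp: space_restrict_space)
    also have "emeasure (restrict_space lborel {0<..f T}) {0<..f t} = emeasure lborel {0<..f t}"
      using mono by (intro emeasure_restrict_space) auto
    also have "\<dots> = ennreal (f t)" using f that by (simp add: good_path_def)
    finally show ?thesis .
  qed
  show S: "emeasure (stieltjes T f) {..t} = ennreal (f t)" if "t \<le> T" for t
  proof (rule emeasure_extend_measure[OF stieltjes_def, where \<mu>'="emeasure ?N"])
    have sets: "sets (stieltjes T f) = sets ?N" by simp
    show "positive (sets (stieltjes T f)) (emeasure ?N)"
      unfolding sets by (rule emeasure_positive)
    show "countably_additive (sets (stieltjes T f)) (emeasure ?N)"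
      unfolding sets by (rule emeasure_countably_additive)
  qed (use that N in auto)
  show "stieltjes T f = ?N"
  proof (rule measure_eqI_generator_eq[where E="atMost ` {..T}" and \<Omega>="{..T}" and A="\<lambda>_. {..T}"])
    show "Int_stable (atMost ` {..T})"
    proof (rule Int_stableI, safe)
      fix a b assume "a \<le> T" "b \<le> T"
      then show "{..a} \<inter> {..b} \<in> atMost ` {..T}"
        by (intro image_eqI[of _ _ "min a b"]) (auto simp: min_le_iff_disj)
    qed
  qed (auto simp: S N sets_time)
qed

lemma nn_integral_stieltjes:
  assumes f: "good_path T f" and h: "h \<in> borel_measurable (time T)"
  shows "(\<integral>\<^sup>+ t. h t \<partial>stieltjes T f) = (\<integral>\<^sup>+ s. h (hit T f s) * indicator {0<..f T} s \<partial>lborel)"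
proof -
  have m: "hit T f \<in> restrict_space lborel {0<..f T} \<rightarrow>\<^sub>M time T"
    using measurable_hit[OF f] by (intro measurable_restrict_space1) simp
  show ?thesis
    unfolding stieltjes_eq(1)[OF f] using h
    by (simp add: nn_integral_distr[OF m] nn_integral_restrict_space)
qed

lemma finite_measure_stieltjes: "good_path T f \<Longrightarrow> finite_measure (stieltjes T f)"
  using emeasure_stieltjes[of T f T] by (intro finite_measureI) auto

lemma good_path_lincomb:
  assumes "good_path T f" "good_path T g" "0 \<le> a" "0 \<le> b"
  shows "good_path T (\<lambda>t. a * f t + b * g t)"
  using assms unfolding good_path_def right_continuous_path_def mono_on_def
  by (auto intro!: continuous_intros add_mono mult_left_mono)

text \<open>The generalised inverse is not linear in the path, so linearity of \<open>dC\<close> is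
  obtained from the generator instead. All three measures are finite, hence complements can be
  handled by subtraction of reals.\<close>

lemma measure_stieltjes_lincomb:
  assumes f: "good_path T f" and g: "good_path T g" and ab: "0 \<le> a" "0 \<le> b"
    and A: "A \<in> sets (time T)"
  shows "measure (stieltjes T (\<lambda>t. a * f t + b * g t)) A =
    a * measure (stieltjes T f) A + b * measure (stieltjes T g) A"
proof -
  let ?h = "\<lambda>t. a * f t + b * g t"
  have h: "good_path T ?h" by (rule good_path_lincomb[OF f g ab])
  interpret F: finite_measure "stieltjes T f" by (rule finite_measure_stieltjes[OF f])
  interpret G: finite_measure "stieltjes T g" by (rule finite_measure_stieltjes[OF g])
  interpret H: finite_measure "stieltjes T ?h" by (rule finite_measure_stieltjes[OF h])
  have top: "measure (stieltjes T p) {..t} = p t" if "good_path T p" "t \<le> T" for p t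
    using emeasure_stieltjes[OF that] that by (simp add: measure_def good_path_def)
  have stable: "Int_stable (atMost ` {..T})"
    by (auto simp: Int_stable_def min_le_iff_disj intro!: image_eqI[of _ atMost "min _ _"])
  have closed: "atMost ` {..T} \<subseteq> Pow {..T}" by auto
  have "A \<in> sigma_sets {..T} (atMost ` {..T})" using A by (simp add: sets_time)
  from stable closed this show ?thesis
  proof (induction rule: sigma_sets_induct_disjoint)
    case (basic A)
    then show ?case using top[OF f] top[OF g] top[OF h] by auto
  next
    case (compl A)
    then have A: "A \<in> sets (time T)" by (simp add: sets_time)
    have "measure (stieltjes T f) ({..T} - A) = f T - measure (stieltjes T f) A"
      "measure (stieltjes T g) ({..T} - A) = g T - measure (stieltjes T g) A"
      "measure (stieltjes T ?h) ({..T} - A) = a * f T + b * g T - measure (stieltjes T ?h) A"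
      using A F.finite_measure_compl[of A] G.finite_measure_compl[of A] H.finite_measure_compl[of A]
        top[OF f, of T] top[OF g, of T] top[OF h, of T] by simp_all
    then show ?case by (simp only: compl(2)) (simp add: algebra_simps)
  next
    case (union A)
    then have A: "range A \<subseteq> sets (time T)" by (simp add: sets_time)
    have "(\<lambda>i. a * measure (stieltjes T f) (A i) + b * measure (stieltjes T g) (A i)) sums
        (a * measure (stieltjes T f) (\<Union>i. A i) + b * measure (stieltjes T g) (\<Union>i. A i))"
      using A union(1) by (intro sums_add sums_mult F.finite_measure_UNION G.finite_measure_UNION) auto
    moreover have "(\<lambda>i. measure (stieltjes T ?h) (A i)) sums measure (stieltjes T ?h) (\<Union>i. A i)"
      using A union(1) by (intro H.finite_measure_UNION) auto
    ultimately show ?case unfolding union(3) by (intro sums_unique2)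
  qed auto
qed

lemma nn_integral_stieltjes_lincomb:
  assumes f: "good_path T f" and g: "good_path T g" and ab: "0 \<le> a" "0 \<le> b"
    and h: "h \<in> borel_measurable (time T)"
  shows "(\<integral>\<^sup>+ t. h t \<partial>stieltjes T (\<lambda>t. a * f t + b * g t)) =
    ennreal a * (\<integral>\<^sup>+ t. h t \<partial>stieltjes T f) + ennreal b * (\<integral>\<^sup>+ t. h t \<partial>stieltjes T g)"
proof -
  let ?p = "\<lambda>t. a * f t + b * g t"
  have p: "good_path T ?p" by (rule good_path_lincomb[OF f g ab])
  interpret F: finite_measure "stieltjes T f" by (rule finite_measure_stieltjes[OF f])
  interpret G: finite_measure "stieltjes T g" by (rule finite_measure_stieltjes[OF g])
  interpret H: finite_measure "stieltjes T ?p" by (rule finite_measure_stieltjes[OF p])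
  from h show ?thesis
  proof (induction rule: borel_measurable_induct)
    case (cong u v)
    have *: "(\<integral>\<^sup>+ t. u t \<partial>stieltjes T q) = (\<integral>\<^sup>+ t. v t \<partial>stieltjes T q)" for q
      using cong(3) by (intro nn_integral_cong) (simp add: space_restrict_space)
    show ?case using cong(4) unfolding * .
  next
    case (set A)
    then show ?case using measure_stieltjes_lincomb[OF f g ab set] ab
      by (simp add: F.emeasure_eq_measure G.emeasure_eq_measure H.emeasure_eq_measure
        ennreal_plus ennreal_mult')
  next
    case (mult u c)
    then show ?case by (simp add: nn_integral_cmult measurable_cong_sets[OF sets_stieltjes refl] algebra_simps)
  next
    case (add u v)
    then show ?case by (simp add: nn_integral_add measurable_cong_sets[OF sets_stieltjes refl] algebra_simps)
  next
    case (seq U)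
    have m: "U i \<in> borel_measurable (stieltjes T q)" for i q
      using seq(1) by (simp add: measurable_cong_sets[OF sets_stieltjes refl])
    have *: "(\<integral>\<^sup>+ t. (SUP i. U i) t \<partial>stieltjes T q) = (SUP i. \<integral>\<^sup>+ t. U i t \<partial>stieltjes T q)" for q
      unfolding SUP_apply using m seq(3) by (intro nn_integral_monotone_convergence_SUP) auto
    have inc: "incseq (\<lambda>i. \<integral>\<^sup>+ t. U i t \<partial>stieltjes T q)" for q
      using seq(3) by (auto simp: incseq_def le_fun_def intro!: nn_integral_mono)
    have "(SUP i. \<integral>\<^sup>+ t. U i t \<partial>stieltjes T ?p) =
      (SUP i. ennreal a * (\<integral>\<^sup>+ t. U i t \<partial>stieltjes T f) + ennreal b * (\<integral>\<^sup>+ t. U i t \<partial>stieltjes T g))"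
      using seq.IH by simp
    also have "\<dots> = (SUP i. ennreal a * (\<integral>\<^sup>+ t. U i t \<partial>stieltjes T f)) + (SUP i. ennreal b * (\<integral>\<^sup>+ t. U i t \<partial>stieltjes T g))"
      by (rule ennreal_SUP_add) (auto simp: incseq_def intro!: mult_left_mono incseqD[OF inc])
    finally show ?case unfolding * by (simp add: SUP_mult_left_ennreal)
  qed
qed

section \<open>Paths of right-continuous functions\<close>

text \<open>Fix a size of the left discontinuity. Right-continuity gives each such time
  \<open>t\<close> an interval to its right on which the oscillation is smaller than this size, so
  the interval contains no other such time. These disjoint intervals contain distinct grid
  points.\<close>

lemma countable_left_discontinuities:
  fixes f :: "ennreal \<Rightarrow> real"
  assumes f: "right_continuous_path T f"
  shows "countable {t. 0 < t \<and> t < T \<and> \<not> (f \<longlongrightarrow> f t) (at_left t)}"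
proof -
  define A where "A k = {t. 0 < t \<and> t < T \<and>
    \<not> (\<forall>\<^sub>F s in at_left t. dist (f s) (f t) < 1 / real (Suc k))}" for k
  have "countable (A k)" for k
  proof -
    let ?e = "1 / real (Suc k)"
    have "\<exists>u>t. \<forall>v. t < v \<longrightarrow> v < u \<longrightarrow> dist (f v) (f t) < ?e / 2" if "t \<in> A k" for t
    proof -
      have "t < T" using that by (simp add: A_def)
      then have "(f \<longlongrightarrow> f t) (at_right t)"
        using f by (auto simp: right_continuous_path_def continuous_within)
      then have "\<forall>\<^sub>F v in at_right t. dist (f v) (f t) < ?e / 2" by (rule tendstoD) simp
      then show ?thesis unfolding eventually_at_right[OF \<open>t < T\<close>] by simp
    qed
    then obtain U where U: "\<And>t. t \<in> A k \<Longrightarrow> t < U t"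
      "\<And>t v. t \<in> A k \<Longrightarrow> t < v \<Longrightarrow> v < U t \<Longrightarrow> dist (f v) (f t) < ?e / 2"
      by metis
    have disj: "v \<notin> A k" if "t \<in> A k" "t < v" "v < U t" for t v
    proof
      assume "v \<in> A k"
      have "dist (f s) (f v) < ?e" if "t < s" "s < v" for s
        using U(2)[of t s] U(2)[of t v] that \<open>t \<in> A k\<close> \<open>t < v\<close> \<open>v < U t\<close>
          dist_triangle_half_l[of "f s" "f t" ?e "f v"] by (simp add: dist_commute)
      then have "\<forall>\<^sub>F s in at_left v. dist (f s) (f v) < ?e"
        unfolding eventually_at_left[OF \<open>t < v\<close>] using \<open>t < v\<close> by (intro exI[of _ t]) simp
      then show False using \<open>v \<in> A k\<close> by (simp add: A_def)
    qed
    have "\<exists>q. q \<in> (\<Union>m. grid m) \<and> t < q \<and> q < U t" if t: "t \<in> A k" for t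
    proof -
      obtain m q where "q \<in> grid m" "t < q" "q < U t" using grid_dense[OF U(1)[OF t]] .
      then show ?thesis by auto
    qed
    then obtain Q where Q: "\<And>t. t \<in> A k \<Longrightarrow> Q t \<in> (\<Union>m. grid m)"
      "\<And>t. t \<in> A k \<Longrightarrow> t < Q t" "\<And>t. t \<in> A k \<Longrightarrow> Q t < U t"
      by metis
    have "inj_on Q (A k)"
    proof (rule linorder_inj_onI)
      fix t t' assume *: "t < t'" "t \<in> A k" "t' \<in> A k"
      show "Q t \<noteq> Q t'"
      proof
        assume "Q t = Q t'"
        then have "t' < U t" using Q(2)[OF *(3)] Q(3)[OF *(2)] by simp
        then show False using disj[OF *(2,1)] *(3) by blast
      qed
    qed auto
    moreover have "countable (Q ` A k)"
    proof (rule countable_subset)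
      show "Q ` A k \<subseteq> (\<Union>m. grid m)" using Q(1) by blast
      show "countable (\<Union>m. grid m)" by (rule countable_UN) (simp_all add: countable_finite)
    qed
    ultimately show ?thesis by (rule countable_image_inj_on[rotated])
  qed
  moreover have "{t. 0 < t \<and> t < T \<and> \<not> (f \<longlongrightarrow> f t) (at_left t)} \<subseteq> (\<Union>k. A k)"
  proof
    fix t assume t: "t \<in> {t. 0 < t \<and> t < T \<and> \<not> (f \<longlongrightarrow> f t) (at_left t)}"
    then obtain e where e: "0 < e" "\<not> (\<forall>\<^sub>F s in at_left t. dist (f s) (f t) < e)"
      unfolding tendsto_iff by auto
    obtain k where "1 / real (Suc k) < e" using nat_approx_posE[OF e(1)] by blast
    then have "\<not> (\<forall>\<^sub>F s in at_left t. dist (f s) (f t) < 1 / real (Suc k))"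
      using e(2) by (meson eventually_mono less_trans)
    then show "t \<in> (\<Union>k. A k)" using t by (auto simp: A_def)
  qed
  ultimately show ?thesis by (rule countable_subset[OF _ countable_UN[OF countableI_type], rotated])
qed

lemma AE_leb_grid_down:
  fixes f :: "ennreal \<Rightarrow> real"
  assumes f: "right_continuous_path T f"
  shows "AE t in leb T. (\<lambda>m. f (grid_down m t)) \<longlonglongrightarrow> f t"
proof -
  \<comment> \<open>The horizon is removed as well, since the countability result concerns times
    strictly before it.\<close>
  have "AE t in leb T. t \<notin> insert T {t. 0 < t \<and> t < T \<and> \<not> (f \<longlongrightarrow> f t) (at_left t)}"
    using countable_left_discontinuities[OF f] by (intro AE_leb_not_in) simp
  then show ?thesis
  proof (rule AE_mp, intro AE_I2 impI)
    fix t assume t: "t \<in> space (leb T)"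
      "t \<notin> insert T {t. 0 < t \<and> t < T \<and> \<not> (f \<longlongrightarrow> f t) (at_left t)}"
    show "(\<lambda>m. f (grid_down m t)) \<longlonglongrightarrow> f t"
    proof (cases "t = 0")
      case True
      then have "grid_down m t = t" for m using grid_down_le[of m t] by simp
      then show ?thesis by simp
    next
      case False
      then have "0 < t" using zero_less_iff_neq_zero by blast
      with t have lim: "(f \<longlongrightarrow> f t) (at_left t)" by auto
      show ?thesis
      proof (rule topological_tendstoI)
        fix S assume "open S" "f t \<in> S"
        then have "\<forall>\<^sub>F s in at_left t. f s \<in> S" using lim by (rule topological_tendstoD[rotated 1])
        then obtain b where b: "b < t" "\<And>s. b < s \<Longrightarrow> s < t \<Longrightarrow> f s \<in> S"
          using eventually_at_left[OF \<open>0 < t\<close>] by metis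
        have "\<forall>\<^sub>F m in sequentially. b < grid_down m t"
          using grid_down_tendsto b(1) by (rule order_tendstoD)
        then show "\<forall>\<^sub>F m in sequentially. f (grid_down m t) \<in> S"
        proof eventually_elim
          case (elim m)
          then show ?case using b(2)[of "grid_down m t"] grid_down_le[of m t] \<open>f t \<in> S\<close>
            by (cases "grid_down m t = t") auto
        qed
      qed
    qed
  qed
qed

section \<open>Progressive and optional processes\<close>

text \<open>Dominated convergence along times decreasing to \<open>t\<close>. Finiteness is required
  only up to some later \<open>u\<close>, because the exponent of a discount factor may diverge at
  an infinite horizon.\<close>

lemma nn_integral_leb_tendsto_right:
  assumes phi: "\<phi> \<in> borel_measurable (time T)" and t: "t < u" "u \<le> T"
    and fin: "(\<integral>\<^sup>+ s. \<phi> s \<partial>leb u) < \<infinity>"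
  shows "((\<lambda>s. \<integral>\<^sup>+ v. \<phi> v \<partial>leb s) \<longlongrightarrow> (\<integral>\<^sup>+ v. \<phi> v \<partial>leb t)) (at_right t)"
proof (rule tendsto_at_right_sequentially[OF t(1)])
  fix S :: "nat \<Rightarrow> ennreal"
  assume S: "\<And>n. t < S n" "\<And>n. S n < u" "decseq S" "S \<longlonglongrightarrow> t"
  have SuT: "S n \<le> T" for n using S(2)[of n] t(2) by simp
  have eq: "(\<integral>\<^sup>+ v. \<phi> v \<partial>leb s) = (\<integral>\<^sup>+ v. \<phi> v * indicator {..s} v \<partial>leb T)" if "s \<le> T" for s
    by (rule nn_integral_leb_restrict[OF that phi])
  have m: "(\<lambda>v. \<phi> v * indicator {..s} v) \<in> borel_measurable (leb T)" for s
    using phi sets_time_Int[of "{..s}" T]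
    by (subst measurable_cong[of _ _ "\<lambda>v. \<phi> v * indicator ({..s} \<inter> {..T}) v"])
      (auto simp: measurable_cong_sets[OF sets_leb refl] split: split_indicator)
  have "(\<lambda>n. \<integral>\<^sup>+ v. \<phi> v * indicator {..S n} v \<partial>leb T) \<longlonglongrightarrow> (\<integral>\<^sup>+ v. \<phi> v * indicator {..t} v \<partial>leb T)"
  proof (rule nn_integral_dominated_convergence[where w="\<lambda>v. \<phi> v * indicator {..u} v"])
    show "(\<integral>\<^sup>+ v. \<phi> v * indicator {..u} v \<partial>leb T) < \<infinity>" using fin eq[OF t(2)] by simp
    show "AE v in leb T. \<phi> v * indicator {..S j} v \<le> \<phi> v * indicator {..u} v" for j
      using S(2)[of j] by (intro AE_I2) (auto split: split_indicator)
    show "AE v in leb T. (\<lambda>n. \<phi> v * indicator {..S n} v) \<longlonglongrightarrow> \<phi> v * indicator {..t} v"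
    proof (intro AE_I2)
      fix v
      show "(\<lambda>n. \<phi> v * indicator {..S n} v) \<longlonglongrightarrow> \<phi> v * indicator {..t} v"
      proof (cases "v \<le> t")
        case True
        then have "v \<le> S n" for n using S(1)[of n] by simp
        then show ?thesis using True by simp
      next
        case False
        then have "\<forall>\<^sub>F n in sequentially. S n < v" using S(4) by (intro order_tendstoD(2)) auto
        then have "\<forall>\<^sub>F n in sequentially. \<phi> v * indicator {..S n} v = \<phi> v * indicator {..t} v"
          by eventually_elim (use False in \<open>auto split: split_indicator\<close>)
        then show ?thesis by (rule tendsto_eventually)
      qed
    qed
  qed (use m in auto)
  then show "(\<lambda>n. \<integral>\<^sup>+ v. \<phi> v \<partial>leb (S n)) \<longlonglongrightarrow> (\<integral>\<^sup>+ v. \<phi> v \<partial>leb t)"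
    using eq SuT t by (simp add: eq)
qed

lemma nn_integral_leb_mono:
  assumes phi: "\<phi> \<in> borel_measurable (time T)" and "s \<le> t" "t \<le> T"
  shows "(\<integral>\<^sup>+ v. \<phi> v \<partial>leb s) \<le> (\<integral>\<^sup>+ v. \<phi> v \<partial>leb t)"
  using assms
  by (subst (1 2) nn_integral_leb_restrict[OF _ phi])
    (auto intro!: nn_integral_mono split: split_indicator)

lemma mono_left_limit:
  fixes f :: "ennreal \<Rightarrow> real"
  assumes "0 < t" "\<And>s u. s \<le> u \<Longrightarrow> u < t \<Longrightarrow> f s \<le> f u" "\<And>s. s < t \<Longrightarrow> f s \<le> K"
  shows "\<exists>l. (f \<longlongrightarrow> l) (at_left t)"
proof
  let ?l = "Sup (f ` {..<t})"
  have ne: "f ` {..<t} \<noteq> {}" using assms(1) by auto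
  have bdd: "bdd_above (f ` {..<t})" using assms(3) by (auto intro!: bdd_aboveI)
  show "(f \<longlongrightarrow> ?l) (at_left t)"
  proof (rule order_tendstoI)
    fix a assume "a < ?l"
    then obtain s where s: "s < t" "a < f s" using less_cSup_iff[OF ne bdd] by auto
    have "\<forall>y>s. y < t \<longrightarrow> a < f y" using s assms(2) by (auto intro: less_le_trans)
    then show "\<forall>\<^sub>F y in at_left t. a < f y"
      unfolding eventually_at_left[OF s(1)] using s(1) by blast
  next
    fix a assume "?l < a"
    moreover have "f y \<le> ?l" if "y < t" for y using that bdd by (intro cSup_upper) auto
    ultimately have "\<forall>y>0. y < t \<longrightarrow> f y < a" by (auto intro: le_less_trans)
    then show "\<forall>\<^sub>F y in at_left t. f y < a"
      unfolding eventually_at_left[OF assms(1)] using assms(1) by blast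
  qed
qed

lemma cadlag_path_step: "cadlag_path T (\<lambda>t. if a \<le> t then z else 0)"
  unfolding cadlag_path_def right_continuous_path_def
proof (intro conjI allI impI)
  fix t assume "t < T"
  have "\<forall>\<^sub>F s in at_right t. (if a \<le> s then z else 0) = (if a \<le> t then z else 0)"
  proof (cases "a \<le> t")
    case True
    have "\<forall>\<^sub>F s in at_right t. t < s" by (auto simp: eventually_at_filter)
    then show ?thesis by eventually_elim (use True in auto)
  next
    case False
    then have "t < a" by simp
    then show ?thesis unfolding eventually_at_right[OF \<open>t < a\<close>] by (intro exI[of _ a]) auto
  qed
  then show "continuous (at_right t) (\<lambda>t. if a \<le> t then z else 0)"
    unfolding continuous_within by (rule tendsto_eventually)
next
  fix t :: ennreal assume "0 < t"
  show "\<exists>l. ((\<lambda>t. if a \<le> t then z else 0) \<longlongrightarrow> l) (at_left t)"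
  proof (cases "a < t")
    case True
    then have "\<forall>\<^sub>F s in at_left t. (if a \<le> s then z else 0) = z"
      unfolding eventually_at_left[OF True] by (intro exI[of _ a]) auto
    then show ?thesis by (intro exI[of _ z] tendsto_eventually)
  next
    case False
    have "\<forall>\<^sub>F s in at_left t. s < t" by (auto simp: eventually_at_filter)
    then have "\<forall>\<^sub>F s in at_left t. (if a \<le> s then z else 0) = 0"
      by eventually_elim (use False in auto)
    then show ?thesis by (intro exI[of _ 0] tendsto_eventually)
  qed
qed

text \<open>The value type is general because marginal utilities can be infinite and are treated as
  \<open>ennreal\<close>-valued processes.\<close>

definition progressive ::
  "ennreal \<Rightarrow> (ennreal \<Rightarrow> 'a measure) \<Rightarrow> (ennreal \<Rightarrow> 'a \<Rightarrow> 'b::topological_space) \<Rightarrow> bool" where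
  "progressive T F X \<longleftrightarrow> (\<forall>t\<le>T. (\<lambda>(s, \<omega>). X s \<omega>) \<in> borel_measurable (time t \<Otimes>\<^sub>M F t))"

locale usual_filtration =
  fixes T :: ennreal and M :: "'a measure" and F :: "ennreal \<Rightarrow> 'a measure"
  assumes usual: "usual_conditions T M F"

sublocale usual_filtration \<subseteq> prob_space M
  using usual by (simp add: usual_conditions_def)

sublocale usual_filtration \<subseteq> filtration "space M" F
  using usual by (simp add: usual_conditions_def)

context usual_filtration
begin

lemma subalg: "subalgebra M (F t)"
  using usual by (simp add: usual_conditions_def)

lemma sets_F_subset: "sets (F t) \<subseteq> sets M"
  using subalg[of t] by (simp add: subalgebra_def)

lemma measurable_F: "f \<in> F t \<rightarrow>\<^sub>M N \<Longrightarrow> f \<in> M \<rightarrow>\<^sub>M N"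
  using subalg by (rule measurable_from_subalg)

lemma measurable_F_mono:
  assumes "s \<le> t" "f \<in> F s \<rightarrow>\<^sub>M N" shows "f \<in> F t \<rightarrow>\<^sub>M N"
  using measurable_from_subalg[of "F t" "F s"] assms sets_F_mono[OF assms(1)]
  by (auto simp: subalgebra_def space_F)

lemma sets_F_right:
  assumes "t < T" "\<And>s. t < s \<Longrightarrow> s \<le> T \<Longrightarrow> A \<in> sets (F s)" shows "A \<in> sets (F t)"
  using usual assms by (auto simp: usual_conditions_def)

lemma null_subset_F: "N \<in> null_sets M \<Longrightarrow> A \<subseteq> N \<Longrightarrow> A \<in> sets (F t)"
  using usual sets_F_mono[of 0 t] by (auto simp: usual_conditions_def)

text \<open>The exceptional set lies in a null set, and the usual conditions put every subset of a
  null set into each \<open>F t\<close>.\<close>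

lemma AE_sets_F:
  assumes "AE \<omega> in M. P \<omega>" shows "{\<omega> \<in> space M. P \<omega>} \<in> sets (F t)"
proof -
  obtain N where "N \<in> null_sets M" "{\<omega> \<in> space M. \<not> P \<omega>} \<subseteq> N"
    using assms by (auto elim!: AE_E simp: null_sets_def)
  then have "{\<omega> \<in> space M. \<not> P \<omega>} \<in> sets (F t)" by (rule null_subset_F)
  then have "space (F t) - {\<omega> \<in> space M. \<not> P \<omega>} \<in> sets (F t)" by blast
  moreover have "space (F t) - {\<omega> \<in> space M. \<not> P \<omega>} = {\<omega> \<in> space M. P \<omega>}"
    by (auto simp: space_F)
  ultimately show ?thesis by simp
qed

text \<open>Preimages under the two functions differ only inside a null set, all of whose subsets
  are already in \<open>F 0\<close>.\<close>

lemma measurable_AE_cong: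
  assumes f: "f \<in> borel_measurable G" and G: "sets (F 0) \<subseteq> sets G" "space G = space M"
    and AE: "AE \<omega> in M. f \<omega> = g \<omega>"
  shows "g \<in> borel_measurable G"
proof (rule measurableI)
  fix B :: "'b set" assume B: "B \<in> sets borel"
  have good: "{\<omega> \<in> space M. f \<omega> = g \<omega>} \<in> sets G" using AE_sets_F[OF AE] G(1) by blast
  have "AE \<omega> in M. f \<omega> = g \<omega> \<and> (f \<omega> = g \<omega> \<or> g \<omega> \<notin> B)" using AE by auto
  obtain N where "N \<in> null_sets M" "{\<omega> \<in> space M. \<not> (f \<omega> = g \<omega>)} \<subseteq> N"
    using AE by (auto elim!: AE_E simp: null_sets_def)
  then have "{\<omega> \<in> space M. f \<omega> \<noteq> g \<omega> \<and> g \<omega> \<in> B} \<in> sets (F 0)"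
    by (intro null_subset_F[of N]) auto
  then have bad: "{\<omega> \<in> space M. f \<omega> \<noteq> g \<omega> \<and> g \<omega> \<in> B} \<in> sets G" using G(1) by blast
  have "g -` B \<inter> space G = ({\<omega> \<in> space M. f \<omega> = g \<omega>} \<inter> (f -` B \<inter> space G)) \<union>
      {\<omega> \<in> space M. f \<omega> \<noteq> g \<omega> \<and> g \<omega> \<in> B}"
    using G(2) by auto
  then show "g -` B \<inter> space G \<in> sets G" using good bad measurable_sets[OF f B] by auto
qed simp

lemma measurable_M_AE_cong:
  "f \<in> borel_measurable M \<Longrightarrow> AE \<omega> in M. f \<omega> = g \<omega> \<Longrightarrow> g \<in> borel_measurable M"
  by (rule measurable_AE_cong) (use sets_F_subset in auto)

lemma subalg_pre_sigma:
  assumes "stopping_time F \<tau>" shows "subalgebra M (pre_sigma \<tau>)"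
proof -
  have "A \<in> sets M" if "A \<in> sets (pre_sigma \<tau>)" for A
  proof -
    have "{\<omega> \<in> A. \<tau> \<omega> \<le> top} \<in> sets (F top)" using assms that by (rule sets_pre_sigmaD)
    then show ?thesis using sets_F_subset by auto
  qed
  then show ?thesis by (auto simp: subalgebra_def space_pre_sigma)
qed

lemma finite_subalg: "subalgebra M G \<Longrightarrow> finite_measure_subalgebra M G"
  by unfold_locales

lemma stopping_time_measurable:
  assumes "stopping_time F \<tau>" shows "\<tau> \<in> borel_measurable M"
  using assms sets_F_subset space_F by (rule measurable_stopping_time)

text \<open>Approximation from the right along grids whose horizon is the current \<open>t\<close>:
  the random time is rounded up to at most \<open>t\<close>, so only \<open>F t\<close>-measurable
  values of the process occur.\<close>

lemma progressive_right_continuous: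
  fixes X :: "'a process"
  assumes X: "adapted T F X" and rc: "\<forall>\<omega>\<in>space M. right_continuous_path T (\<lambda>t. X t \<omega>)"
  shows "progressive T F X"
  unfolding progressive_def
proof (intro allI impI)
  fix t assume t: "t \<le> T"
  show "(\<lambda>(s, \<omega>). X s \<omega>) \<in> borel_measurable (time t \<Otimes>\<^sub>M F t)"
  proof (rule borel_measurable_LIMSEQ_metric)
    fix m
    let ?I = "insert t {q \<in> grid m. q \<le> t}"
    show "(\<lambda>x. X (grid_up m t (fst x)) (snd x)) \<in> borel_measurable (time t \<Otimes>\<^sub>M F t)"
    proof (rule measurable_compose_countable'[where I="?I"])
      fix q assume "q \<in> ?I"
      then have "q \<le> t" by auto
      then have "X q \<in> borel_measurable (F t)"
        using X t measurable_F_mono[of q t "X q"] by (auto simp: adapted_def)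
      then show "(\<lambda>x. X q (snd x)) \<in> borel_measurable (time t \<Otimes>\<^sub>M F t)"
        by (rule measurable_compose[OF measurable_snd])
    next
      have "(\<lambda>x. x) \<in> time t \<rightarrow>\<^sub>M borel" by (rule measurable_restrict_space1) simp
      then have "fst \<in> time t \<Otimes>\<^sub>M F t \<rightarrow>\<^sub>M borel" by (rule measurable_compose[OF measurable_fst])
      then have "(\<lambda>x. grid_up m t (fst x)) \<in> time t \<Otimes>\<^sub>M F t \<rightarrow>\<^sub>M borel"
        by (rule measurable_compose) (rule measurable_grid_up)
      then show "(\<lambda>x. grid_up m t (fst x)) \<in> time t \<Otimes>\<^sub>M F t \<rightarrow>\<^sub>M count_space ?I"
        using grid_up_in[of m t] grid_up_le[of m t] by (intro measurable_count_space_finite) auto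
    qed (auto intro: countable_finite)
  next
    fix x assume "x \<in> space (time t \<Otimes>\<^sub>M F t)"
    then have x: "fst x \<le> t" "snd x \<in> space M"
      by (auto simp: space_pair_measure space_restrict_space space_F)
    show "(\<lambda>m. X (grid_up m t (fst x)) (snd x)) \<longlonglongrightarrow> (case x of (s, \<omega>) \<Rightarrow> X s \<omega>)"
    proof (cases "fst x = t")
      case True
      then show ?thesis by (simp add: case_prod_beta)
    next
      case False
      then have "fst x < t" using x by simp
      then have "((\<lambda>s. X s (snd x)) \<longlongrightarrow> X (fst x) (snd x)) (at_right (fst x))"
        using rc x t by (auto simp: right_continuous_path_def continuous_within)
      from filterlim_compose[OF this grid_up_tendsto[OF \<open>fst x < t\<close>]]
      show ?thesis by (simp add: case_prod_beta)
    qed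
  qed
qed

lemma space_optional_sigma: "space (optional_sigma T M F) = {..T} \<times> space M"
  unfolding optional_sigma_def by (rule space_measure_of) auto

lemma sets_optional_sigma: "sets (optional_sigma T M F) = sigma_sets ({..T} \<times> space M)
     {{(t, \<omega>) \<in> {..T} \<times> space M. X t \<omega> \<in> B} | X B.
        adapted T F X \<and> (\<forall>\<omega>\<in>space M. cadlag_path T (\<lambda>t. X t \<omega>)) \<and> B \<in> sets borel}"
  unfolding optional_sigma_def by (rule sets_measure_of) auto

lemma optional_cadlag:
  assumes "adapted T F X" "\<And>\<omega>. \<omega> \<in> space M \<Longrightarrow> cadlag_path T (\<lambda>t. X t \<omega>)"
  shows "optional T M F X"
  unfolding optional_def
proof (rule measurableI)
  fix B :: "real set" assume "B \<in> sets borel"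
  then have "{(t, \<omega>) \<in> {..T} \<times> space M. X t \<omega> \<in> B} \<in> sets (optional_sigma T M F)"
    unfolding sets_optional_sigma using assms by (intro sigma_sets.Basic) blast
  then show "(\<lambda>(t, \<omega>). X t \<omega>) -` B \<inter> space (optional_sigma T M F) \<in> sets (optional_sigma T M F)"
    by (rule back_subst[of "\<lambda>A. A \<in> _"]) (auto simp: space_optional_sigma)
qed simp

text \<open>Optional sets are progressive: it suffices to check the generating cadlag processes,
  which are right-continuous and adapted.\<close>

lemma measurable_optional_sigma:
  assumes t: "t \<le> T"
  shows "(\<lambda>x. x) \<in> time t \<Otimes>\<^sub>M F t \<rightarrow>\<^sub>M optional_sigma T M F"
proof (rule measurable_sigma_sets[OF sets_optional_sigma])
  show "(\<lambda>x. x) \<in> space (time t \<Otimes>\<^sub>M F t) \<rightarrow> {..T} \<times> space M"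
    using t by (auto simp: space_pair_measure space_restrict_space space_F)
next
  fix y assume "y \<in> {{(t, \<omega>) \<in> {..T} \<times> space M. X t \<omega> \<in> B} | X B.
        adapted T F X \<and> (\<forall>\<omega>\<in>space M. cadlag_path T (\<lambda>t. X t \<omega>)) \<and> B \<in> sets borel}"
  then obtain X B where y: "y = {(t, \<omega>) \<in> {..T} \<times> space M. X t \<omega> \<in> B}"
    and X: "adapted T F X" "\<forall>\<omega>\<in>space M. cadlag_path T (\<lambda>t. X t \<omega>)" "B \<in> sets borel"
    by blast
  have "progressive T F X"
    using X by (intro progressive_right_continuous) (auto simp: cadlag_path_def)
  then have "(\<lambda>(s, \<omega>). X s \<omega>) -` B \<inter> space (time t \<Otimes>\<^sub>M F t) \<in> sets (time t \<Otimes>\<^sub>M F t)"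
    using t X(3) by (auto simp: progressive_def intro: measurable_sets)
  moreover have "(\<lambda>x. x) -` y \<inter> space (time t \<Otimes>\<^sub>M F t) =
      (\<lambda>(s, \<omega>). X s \<omega>) -` B \<inter> space (time t \<Otimes>\<^sub>M F t)"
    unfolding y using t by (auto simp: space_pair_measure space_restrict_space space_F)
  ultimately show "(\<lambda>x. x) -` y \<inter> space (time t \<Otimes>\<^sub>M F t) \<in> sets (time t \<Otimes>\<^sub>M F t)" by simp
qed auto

lemma optional_progressive:
  fixes X :: "ennreal \<Rightarrow> 'a \<Rightarrow> 'b::topological_space"
  assumes "(\<lambda>(t, \<omega>). X t \<omega>) \<in> borel_measurable (optional_sigma T M F)"
  shows "progressive T F X"
  unfolding progressive_def using measurable_compose[OF measurable_optional_sigma assms] by auto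

lemma progressive_jointly:
  assumes "progressive T F X"
  shows "(\<lambda>(t, \<omega>). X t \<omega>) \<in> borel_measurable (time T \<Otimes>\<^sub>M M)"
proof -
  have "(\<lambda>x. x) \<in> M \<rightarrow>\<^sub>M F T" by (intro measurable_F[of _ T] measurable_ident_sets refl)
  then have "snd \<in> time T \<Otimes>\<^sub>M M \<rightarrow>\<^sub>M F T" by (rule measurable_compose[OF measurable_snd])
  then have "(\<lambda>x. (fst x, snd x)) \<in> time T \<Otimes>\<^sub>M M \<rightarrow>\<^sub>M time T \<Otimes>\<^sub>M F T"
    by (intro measurable_Pair measurable_fst)
  moreover have "(\<lambda>(s, \<omega>). X s \<omega>) \<in> borel_measurable (time T \<Otimes>\<^sub>M F T)"
    using assms by (simp add: progressive_def)
  ultimately have "(\<lambda>x. (\<lambda>(s, \<omega>). X s \<omega>) (fst x, snd x)) \<in> borel_measurable (time T \<Otimes>\<^sub>M M)"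
    by (rule measurable_compose)
  then show ?thesis by (simp add: case_prod_beta)
qed

lemma progressive_adapted:
  assumes "progressive T F X" "t \<le> T" shows "X t \<in> borel_measurable (F t)"
proof -
  have "(\<lambda>\<omega>. (t, \<omega>)) \<in> F t \<rightarrow>\<^sub>M time t \<Otimes>\<^sub>M F t"
    by (intro measurable_Pair measurable_const measurable_ident_sets refl) (simp add: space_restrict_space)
  then have "(\<lambda>\<omega>. (\<lambda>(s, \<omega>). X s \<omega>) (t, \<omega>)) \<in> borel_measurable (F t)"
    by (rule measurable_compose) (use assms in \<open>simp add: progressive_def\<close>)
  then show ?thesis by simp
qed

text \<open>Stopping times are bounded by \<open>T\<close> only almost surely, hence the default
  value \<open>z\<close>. On {\<tau> \<le> t} the stopped value is the process at the minimum of
  \<tau> and \<open>t\<close>, a composition with an \<open>F t\<close>-measurable map.\<close>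

lemma progressive_stopped:
  assumes X: "progressive T F X" and tau: "stopping_time F \<tau>"
  shows "(\<lambda>\<omega>. if \<tau> \<omega> \<le> T then X (\<tau> \<omega>) \<omega> else z) \<in> borel_measurable (pre_sigma \<tau>)"
proof (rule measurableI)
  fix B :: "'b set" assume B: "B \<in> sets borel"
  let ?f = "\<lambda>\<omega>. if \<tau> \<omega> \<le> T then X (\<tau> \<omega>) \<omega> else z"
  have le: "{\<omega> \<in> space M. \<tau> \<omega> \<le> s} \<in> sets (F t)" if "s \<le> t" for s t
    using stopping_time_le_const[OF tau that] by (simp add: pred_def space_F)
  have small: "{\<omega> \<in> space M. \<tau> \<omega> \<le> t \<and> X (\<tau> \<omega>) \<omega> \<in> B} \<in> sets (F t)" if t: "t \<le> T" for t
  proof -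
    have "(\<lambda>\<omega>. min (\<tau> \<omega>) t) \<in> F t \<rightarrow>\<^sub>M time t"
    proof (rule measurable_restrict_space2)
      show "(\<lambda>\<omega>. min (\<tau> \<omega>) t) \<in> borel_measurable (F t)"
      proof (rule borel_measurableI_le)
        fix y
        show "{\<omega> \<in> space (F t). min (\<tau> \<omega>) t \<le> y} \<in> sets (F t)"
        proof (cases "t \<le> y")
          case True
          then have "{\<omega> \<in> space (F t). min (\<tau> \<omega>) t \<le> y} = space (F t)" by (auto simp: min_le_iff_disj)
          then show ?thesis by simp
        next
          case False
          then have "{\<omega> \<in> space (F t). min (\<tau> \<omega>) t \<le> y} = {\<omega> \<in> space M. \<tau> \<omega> \<le> y}"
            by (auto simp: min_le_iff_disj space_F)
          then show ?thesis using le[of y t] False by simp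
        qed
      qed
    qed auto
    then have "(\<lambda>\<omega>. (min (\<tau> \<omega>) t, \<omega>)) \<in> F t \<rightarrow>\<^sub>M time t \<Otimes>\<^sub>M F t"
      by (intro measurable_Pair measurable_ident_sets refl)
    then have "(\<lambda>\<omega>. (\<lambda>(s, \<omega>). X s \<omega>) (min (\<tau> \<omega>) t, \<omega>)) \<in> borel_measurable (F t)"
      by (rule measurable_compose) (use X t in \<open>simp add: progressive_def\<close>)
    then have "(\<lambda>\<omega>. X (min (\<tau> \<omega>) t) \<omega>) -` B \<inter> space (F t) \<in> sets (F t)"
      using B by (auto intro: measurable_sets)
    then have "{\<omega> \<in> space M. \<tau> \<omega> \<le> t} \<inter> ((\<lambda>\<omega>. X (min (\<tau> \<omega>) t) \<omega>) -` B \<inter> space (F t)) \<in> sets (F t)"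
      using le[of t t] by auto
    then show ?thesis
      by (rule back_subst[of "\<lambda>A. A \<in> _"]) (auto simp: space_F min_def)
  qed
  show "?f -` B \<inter> space (pre_sigma \<tau>) \<in> sets (pre_sigma \<tau>)"
  proof (rule sets_pre_sigmaI[OF tau])
    fix t
    show "{\<omega> \<in> ?f -` B \<inter> space (pre_sigma \<tau>). \<tau> \<omega> \<le> t} \<in> sets (F t)"
    proof (cases "t \<le> T")
      case True
      then have "{\<omega> \<in> ?f -` B \<inter> space (pre_sigma \<tau>). \<tau> \<omega> \<le> t} =
          {\<omega> \<in> space M. \<tau> \<omega> \<le> t \<and> X (\<tau> \<omega>) \<omega> \<in> B}"
        by (auto simp: space_pre_sigma)
      then show ?thesis using small[OF True] by simp
    next
      \<comment> \<open>Past the horizon the event consists of the part stopped by \<open>T\<close>,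
        known at \<open>T\<close>, and the part stopped in (T,t], where the value is constantly
        \<open>z\<close>.\<close>
      case False
      then have "T \<le> t" by simp
      have "{\<omega> \<in> space M. \<tau> \<omega> \<le> T \<and> X (\<tau> \<omega>) \<omega> \<in> B} \<in> sets (F t)"
        using small[of T] sets_F_mono[OF \<open>T \<le> t\<close>] by auto
      moreover have "{\<omega> \<in> space M. \<tau> \<omega> \<le> t} - {\<omega> \<in> space M. \<tau> \<omega> \<le> T} \<in> sets (F t)"
        using le[of t t] le[OF \<open>T \<le> t\<close>] by blast
      ultimately have "{\<omega> \<in> space M. \<tau> \<omega> \<le> T \<and> X (\<tau> \<omega>) \<omega> \<in> B} \<union>
          (if z \<in> B then {\<omega> \<in> space M. \<tau> \<omega> \<le> t} - {\<omega> \<in> space M. \<tau> \<omega> \<le> T} else {}) \<in> sets (F t)"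
        by auto
      then show ?thesis
        by (rule back_subst[of "\<lambda>A. A \<in> _"])
          (use \<open>T \<le> t\<close> in \<open>auto simp: space_pre_sigma split: if_splits\<close>)
    qed
  qed
qed simp

lemma progressive_nn_integral:
  fixes X :: "ennreal \<Rightarrow> 'a \<Rightarrow> ennreal"
  assumes "progressive T F X" "t \<le> T"
  shows "(\<lambda>\<omega>. \<integral>\<^sup>+ s. X s \<omega> \<partial>leb t) \<in> borel_measurable (F t)"
proof -
  interpret leb: sigma_finite_measure "leb t" by (rule sigma_finite_leb)
  have "(\<lambda>(s, \<omega>). X s \<omega>) \<in> borel_measurable (leb t \<Otimes>\<^sub>M F t)"
    using assms by (simp add: progressive_def measurable_cong_sets[OF sets_pair_measure_cong[OF sets_leb refl] refl])
  then have "(\<lambda>(\<omega>, s). X s \<omega>) \<in> borel_measurable (F t \<Otimes>\<^sub>M leb t)"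
    by (subst measurable_pair_swap_iff) (simp add: case_prod_beta)
  then show ?thesis by (rule leb.borel_measurable_nn_integral)
qed

text \<open>A deterministic step from time \<open>y\<close> on is cadlag and adapted; these steps
  generate the Borel sets of time.\<close>

lemma measurable_fst_optional: "fst \<in> optional_sigma T M F \<rightarrow>\<^sub>M time T"
proof (rule measurable_restrict_space2)
  show "fst \<in> borel_measurable (optional_sigma T M F)"
  proof (rule borel_measurableI_ge)
    fix y
    have "optional T M F (\<lambda>t \<omega>. if y \<le> t then 1 else 0)"
      by (intro optional_cadlag cadlag_path_step) (simp add: adapted_def)
    then have "(\<lambda>(t, \<omega>). if y \<le> t then 1 else 0) -` {1::real} \<inter> space (optional_sigma T M F)
        \<in> sets (optional_sigma T M F)"
      unfolding optional_def by (rule measurable_sets) simp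
    then show "{x \<in> space (optional_sigma T M F). y \<le> fst x} \<in> sets (optional_sigma T M F)"
      by (rule back_subst[of "\<lambda>A. A \<in> _"]) (auto split: if_splits)
  qed
qed (auto simp: space_optional_sigma)

lemma optional_deterministic:
  assumes "f \<in> borel_measurable (time T)" shows "optional T M F (\<lambda>t \<omega>. f t)"
  using measurable_compose[OF measurable_fst_optional assms] by (simp add: optional_def case_prod_beta)

lemma optional_step:
  assumes tau: "stopping_time F \<tau>" and A: "A \<in> sets (pre_sigma \<tau>)"
  shows "optional T M F (\<lambda>t \<omega>. if \<tau> \<omega> \<le> t then indicator A \<omega> else 0)"
proof (intro optional_cadlag cadlag_path_step)
  show "adapted T F (\<lambda>t \<omega>. if \<tau> \<omega> \<le> t then indicator A \<omega> else 0)"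
    unfolding adapted_def
  proof (intro allI impI)
    fix t
    have "{\<omega> \<in> A. \<tau> \<omega> \<le> t} \<in> sets (F t)" using tau A by (rule sets_pre_sigmaD)
    then have "(indicator {\<omega> \<in> A. \<tau> \<omega> \<le> t} :: 'a \<Rightarrow> real) \<in> borel_measurable (F t)" by simp
    then show "(\<lambda>\<omega>. if \<tau> \<omega> \<le> t then indicator A \<omega> else 0 :: real) \<in> borel_measurable (F t)"
      by (rule back_subst[of "\<lambda>f. f \<in> _"]) (auto split: split_indicator)
  qed
qed

text \<open>The optional sigma-algebra is generated by processes that also have left limits, which a
  price need not have. Rounding time down to a grid gives optional processes; on each path they
  converge except at the countably many left discontinuities and possibly at
  \<open>T\<close>.\<close>

lemma right_continuous_AE_optional:
  assumes X: "adapted T F X" and rc: "\<forall>\<omega>\<in>space M. right_continuous_path T (\<lambda>t. X t \<omega>)"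
  obtains X' where "optional T M F X'" "\<And>\<omega>. \<omega> \<in> space M \<Longrightarrow> AE t in leb T. X' t \<omega> = X t \<omega>"
proof
  let ?X = "\<lambda>t \<omega>. lim (\<lambda>m. X (grid_down m t) \<omega>)"
  show "optional T M F ?X"
    unfolding optional_def case_prod_beta
  proof (rule borel_measurable_lim_metric)
    fix m
    let ?I = "insert 0 {q \<in> grid m. q \<le> T}"
    \<comment> \<open>The guard \<open>q \<le> fst x\<close> holds automatically for the rounded
      time, but it turns each piece into a step process starting at \<open>q\<close>, which is
      adapted and cadlag.\<close>
    have "(\<lambda>x. (\<lambda>q x. if q \<le> fst x then X q (snd x) else 0) (grid_down m (fst x)) x)
        \<in> borel_measurable (optional_sigma T M F)"
    proof (rule measurable_compose_countable'[where I="?I"])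
      fix q assume "q \<in> ?I"
      then have q: "q \<le> T" by auto
      have "optional T M F (\<lambda>t \<omega>. if q \<le> t then X q \<omega> else 0)"
      proof (intro optional_cadlag cadlag_path_step)
        show "adapted T F (\<lambda>t \<omega>. if q \<le> t then X q \<omega> else 0)"
          unfolding adapted_def
        proof (intro allI impI)
          fix t
          show "(\<lambda>\<omega>. if q \<le> t then X q \<omega> else 0) \<in> borel_measurable (F t)"
            using X q measurable_F_mono[of q t "X q"] by (cases "q \<le> t") (auto simp: adapted_def)
        qed
      qed
      then show "(\<lambda>x. if q \<le> fst x then X q (snd x) else 0) \<in> borel_measurable (optional_sigma T M F)"
        unfolding optional_def case_prod_beta' .
    next
      have "fst \<in> borel_measurable (optional_sigma T M F)"
        using measurable_compose[OF measurable_fst_optional, of "\<lambda>x. x" borel]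
        by (simp add: measurable_restrict_space1)
      then have "(\<lambda>x. grid_down m (fst x)) \<in> borel_measurable (optional_sigma T M F)"
        by (rule measurable_compose) (rule measurable_grid_down)
      then show "(\<lambda>x. grid_down m (fst x)) \<in> optional_sigma T M F \<rightarrow>\<^sub>M count_space ?I"
        using grid_down_in[of m] order_trans[OF grid_down_le[of m], of _ T]
        by (intro measurable_count_space_finite) (auto simp: space_optional_sigma)
    qed (auto intro: countable_finite)
    then show "(\<lambda>x. X (grid_down m (fst x)) (snd x)) \<in> borel_measurable (optional_sigma T M F)"
      by (simp add: grid_down_le)
  qed
  fix \<omega> assume "\<omega> \<in> space M"
  then have "AE t in leb T. (\<lambda>m. X (grid_down m t) \<omega>) \<longlonglongrightarrow> X t \<omega>"
    using rc by (intro AE_leb_grid_down) auto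
  then show "AE t in leb T. ?X t \<omega> = X t \<omega>"
    by eventually_elim (rule limI)
qed

end

section \<open>The discount factor\<close>

lemma discount_bounds: "0 \<le> discount \<rho> t" "discount \<rho> t \<le> 1"
  by (auto simp: discount_def Let_def)

lemma discount_exponent_finite:
  assumes "t \<noteq> \<infinity>" "\<And>s. s \<le> t \<Longrightarrow> \<rho> s \<le> K"
  shows "(\<integral>\<^sup>+ s. ennreal (\<rho> s) \<partial>leb t) < \<infinity>"
proof -
  obtain a where a: "t = ennreal a" using assms(1) by (cases t) auto
  have "(\<integral>\<^sup>+ s. ennreal (\<rho> s) \<partial>leb t) \<le> (\<integral>\<^sup>+ s. ennreal K \<partial>leb t)"
    using assms(2) by (intro nn_integral_mono) (auto intro: ennreal_leI)
  also have "\<dots> = ennreal K * emeasure (leb t) ({..ennreal a} \<inter> {..t})" using a by simp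
  also have "\<dots> < \<infinity>"
    using emeasure_leb_finite[of t a] by (auto simp: ennreal_mult_less_top)
  finally show ?thesis .
qed

lemma discount_pos:
  assumes "t \<noteq> \<infinity>" "\<And>s. s \<le> t \<Longrightarrow> \<rho> s \<le> K" shows "0 < discount \<rho> t"
  using discount_exponent_finite[of t \<rho> K, OF assms] by (auto simp: discount_def Let_def)

lemma discount_antimono:
  assumes "(\<lambda>s. ennreal (\<rho> s)) \<in> borel_measurable (time T)" "s \<le> t" "t \<le> T"
  shows "discount \<rho> t \<le> discount \<rho> s"
  using nn_integral_leb_mono[OF assms]
  by (auto simp: discount_def Let_def top_unique less_top[symmetric] enn2real_mono)

text \<open>Before the horizon times are finite and the exponent is finite and right-continuous
  there. Left limits come from monotonicity, so that \<infinity>, where the exponent may diverge,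
  needs no separate treatment.\<close>

lemma cadlag_path_discount:
  assumes rho: "\<rho> \<in> borel_measurable (time T)" and K: "\<And>s. s \<le> T \<Longrightarrow> \<rho> s \<le> K"
  shows "cadlag_path T (discount \<rho>)"
  unfolding cadlag_path_def right_continuous_path_def
proof (intro conjI allI impI)
  have m: "(\<lambda>s. ennreal (\<rho> s)) \<in> borel_measurable (time T)" using rho by simp
  let ?I = "\<lambda>t. \<integral>\<^sup>+ s. ennreal (\<rho> s) \<partial>leb t"
  fix t assume t: "t < T"
  then obtain u where u: "t < u" "u < T" using dense by blast
  have fin: "?I s < \<infinity>" if "s \<le> u" for s
    using that u K by (intro discount_exponent_finite[of _ _ K]) (auto simp: top_unique)
  have "(?I \<longlongrightarrow> ?I t) (at_right t)"
    using u fin[of u] by (intro nn_integral_leb_tendsto_right[OF m, of t u]) auto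
  then have "((\<lambda>s. exp (- enn2real (?I s))) \<longlongrightarrow> exp (- enn2real (?I t))) (at_right t)"
    using fin[of t] u by (intro tendsto_intros tendsto_enn2real) auto
  moreover have "\<forall>\<^sub>F s in at_right t. discount \<rho> s = exp (- enn2real (?I s))"
    unfolding eventually_at_right[OF u(1)] using u(1) fin
    by (intro exI[of _ u]) (auto simp: discount_def Let_def less_top[symmetric])
  moreover have "discount \<rho> t = exp (- enn2real (?I t))"
    using fin[OF less_imp_le[OF u(1)]] by (auto simp: discount_def Let_def)
  ultimately show "continuous (at_right t) (discount \<rho>)"
    unfolding continuous_within by (simp add: tendsto_cong)
next
  have m: "(\<lambda>s. ennreal (\<rho> s)) \<in> borel_measurable (time T)" using rho by simp
  fix t assume t: "t \<le> T" "0 < t"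
  have "\<exists>l. ((\<lambda>s. - discount \<rho> s) \<longlongrightarrow> l) (at_left t)"
    using discount_antimono[OF m] discount_bounds[of \<rho>] t
    by (intro mono_left_limit[of _ _ 0]) auto
  then obtain l where "((\<lambda>s. - discount \<rho> s) \<longlongrightarrow> l) (at_left t)" ..
  from tendsto_minus[OF this] show "\<exists>l. (discount \<rho> \<longlongrightarrow> l) (at_left t)" by auto
qed

lemma (in usual_filtration) optional_discount:
  assumes r: "progressive T F r" and K: "\<And>t \<omega>. t \<le> T \<Longrightarrow> \<omega> \<in> space M \<Longrightarrow> r t \<omega> \<le> K"
  shows "optional T M F (\<lambda>t \<omega>. discount (\<lambda>s. r s \<omega>) t)"
proof (rule optional_cadlag)
  have "progressive T F (\<lambda>t \<omega>. ennreal (r t \<omega>))"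
    using r unfolding progressive_def case_prod_beta by auto
  then have m: "(\<lambda>\<omega>. \<integral>\<^sup>+ s. ennreal (r s \<omega>) \<partial>leb t) \<in> borel_measurable (F t)" if "t \<le> T" for t
    using that by (rule progressive_nn_integral)
  have "(\<lambda>\<omega>. discount (\<lambda>s. r s \<omega>) t) \<in> borel_measurable (F t)" if "t \<le> T" for t
    unfolding discount_def Let_def
    by (intro measurable_If borel_measurable_const borel_measurable_exp borel_measurable_uminus
        borel_measurable_enn2real m[OF that]) (use m[OF that] in measurable)
  then show "adapted T F (\<lambda>t \<omega>. discount (\<lambda>s. r s \<omega>) t)"
    unfolding adapted_def by blast
  fix \<omega> assume "\<omega> \<in> space M"
  then have "(\<lambda>t. (\<lambda>(t, \<omega>). r t \<omega>) (t, \<omega>)) \<in> borel_measurable (time T)"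
    using progressive_jointly[OF r] by (intro measurable_compose[OF measurable_Pair2']) auto
  then show "cadlag_path T (discount (\<lambda>s. r s \<omega>))"
    using K \<open>\<omega> \<in> space M\<close> by (intro cadlag_path_discount[of _ _ K]) auto
qed

section \<open>Utility functions\<close>

text \<open>By concavity the quotients increase as the step shrinks, so this supremum is the right
  derivative. Being a countable supremum of utilities it is measurable in the point without any
  differentiability; \<open>partial_x_eq\<close> identifies it with \<open>partial_x\<close> where a
  gradient exists.\<close>

definition ennreal_partial_x :: "(real \<times> real \<Rightarrow> real) \<Rightarrow> real \<Rightarrow> real \<Rightarrow> ennreal" where
  "ennreal_partial_x u x c = (SUP n. ennreal ((u (x + 1 / real (Suc n), c) - u (x, c)) * real (Suc n)))"

definition ennreal_partial_c :: "(real \<times> real \<Rightarrow> real) \<Rightarrow> real \<Rightarrow> real \<Rightarrow> ennreal" where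
  "ennreal_partial_c u x c = (SUP n. ennreal ((u (x, c + 1 / real (Suc n)) - u (x, c)) * real (Suc n)))"

definition dir_quotient :: "(real \<times> real \<Rightarrow> real) \<Rightarrow> real \<Rightarrow> real \<Rightarrow> real \<Rightarrow> real \<Rightarrow> real \<Rightarrow> real" where
  "dir_quotient u x c y k e = (u (x + e * (y - x), c + e * (k - c)) - u (x, c)) / e"

lemma utility_nonneg: "utility u \<Longrightarrow> 0 \<le> x \<Longrightarrow> 0 \<le> c \<Longrightarrow> 0 \<le> u (x, c)"
  by (simp add: utility_def nonneg_quadrant_def)

lemma utility_mono:
  "utility u \<Longrightarrow> 0 \<le> x \<Longrightarrow> x \<le> y \<Longrightarrow> 0 \<le> c \<Longrightarrow> c \<le> k \<Longrightarrow> u (x, c) \<le> u (y, k)"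
  by (simp add: utility_def)

lemma utility_concave:
  assumes u: "utility u" and nn: "0 \<le> x" "0 \<le> c" "0 \<le> y" "0 \<le> k" and a: "0 \<le> a" "a \<le> 1"
  shows "(1 - a) * u (x, c) + a * u (y, k) \<le> u (x + a * (y - x), c + a * (k - c))"
proof (cases "(x, c) = (y, k) \<or> a = 0 \<or> a = 1")
  case True
  then show ?thesis by (auto simp: algebra_simps)
next
  case False
  have "strictly_concave_on nonneg_quadrant u" using u by (simp add: utility_def)
  then have "(1 - a) * u (x, c) + a * u (y, k) < u ((1 - a) *\<^sub>R (x, c) + a *\<^sub>R (y, k))"
    unfolding strictly_concave_on_def using False a nn by (auto simp: nonneg_quadrant_def)
  also have "(1 - a) *\<^sub>R (x, c) + a *\<^sub>R (y, k) = (x + a * (y - x), c + a * (k - c))"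
    by (simp add: algebra_simps)
  finally show ?thesis by simp
qed

lemma convex_combination_nonneg:
  "0 \<le> x \<Longrightarrow> 0 \<le> y \<Longrightarrow> 0 \<le> a \<Longrightarrow> a \<le> 1 \<Longrightarrow> 0 \<le> x + a * (y - x)" for x y a :: real
proof -
  assume "0 \<le> x" "0 \<le> y" "0 \<le> a" "a \<le> 1"
  then have "0 \<le> (1 - a) * x + a * y" by simp
  then show ?thesis by (simp add: algebra_simps)
qed

text \<open>Strict concavity puts the value at the midpoint strictly above the average of the end
  values, and monotonicity puts it below the right end value.\<close>

lemma utility_strict_mono_x:
  assumes u: "utility u" and nn: "0 \<le> x" "0 \<le> c" shows "u (x, c) < u (x + 1, c)"
proof -
  have "strictly_concave_on nonneg_quadrant u" using u by (simp add: utility_def)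
  then have "(1 - 1/2) * u (x, c) + 1/2 * u (x + 1, c) < u ((1 - 1/2) *\<^sub>R (x, c) + (1/2) *\<^sub>R (x + 1, c))"
    unfolding strictly_concave_on_def
    using nn by (elim conjE) (drule bspec[of _ _ "(x, c)"], simp add: nonneg_quadrant_def,
      drule bspec[of _ _ "(x + 1, c)"], simp add: nonneg_quadrant_def, drule spec[of _ "1/2"], simp)
  also have "(1 - 1/2) *\<^sub>R (x, c) + (1/2) *\<^sub>R (x + 1, c) = (x + 1/2, c)"
    by (simp add: field_simps)
  also have "u (x + 1/2, c) \<le> u (x + 1, c)" using nn by (intro utility_mono[OF u]) auto
  finally show ?thesis by simp
qed

text \<open>Concavity along the ray from the origin, where utility is nonnegative. It bounds the
  payoff of a policy by that of a scaled-down, individually affordable one.\<close>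

lemma utility_scale:
  assumes u: "utility u" and nn: "0 \<le> x" "0 \<le> c" and a: "0 < a" "a \<le> 1"
  shows "u (x, c) \<le> u (a * x, a * c) / a"
proof -
  have "(1 - a) * u (0, 0) + a * u (x, c) \<le> u (a * x, a * c)"
    using utility_concave[OF u, of 0 0 x c a] nn a by simp
  moreover have "0 \<le> (1 - a) * u (0, 0)" using utility_nonneg[OF u, of 0 0] a by simp
  ultimately show ?thesis using a by (simp add: field_simps)
qed

text \<open>The point at step \<open>e\<close> is the convex combination, with weight
  \<open>e / e'\<close>, of the base point and the point at step \<open>e'\<close>.\<close>

lemma dir_quotient_antimono:
  assumes u: "utility u" and nn: "0 \<le> x" "0 \<le> c" "0 \<le> y" "0 \<le> k" and e: "0 < e" "e \<le> e'" "e' \<le> 1"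
  shows "dir_quotient u x c y k e' \<le> dir_quotient u x c y k e"
proof -
  let ?x' = "x + e' * (y - x)" and ?c' = "c + e' * (k - c)" and ?a = "e / e'"
  have "0 \<le> ?x'" "0 \<le> ?c'" using nn e by (auto intro!: convex_combination_nonneg)
  then have "(1 - ?a) * u (x, c) + ?a * u (?x', ?c') \<le> u (x + ?a * (?x' - x), c + ?a * (?c' - c))"
    using nn e by (intro utility_concave[OF u]) auto
  also have "u (x + ?a * (?x' - x), c + ?a * (?c' - c)) = u (x + e * (y - x), c + e * (k - c))"
    using e by simp
  finally have "?a * (u (?x', ?c') - u (x, c)) \<le> u (x + e * (y - x), c + e * (k - c)) - u (x, c)"
    by (simp add: algebra_simps)
  then show ?thesis using e unfolding dir_quotient_def by (simp add: field_simps)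
qed

lemma dir_quotient_ge:
  assumes u: "utility u" and nn: "0 \<le> x" "0 \<le> c" "0 \<le> y" "0 \<le> k" and e: "0 < e" "e \<le> 1"
  shows "u (y, k) - u (x, c) \<le> dir_quotient u x c y k e"
  using dir_quotient_antimono[OF u nn e order_refl] by (simp add: dir_quotient_def)

lemma at_right_0_Suc: "filterlim (\<lambda>n. 1 / real (Suc n)) (at_right 0) sequentially"
proof (rule filterlim_at_withinI)
  show "(\<lambda>n. 1 / real (Suc n)) \<longlonglongrightarrow> 0" by (rule LIMSEQ_Suc[OF lim_1_over_n])
qed auto

lemma incseq_ennreal_SUP_lim:
  fixes q :: "nat \<Rightarrow> real"
  assumes inc: "incseq q" and nn: "\<And>n. 0 \<le> q n" and lim: "(\<lambda>n. ereal (q n)) \<longlonglongrightarrow> l"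
  shows "l = enn2ereal (SUP n. ennreal (q n))"
proof -
  have "incseq (\<lambda>n. ennreal (q n))" using inc by (auto simp: incseq_def intro: ennreal_leI)
  then have "(\<lambda>n. ennreal (q n)) \<longlonglongrightarrow> (SUP n. ennreal (q n))" by (rule LIMSEQ_SUP)
  then have "(\<lambda>n. enn2ereal (ennreal (q n))) \<longlonglongrightarrow> enn2ereal (SUP n. ennreal (q n))"
    by (rule tendsto_enn2erealI)
  then show ?thesis using nn lim by (simp add: LIMSEQ_unique)
qed

context
  fixes u :: "real \<times> real \<Rightarrow> real" and x c :: real
  assumes u: "utility u" and nn: "0 \<le> x" "0 \<le> c" and grad: "has_gradient u x c"
begin

lemma gradient_lim:
  assumes "0 \<le> y" "0 \<le> k"
  shows "((\<lambda>e. ereal (dir_quotient u x c y k e)) \<longlongrightarrow>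
    partial_x u x c * ereal (y - x) + partial_c u x c * ereal (k - c)) (at_right 0)"
  using grad assms unfolding has_gradient_def dir_quotient_def by blast

text \<open>The direction towards \<open>(x + 1, c)\<close> has second component 0, and in
  \<open>ereal\<close> an infinite \<open>partial_c\<close> times 0 is 0; so the directional limit
  is \<open>partial_x\<close> alone.\<close>

lemma partial_x_eq: "partial_x u x c = enn2ereal (ennreal_partial_x u x c)"
proof -
  let ?q = "\<lambda>n. dir_quotient u x c (x + 1) c (1 / real (Suc n))"
  have "(\<lambda>n. ereal (?q n)) \<longlonglongrightarrow> partial_x u x c * ereal (x + 1 - x) + partial_c u x c * ereal (c - c)"
    using nn by (intro filterlim_compose[OF gradient_lim at_right_0_Suc]) auto
  then have "(\<lambda>n. ereal (?q n)) \<longlonglongrightarrow> partial_x u x c" by (simp flip: zero_ereal_def one_ereal_def)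
  moreover have "incseq ?q"
    using nn by (intro incseq_SucI dir_quotient_antimono[OF u]) (auto simp: field_simps)
  moreover have "0 \<le> ?q n" for n
    using dir_quotient_ge[OF u nn, of "x + 1" c "1 / real (Suc n)"] nn
      utility_strict_mono_x[OF u nn] by simp
  ultimately have "partial_x u x c = enn2ereal (SUP n. ennreal (?q n))"
    by (intro incseq_ennreal_SUP_lim)
  then show ?thesis by (simp add: ennreal_partial_x_def dir_quotient_def)
qed

lemma partial_c_eq: "partial_c u x c = enn2ereal (ennreal_partial_c u x c)"
proof -
  let ?q = "\<lambda>n. dir_quotient u x c x (c + 1) (1 / real (Suc n))"
  have "(\<lambda>n. ereal (?q n)) \<longlonglongrightarrow> partial_x u x c * ereal (x - x) + partial_c u x c * ereal (c + 1 - c)"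
    using nn by (intro filterlim_compose[OF gradient_lim at_right_0_Suc]) auto
  then have "(\<lambda>n. ereal (?q n)) \<longlonglongrightarrow> partial_c u x c" by (simp flip: zero_ereal_def one_ereal_def)
  moreover have "incseq ?q"
    using nn by (intro incseq_SucI dir_quotient_antimono[OF u]) (auto simp: field_simps)
  moreover have "0 \<le> ?q n" for n
    using dir_quotient_ge[OF u nn, of x "c + 1" "1 / real (Suc n)"] nn
      utility_mono[OF u, of x x c "c + 1"] by simp
  ultimately have "partial_c u x c = enn2ereal (SUP n. ennreal (?q n))"
    by (intro incseq_ennreal_SUP_lim)
  then show ?thesis by (simp add: ennreal_partial_c_def dir_quotient_def)
qed

abbreviation (input) "Px \<equiv> ennreal_partial_x u x c"
abbreviation (input) "Pc \<equiv> ennreal_partial_c u x c"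

text \<open>The concavity inequality \<open>dir_quotient_ge\<close> holds for every step in (0,1),
  and the limit of the quotients inherits it.\<close>

lemma gradient_ge:
  assumes "0 \<le> y" "0 \<le> k"
  shows "ereal (u (y, k) - u (x, c)) \<le> enn2ereal Px * ereal (y - x) + enn2ereal Pc * ereal (k - c)"
proof (rule tendsto_lowerbound[OF gradient_lim[OF assms, unfolded partial_x_eq partial_c_eq]])
  have "\<forall>e>0. e < 1 \<longrightarrow> ereal (u (y, k) - u (x, c)) \<le> ereal (dir_quotient u x c y k e)"
    using dir_quotient_ge[OF u nn assms] by simp
  then show "\<forall>\<^sub>F e in at_right 0. ereal (u (y, k) - u (x, c)) \<le> ereal (dir_quotient u x c y k e)"
    unfolding eventually_at_right[OF zero_less_one] by (intro exI[of _ 1]) auto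
qed simp

text \<open>Towards the origin an infinite derivative at a positive coordinate makes the right-hand
  side of \<open>gradient_ge\<close> equal to minus infinity; the other summand is never positive
  there.\<close>

lemma gradient_finite_x: "0 < x \<Longrightarrow> Px \<noteq> \<top>"
  using gradient_ge[of 0 0] nn by (cases Pc) (auto simp: top_ennreal.rep_eq zero_less_mult_iff not_less le_less)

lemma gradient_finite_c: "0 < c \<Longrightarrow> Pc \<noteq> \<top>"
  using gradient_ge[of 0 0] nn gradient_finite_x
  by (cases Px; cases "x = 0") (auto simp: top_ennreal.rep_eq le_less)

text \<open>An infinite partial derivative forces its own coordinate to vanish, so feasible
  directions never produce a difference of infinities.\<close>

lemma gradient_cases:
  obtains (fin) a b where "Px = ennreal a" "Pc = ennreal b" "0 \<le> a" "0 \<le> b"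
  | (x) b where "Px = \<top>" "x = 0" "Pc = ennreal b" "0 \<le> b"
  | (c) a where "Pc = \<top>" "c = 0" "Px = ennreal a" "0 \<le> a"
  | (xc) "Px = \<top>" "Pc = \<top>" "x = 0" "c = 0"
  using nn gradient_finite_x gradient_finite_c by (cases Px; cases Pc) (auto simp: less_le)

text \<open>The gradient inequality towards the origin, where utility is nonnegative. Integrated, it
  bounds the linearised payoff of a policy by its welfare.\<close>

lemma gradient_le_utility: "Px * ennreal x + Pc * ennreal c \<le> ennreal (u (x, c))"
proof (cases rule: gradient_cases)
  case (fin a b)
  then have "a * x + b * c \<le> u (x, c)"
    using gradient_ge[of 0 0] utility_nonneg[OF u, of 0 0] by simp
  then show ?thesis using fin nn by (simp flip: ennreal_mult ennreal_plus add: ennreal_leI)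
next
  case (x b)
  then have "b * c \<le> u (x, c)"
    using gradient_ge[of 0 0] utility_nonneg[OF u, of 0 0] by (simp add: zero_ereal_def[symmetric])
  then show ?thesis using x nn by (simp flip: ennreal_mult add: ennreal_leI)
next
  case (c a)
  then have "a * x \<le> u (x, c)"
    using gradient_ge[of 0 0] utility_nonneg[OF u, of 0 0] by (simp add: zero_ereal_def[symmetric])
  then show ?thesis using c nn by (simp flip: ennreal_mult add: ennreal_leI)
qed simp

text \<open>Adding \<open>u (x, c)\<close> makes the quotients nonnegative, since they dominate
  \<open>u (y, k) - u (x, c)\<close>. The limit \<open>G\<close> is characterised by an identity
  with the negative part of the scalar product moved to the left, which stays meaningful when a
  partial derivative is infinite.\<close>

lemma gradient_direction:
  assumes yk: "0 \<le> y" "0 \<le> k"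
  obtains G where
    "(\<lambda>n. ennreal (dir_quotient u x c y k (1 / real (Suc n)) + u (x, c))) \<longlonglongrightarrow> G"
    "ennreal (u (y, k)) \<le> G"
    "G + (Px * ennreal x + Pc * ennreal c) = ennreal (u (x, c)) + (Px * ennreal y + Pc * ennreal k)"
proof -
  let ?L = "enn2ereal Px * ereal (y - x) + enn2ereal Pc * ereal (k - c)"
  let ?q = "\<lambda>n. dir_quotient u x c y k (1 / real (Suc n))"
  define G where "G = e2ennreal (?L + ereal (u (x, c)))"
  have unn: "0 \<le> u (x, c)" using utility_nonneg[OF u nn] .
  have "(\<lambda>n. ereal (?q n)) \<longlonglongrightarrow> ?L"
    using filterlim_compose[OF gradient_lim[OF yk] at_right_0_Suc]
    unfolding partial_x_eq partial_c_eq .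
  then have "(\<lambda>n. ereal (?q n) + ereal (u (x, c))) \<longlonglongrightarrow> ?L + ereal (u (x, c))"
    by (intro tendsto_add_ereal_general) auto
  then have "(\<lambda>n. e2ennreal (ereal (?q n) + ereal (u (x, c)))) \<longlonglongrightarrow> G"
    unfolding G_def by (rule tendsto_e2ennrealI)
  then have 1: "(\<lambda>n. ennreal (?q n + u (x, c))) \<longlonglongrightarrow> G" by (simp add: ennreal.abs_eq e2ennreal_ereal)
  have 2: "ennreal (u (y, k)) \<le> G"
  proof -
    have "ereal (u (y, k)) \<le> ?L + ereal (u (x, c))"
      using add_right_mono[OF gradient_ge[OF yk], of "ereal (u (x, c))"] by simp
    then show ?thesis unfolding G_def e2ennreal_ereal[symmetric] by (rule e2ennreal_mono)
  qed
  \<comment> \<open>An infinite derivative occurs only at coordinate 0. If the target coordinate is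
    0 too, its products vanish on both sides; otherwise both sides are infinite.\<close>
  have 3: "G + (Px * ennreal x + Pc * ennreal c) = ennreal (u (x, c)) + (Px * ennreal y + Pc * ennreal k)"
  proof (cases rule: gradient_cases)
    case (fin a b)
    have "G = ennreal (a * (y - x) + b * (k - c) + u (x, c))"
      unfolding G_def using fin by (simp add: e2ennreal_ereal)
    moreover have "u (y, k) - u (x, c) \<le> a * (y - x) + b * (k - c)"
      using gradient_ge[OF yk] fin by simp
    then have "0 \<le> a * (y - x) + b * (k - c) + u (x, c)" using utility_nonneg[OF u yk] by simp
    ultimately show ?thesis using fin nn yk unn
      by (simp flip: ennreal_mult ennreal_plus) (simp add: algebra_simps)
  next
    case (x b)
    show ?thesis
    proof (cases "y = 0")
      case True
      have "G = ennreal (b * (k - c) + u (x, c))"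
        unfolding G_def using x True by (simp add: e2ennreal_ereal zero_ereal_def[symmetric])
      moreover have "u (y, k) - u (x, c) \<le> b * (k - c)"
        using gradient_ge[OF yk] x True by (simp add: zero_ereal_def[symmetric])
      then have "0 \<le> b * (k - c) + u (x, c)" using utility_nonneg[OF u yk] by simp
      ultimately show ?thesis using x True nn yk unn
        by (simp flip: ennreal_mult ennreal_plus) (simp add: algebra_simps)
    next
      case False
      then show ?thesis using x yk unn unfolding G_def
        by (simp add: top_ennreal.rep_eq ennreal_top_mult e2ennreal_infty)
    qed
  next
    case (c a)
    show ?thesis
    proof (cases "k = 0")
      case True
      have "G = ennreal (a * (y - x) + u (x, c))"
        unfolding G_def using c True by (simp add: e2ennreal_ereal zero_ereal_def[symmetric])
      moreover have "u (y, k) - u (x, c) \<le> a * (y - x)"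
        using gradient_ge[OF yk] c True by (simp add: zero_ereal_def[symmetric])
      then have "0 \<le> a * (y - x) + u (x, c)" using utility_nonneg[OF u yk] by simp
      ultimately show ?thesis using c True nn yk unn
        by (simp flip: ennreal_mult ennreal_plus) (simp add: algebra_simps)
    next
      case False
      then show ?thesis using c yk unn unfolding G_def
        by (simp add: top_ennreal.rep_eq ennreal_top_mult e2ennreal_infty)
    qed
  next
    case xc
    then show ?thesis using yk unn unfolding G_def
      by (cases "y = 0"; cases "k = 0")
        (simp_all add: top_ennreal.rep_eq ennreal_top_mult e2ennreal_infty zero_ereal_def[symmetric] e2ennreal_ereal)
  qed
  show ?thesis using that 1 2 3 by blast
qed

end

lemma partial_x_pos:
  assumes u: "utility u" and nn: "0 \<le> x" "0 \<le> c" shows "0 < ennreal_partial_x u x c"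
proof -
  have "0 < ennreal ((u (x + 1 / real (Suc 0), c) - u (x, c)) * real (Suc 0))"
    using utility_strict_mono_x[OF u nn] by simp
  also have "\<dots> \<le> ennreal_partial_x u x c" unfolding ennreal_partial_x_def by (rule SUP_upper) simp
  finally show ?thesis .
qed

text \<open>On the open quadrant Frechet differentiability makes every directional derivative linear
  in the direction, so a gradient exists there from smoothness alone.\<close>

lemma interior_gradient:
  assumes u: "utility u" and pos: "0 < x" "0 < c"
  shows "has_gradient u x c" and "\<exists>a. partial_x u x c = ereal a"
proof -
  obtain f' :: "real \<times> real \<Rightarrow> (real \<times> real) \<Rightarrow>\<^sub>L real"
    where f': "\<And>z. z \<in> pos_quadrant \<Longrightarrow> (u has_derivative blinfun_apply (f' z)) (at z)"
    using u unfolding utility_def C2_negative_definite_on_def by blast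
  define D where "D = blinfun_apply (f' (x, c))"
  have D: "(u has_derivative D) (at (x, c))"
    unfolding D_def using pos by (intro f') (simp add: pos_quadrant_def)
  have lin: "linear D" using D by (rule has_derivative_linear)
  have dir: "((\<lambda>e. (u (x + e * v, c + e * h) - u (x, c)) / e) \<longlongrightarrow> D (v, h)) (at 0)" for v h
  proof -
    have "((\<lambda>e. (x + e * v, c + e * h)) has_derivative (\<lambda>e. (e * v, e * h))) (at 0)"
      by (auto intro!: derivative_eq_intros)
    moreover have "(u has_derivative D) (at ((\<lambda>e. (x + e * v, c + e * h)) (0::real)))" using D by simp
    ultimately have "((\<lambda>e. u (x + e * v, c + e * h)) has_derivative (\<lambda>e. D (e * v, e * h))) (at 0)"
      using has_derivative_compose[of "\<lambda>e. (x + e * v, c + e * h)" _ 0 UNIV u D] by simp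
    moreover have "(\<lambda>e. D (e * v, e * h)) = (*) (D (v, h))"
      using linear_scale[OF lin, of _ "(v, h)"] by (auto simp: mult.commute)
    ultimately have "((\<lambda>e. u (x + e * v, c + e * h)) has_field_derivative D (v, h)) (at 0)"
      by (simp add: has_field_derivative_def)
    then show ?thesis by (simp add: has_field_derivative_iff)
  qed
  have shift: "((\<lambda>y. f (y - a)) \<longlongrightarrow> l) (at a within S)" if "(f \<longlongrightarrow> l) (at 0)"
    for f :: "real \<Rightarrow> real" and a l S
  proof -
    have "((\<lambda>y. f (y - a)) \<longlongrightarrow> l) (at a)"
      using that by (subst LIM_offset_zero_iff) simp_all
    then show ?thesis by (rule tendsto_within_subset) simp
  qed
  \<comment> \<open>The partial derivatives are defined by \<open>Lim\<close>, which is determined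
    by convergence only along a nontrivial filter.\<close>
  have ntx: "at y within {0..} \<noteq> bot" if "0 < y" for y :: real
  proof -
    have Ioi_subset_Ici: "{0<..} \<subseteq> {0::real..}" by auto
    have "at y \<le> at y within {0..}"
      using that at_le[of "{0<..}" "{0..}" y, OF Ioi_subset_Ici] at_within_open[of y "{0<..}"] by auto
    then show ?thesis using at_neq_bot[of y] by (auto simp: bot_unique)
  qed
  have "((\<lambda>y. (u (y, c) - u (x, c)) / (y - x)) \<longlongrightarrow> D (1, 0)) (at x within {0..})"
    using shift[OF dir[of 1 0], of x] by simp
  then have px: "partial_x u x c = ereal (D (1, 0))"
    unfolding partial_x_def using ntx[OF pos(1)] by (intro tendsto_Lim tendsto_intros) auto
  have "((\<lambda>k. (u (x, k) - u (x, c)) / (k - c)) \<longlongrightarrow> D (0, 1)) (at c within {0..})"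
    using shift[OF dir[of 0 1], of c] by simp
  then have pc: "partial_c u x c = ereal (D (0, 1))"
    unfolding partial_c_def using ntx[OF pos(2)] by (intro tendsto_Lim tendsto_intros) auto
  have split: "D (v, h) = D (1, 0) * v + D (0, 1) * h" for v h
  proof -
    have "D (v, h) = D (v *\<^sub>R (1, 0) + h *\<^sub>R (0, 1))" by simp
    also have "\<dots> = v * D (1, 0) + h * D (0, 1)"
      by (simp only: linear_add[OF lin] linear_scale[OF lin] real_scaleR_def)
    finally show ?thesis by (simp add: mult.commute)
  qed
  show "has_gradient u x c"
    unfolding has_gradient_def px pc
  proof (intro allI impI)
    fix y k :: real
    have "((\<lambda>e. (u (x + e * (y - x), c + e * (k - c)) - u (x, c)) / e) \<longlongrightarrow> D (y - x, k - c)) (at_right 0)"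
      using dir by (rule tendsto_within_subset) simp
    then show "((\<lambda>e. ereal ((u (x + e * (y - x), c + e * (k - c)) - u (x, c)) / e)) \<longlongrightarrow>
        ereal (D (1, 0)) * ereal (y - x) + ereal (D (0, 1)) * ereal (k - c)) (at_right 0)"
      by (simp only: split[of "y - x" "k - c"] times_ereal.simps plus_ereal.simps tendsto_ereal)
  qed
  show "\<exists>a. partial_x u x c = ereal a" using px by blast
qed

text \<open>By concavity the slope of the chord from 0 to \<open>h\<close> dominates the derivative
  at \<open>h\<close>, which tends to infinity.\<close>

lemma inada:
  assumes u: "utility u" and c: "0 < c"
  shows "((\<lambda>h. ereal ((u (h, c) - u (0, c)) / h)) \<longlongrightarrow> \<infinity>) (at_right 0)"
proof (rule tendsto_sandwich[where f="\<lambda>h. partial_x u h c" and h="\<lambda>_. \<infinity>"])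
  have "partial_x u h c \<le> ereal ((u (h, c) - u (0, c)) / h)" if h: "0 < h" for h
  proof -
    have g: "has_gradient u h c" using interior_gradient[OF u h c] by simp
    obtain a where a: "partial_x u h c = ereal a" using interior_gradient(2)[OF u h c] by blast
    have "ereal (u (0, c) - u (h, c)) \<le>
        partial_x u h c * ereal (0 - h) + enn2ereal (ennreal_partial_c u h c) * ereal (c - c)"
      using gradient_ge[OF u _ _ g, of 0 c] partial_x_eq[OF u _ _ g] h c by simp
    then have "u (0, c) - u (h, c) \<le> - (a * h)" using a by (simp add: zero_ereal_def[symmetric])
    then show ?thesis using a h by (simp add: field_simps)
  qed
  then have "\<forall>h>0. h < 1 \<longrightarrow> partial_x u h c \<le> ereal ((u (h, c) - u (0, c)) / h)" by simp
  then show "\<forall>\<^sub>F h in at_right 0. partial_x u h c \<le> ereal ((u (h, c) - u (0, c)) / h)"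
    unfolding eventually_at_right[OF zero_less_one] by (intro exI[of _ 1]) auto
  show "((\<lambda>h. partial_x u h c) \<longlongrightarrow> \<infinity>) (at_right 0)" using u c by (simp add: utility_def)
qed auto

lemma inada_partial_x:
  assumes "utility u" "0 < c" shows "partial_x u 0 c = \<infinity>"
  unfolding partial_x_def using inada[OF assms]
  by (intro tendsto_Lim) (simp_all add: at_within_Ici_at_right)

text \<open>Moving from \<open>(0, c)\<close> towards \<open>(y, 0)\<close> raises consumption and
  lowers the public good at once. The point reached is the midpoint of \<open>(2 * y / N, c)\<close>
  and \<open>(0, c - 2 * c / N)\<close> with \<open>N = Suc n\<close>; concavity bounds the loss
  from the second by a fixed amount, while the slope towards the first is infinite.\<close>

lemma inada_direction:
  assumes u: "utility u" and c: "0 < c" and y: "0 < y"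
  shows "(\<lambda>n. ennreal (dir_quotient u 0 c y 0 (1 / real (Suc n)) + u (0, c))) \<longlonglongrightarrow> \<infinity>"
proof -
  \<comment> \<open>Twice the displacement of the first coordinate, because the actual point is used
    as a midpoint.\<close>
  let ?h = "\<lambda>n. 2 * y / real (Suc n)"
  have "filterlim ?h (at_right 0) sequentially"
  proof (rule filterlim_at_withinI)
    have "(\<lambda>n. (2 * y) * (1 / real (Suc n))) \<longlonglongrightarrow> 2 * y * 0"
      using LIMSEQ_Suc[OF lim_1_over_n] by (intro tendsto_mult_left)
    then show "?h \<longlonglongrightarrow> 0" by simp
  qed (use y in auto)
  from filterlim_compose[OF inada[OF u c] this]
  have "(\<lambda>n. ereal ((u (?h n, c) - u (0, c)) / ?h n)) \<longlonglongrightarrow> \<infinity>" .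
  then have "filterlim (\<lambda>n. (u (?h n, c) - u (0, c)) / ?h n) at_top sequentially"
    by (simp add: tendsto_PInfty_eq_at_top)
  then have lim: "filterlim (\<lambda>n. y * ((u (?h n, c) - u (0, c)) / ?h n)) at_top sequentially"
    using y by (intro filterlim_tendsto_pos_mult_at_top[OF tendsto_const])
  have "y * ((u (?h n, c) - u (0, c)) / ?h n) \<le> dir_quotient u 0 c y 0 (1 / real (Suc n)) + u (0, c)"
    \<comment> \<open>With \<open>Suc n\<close> at least 2 the second end point of the segment still
      has a nonnegative public good.\<close>
    if n: "1 \<le> n" for n
  proof -
    let ?N = "real (Suc n)"
    have N: "2 \<le> ?N" using n by simp
    have eqs: "?h n + 1/2 * (0 - ?h n) = y / ?N" "c + 1/2 * ((c + 2 / ?N * (0 - c)) - c) = c + 1 / ?N * (0 - c)"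
      by (simp_all add: algebra_simps)
    have c': "0 \<le> c + 2 / ?N * (0 - c)"
      using c N by (intro convex_combination_nonneg) (auto simp: field_simps)
    have 1: "(1 - 2 / ?N) * u (0, c) + 2 / ?N * u (0, 0) \<le> u (0 + 2 / ?N * (0 - 0), c + 2 / ?N * (0 - c))"
      using c N by (intro utility_concave[OF u]) (auto simp: field_simps)
    have "(1 - 1/2) * u (?h n, c) + 1/2 * u (0, c + 2 / ?N * (0 - c)) \<le>
        u (?h n + 1/2 * (0 - ?h n), c + 1/2 * ((c + 2 / ?N * (0 - c)) - c))"
      using y c c' by (intro utility_concave[OF u]) auto
    then have 2: "1/2 * u (?h n, c) + 1/2 * u (0, c + 2 / ?N * (0 - c)) \<le> u (y / ?N, c + 1 / ?N * (0 - c))"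
      unfolding eqs by simp
    have "?N * (1/2 * u (?h n, c) + 1/2 * ((1 - 2 / ?N) * u (0, c)) - u (0, c)) \<le>
        ?N * (u (y / ?N, c + 1 / ?N * (0 - c)) - u (0, c))"
    proof (intro mult_left_mono)
      have "0 \<le> 2 / ?N * u (0, 0)" using utility_nonneg[OF u, of 0 0] by simp
      moreover have "(1 - 2 / ?N) * u (0, c) + 2 / ?N * u (0, 0) \<le> u (0, c + 2 / ?N * (0 - c))"
        using 1 by (simp only: diff_self mult_zero_right add_0_left)
      moreover have "1/2 * a + 1/2 * p - v \<le> b - v"
        if "0 \<le> d" "p + d \<le> q" "1/2 * a + 1/2 * q \<le> b" for a b d p q v :: real
        using that by simp
      ultimately show "1/2 * u (?h n, c) + 1/2 * ((1 - 2 / ?N) * u (0, c)) - u (0, c) \<le>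
          u (y / ?N, c + 1 / ?N * (0 - c)) - u (0, c)" using 2 by blast
    qed simp
    moreover have "dir_quotient u 0 c y 0 (1 / ?N) = ?N * (u (y / ?N, c + 1 / ?N * (0 - c)) - u (0, c))"
      by (simp add: dir_quotient_def)
    moreover have "y * ((u (?h n, c) - u (0, c)) / ?h n) = ?N * (1/2 * u (?h n, c) - 1/2 * u (0, c))"
      using y N by (simp add: field_simps)
    moreover have "?N * (1/2 * u (?h n, c) + 1/2 * ((1 - 2 / ?N) * u (0, c)) - u (0, c)) =
       ?N * (1/2 * u (?h n, c) - 1/2 * u (0, c)) - u (0, c)"
      using N by (simp add: field_simps)
    ultimately show ?thesis by linarith
  qed
  then have "\<forall>\<^sub>F n in sequentially. y * ((u (?h n, c) - u (0, c)) / ?h n)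
      \<le> dir_quotient u 0 c y 0 (1 / real (Suc n)) + u (0, c)"
    unfolding eventually_sequentially by blast
  with lim have "filterlim (\<lambda>n. dir_quotient u 0 c y 0 (1 / real (Suc n)) + u (0, c)) at_top sequentially"
    by (rule filterlim_at_top_mono)
  then have "(\<lambda>n. e2ennreal (ereal (dir_quotient u 0 c y 0 (1 / real (Suc n)) + u (0, c)))) \<longlonglongrightarrow> e2ennreal \<infinity>"
    by (intro tendsto_e2ennrealI) (simp add: tendsto_PInfty_eq_at_top)
  then show ?thesis by (simp add: e2ennreal_ereal e2ennreal_infty)
qed

section \<open>Measurability of utilities and marginal utilities\<close>

definition clip :: "real \<times> real \<Rightarrow> real \<times> real" where
  "clip p = (max 0 (fst p), max 0 (snd p))"

text \<open>Smoothness gives continuity on the open quadrant only. On the two axes utility is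
  monotone in the remaining variable, hence Borel. Clipping hides the arbitrary values outside the
  quadrant.\<close>

lemma measurable_utility:
  assumes u: "utility u" shows "(\<lambda>p. u (clip p)) \<in> borel_measurable borel"
proof -
  obtain f' :: "real \<times> real \<Rightarrow> (real \<times> real) \<Rightarrow>\<^sub>L real"
    where f': "\<And>z. z \<in> pos_quadrant \<Longrightarrow> (u has_derivative blinfun_apply (f' z)) (at z)"
    using u unfolding utility_def C2_negative_definite_on_def by blast
  have "open pos_quadrant" unfolding pos_quadrant_def by (intro open_Times open_greaterThan)
  moreover have "isCont u z" if "z \<in> pos_quadrant" for z
    using f'[OF that] by (rule has_derivative_continuous)
  then have "continuous_on pos_quadrant u" by (intro continuous_at_imp_continuous_on) blast
  ultimately have int: "(\<lambda>p. indicator pos_quadrant p *\<^sub>R u p) \<in> borel_measurable borel"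
    by (intro borel_measurable_continuous_on_indicator) auto
  have "mono (\<lambda>s. u (max 0 s, 0))" "mono (\<lambda>s. u (0, max 0 s))"
    by (auto intro!: monoI utility_mono[OF u])
  then have m: "(\<lambda>s. u (max 0 s, 0)) \<in> borel_measurable borel" "(\<lambda>s. u (0, max 0 s)) \<in> borel_measurable borel"
    by (auto intro: borel_measurable_mono)
  have "(\<lambda>p. u (clip p)) = (\<lambda>p. if 0 < fst p \<and> 0 < snd p then indicator pos_quadrant p *\<^sub>R u p
      else if fst p \<le> 0 then u (0, max 0 (snd p)) else u (max 0 (fst p), 0))"
    by (auto simp: fun_eq_iff clip_def pos_quadrant_def max_def)
  also have "\<dots> \<in> borel_measurable borel"
  proof (intro measurable_If int)
    have "fst \<in> borel \<rightarrow>\<^sub>M (borel :: real measure)" "snd \<in> borel \<rightarrow>\<^sub>M (borel :: real measure)"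
      by (intro borel_measurable_continuous_onI continuous_intros)+
    show "(\<lambda>p :: real \<times> real. u (0, max 0 (snd p))) \<in> borel_measurable borel"
      by (rule measurable_compose[OF \<open>snd \<in> _\<close> m(2)])
    show "(\<lambda>p :: real \<times> real. u (max 0 (fst p), 0)) \<in> borel_measurable borel"
      by (rule measurable_compose[OF \<open>fst \<in> _\<close> m(1)])
    show "{p \<in> space borel. 0 < fst p \<and> 0 < snd (p :: real \<times> real)} \<in> sets borel"
      "{p \<in> space borel. fst (p :: real \<times> real) \<le> 0} \<in> sets borel"
      using \<open>fst \<in> _\<close> \<open>snd \<in> _\<close> by measurable
  qed
  finally show ?thesis .
qed

lemma measurable_utility_compose:
  assumes u: "utility u" and f: "f \<in> borel_measurable N" and g: "g \<in> borel_measurable N"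
    and nn: "\<And>z. z \<in> space N \<Longrightarrow> 0 \<le> f z" "\<And>z. z \<in> space N \<Longrightarrow> 0 \<le> g z"
  shows "(\<lambda>z. u (f z, g z)) \<in> borel_measurable N"
proof -
  have "(\<lambda>z. (f z, g z)) \<in> N \<rightarrow>\<^sub>M borel" using f g by simp
  then have "(\<lambda>z. u (clip (f z, g z))) \<in> borel_measurable N"
    by (rule measurable_compose) (rule measurable_utility[OF u])
  then show ?thesis
    by (rule measurable_cong[THEN iffD1, rotated]) (use nn in \<open>simp add: clip_def max_def\<close>)
qed

lemma measurable_partials:
  assumes u: "utility u" and f: "f \<in> borel_measurable N" and g: "g \<in> borel_measurable N"
    and nn: "\<And>z. z \<in> space N \<Longrightarrow> 0 \<le> f z" "\<And>z. z \<in> space N \<Longrightarrow> 0 \<le> g z"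
  shows "(\<lambda>z. ennreal_partial_x u (f z) (g z)) \<in> borel_measurable N"
    and "(\<lambda>z. ennreal_partial_c u (f z) (g z)) \<in> borel_measurable N"
proof -
  have m: "(\<lambda>z. u (f z, g z)) \<in> borel_measurable N"
    "(\<lambda>z. u (f z + 1 / real (Suc n), g z)) \<in> borel_measurable N"
    "(\<lambda>z. u (f z, g z + 1 / real (Suc n))) \<in> borel_measurable N" for n
    using f g nn by (auto intro!: measurable_utility_compose[OF u])
  show "(\<lambda>z. ennreal_partial_x u (f z) (g z)) \<in> borel_measurable N"
    unfolding ennreal_partial_x_def
    by (intro borel_measurable_SUP measurable_compose[OF _ measurable_ennreal] borel_measurable_times
        borel_measurable_diff m) auto
  show "(\<lambda>z. ennreal_partial_c u (f z) (g z)) \<in> borel_measurable N"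
    unfolding ennreal_partial_c_def
    by (intro borel_measurable_SUP measurable_compose[OF _ measurable_ennreal] borel_measurable_times
        borel_measurable_diff m) auto
qed

section \<open>Regularity of bounded martingales\<close>

text \<open>The recursion peels off the last upcrossing: a low value at \<open>p\<close>, then a
  high one at \<open>q\<close>, with the remaining upcrossings completed by \<open>p\<close>. This
  is the order of the induction in \<open>upcross_inequality\<close>.\<close>

primrec upcross :: "ennreal set \<Rightarrow> (ennreal \<Rightarrow> ennreal) \<Rightarrow> ennreal \<Rightarrow> ennreal \<Rightarrow> nat \<Rightarrow> ennreal \<Rightarrow> bool" where
  "upcross D g a b 0 t = True"
| "upcross D g a b (Suc k) t =
    (\<exists>q\<in>D. q \<le> t \<and> b \<le> g q \<and> (\<exists>p\<in>D. p \<le> q \<and> g p \<le> a \<and> upcross D g a b k p))"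

lemma upcross_mono_time: "upcross D g a b k s \<Longrightarrow> s \<le> t \<Longrightarrow> upcross D g a b k t"
  by (cases k) (auto intro: order_trans)

lemma upcross_mono_set: "upcross D g a b k t \<Longrightarrow> D \<subseteq> D' \<Longrightarrow> upcross D' g a b k t"
proof (induction k arbitrary: t)
  case (Suc k)
  then obtain q p where *: "q \<in> D" "q \<le> t" "b \<le> g q" "p \<in> D" "p \<le> q" "g p \<le> a"
    "upcross D g a b k p" by auto
  have "upcross D' g a b k p" using *(7) Suc.prems(2) by (rule Suc.IH)
  then show ?case using * Suc.prems(2) unfolding upcross.simps by blast
qed simp

text \<open>A chain of upcrossings uses finitely many times, which all lie in one stage of an
  increasing family.\<close>

lemma upcross_Union:
  assumes "incseq D" "upcross (\<Union>m. D m) g a b k t"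
  shows "\<exists>m. upcross (D m) g a b k t"
  using assms(2)
proof (induction k arbitrary: t)
  case (Suc k)
  then obtain q p i j where *: "q \<in> D i" "q \<le> t" "b \<le> g q" "p \<in> D j" "p \<le> q" "g p \<le> a"
    "upcross (\<Union>m. D m) g a b k p" by auto
  obtain l where l: "upcross (D l) g a b k p" using Suc.IH[OF *(7)] ..
  let ?m = "max i (max j l)"
  have "D i \<subseteq> D ?m" "D j \<subseteq> D ?m" "D l \<subseteq> D ?m"
    by (rule incseqD[OF assms(1)], simp)+
  then have "upcross (D ?m) g a b (Suc k) t"
    using * upcross_mono_set[OF l] unfolding upcross.simps by blast
  then show ?case ..
qed simp

text \<open>In \<open>ennreal\<close>, failing to converge means that the lower limit is strictly
  below the upper one. Rational separating levels keep the later union of exceptional events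
  countable.\<close>

lemma oscillation_or_limit:
  fixes g :: "'b \<Rightarrow> ennreal"
  assumes "\<nexists>l. (g \<longlongrightarrow> l) G"
  obtains a b where "a \<in> ennreal ` \<rat>" "b \<in> ennreal ` \<rat>" "a < b"
    "\<exists>\<^sub>F x in G. g x \<le> a" "\<exists>\<^sub>F x in G. b \<le> g x"
proof -
  have "G \<noteq> bot" using assms by auto
  then have "Liminf G g \<noteq> Limsup G g" using assms tendsto_iff_Liminf_eq_Limsup[of G g] by blast
  then have "Liminf G g < Limsup G g" using Liminf_le_Limsup[OF \<open>G \<noteq> bot\<close>, of g] by simp
  then obtain a where a: "Liminf G g < ennreal (real_of_rat a)" "ennreal (real_of_rat a) < Limsup G g"
    using ennreal_rat_dense by blast
  then obtain b where b: "ennreal (real_of_rat a) < ennreal (real_of_rat b)" "ennreal (real_of_rat b) < Limsup G g"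
    using ennreal_rat_dense by blast
  have "\<exists>\<^sub>F x in G. g x \<le> ennreal (real_of_rat a)"
  proof (rule ccontr)
    assume "\<not> ?thesis"
    then have "\<forall>\<^sub>F x in G. ennreal (real_of_rat a) \<le> g x"
      unfolding not_frequently by eventually_elim auto
    then have "ennreal (real_of_rat a) \<le> Liminf G g" by (rule Liminf_bounded)
    then show False using a by simp
  qed
  moreover have "\<exists>\<^sub>F x in G. ennreal (real_of_rat b) \<le> g x"
  proof (rule ccontr)
    assume "\<not> ?thesis"
    then have "\<forall>\<^sub>F x in G. g x \<le> ennreal (real_of_rat b)"
      unfolding not_frequently by eventually_elim auto
    then have "Limsup G g \<le> ennreal (real_of_rat b)" by (rule Limsup_bounded)
    then show False using b by simp
  qed
  ultimately show ?thesis
    using that[of "ennreal (real_of_rat a)" "ennreal (real_of_rat b)"] b by (simp add: image_eqI)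
qed

lemma frequently_right_witness:
  fixes t :: ennreal
  assumes "\<exists>\<^sub>F q in at t within (D \<inter> {t<..}). P q" "t < s"
  shows "\<exists>q\<in>D. t < q \<and> q < s \<and> P q"
proof -
  have "\<forall>\<^sub>F q in at t within (D \<inter> {t<..}). q < s \<and> q \<in> D \<and> t < q"
    unfolding eventually_at_topological using assms(2) by (intro exI[of _ "{..<s}"]) auto
  from frequently_eventually_frequently[OF assms(1) this] show ?thesis
    by (auto dest: frequently_ex)
qed

lemma frequently_left_witness:
  fixes t :: ennreal
  assumes "\<exists>\<^sub>F q in at t within (D \<inter> {..<t}). P q" "s < t"
  shows "\<exists>q\<in>D. s < q \<and> q < t \<and> P q"
proof -
  have "\<forall>\<^sub>F q in at t within (D \<inter> {..<t}). s < q \<and> q \<in> D \<and> q < t"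
    unfolding eventually_at_topological using assms(2) by (intro exI[of _ "{s<..}"]) auto
  from frequently_eventually_frequently[OF assms(1) this] show ?thesis
    by (auto dest: frequently_ex)
qed

text \<open>If low and high values accumulate at \<open>t\<close> from the right, upcrossings can be
  inserted ever closer to \<open>t\<close>; any interval to the right of \<open>t\<close> then
  contains arbitrarily many.\<close>

lemma right_limit_exists:
  assumes no: "\<And>a b. a \<in> ennreal ` \<rat> \<Longrightarrow> b \<in> ennreal ` \<rat> \<Longrightarrow> a < b \<Longrightarrow> \<exists>k. \<not> upcross D g a b k T"
    and t: "t < T"
  shows "\<exists>l. (g \<longlongrightarrow> l) (at t within (D \<inter> {t<..}))"
proof (rule ccontr)
  assume "\<not> ?thesis"
  then obtain a b where ab: "a \<in> ennreal ` \<rat>" "b \<in> ennreal ` \<rat>" "a < b"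
    "\<exists>\<^sub>F q in at t within (D \<inter> {t<..}). g q \<le> a" "\<exists>\<^sub>F q in at t within (D \<inter> {t<..}). b \<le> g q"
    by (rule oscillation_or_limit)
  have "upcross D g a b k s" if "t < s" for k s
    using that
  proof (induction k arbitrary: s)
    case (Suc k)
    obtain q where q: "q \<in> D" "t < q" "q < s" "b \<le> g q"
      using frequently_right_witness[OF ab(5) Suc.prems] by blast
    obtain p where p: "p \<in> D" "t < p" "p < q" "g p \<le> a"
      using frequently_right_witness[OF ab(4) q(2)] by blast
    have "upcross D g a b k p" using p(2) by (rule Suc.IH)
    then show ?case using q p less_imp_le unfolding upcross.simps by blast
  qed simp
  then show False using no[OF ab(1-3)] t by blast
qed

text \<open>On the left of \<open>t\<close> the upcrossings are appended one after another, each of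
  them still ending before \<open>t\<close>.\<close>

lemma left_limit_exists:
  assumes no: "\<And>a b. a \<in> ennreal ` \<rat> \<Longrightarrow> b \<in> ennreal ` \<rat> \<Longrightarrow> a < b \<Longrightarrow> \<exists>k. \<not> upcross D g a b k T"
    and t: "0 < t" "t \<le> T"
  shows "\<exists>l. (g \<longlongrightarrow> l) (at t within (D \<inter> {..<t}))"
proof (rule ccontr)
  assume "\<not> ?thesis"
  then obtain a b where ab: "a \<in> ennreal ` \<rat>" "b \<in> ennreal ` \<rat>" "a < b"
    "\<exists>\<^sub>F q in at t within (D \<inter> {..<t}). g q \<le> a" "\<exists>\<^sub>F q in at t within (D \<inter> {..<t}). b \<le> g q"
    by (rule oscillation_or_limit)
  have "\<exists>s<t. upcross D g a b k s" for k
  proof (induction k)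
    case 0
    then show ?case using t by auto
  next
    case (Suc k)
    then obtain s where s: "s < t" "upcross D g a b k s" by blast
    obtain p where p: "p \<in> D" "s < p" "p < t" "g p \<le> a"
      using frequently_left_witness[OF ab(4) s(1)] by blast
    obtain q where q: "q \<in> D" "p < q" "q < t" "b \<le> g q"
      using frequently_left_witness[OF ab(5) p(3)] by blast
    have "upcross D g a b k p" using upcross_mono_time[OF s(2)] p(2) by auto
    then have "upcross D g a b (Suc k) q"
      using q p less_imp_le order_refl unfolding upcross.simps by blast
    then show ?case using q(3) by blast
  qed
  then have "upcross D g a b k T" for k
    using t(2) by (meson upcross_mono_time less_imp_le order_trans)
  then show False using no[OF ab(1-3)] by blast
qed

text \<open>Closed constraints pass from the values of \<open>g\<close> on the dense set to its
  right limits. The one-sided limits of \<open>h\<close> then follow by taking half-lines as the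
  closed sets.\<close>

lemma regularized_right_limit:
  fixes g h :: "ennreal \<Rightarrow> ennreal"
  assumes dense: "\<And>s u. s < u \<Longrightarrow> u \<le> T \<Longrightarrow> \<exists>q\<in>D. s < q \<and> q < u"
    and h: "\<And>s. s < T \<Longrightarrow> (g \<longlongrightarrow> h s) (at s within (D \<inter> {s<..}))"
    and I: "v < u" "u \<le> T" and C: "closed C" "\<And>q. q \<in> D \<Longrightarrow> v < q \<Longrightarrow> q < u \<Longrightarrow> g q \<in> C"
    and s: "v < s" "s < u"
  shows "h s \<in> C"
proof (rule Lim_in_closed_set[OF C(1) _ _ h])
  show "s < T" using s I by simp
  show "\<forall>\<^sub>F q in at s within (D \<inter> {s<..}). g q \<in> C"
    unfolding eventually_at_topological using s C(2) by (intro exI[of _ "{..<u}"]) auto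
  show "at s within (D \<inter> {s<..}) \<noteq> bot"
  proof
    assume "at s within (D \<inter> {s<..}) = bot"
    then have "\<forall>\<^sub>F q in at s within (D \<inter> {s<..}). False" by simp
    then obtain S where S: "open S" "s \<in> S" "\<forall>q\<in>S. q \<noteq> s \<longrightarrow> q \<in> D \<inter> {s<..} \<longrightarrow> False"
      unfolding eventually_at_topological by blast
    obtain w where w: "s < w" "{s..<w} \<subseteq> S" using open_right[OF S(1,2) s(2)] by blast
    obtain q where "q \<in> D" "s < q" "q < min w u" using dense[of s "min w u"] w s I by (auto simp: min_le_iff_disj)
    moreover have "q \<in> S" using w(2) \<open>s < q\<close> \<open>q < min w u\<close> by auto
    ultimately show False using S(3) by auto
  qed
qed

lemma ennreal_order_tendsto_closed:
  fixes h :: "'b \<Rightarrow> ennreal"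
  assumes "\<And>a. a < l \<Longrightarrow> \<forall>\<^sub>F x in G. h x \<in> {a..}" "\<And>a. l < a \<Longrightarrow> \<forall>\<^sub>F x in G. h x \<in> {..a}"
  shows "(h \<longlongrightarrow> l) G"
proof (rule order_tendstoI)
  fix a assume "a < l"
  then obtain b where b: "a < b" "b < l" using dense by blast
  show "\<forall>\<^sub>F x in G. a < h x" using assms(1)[OF b(2)] by eventually_elim (use b in auto)
next
  fix a assume "l < a"
  then obtain b where b: "l < b" "b < a" using dense by blast
  show "\<forall>\<^sub>F x in G. h x < a" using assms(2)[OF b(1)] by eventually_elim (use b in auto)
qed

lemma regularized_right_continuous:
  fixes g h :: "ennreal \<Rightarrow> ennreal"
  assumes dense: "\<And>s u. s < u \<Longrightarrow> u \<le> T \<Longrightarrow> \<exists>q\<in>D. s < q \<and> q < u"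
    and h: "\<And>s. s < T \<Longrightarrow> (g \<longlongrightarrow> h s) (at s within (D \<inter> {s<..}))"
    and t: "t < T"
  shows "(h \<longlongrightarrow> h t) (at_right t)"
proof (rule ennreal_order_tendsto_closed)
  have *: "\<forall>\<^sub>F s in at_right t. h s \<in> C"
    if C: "closed C" and ev: "\<forall>\<^sub>F q in at t within (D \<inter> {t<..}). g q \<in> C" for C
  proof -
    obtain S where S: "open S" "t \<in> S" "\<And>q. q \<in> S \<Longrightarrow> q \<in> D \<Longrightarrow> t < q \<Longrightarrow> g q \<in> C"
      using ev unfolding eventually_at_topological by auto
    obtain w where w: "t < w" "{t..<w} \<subseteq> S" using open_right[OF S(1,2) t] by blast
    have "h s \<in> C" if "t < s" "s < min w T" for s
      by (rule regularized_right_limit[OF dense h _ _ C _ that]) (use w t in \<open>auto intro!: S(3) subsetD[OF w(2)]\<close>)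
    then show ?thesis
      using w t unfolding eventually_at_right[OF t] by (intro exI[of _ "min w T"]) auto
  qed
  show "\<forall>\<^sub>F s in at_right t. h s \<in> {a..}" if "a < h t" for a
    using order_tendstoD(1)[OF h[OF t] that] by (intro *) (auto elim: eventually_mono)
  show "\<forall>\<^sub>F s in at_right t. h s \<in> {..a}" if "h t < a" for a
    using order_tendstoD(2)[OF h[OF t] that] by (intro *) (auto elim: eventually_mono)
qed

lemma regularized_left_limit:
  fixes g h :: "ennreal \<Rightarrow> ennreal"
  assumes dense: "\<And>s u. s < u \<Longrightarrow> u \<le> T \<Longrightarrow> \<exists>q\<in>D. s < q \<and> q < u"
    and h: "\<And>s. s < T \<Longrightarrow> (g \<longlongrightarrow> h s) (at s within (D \<inter> {s<..}))"
    and t: "0 < t" "t \<le> T" and l: "(g \<longlongrightarrow> l) (at t within (D \<inter> {..<t}))"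
  shows "(h \<longlongrightarrow> l) (at_left t)"
proof (rule ennreal_order_tendsto_closed)
  have *: "\<forall>\<^sub>F s in at_left t. h s \<in> C"
    if C: "closed C" and ev: "\<forall>\<^sub>F q in at t within (D \<inter> {..<t}). g q \<in> C" for C
  proof -
    obtain S where S: "open S" "t \<in> S" "\<And>q. q \<in> S \<Longrightarrow> q \<in> D \<Longrightarrow> q < t \<Longrightarrow> g q \<in> C"
      using ev unfolding eventually_at_topological by auto
    obtain w where w: "w < t" "{w<..t} \<subseteq> S" using open_left[OF S(1,2) t(1)] by blast
    have "h s \<in> C" if "w < s" "s < t" for s
      by (rule regularized_right_limit[OF dense h w(1) t(2) C _ that]) (use w in \<open>auto intro!: S(3) subsetD[OF w(2)]\<close>)
    then show ?thesis
      using w unfolding eventually_at_left[OF t(1)] by (intro exI[of _ w]) auto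
  qed
  show "\<forall>\<^sub>F s in at_left t. h s \<in> {a..}" if "a < l" for a
    using order_tendstoD(1)[OF l that] by (intro *) (auto elim: eventually_mono)
  show "\<forall>\<^sub>F s in at_left t. h s \<in> {..a}" if "l < a" for a
    using order_tendstoD(2)[OF l that] by (intro *) (auto elim: eventually_mono)
qed

lemma nn_integral_Un_disjoint:
  assumes "A \<in> sets M" "B \<in> sets M" "A \<inter> B = {}" "f \<in> borel_measurable M"
  shows "(\<integral>\<^sup>+ x\<in>A \<union> B. f x \<partial>M) = (\<integral>\<^sup>+ x\<in>A. f x \<partial>M) + (\<integral>\<^sup>+ x\<in>B. f x \<partial>M)"
  using assms by (subst nn_integral_add[symmetric])
    (auto intro!: nn_integral_cong split: split_indicator)

section \<open>Cadlag versions of bounded closed martingales\<close>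

definition horizon_grid :: "nat \<Rightarrow> ennreal \<Rightarrow> ennreal set" where
  "horizon_grid m T = insert T {q \<in> grid m. q < T}"

lemma finite_horizon_grid [simp]: "finite (horizon_grid m T)"
  by (simp add: horizon_grid_def)

lemma horizon_grid_le: "q \<in> horizon_grid m T \<Longrightarrow> q \<le> T"
  by (auto simp: horizon_grid_def)

lemma incseq_horizon_grid: "incseq (\<lambda>m. horizon_grid m T)"
  using grid_mono by (auto simp: incseq_def horizon_grid_def)

lemma horizon_grid_dense: "s < u \<Longrightarrow> u \<le> T \<Longrightarrow> \<exists>q\<in>(\<Union>m. horizon_grid m T). s < q \<and> q < u"
proof -
  assume "s < u" "u \<le> T"
  moreover obtain m q where "q \<in> grid m" "s < q" "q < u" using grid_dense[OF \<open>s < u\<close>] .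
  ultimately show ?thesis by (intro bexI[of _ q]) (auto simp: horizon_grid_def)
qed

lemma grid_up_in_horizon_grid: "grid_up m T s \<in> horizon_grid m T"
  using grid_up_in[of m T s] grid_up_le[of m T s] by (auto simp: horizon_grid_def)

lemma grid_up_tendsto_horizon_grid:
  assumes "s < T"
  shows "filterlim (\<lambda>m. grid_up m T s) (at s within ((\<Union>m. horizon_grid m T) \<inter> {s<..})) sequentially"
proof (rule filterlim_at_withinI)
  show "(\<lambda>m. grid_up m T s) \<longlonglongrightarrow> s"
    using grid_up_tendsto[OF assms] by (auto simp: filterlim_at)
  show "\<forall>\<^sub>F m in sequentially. grid_up m T s \<in> (\<Union>m. horizon_grid m T) \<inter> {s<..} - {s}"
    using less_grid_up[OF assms] grid_up_in_horizon_grid[of _ T s]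
    by (intro always_eventually) (auto simp: less_imp_neq)
qed

text \<open>The bound holds for every outcome and not just almost surely, so that path limits are
  finite everywhere. Stating the martingale property through integrals against the closing variable
  \<xi> avoids conditional expectations in the upcrossing argument.\<close>

locale closed_martingale = usual_filtration +
  fixes \<xi> :: "'a \<Rightarrow> ennreal" and N :: "ennreal \<Rightarrow> 'a \<Rightarrow> ennreal" and K :: real
  assumes xi: "\<xi> \<in> borel_measurable M"
    and N_measurable: "\<And>q. N q \<in> borel_measurable (F q)"
    and N_bounded: "\<And>q \<omega>. N q \<omega> \<le> ennreal K"
    and N_integral: "\<And>q A. A \<in> sets (F q) \<Longrightarrow> (\<integral>\<^sup>+ \<omega>\<in>A. N q \<omega> \<partial>M) = (\<integral>\<^sup>+ \<omega>\<in>A. \<xi> \<omega> \<partial>M)"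
begin

text \<open>Doob's maximal inequality restricted to events \<open>B q\<close> known at time
  \<open>q\<close>. Times are added in increasing order: the part of the event that is new at the
  last time \<open>m\<close> belongs to \<open>F m\<close>, so on it \<xi> may be replaced by
  \<open>N m\<close>, which is at least \<open>b\<close>.\<close>

lemma maximal_ge:
  fixes b :: ennreal
  assumes "finite D" "\<And>q. q \<in> D \<Longrightarrow> B q \<in> sets (F q)" "\<And>q. q \<in> D \<Longrightarrow> q \<le> t"
  defines "A \<equiv> \<Union>q\<in>D. B q \<inter> {\<omega> \<in> space M. b \<le> N q \<omega>}"
  shows "A \<in> sets (F t) \<and> b * emeasure M A \<le> (\<integral>\<^sup>+ \<omega>\<in>A. \<xi> \<omega> \<partial>M)"
  using assms(1-3) unfolding A_def
proof (induction D arbitrary: t rule: finite_linorder_max_induct)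
  case (insert m D)
  let ?A = "\<Union>q\<in>D. B q \<inter> {\<omega> \<in> space M. b \<le> N q \<omega>}"
  let ?E = "B m \<inter> {\<omega> \<in> space M. b \<le> N m \<omega>}"
  have IH: "?A \<in> sets (F m)" "b * emeasure M ?A \<le> (\<integral>\<^sup>+ \<omega>\<in>?A. \<xi> \<omega> \<partial>M)"
    using insert.IH[of m] insert.prems insert.hyps(2) by (simp_all add: less_imp_le)
  have "{\<omega> \<in> space (F m). b \<le> N m \<omega>} \<in> sets (F m)"
    using N_measurable[of m] by measurable
  then have E: "?E \<in> sets (F m)" using insert.prems by (auto simp: space_F)
  define C where "C = ?E - ?A"
  have C: "C \<in> sets (F m)" unfolding C_def using E IH(1) by blast
  have M: "C \<in> sets M" "?A \<in> sets M" using C IH(1) sets_F_subset by auto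
  have Un: "(\<Union>q\<in>insert m D. B q \<inter> {\<omega> \<in> space M. b \<le> N q \<omega>}) = ?A \<union> C"
    unfolding C_def by auto
  have "b * emeasure M C = (\<integral>\<^sup>+ \<omega>\<in>C. b \<partial>M)" using M by (simp add: nn_integral_cmult_indicator)
  also have "\<dots> \<le> (\<integral>\<^sup>+ \<omega>\<in>C. N m \<omega> \<partial>M)"
    by (intro nn_integral_mono) (auto simp: C_def split: split_indicator)
  also have "\<dots> = (\<integral>\<^sup>+ \<omega>\<in>C. \<xi> \<omega> \<partial>M)" using C by (rule N_integral)
  finally have "b * emeasure M ?A + b * emeasure M C \<le> (\<integral>\<^sup>+ \<omega>\<in>?A. \<xi> \<omega> \<partial>M) + (\<integral>\<^sup>+ \<omega>\<in>C. \<xi> \<omega> \<partial>M)"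
    using IH(2) by (intro add_mono)
  moreover have "?A \<inter> C = {}" unfolding C_def by auto
  ultimately have "b * emeasure M (?A \<union> C) \<le> (\<integral>\<^sup>+ \<omega>\<in>?A \<union> C. \<xi> \<omega> \<partial>M)"
    using M xi by (simp add: nn_integral_Un_disjoint plus_emeasure[symmetric] distrib_left)
  moreover have "?A \<union> C \<in> sets (F t)"
    using IH(1) C sets_F_mono[of m t] insert.prems by auto
  ultimately show ?case unfolding Un by simp
qed simp

text \<open>The decomposition of \<open>maximal_ge\<close> with the inequality reversed: the new
  part at the last time is where \<open>N m\<close> is at most \<open>a\<close>.\<close>

lemma maximal_le:
  fixes a :: ennreal
  assumes "finite D" "\<And>q. q \<in> D \<Longrightarrow> B q \<in> sets (F q)" "\<And>q. q \<in> D \<Longrightarrow> q \<le> t"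
  defines "A \<equiv> \<Union>q\<in>D. B q \<inter> {\<omega> \<in> space M. N q \<omega> \<le> a}"
  shows "A \<in> sets (F t) \<and> (\<integral>\<^sup>+ \<omega>\<in>A. \<xi> \<omega> \<partial>M) \<le> a * emeasure M A"
  using assms(1-3) unfolding A_def
proof (induction D arbitrary: t rule: finite_linorder_max_induct)
  case (insert m D)
  let ?A = "\<Union>q\<in>D. B q \<inter> {\<omega> \<in> space M. N q \<omega> \<le> a}"
  let ?E = "B m \<inter> {\<omega> \<in> space M. N m \<omega> \<le> a}"
  have IH: "?A \<in> sets (F m)" "(\<integral>\<^sup>+ \<omega>\<in>?A. \<xi> \<omega> \<partial>M) \<le> a * emeasure M ?A"
    using insert.IH[of m] insert.prems insert.hyps(2) by (simp_all add: less_imp_le)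
  have "{\<omega> \<in> space (F m). N m \<omega> \<le> a} \<in> sets (F m)"
    using N_measurable[of m] by measurable
  then have E: "?E \<in> sets (F m)" using insert.prems by (auto simp: space_F)
  define C where "C = ?E - ?A"
  have C: "C \<in> sets (F m)" unfolding C_def using E IH(1) by blast
  have M: "C \<in> sets M" "?A \<in> sets M" using C IH(1) sets_F_subset by auto
  have Un: "(\<Union>q\<in>insert m D. B q \<inter> {\<omega> \<in> space M. N q \<omega> \<le> a}) = ?A \<union> C"
    unfolding C_def by auto
  have "(\<integral>\<^sup>+ \<omega>\<in>C. \<xi> \<omega> \<partial>M) = (\<integral>\<^sup>+ \<omega>\<in>C. N m \<omega> \<partial>M)" using C by (rule N_integral[symmetric])
  also have "\<dots> \<le> (\<integral>\<^sup>+ \<omega>\<in>C. a \<partial>M)"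
    by (intro nn_integral_mono) (auto simp: C_def split: split_indicator)
  also have "\<dots> = a * emeasure M C" using M by (simp add: nn_integral_cmult_indicator)
  finally have "(\<integral>\<^sup>+ \<omega>\<in>?A. \<xi> \<omega> \<partial>M) + (\<integral>\<^sup>+ \<omega>\<in>C. \<xi> \<omega> \<partial>M) \<le> a * emeasure M ?A + a * emeasure M C"
    using IH(2) by (intro add_mono)
  moreover have "?A \<inter> C = {}" unfolding C_def by auto
  ultimately have "(\<integral>\<^sup>+ \<omega>\<in>?A \<union> C. \<xi> \<omega> \<partial>M) \<le> a * emeasure M (?A \<union> C)"
    using M xi by (simp add: nn_integral_Un_disjoint plus_emeasure[symmetric] distrib_left)
  moreover have "?A \<union> C \<in> sets (F t)"
    using IH(1) C sets_F_mono[of m t] insert.prems by auto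
  ultimately show ?case unfolding Un by simp
qed simp

text \<open>Dubins' inequality. An upcrossing is completed at a time when the martingale exceeds \<open>b\<close>, after
  a time when it was below \<open>a\<close>; comparing the integrals of the closing variable \<open>\<xi>\<close> over the two
  events gains a factor \<open>a / b\<close> per upcrossing.\<close>

lemma upcross_inequality:
  fixes a b :: ennreal
  assumes D: "finite D"
  defines "U \<equiv> \<lambda>k t. {\<omega> \<in> space M. upcross D (\<lambda>q. N q \<omega>) a b k t}"
  shows "U k t \<in> sets (F t) \<and> b ^ k * emeasure M (U k t) \<le> a ^ k"
proof (induction k arbitrary: t)
  case 0
  have "U 0 t = space (F t)" unfolding U_def by (simp add: space_F)
  then show ?case using emeasure_space_1 sets.top[of "F t"] by (simp add: space_F)
next
  case (Suc k)
  \<comment> \<open>The event that \<open>k\<close> upcrossings are followed by a value at most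
    \<open>a\<close>, all by time \<open>t\<close>. It lies between the events of \<open>k\<close>
    and of \<open>k + 1\<close> upcrossings, and the two maximal inequalities are applied on its two
    sides.\<close>
  define V where "V = (\<lambda>t. \<Union>p\<in>{p \<in> D. p \<le> t}. U k p \<inter> {\<omega> \<in> space M. N p \<omega> \<le> a})"
  have V: "V s \<in> sets (F s)" "(\<integral>\<^sup>+ \<omega>\<in>V s. \<xi> \<omega> \<partial>M) \<le> a * emeasure M (V s)" for s
  proof -
    have "V s \<in> sets (F s) \<and> (\<integral>\<^sup>+ \<omega>\<in>V s. \<xi> \<omega> \<partial>M) \<le> a * emeasure M (V s)"
      unfolding V_def using Suc.IH D by (intro maximal_le) simp_all
    then show "V s \<in> sets (F s)" "(\<integral>\<^sup>+ \<omega>\<in>V s. \<xi> \<omega> \<partial>M) \<le> a * emeasure M (V s)" by simp_all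
  qed
  have eq: "U (Suc k) t = (\<Union>q\<in>{q \<in> D. q \<le> t}. V q \<inter> {\<omega> \<in> space M. b \<le> N q \<omega>})"
    unfolding U_def V_def upcross.simps by blast
  have U: "U (Suc k) t \<in> sets (F t)"
    "b * emeasure M (U (Suc k) t) \<le> (\<integral>\<^sup>+ \<omega>\<in>U (Suc k) t. \<xi> \<omega> \<partial>M)"
  proof -
    have "U (Suc k) t \<in> sets (F t) \<and>
        b * emeasure M (U (Suc k) t) \<le> (\<integral>\<^sup>+ \<omega>\<in>U (Suc k) t. \<xi> \<omega> \<partial>M)"
      unfolding eq using V(1) D by (intro maximal_ge) simp_all
    then show "U (Suc k) t \<in> sets (F t)"
      "b * emeasure M (U (Suc k) t) \<le> (\<integral>\<^sup>+ \<omega>\<in>U (Suc k) t. \<xi> \<omega> \<partial>M)" by simp_all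
  qed
  have "V q \<subseteq> V t" if "q \<le> t" for q using that unfolding V_def by (auto intro: order_trans)
  then have "U (Suc k) t \<subseteq> V t" unfolding eq by blast
  then have le: "(\<integral>\<^sup>+ \<omega>\<in>U (Suc k) t. \<xi> \<omega> \<partial>M) \<le> (\<integral>\<^sup>+ \<omega>\<in>V t. \<xi> \<omega> \<partial>M)"
    by (intro nn_integral_mono) (auto split: split_indicator)
  have "V t \<subseteq> U k t" unfolding V_def U_def by (auto intro: upcross_mono_time)
  then have "emeasure M (V t) \<le> emeasure M (U k t)"
    using Suc sets_F_subset by (intro emeasure_mono) auto
  then have "b * emeasure M (U (Suc k) t) \<le> a * emeasure M (U k t)"
    using U(2) le V(2)[of t] by (meson mult_left_mono order_trans zero_le)
  then have "b ^ k * (b * emeasure M (U (Suc k) t)) \<le> b ^ k * (a * emeasure M (U k t))"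
    by (intro mult_left_mono) auto
  also have "\<dots> = a * (b ^ k * emeasure M (U k t))" by (simp add: ac_simps)
  also have "\<dots> \<le> a * a ^ k" using Suc by (intro mult_left_mono) auto
  finally show ?case using U(1) by (simp add: ac_simps)
qed

definition times :: "ennreal set" where "times = (\<Union>m. horizon_grid m T)"

text \<open>On every finite grid the probability of \<open>k\<close> upcrossings is at most the
  \<open>k\<close>th power of the ratio of the levels. The bound does not depend on the grid, so it
  survives the union over grids and then tends to 0 in \<open>k\<close>.\<close>

lemma AE_no_oscillation:
  assumes ab: "a < b" "b < \<top>"
  shows "AE \<omega> in M. \<exists>k. \<not> upcross times (\<lambda>q. N q \<omega>) a b k T"
proof -
  define U where "U m k = {\<omega> \<in> space M. upcross (horizon_grid m T) (\<lambda>q. N q \<omega>) a b k T}" for m k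
  obtain \<alpha> \<beta> where r: "a = ennreal \<alpha>" "b = ennreal \<beta>" "0 \<le> \<alpha>" "\<alpha> < \<beta>"
    using ab by (cases a; cases b) (auto simp: ennreal_less_iff)
  have U: "U m k \<in> sets M" "b ^ k * emeasure M (U m k) \<le> a ^ k" for m k
    using upcross_inequality[of "horizon_grid m T" a b k T] sets_F_subset[of T] unfolding U_def by auto
  have "incseq (\<lambda>m. U m k)" for k
    using upcross_mono_set[OF _ incseqD[OF incseq_horizon_grid]]
    unfolding U_def incseq_def by blast
  then have *: "(SUP m. emeasure M (U m k)) = emeasure M (\<Union>m. U m k)" for k
    using U(1) by (intro SUP_emeasure_incseq) auto
  have bound: "measure M (\<Union>m. U m k) \<le> (\<alpha> / \<beta>) ^ k" for k
  proof -
    have "b ^ k * emeasure M (\<Union>m. U m k) = (SUP m. b ^ k * emeasure M (U m k))"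
      unfolding *[symmetric] by (rule SUP_mult_left_ennreal)
    also have "\<dots> \<le> a ^ k" using U(2) by (rule SUP_least)
    finally have "\<beta> ^ k * measure M (\<Union>m. U m k) \<le> \<alpha> ^ k"
      using r by (simp add: emeasure_eq_measure ennreal_power flip: ennreal_mult) 
    then show ?thesis using r by (simp add: power_divide field_simps)
  qed
  define E where "E = (\<Inter>k. \<Union>m. U m k)"
  have E: "E \<in> sets M" unfolding E_def using U(1) by auto
  have "measure M E \<le> (\<alpha> / \<beta>) ^ k" for k
    using U(1) by (intro order_trans[OF finite_measure_mono bound[of k]]) (auto simp: E_def)
  moreover have "(\<lambda>k. (\<alpha> / \<beta>) ^ k) \<longlonglongrightarrow> 0" using r by (intro LIMSEQ_realpow_zero) auto
  ultimately have "measure M E \<le> 0" by (intro LIMSEQ_le_const) auto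
  then have "emeasure M E = 0" by (simp add: emeasure_eq_measure measure_le_0_iff)
  then have "AE \<omega> in M. \<omega> \<notin> E" using E by (intro AE_not_in) (simp add: null_sets_def)
  then show ?thesis
  proof (rule AE_mp, intro AE_I2 impI)
    fix \<omega> assume "\<omega> \<in> space M" "\<omega> \<notin> E"
    then obtain k where "\<And>m. \<omega> \<notin> U m k" unfolding E_def by auto
    then have "\<not> upcross times (\<lambda>q. N q \<omega>) a b k T"
      using upcross_Union[OF incseq_horizon_grid] \<open>\<omega> \<in> space M\<close> unfolding U_def times_def by blast
    then show "\<exists>k. \<not> upcross times (\<lambda>q. N q \<omega>) a b k T" ..
  qed
qed

definition regular :: "'a set" where
  "regular = {\<omega> \<in> space M. \<forall>a\<in>ennreal ` \<rat>. \<forall>b\<in>ennreal ` \<rat>. a < b \<longrightarrow>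
    (\<exists>k. \<not> upcross times (\<lambda>q. N q \<omega>) a b k T)}"

lemma AE_regular: "AE \<omega> in M. \<omega> \<in> regular"
proof -
  have c: "countable (ennreal ` \<rat>)" by (intro countable_image countable_rat)
  have "AE \<omega> in M. a < b \<longrightarrow> (\<exists>k. \<not> upcross times (\<lambda>q. N q \<omega>) a b k T)"
    if "b \<in> ennreal ` \<rat>" for a b
    using AE_no_oscillation[of a b] that by (cases "a < b") (auto simp: less_top[symmetric])
  then have "AE \<omega> in M. \<forall>a\<in>ennreal ` \<rat>. \<forall>b\<in>ennreal ` \<rat>. a < b \<longrightarrow>
      (\<exists>k. \<not> upcross times (\<lambda>q. N q \<omega>) a b k T)"
    by (subst AE_ball_countable[OF c], intro ballI, subst AE_ball_countable[OF c]) auto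
  then show ?thesis using AE_space by eventually_elim (auto simp: regular_def)
qed

lemma regular_F: "regular \<in> sets (F t)"
  using AE_sets_F[OF AE_regular, of t] unfolding regular_def by (simp add: Collect_conj_eq[symmetric] conj_assoc[symmetric])

text \<open>The lower limit is defined and measurable for every path and is a limit on the regular
  ones. At the horizon the rounded time is \<open>T\<close> itself, so the value there is
  \<open>N T\<close>.\<close>

definition cadlag_version :: "ennreal \<Rightarrow> 'a \<Rightarrow> ennreal" where
  "cadlag_version t \<omega> = (if \<omega> \<in> regular then liminf (\<lambda>m. N (grid_up m T t) \<omega>) else 0)"

lemma cadlag_version_right_limit:
  assumes "\<omega> \<in> regular" "t < T"
  shows "((\<lambda>q. N q \<omega>) \<longlongrightarrow> cadlag_version t \<omega>) (at t within (times \<inter> {t<..}))"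
proof -
  obtain l where l: "((\<lambda>q. N q \<omega>) \<longlongrightarrow> l) (at t within (times \<inter> {t<..}))"
    using right_limit_exists[of times "\<lambda>q. N q \<omega>" T t] assms unfolding regular_def by blast
  then have "(\<lambda>m. N (grid_up m T t) \<omega>) \<longlonglongrightarrow> l"
    using grid_up_tendsto_horizon_grid[OF assms(2)] unfolding times_def by (rule filterlim_compose)
  then have "liminf (\<lambda>m. N (grid_up m T t) \<omega>) = l" by (intro lim_imp_Liminf) auto
  then show ?thesis using l assms by (simp add: cadlag_version_def)
qed

lemma cadlag_version_tendsto:
  assumes "\<omega> \<in> regular" "t \<le> T"
  shows "(\<lambda>m. N (grid_up m T t) \<omega>) \<longlonglongrightarrow> cadlag_version t \<omega>"
proof (cases "t < T")
  case True
  then show ?thesis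
    using filterlim_compose[OF cadlag_version_right_limit[OF assms(1) True]]
      grid_up_tendsto_horizon_grid[OF True] unfolding times_def by blast
next
  case False
  then show ?thesis using assms by (simp add: cadlag_version_def Liminf_const)
qed

lemma cadlag_version_le: "cadlag_version t \<omega> \<le> ennreal K"
proof -
  have "liminf (\<lambda>m. N (grid_up m T t) \<omega>) \<le> limsup (\<lambda>m. N (grid_up m T t) \<omega>)"
    by (rule Liminf_le_Limsup) simp
  also have "\<dots> \<le> ennreal K" using N_bounded by (intro Limsup_bounded) simp
  finally show ?thesis by (simp add: cadlag_version_def)
qed

text \<open>For each \<open>s > t\<close> the lower limit only sees times at most \<open>s\<close>,
  so it is \<open>F s\<close>-measurable; right-continuity of the filtration brings this down to
  \<open>F t\<close>.\<close>

lemma cadlag_version_measurable: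
  assumes "t \<le> T" shows "cadlag_version t \<in> borel_measurable (F t)"
proof -
  have *: "cadlag_version t \<in> borel_measurable (F s)" if s: "t < s \<or> s = T" "s \<le> T" for s
  proof -
    \<comment> \<open>Values at grid times beyond \<open>s\<close> are replaced by 0. Only finitely
      many \<open>m\<close> are affected, so the lower limit is unchanged.\<close>
    let ?f = "\<lambda>m \<omega>. if grid_up m T t \<le> s then N (grid_up m T t) \<omega> else 0"
    have m: "?f m \<in> borel_measurable (F s)" for m
      using N_measurable measurable_F_mono[of "grid_up m T t" s "N (grid_up m T t)"]
      by (cases "grid_up m T t \<le> s") auto
    have "\<forall>\<^sub>F m in sequentially. grid_up m T t \<le> s"
    proof (cases "s = T")
      case True
      then show ?thesis by (simp add: grid_up_le)
    next
      case False
      then have "t < s" "t < T" using s by auto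
      have "(\<lambda>m. grid_up m T t) \<longlonglongrightarrow> t"
        using grid_up_tendsto[OF \<open>t < T\<close>] by (auto simp: filterlim_at)
      then have "\<forall>\<^sub>F m in sequentially. grid_up m T t < s" using \<open>t < s\<close> by (rule order_tendstoD)
      then show ?thesis by eventually_elim simp
    qed
    then have "liminf (\<lambda>m. N (grid_up m T t) \<omega>) = liminf (\<lambda>m. ?f m \<omega>)" for \<omega>
      by (intro Liminf_eq) (auto elim!: eventually_mono)
    then have "cadlag_version t = (\<lambda>\<omega>. if \<omega> \<in> regular then liminf (\<lambda>m. ?f m \<omega>) else 0)"
      by (simp add: cadlag_version_def fun_eq_iff)
    also have "\<dots> \<in> borel_measurable (F s)"
      using regular_F[of s] m by (intro measurable_If_set borel_measurable_liminf) (auto simp: sets.Int_space_eq2)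
    finally show ?thesis .
  qed
  show ?thesis
  proof (cases "t = T")
    case True
    then show ?thesis using * by simp
  next
    case False
    then have "t < T" using assms by simp
    show ?thesis
    proof (rule measurableI)
      fix B :: "ennreal set" assume B: "B \<in> sets borel"
      show "cadlag_version t -` B \<inter> space (F t) \<in> sets (F t)"
      proof (rule sets_F_right[OF \<open>t < T\<close>])
        fix s assume "t < s" "s \<le> T"
        then have "cadlag_version t -` B \<inter> space (F s) \<in> sets (F s)"
          using * B by (intro measurable_sets) auto
        then show "cadlag_version t -` B \<inter> space (F t) \<in> sets (F s)" by (simp add: space_F)
      qed
    qed simp
  qed
qed

lemma cadlag_version_cadlag: "cadlag_path T (\<lambda>t. enn2real (cadlag_version t \<omega>))"
proof (cases "\<omega> \<in> regular")
  case True
  have dense: "s < u \<Longrightarrow> u \<le> T \<Longrightarrow> \<exists>q\<in>times. s < q \<and> q < u" for s u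
    unfolding times_def by (rule horizon_grid_dense)
  note lims = cadlag_version_right_limit[OF True]
  have fin: "cadlag_version t \<omega> \<noteq> \<top>" for t using cadlag_version_le[of t \<omega>] by (auto simp: top_unique)
  show ?thesis
    unfolding cadlag_path_def right_continuous_path_def
  proof (intro conjI allI impI)
    fix t assume "t < T"
    have "((\<lambda>t. cadlag_version t \<omega>) \<longlongrightarrow> cadlag_version t \<omega>) (at_right t)"
      by (rule regularized_right_continuous[OF dense lims \<open>t < T\<close>])
    then show "continuous (at_right t) (\<lambda>t. enn2real (cadlag_version t \<omega>))"
      unfolding continuous_within using fin[of t]
      by (intro tendsto_enn2real) (auto simp: ennreal_enn2real_if)
  next
    fix t assume t: "t \<le> T" "0 < t"
    obtain l where l': "((\<lambda>q. N q \<omega>) \<longlongrightarrow> l) (at t within (times \<inter> {..<t}))"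
      using left_limit_exists[of times "\<lambda>q. N q \<omega>" T t] t True unfolding regular_def by blast
    have l: "((\<lambda>t. cadlag_version t \<omega>) \<longlongrightarrow> l) (at_left t)"
      by (rule regularized_left_limit[OF dense lims t(2,1) l'])
    have "at_left t \<noteq> bot"
    proof
      assume "at_left t = bot"
      then have "\<forall>\<^sub>F s in at_left t. False" by simp
      then obtain v where "v < t" "\<And>s. v < s \<Longrightarrow> \<not> s < t"
        unfolding eventually_at_left[OF t(2)] by blast
      then show False using Orderings.dense[of v t] by blast
    qed
    then have "l \<le> ennreal K" using l cadlag_version_le by (intro tendsto_upperbound[OF l]) auto
    then obtain l' where "l = ennreal l'" "0 \<le> l'" by (cases l) (auto simp: top_unique)
    then show "\<exists>l. ((\<lambda>t. enn2real (cadlag_version t \<omega>)) \<longlongrightarrow> l) (at_left t)"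
      using tendsto_enn2real[of "\<lambda>t. cadlag_version t \<omega>" l'] l by blast
  qed
next
  case False
  then show ?thesis using cadlag_path_step[of T 0 0] by (simp add: cadlag_version_def)
qed

lemma cadlag_version_optional: "optional T M F (\<lambda>t \<omega>. enn2real (cadlag_version t \<omega>))"
  using cadlag_version_measurable cadlag_version_cadlag
  by (intro optional_cadlag) (auto simp: adapted_def)

text \<open>Optional stopping. The stopping time is rounded up to a finite grid, where the
  martingale identity is applied on each event of constant value, and the bound \<open>K\<close>
  allows dominated convergence as the grid is refined.\<close>

lemma cadlag_version_integral:
  assumes tau: "stopping_time F \<tau>" and A: "A \<in> sets (pre_sigma \<tau>)" and le: "\<And>\<omega>. \<omega> \<in> A \<Longrightarrow> \<tau> \<omega> \<le> T"
  shows "(\<integral>\<^sup>+ \<omega>\<in>A. cadlag_version (\<tau> \<omega>) \<omega> \<partial>M) = (\<integral>\<^sup>+ \<omega>\<in>A. \<xi> \<omega> \<partial>M)"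
proof -
  have AM: "A \<in> sets M" using A subalg_pre_sigma[OF tau] by (auto simp: subalgebra_def)
  have Asub: "A \<subseteq> space M" using AM sets.sets_into_space by blast
  have Aless: "{\<omega> \<in> A. \<tau> \<omega> < p} \<in> sets (F p)" for p
  proof -
    have "{\<omega> \<in> space M. \<tau> \<omega> < p} \<in> sets (F p)"
      using stopping_time_less_const[OF tau, of p] by (simp add: pred_def space_F)
    then have "{\<omega> \<in> A. \<tau> \<omega> \<le> p} \<inter> {\<omega> \<in> space M. \<tau> \<omega> < p} \<in> sets (F p)"
      using sets_pre_sigmaD[OF tau A, of p] by blast
    then show ?thesis by (rule back_subst[of "\<lambda>A. A \<in> _"]) (use Asub in auto)
  qed
  have piece: "{\<omega> \<in> A. grid_up m T (\<tau> \<omega>) = q} \<in> sets (F q)" if q: "q \<in> horizon_grid m T" for m q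
  proof -
    let ?L = "\<Union>p\<in>{p \<in> grid m. p < q}. {\<omega> \<in> A. \<tau> \<omega> < p}"
    \<comment> \<open>\<open>?L\<close> is the event that the rounded time is smaller than
      \<open>q\<close>: some earlier grid point lies strictly after \<tau>.\<close>
    have L: "?L \<in> sets (F q)"
      using Aless sets_F_mono by (intro sets.finite_UN) (auto dest!: less_imp_le)
    have up: "grid_up m T s < q \<longleftrightarrow> (\<exists>p\<in>grid m. p < q \<and> s < p)" if "s \<le> T" for s
      unfolding grid_up_def using horizon_grid_le[OF q] by (subst Min_less_iff) auto
    have "{\<omega> \<in> A. grid_up m T (\<tau> \<omega>) = q} = {\<omega> \<in> A. grid_up m T (\<tau> \<omega>) \<le> q} - ?L"
      using up le by (auto simp: less_le) 
    moreover have "{\<omega> \<in> A. grid_up m T (\<tau> \<omega>) \<le> q} \<in> sets (F q)"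
    proof (cases "q = T")
      case True
      then have "{\<omega> \<in> A. grid_up m T (\<tau> \<omega>) \<le> q} = {\<omega> \<in> A. \<tau> \<omega> \<le> T}" using le grid_up_le by auto
      then show ?thesis using sets_pre_sigmaD[OF tau A, of T] True by simp
    next
      \<comment> \<open>For a grid point below the horizon, rounding strictly upwards makes rounded
        time at most \<open>q\<close> the same as \<tau> strictly before \<open>q\<close>.\<close>
      case False
      then have q': "q \<in> grid m" "q < T" using q by (auto simp: horizon_grid_def)
      have "grid_up m T s \<le> q \<longleftrightarrow> s < q" if "s \<le> T" for s
      proof
        assume "s < q"
        then show "grid_up m T s \<le> q" unfolding grid_up_def using q' by (intro Min_le) auto
      next
        assume *: "grid_up m T s \<le> q"
        then have "s \<noteq> T" using q' by auto
        then have "s < T" using that by simp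
        from less_grid_up[OF this, of m] * show "s < q" by simp
      qed
      then have "{\<omega> \<in> A. grid_up m T (\<tau> \<omega>) \<le> q} = {\<omega> \<in> A. \<tau> \<omega> < q}" using le by auto
      then show ?thesis using Aless by simp
    qed
    ultimately show ?thesis using L by auto
  qed
  have step: "(\<integral>\<^sup>+ \<omega>\<in>A. N (grid_up m T (\<tau> \<omega>)) \<omega> \<partial>M) = (\<integral>\<^sup>+ \<omega>\<in>A. \<xi> \<omega> \<partial>M)" for m
  proof -
    let ?P = "\<lambda>q. {\<omega> \<in> A. grid_up m T (\<tau> \<omega>) = q}"
    have sum_ind: "h (grid_up m T (\<tau> \<omega>)) \<omega> * indicator A \<omega> =
        (\<Sum>q\<in>horizon_grid m T. h q \<omega> * indicator (?P q) \<omega>)" for h :: "ennreal \<Rightarrow> 'a \<Rightarrow> ennreal" and \<omega>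
    proof -
      have "(\<Sum>q\<in>horizon_grid m T. h q \<omega> * indicator (?P q) \<omega>) =
          (\<Sum>q\<in>horizon_grid m T. if q = grid_up m T (\<tau> \<omega>) then h q \<omega> * indicator A \<omega> else 0)"
        by (intro sum.cong) (auto split: split_indicator)
      then show ?thesis using grid_up_in_horizon_grid[of m T "\<tau> \<omega>"] by simp
    qed
    have PM: "?P q \<in> sets M" if "q \<in> horizon_grid m T" for q using piece[OF that] sets_F_subset by blast
    have NM: "N q \<in> borel_measurable M" for q using N_measurable by (rule measurable_F)
    have "(\<integral>\<^sup>+ \<omega>\<in>A. N (grid_up m T (\<tau> \<omega>)) \<omega> \<partial>M) =
        (\<Sum>q\<in>horizon_grid m T. \<integral>\<^sup>+ \<omega>\<in>?P q. N q \<omega> \<partial>M)"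
      unfolding sum_ind[of N] using PM NM by (intro nn_integral_sum) auto
    also have "\<dots> = (\<Sum>q\<in>horizon_grid m T. \<integral>\<^sup>+ \<omega>\<in>?P q. \<xi> \<omega> \<partial>M)"
      using piece by (intro sum.cong refl N_integral) auto
    also have "\<dots> = (\<integral>\<^sup>+ \<omega>\<in>A. \<xi> \<omega> \<partial>M)"
      unfolding sum_ind[of "\<lambda>_. \<xi>"] using PM xi by (intro nn_integral_sum[symmetric]) auto
    finally show ?thesis .
  qed
  have tauM: "\<tau> \<in> borel_measurable M" using tau by (rule stopping_time_measurable)
  have meas: "(\<lambda>\<omega>. N (grid_up m T (\<tau> \<omega>)) \<omega>) \<in> borel_measurable M" for m
  proof (rule measurable_compose_countable'[where I="horizon_grid m T" and f=N and g="\<lambda>\<omega>. grid_up m T (\<tau> \<omega>)"])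
    show "N q \<in> borel_measurable M" for q using N_measurable by (rule measurable_F)
    show "(\<lambda>\<omega>. grid_up m T (\<tau> \<omega>)) \<in> M \<rightarrow>\<^sub>M count_space (horizon_grid m T)"
      using measurable_compose[OF tauM measurable_grid_up] grid_up_in_horizon_grid
      by (intro measurable_count_space_finite) auto
  qed (simp add: countable_finite)
  have "(\<lambda>m. \<integral>\<^sup>+ \<omega>\<in>A. N (grid_up m T (\<tau> \<omega>)) \<omega> \<partial>M) \<longlonglongrightarrow>
      (\<integral>\<^sup>+ \<omega>\<in>A. cadlag_version (\<tau> \<omega>) \<omega> \<partial>M)"
  proof (rule nn_integral_dominated_convergence[where w="\<lambda>_. ennreal K"])
    show "(\<lambda>\<omega>. N (grid_up m T (\<tau> \<omega>)) \<omega> * indicator A \<omega>) \<in> borel_measurable M" for m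
      using meas AM by auto
    have "cadlag_version (\<tau> \<omega>) \<omega> * indicator A \<omega> =
        indicator (regular \<inter> A) \<omega> * liminf (\<lambda>m. N (grid_up m T (\<tau> \<omega>)) \<omega>)" for \<omega>
      by (auto simp: cadlag_version_def split: split_indicator)
    moreover have "regular \<inter> A \<in> sets M" using regular_F[of 0] sets_F_subset AM by blast
    ultimately show "(\<lambda>\<omega>. cadlag_version (\<tau> \<omega>) \<omega> * indicator A \<omega>) \<in> borel_measurable M"
      using meas by (auto intro!: borel_measurable_times_ennreal borel_measurable_liminf)
    show "AE \<omega> in M. N (grid_up m T (\<tau> \<omega>)) \<omega> * indicator A \<omega> \<le> ennreal K" for m
      using N_bounded by (intro AE_I2) (auto split: split_indicator)
    show "(\<integral>\<^sup>+ \<omega>. ennreal K \<partial>M) < \<infinity>" by (simp add: emeasure_space_1 ennreal_mult_less_top)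
    show "AE \<omega> in M. (\<lambda>m. N (grid_up m T (\<tau> \<omega>)) \<omega> * indicator A \<omega>) \<longlonglongrightarrow>
        cadlag_version (\<tau> \<omega>) \<omega> * indicator A \<omega>"
      using AE_regular
    proof eventually_elim
      case (elim \<omega>)
      then show ?case using cadlag_version_tendsto[OF elim] le by (auto split: split_indicator)
    qed
  qed simp
  then show ?thesis unfolding step by (simp add: LIMSEQ_const_iff)
qed

lemma cadlag_version_cond_exp:
  assumes "\<tau> \<in> stopping_times T M F"
  shows "AE \<omega> in M. nn_cond_exp M (pre_sigma \<tau>) \<xi> \<omega> = cadlag_version (\<tau> \<omega>) \<omega>"
proof -
  have tau: "stopping_time F \<tau>" and leT: "AE \<omega> in M. \<tau> \<omega> \<le> T"
    using assms by (auto simp: stopping_times_def)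
  interpret G: finite_measure_subalgebra M "pre_sigma \<tau>"
    by (rule finite_subalg[OF subalg_pre_sigma[OF tau]])
  let ?g = "\<lambda>\<omega>. if \<tau> \<omega> \<le> T then ennreal (enn2real (cadlag_version (\<tau> \<omega>) \<omega>)) else 0"
  have "progressive T F (\<lambda>t \<omega>. ennreal (enn2real (cadlag_version t \<omega>)))"
    using cadlag_version_optional by (intro optional_progressive) (auto simp: optional_def case_prod_beta')
  then have m: "?g \<in> borel_measurable (pre_sigma \<tau>)" using tau by (rule progressive_stopped)
  have g: "?g \<omega> = cadlag_version (\<tau> \<omega>) \<omega>" if "\<tau> \<omega> \<le> T" for \<omega>
    using that cadlag_version_le[of "\<tau> \<omega>" \<omega>] by (auto simp: ennreal_enn2real_if top_unique)
  have "AE \<omega> in M. ?g \<omega> = nn_cond_exp M (pre_sigma \<tau>) \<xi> \<omega>"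
  proof (rule G.nn_cond_exp_charact[OF _ xi m])
    fix A assume A: "A \<in> sets (pre_sigma \<tau>)"
    let ?A = "{\<omega> \<in> A. \<tau> \<omega> \<le> T}"
    have "{\<omega> \<in> space (pre_sigma \<tau>). \<tau> \<omega> \<le> T} \<in> sets (pre_sigma \<tau>)"
      using measurable_stopping_time_pre_sigma[OF tau] by measurable
    moreover have "?A = A \<inter> {\<omega> \<in> space (pre_sigma \<tau>). \<tau> \<omega> \<le> T}" using sets.sets_into_space[OF A] by auto
    ultimately have A': "?A \<in> sets (pre_sigma \<tau>)" using A by auto
    have "(\<integral>\<^sup>+ \<omega>\<in>A. \<xi> \<omega> \<partial>M) = (\<integral>\<^sup>+ \<omega>\<in>?A. \<xi> \<omega> \<partial>M)"
      using leT by (intro nn_integral_cong_AE) (auto elim!: eventually_mono split: split_indicator)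
    also have "\<dots> = (\<integral>\<^sup>+ \<omega>\<in>?A. cadlag_version (\<tau> \<omega>) \<omega> \<partial>M)"
      by (rule cadlag_version_integral[OF tau A', symmetric]) simp
    also have "\<dots> = (\<integral>\<^sup>+ \<omega>\<in>A. ?g \<omega> \<partial>M)"
      by (intro nn_integral_cong) (use g in \<open>auto split: split_indicator\<close>)
    finally show "(\<integral>\<^sup>+ \<omega>\<in>A. \<xi> \<omega> \<partial>M) = (\<integral>\<^sup>+ \<omega>\<in>A. ?g \<omega> \<partial>M)" .
  qed
  then show ?thesis using leT by eventually_elim (use g in simp)
qed

end

section \<open>Optional projections\<close>

context usual_filtration
begin

lemma optional_projection_bounded:
  assumes xi: "\<xi> \<in> borel_measurable M" and K: "\<And>\<omega>. \<xi> \<omega> \<le> ennreal K"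
  obtains Y where "optional T M F Y" "\<And>t \<omega>. 0 \<le> Y t \<omega>"
    "\<And>\<tau>. \<tau> \<in> stopping_times T M F \<Longrightarrow>
      AE \<omega> in M. nn_cond_exp M (pre_sigma \<tau>) \<xi> \<omega> = ennreal (Y (\<tau> \<omega>) \<omega>)"
proof -
  \<comment> \<open>A conditional expectation of a variable bounded by \<open>K\<close> is bounded
    almost everywhere only; the minimum provides a version bounded everywhere.\<close>
  let ?N = "\<lambda>q \<omega>. min (nn_cond_exp M (F q) \<xi> \<omega>) (ennreal K)"
  interpret closed_martingale T M F \<xi> ?N K
  proof unfold_locales
    fix q A assume A: "A \<in> sets (F q)"
    interpret Fq: finite_measure_subalgebra M "F q" by (rule finite_subalg[OF subalg])
    have "AE \<omega> in M. nn_cond_exp M (F q) \<xi> \<omega> \<le> nn_cond_exp M (F q) (\<lambda>_. ennreal K) \<omega>"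
      using xi K by (intro Fq.nn_cond_exp_mono) auto
    moreover have "AE \<omega> in M. ennreal K = nn_cond_exp M (F q) (\<lambda>_. ennreal K) \<omega>"
      by (rule Fq.nn_cond_exp_F_meas) simp
    ultimately have "AE \<omega> in M. ?N q \<omega> = nn_cond_exp M (F q) \<xi> \<omega>" by eventually_elim simp
    then have "(\<integral>\<^sup>+ \<omega>\<in>A. ?N q \<omega> \<partial>M) = (\<integral>\<^sup>+ \<omega>. indicator A \<omega> * nn_cond_exp M (F q) \<xi> \<omega> \<partial>M)"
      by (intro nn_integral_cong_AE) (auto elim!: eventually_mono simp: mult.commute)
    also have "\<dots> = (\<integral>\<^sup>+ \<omega>. indicator A \<omega> * \<xi> \<omega> \<partial>M)"
      using A xi by (intro Fq.nn_cond_exp_intg) auto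
    finally show "(\<integral>\<^sup>+ \<omega>\<in>A. ?N q \<omega> \<partial>M) = (\<integral>\<^sup>+ \<omega>\<in>A. \<xi> \<omega> \<partial>M)" by (simp add: mult.commute)
  qed (use xi in auto)
  have fin: "ennreal (enn2real (cadlag_version t \<omega>)) = cadlag_version t \<omega>" for t \<omega>
    using cadlag_version_le[of t \<omega>] by (auto simp: ennreal_enn2real_if top_unique)
  show ?thesis
    by (rule that[OF cadlag_version_optional]) (use cadlag_version_cond_exp fin in auto)
qed

text \<open>Monotone convergence in the integrals over test sets. It extends projections from
  bounded variables to arbitrary nonnegative ones.\<close>

lemma nn_cond_exp_truncation:
  assumes G: "subalgebra M G" and xi: "\<xi> \<in> borel_measurable M"
  shows "AE \<omega> in M. (SUP k. nn_cond_exp M G (\<lambda>\<omega>. min (\<xi> \<omega>) (ennreal (real k))) \<omega>) = nn_cond_exp M G \<xi> \<omega>"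
proof -
  interpret G: finite_measure_subalgebra M G by (rule finite_subalg[OF G])
  let ?x = "\<lambda>k \<omega>. min (\<xi> \<omega>) (ennreal (real k))"
  have m: "?x k \<in> borel_measurable M" for k using xi by simp
  have mono: "?x j \<omega> \<le> ?x k \<omega>" if "j \<le> k" for j k \<omega>
    by (rule min.mono[OF order_refl ennreal_leI]) (use that in simp)
  show ?thesis
  proof (rule G.nn_cond_exp_charact[OF _ xi])
    fix A assume A: "A \<in> sets G"
    then have AM: "A \<in> sets M" using G by (auto simp: subalgebra_def)
    have sup: "(SUP k. ?x k \<omega>) = \<xi> \<omega>" for \<omega>
    proof -
      have "(SUP k. ?x k \<omega>) = min (\<xi> \<omega>) (SUP k. ennreal (real k))"
        by (simp add: inf_min[symmetric] inf_SUP)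
      moreover have "(SUP k. ennreal (real k)) = \<top>"
        using ennreal_SUP_of_nat_eq_top by (simp add: ennreal_of_nat_eq_real_of_nat)
      ultimately show ?thesis by simp
    qed
    have "(\<integral>\<^sup>+ \<omega>\<in>A. \<xi> \<omega> \<partial>M) = (\<integral>\<^sup>+ \<omega>. (SUP k. indicator A \<omega> * ?x k \<omega>) \<partial>M)"
      by (simp add: SUP_mult_left_ennreal[symmetric] sup mult.commute)
    also have "\<dots> = (SUP k. \<integral>\<^sup>+ \<omega>. indicator A \<omega> * ?x k \<omega> \<partial>M)"
      using AM m by (intro nn_integral_monotone_convergence_SUP)
        (auto simp: incseq_def le_fun_def intro!: mult_left_mono mono)
    also have "\<dots> = (SUP k. \<integral>\<^sup>+ \<omega>. indicator A \<omega> * nn_cond_exp M G (?x k) \<omega> \<partial>M)"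
      using A m by (simp add: G.nn_cond_exp_intg)
    also have "\<dots> = (\<integral>\<^sup>+ \<omega>. (SUP k. indicator A \<omega> * nn_cond_exp M G (?x k) \<omega>) \<partial>M)"
    proof (rule nn_integral_monotone_convergence_SUP_AE[symmetric])
      fix k
      have "AE \<omega> in M. nn_cond_exp M G (?x k) \<omega> \<le> nn_cond_exp M G (?x (Suc k)) \<omega>"
        using mono[of k "Suc k"] by (intro G.nn_cond_exp_mono AE_I2 m) simp
      then show "AE \<omega> in M. indicator A \<omega> * nn_cond_exp M G (?x k) \<omega>
          \<le> indicator A \<omega> * nn_cond_exp M G (?x (Suc k)) \<omega>"
        by eventually_elim (intro mult_left_mono, auto)
    qed (use AM in auto)
    finally show "(\<integral>\<^sup>+ \<omega>\<in>A. \<xi> \<omega> \<partial>M) = (\<integral>\<^sup>+ \<omega>\<in>A. (SUP k. nn_cond_exp M G (?x k) \<omega>) \<partial>M)"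
      by (simp add: SUP_mult_left_ennreal[symmetric] mult.commute)
  qed auto
qed

lemma optional_projection_variable:
  assumes xi: "\<xi> \<in> borel_measurable M"
  obtains Z :: "ennreal \<Rightarrow> 'a \<Rightarrow> ennreal" where
    "(\<lambda>(t, \<omega>). Z t \<omega>) \<in> borel_measurable (optional_sigma T M F)"
    "\<And>\<tau>. \<tau> \<in> stopping_times T M F \<Longrightarrow> AE \<omega> in M. nn_cond_exp M (pre_sigma \<tau>) \<xi> \<omega> = Z (\<tau> \<omega>) \<omega>"
proof -
  have "\<exists>Y. optional T M F Y \<and> (\<forall>\<tau>\<in>stopping_times T M F. AE \<omega> in M.
      nn_cond_exp M (pre_sigma \<tau>) (\<lambda>\<omega>. min (\<xi> \<omega>) (ennreal (real k))) \<omega> = ennreal (Y (\<tau> \<omega>) \<omega>))" for k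
  proof -
    have "(\<lambda>\<omega>. min (\<xi> \<omega>) (ennreal (real k))) \<in> borel_measurable M" using xi by simp
    then show ?thesis
      by (rule optional_projection_bounded[where K="real k"]) auto
  qed
  then obtain Y where Y: "\<And>k. optional T M F (Y k)"
    "\<And>k \<tau>. \<tau> \<in> stopping_times T M F \<Longrightarrow> AE \<omega> in M.
      nn_cond_exp M (pre_sigma \<tau>) (\<lambda>\<omega>. min (\<xi> \<omega>) (ennreal (real k))) \<omega> = ennreal (Y k (\<tau> \<omega>) \<omega>)"
    by metis
  show ?thesis
  proof (rule that[of "\<lambda>t \<omega>. SUP k. ennreal (Y k t \<omega>)"])
    show "(\<lambda>(t, \<omega>). SUP k. ennreal (Y k t \<omega>)) \<in> borel_measurable (optional_sigma T M F)"
      using Y(1) unfolding optional_def case_prod_beta'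
      by (intro borel_measurable_SUP measurable_compose[OF _ measurable_ennreal]) auto
    fix \<tau> assume tau: "\<tau> \<in> stopping_times T M F"
    then have "AE \<omega> in M. \<forall>k. nn_cond_exp M (pre_sigma \<tau>) (\<lambda>\<omega>. min (\<xi> \<omega>) (ennreal (real k))) \<omega>
        = ennreal (Y k (\<tau> \<omega>) \<omega>)"
      using Y(2) by (subst AE_all_countable) auto
    moreover have "subalgebra M (pre_sigma \<tau>)"
      using tau by (intro subalg_pre_sigma) (simp add: stopping_times_def)
    note nn_cond_exp_truncation[OF this xi]
    ultimately show "AE \<omega> in M. nn_cond_exp M (pre_sigma \<tau>) \<xi> \<omega> = (SUP k. ennreal (Y k (\<tau> \<omega>) \<omega>))"
      by eventually_elim simp
  qed
qed

end

section \<open>Tail integrals\<close>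

lemma measurable_nn_integral_tail:
  assumes h: "(\<lambda>(z, s). h z s) \<in> borel_measurable (N \<Otimes>\<^sub>M leb T)" and \<sigma>: "\<sigma> \<in> borel_measurable N"
  shows "(\<lambda>z. \<integral>\<^sup>+ s\<in>{\<sigma> z..}. h z s \<partial>leb T) \<in> borel_measurable N"
proof -
  interpret leb: sigma_finite_measure "leb T" by (rule sigma_finite_leb)
  have "(\<lambda>x. x) \<in> borel_measurable (leb T)"
    by (subst measurable_cong_sets[OF sets_leb refl], rule measurable_restrict_space1) simp
  then have s: "(\<lambda>p. snd p) \<in> borel_measurable (N \<Otimes>\<^sub>M leb T)" by (rule measurable_compose[OF measurable_snd])
  have z: "(\<lambda>p. \<sigma> (fst p)) \<in> borel_measurable (N \<Otimes>\<^sub>M leb T)" by (rule measurable_compose[OF measurable_fst \<sigma>])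
  have "{p \<in> space (N \<Otimes>\<^sub>M leb T). \<sigma> (fst p) \<le> snd p} \<in> sets (N \<Otimes>\<^sub>M leb T)"
    using z s by (rule borel_measurable_le)
  then have "(\<lambda>p. if \<sigma> (fst p) \<le> snd p then h (fst p) (snd p) else 0) \<in> borel_measurable (N \<Otimes>\<^sub>M leb T)"
    using h by (intro measurable_If) (auto simp: case_prod_beta')
  then have "(\<lambda>(z, s). h z s * indicator {\<sigma> z..} s) \<in> borel_measurable (N \<Otimes>\<^sub>M leb T)"
    by (rule back_subst[of "\<lambda>f. f \<in> _"]) (auto simp: fun_eq_iff split: split_indicator)
  then show ?thesis by (rule leb.borel_measurable_nn_integral)
qed

lemma tail_integral_split:
  assumes phi: "(\<lambda>s. \<phi> s \<omega>) \<in> borel_measurable (time T)" and t: "t \<le> T"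
  shows "tail_integral T \<phi> t \<omega> + (\<integral>\<^sup>+ s. \<phi> s \<omega> \<partial>leb t) = (\<integral>\<^sup>+ s. \<phi> s \<omega> \<partial>leb T)"
proof -
  have m: "(\<lambda>s. \<phi> s \<omega> * indicator A s) \<in> borel_measurable (leb T)" if "A \<in> sets borel" for A
    using phi that sets_time_Int[OF that, of T]
    by (subst measurable_cong[of _ _ "\<lambda>s. \<phi> s \<omega> * indicator (A \<inter> {..T}) s"])
      (auto simp: measurable_cong_sets[OF sets_leb refl] split: split_indicator)
  have "tail_integral T \<phi> t \<omega> + (\<integral>\<^sup>+ s. \<phi> s \<omega> \<partial>leb t) =
      (\<integral>\<^sup>+ s. \<phi> s \<omega> * indicator {t..} s + \<phi> s \<omega> * indicator {..t} s \<partial>leb T)"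
    unfolding tail_integral_def nn_integral_leb_restrict[OF t phi]
    by (intro nn_integral_add[symmetric] m) auto
  also have "\<dots> = (\<integral>\<^sup>+ s. \<phi> s \<omega> \<partial>leb T)"
    \<comment> \<open>The two pieces of the time interval overlap only at \<open>t\<close>, a null
      time.\<close>
    using AE_leb_neq[of t T]
    by (intro nn_integral_cong_AE) (auto elim!: eventually_mono split: split_indicator)
  finally show ?thesis .
qed

text \<open>The time change turns \<open>dC\<close> into Lebesgue measure on levels. Since
  \<open>hit T f s \<le> u\<close> means \<open>s \<le> f u\<close> there, exchanging the integrals
  leaves for each \<open>u\<close> the length of (0, f u].\<close>

lemma stieltjes_fubini:
  assumes f: "good_path T f" and phi: "\<phi> \<in> borel_measurable (time T)"
  shows "(\<integral>\<^sup>+ t. (\<integral>\<^sup>+ s\<in>{t..}. \<phi> s \<partial>leb T) \<partial>stieltjes T f) = (\<integral>\<^sup>+ t. \<phi> t * ennreal (f t) \<partial>leb T)"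
proof -
  interpret leb: sigma_finite_measure "leb T" by (rule sigma_finite_leb)
  interpret P: pair_sigma_finite lborel "leb T" by unfold_locales
  have phi': "\<phi> \<in> borel_measurable (leb T)" using phi by (simp add: measurable_cong_sets[OF sets_leb refl])
  have id: "(\<lambda>x. x) \<in> borel_measurable (time T)" by (rule measurable_restrict_space1) simp
  have tail: "(\<lambda>t. \<integral>\<^sup>+ s\<in>{t..}. \<phi> s \<partial>leb T) \<in> borel_measurable (time T)"
    using measurable_nn_integral_tail[of "\<lambda>z. \<phi>" "time T" T "\<lambda>x. x"] id phi'
    by (simp add: case_prod_beta')
  let ?g = "\<lambda>s u. \<phi> u * indicator {hit T f s..} u * indicator {0<..f T} s"
  have g: "(\<lambda>(s, u). ?g s u) \<in> borel_measurable (lborel \<Otimes>\<^sub>M leb T)"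
  proof -
    have h: "(\<lambda>p. hit T f (fst p)) \<in> borel_measurable (lborel \<Otimes>\<^sub>M leb T)"
      using measurable_compose[OF measurable_hit[OF f] id]
      by (intro measurable_compose[OF measurable_fst]) simp
    have s: "(\<lambda>p. snd p) \<in> borel_measurable (lborel \<Otimes>\<^sub>M leb T)"
      using id by (intro measurable_compose[OF measurable_snd]) (simp add: measurable_cong_sets[OF sets_leb refl])
    have "{p \<in> space (lborel \<Otimes>\<^sub>M leb T). hit T f (fst p) \<le> snd p} \<in> sets (lborel \<Otimes>\<^sub>M leb T)"
      using h s by (rule borel_measurable_le)
    then have "(\<lambda>p. (if hit T f (fst p) \<le> snd p then \<phi> (snd p) else 0) * indicator {0<..f T} (fst p))
        \<in> borel_measurable (lborel \<Otimes>\<^sub>M leb T)"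
      using phi' by (intro borel_measurable_times_ennreal measurable_If) auto
    then show ?thesis
      by (rule back_subst[of "\<lambda>f. f \<in> _"]) (auto simp: fun_eq_iff split: split_indicator)
  qed
  have "(\<integral>\<^sup>+ t. (\<integral>\<^sup>+ s\<in>{t..}. \<phi> s \<partial>leb T) \<partial>stieltjes T f) =
      (\<integral>\<^sup>+ s. (\<integral>\<^sup>+ u. \<phi> u * indicator {hit T f s..} u \<partial>leb T) * indicator {0<..f T} s \<partial>lborel)"
    by (rule nn_integral_stieltjes[OF f tail])
  also have "\<dots> = (\<integral>\<^sup>+ s. \<integral>\<^sup>+ u. ?g s u \<partial>leb T \<partial>lborel)"
  proof (intro nn_integral_cong)
    fix s
    show "(\<integral>\<^sup>+ u. \<phi> u * indicator {hit T f s..} u \<partial>leb T) * indicator {0<..f T} s = (\<integral>\<^sup>+ u. ?g s u \<partial>leb T)"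
      by (cases "s \<in> {0<..f T}") (simp_all split: split_indicator)
  qed
  also have "\<dots> = (\<integral>\<^sup>+ u. \<integral>\<^sup>+ s. ?g s u \<partial>lborel \<partial>leb T)"
    using g by (rule P.Fubini'[symmetric])
  also have "\<dots> = (\<integral>\<^sup>+ u. \<phi> u * ennreal (f u) \<partial>leb T)"
  proof (rule nn_integral_cong)
    fix u assume "u \<in> space (leb T)"
    then have u: "u \<le> T" by simp
    have mono: "f u \<le> f T" "0 \<le> f u" using f u by (auto simp: good_path_def mono_on_def)
    have "(\<integral>\<^sup>+ s. ?g s u \<partial>lborel) = (\<integral>\<^sup>+ s. \<phi> u * indicator {0<..f u} s \<partial>lborel)"
      using hit_le_iff_final[OF f u] mono by (intro nn_integral_cong) (auto split: split_indicator)
    also have "\<dots> = \<phi> u * ennreal (f u)" using mono by (simp add: nn_integral_cmult_indicator)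
    finally show "(\<integral>\<^sup>+ s. ?g s u \<partial>lborel) = \<phi> u * ennreal (f u)" .
  qed
  finally show ?thesis .
qed

context usual_filtration
begin

lemma jointly_swap:
  assumes "(\<lambda>(t, \<omega>). Z t \<omega>) \<in> borel_measurable (time T \<Otimes>\<^sub>M M)"
  shows "(\<lambda>(\<omega>, t). Z t \<omega>) \<in> borel_measurable (M \<Otimes>\<^sub>M leb T)"
proof -
  have "(\<lambda>(t, \<omega>). Z t \<omega>) \<in> borel_measurable (leb T \<Otimes>\<^sub>M M)"
    using assms by (simp add: measurable_cong_sets[OF sets_pair_measure_cong[OF sets_leb refl] refl])
  then show ?thesis by (subst measurable_pair_swap_iff) (simp add: case_prod_beta)
qed

lemma jointly_section:
  assumes "(\<lambda>(t, \<omega>). Z t \<omega>) \<in> borel_measurable (time T \<Otimes>\<^sub>M M)" "\<omega> \<in> space M"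
  shows "(\<lambda>t. Z t \<omega>) \<in> borel_measurable (time T)"
  using measurable_compose[OF measurable_Pair2'[OF assms(2)] assms(1)] by simp

lemma measurable_tail:
  assumes phi: "(\<lambda>(t, \<omega>). \<phi> t \<omega>) \<in> borel_measurable (time T \<Otimes>\<^sub>M M)"
    and \<sigma>: "\<sigma> \<in> borel_measurable N" and p: "p \<in> N \<rightarrow>\<^sub>M M"
  shows "(\<lambda>z. tail_integral T \<phi> (\<sigma> z) (p z)) \<in> borel_measurable N"
  unfolding tail_integral_def
proof (rule measurable_nn_integral_tail[OF _ \<sigma>])
  have "(\<lambda>x. (p (fst x), snd x)) \<in> N \<Otimes>\<^sub>M leb T \<rightarrow>\<^sub>M M \<Otimes>\<^sub>M leb T"
    using p by (intro measurable_Pair measurable_compose[OF measurable_fst] measurable_snd)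
  from measurable_compose[OF this jointly_swap[OF phi]]
  show "(\<lambda>(z, s). \<phi> s (p z)) \<in> borel_measurable (N \<Otimes>\<^sub>M leb T)" by (simp add: case_prod_beta')
qed

lemma measurable_nn_integral_time:
  assumes "(\<lambda>(t, \<omega>). Z t \<omega>) \<in> borel_measurable (time T \<Otimes>\<^sub>M M)"
  shows "(\<lambda>\<omega>. \<integral>\<^sup>+ t. Z t \<omega> \<partial>leb T) \<in> borel_measurable M"
proof -
  interpret leb: sigma_finite_measure "leb T" by (rule sigma_finite_leb)
  show ?thesis using jointly_swap[OF assms] by (rule leb.borel_measurable_nn_integral)
qed

text \<open>The tail is the total integral minus the part already accumulated. The total is a single
  random variable, whose projection is known at all stopping times; the accumulated part is an
  adapted continuous process and is subtracted.\<close>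

lemma optional_projection_tail:
  assumes phi: "progressive T F \<phi>" and fin: "(\<integral>\<^sup>+ \<omega>. \<integral>\<^sup>+ t. \<phi> t \<omega> \<partial>leb T \<partial>M) < \<infinity>"
  obtains Y where "optional_projection T M F (tail_integral T \<phi>) Y"
proof -
  define \<xi> where "\<xi> \<omega> = (\<integral>\<^sup>+ t. \<phi> t \<omega> \<partial>leb T)" for \<omega>
  \<comment> \<open>Outcomes with infinite total are set to 0. They form a null event, which belongs
    to every \<open>F t\<close>, so adaptedness survives.\<close>
  define I where "I t \<omega> = (if \<xi> \<omega> < \<infinity> then enn2real (\<integral>\<^sup>+ s. \<phi> s \<omega> \<partial>leb t) else 0)" for t \<omega>
  note joint = progressive_jointly[OF phi]
  have xi: "\<xi> \<in> borel_measurable M" unfolding \<xi>_def by (rule measurable_nn_integral_time[OF joint])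
  have xi_fin: "AE \<omega> in M. \<xi> \<omega> < \<infinity>"
    using nn_integral_noteq_infinite[OF xi] fin unfolding \<xi>_def by (simp add: less_top)
  have sec: "(\<lambda>t. \<phi> t \<omega>) \<in> borel_measurable (time T)" if "\<omega> \<in> space M" for \<omega>
    by (rule jointly_section[OF joint that])
  have part: "(\<integral>\<^sup>+ s. \<phi> s \<omega> \<partial>leb t) = ennreal (I t \<omega>)" if "\<omega> \<in> space M" "\<xi> \<omega> < \<infinity>" "t \<le> T" for t \<omega>
    using nn_integral_leb_mono[OF sec[OF that(1)] that(3) order_refl] that(2)
    unfolding I_def \<xi>_def by (auto simp: ennreal_enn2real_if top_unique)
  have I_opt: "optional T M F I"
  proof (rule optional_cadlag)
    show "adapted T F I"
      unfolding adapted_def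
    proof (intro allI impI)
      fix t assume t: "t \<le> T"
      have "{\<omega> \<in> space (F t). \<xi> \<omega> < \<infinity>} \<in> sets (F t)" using AE_sets_F[OF xi_fin] by (simp add: space_F)
      then show "I t \<in> borel_measurable (F t)"
        unfolding I_def using progressive_nn_integral[OF phi t] by (intro measurable_If) auto
    qed
    fix \<omega> assume w: "\<omega> \<in> space M"
    show "cadlag_path T (\<lambda>t. I t \<omega>)"
    proof (cases "\<xi> \<omega> < \<infinity>")
      case True
      show ?thesis
        unfolding cadlag_path_def right_continuous_path_def
      proof (intro conjI allI impI)
        fix t assume t: "t < T"
        have "((\<lambda>s. \<integral>\<^sup>+ v. \<phi> v \<omega> \<partial>leb s) \<longlongrightarrow> (\<integral>\<^sup>+ v. \<phi> v \<omega> \<partial>leb t)) (at_right t)"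
          using True t by (intro nn_integral_leb_tendsto_right[OF sec[OF w] t]) (auto simp: \<xi>_def)
        then have "((\<lambda>s. \<integral>\<^sup>+ v. \<phi> v \<omega> \<partial>leb s) \<longlongrightarrow> ennreal (I t \<omega>)) (at_right t)"
          using part[OF w True] t by simp
        then have "((\<lambda>s. enn2real (\<integral>\<^sup>+ v. \<phi> v \<omega> \<partial>leb s)) \<longlongrightarrow> I t \<omega>) (at_right t)"
          by (rule tendsto_enn2real) (simp add: I_def)
        then show "continuous (at_right t) (\<lambda>t. I t \<omega>)"
          unfolding continuous_within using True by (simp add: I_def)
      next
        fix t assume t: "t \<le> T" "0 < t"
        have "I s \<omega> \<le> I v \<omega>" if "s \<le> v" "v \<le> T" for s v
        proof -
          have "ennreal (I s \<omega>) \<le> ennreal (I v \<omega>)"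
            using nn_integral_leb_mono[OF sec[OF w] that] part[OF w True] that by simp
          then show ?thesis by (simp add: I_def)
        qed
        then show "\<exists>l. ((\<lambda>t. I t \<omega>) \<longlongrightarrow> l) (at_left t)"
          using t by (intro mono_left_limit[of t _ "I T \<omega>"]) auto
      qed
    next
      case False
      then show ?thesis using cadlag_path_step[of T 0 0] by (simp add: I_def)
    qed
  qed
  obtain Z :: "ennreal \<Rightarrow> 'a \<Rightarrow> ennreal" where
    Z: "(\<lambda>(t, \<omega>). Z t \<omega>) \<in> borel_measurable (optional_sigma T M F)"
    "\<And>\<tau>. \<tau> \<in> stopping_times T M F \<Longrightarrow> AE \<omega> in M. nn_cond_exp M (pre_sigma \<tau>) \<xi> \<omega> = Z (\<tau> \<omega>) \<omega>"
    using optional_projection_variable[OF xi] by metis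
  show ?thesis
  proof (rule that[of "\<lambda>t \<omega>. enn2real (Z t \<omega> - ennreal (I t \<omega>))"], unfold optional_projection_def, intro conjI ballI)
    show "optional T M F (\<lambda>t \<omega>. enn2real (Z t \<omega> - ennreal (I t \<omega>)))"
      using Z(1) I_opt unfolding optional_def case_prod_beta'
      by (intro borel_measurable_enn2real borel_measurable_minus_ennreal measurable_compose[OF _ measurable_ennreal]) auto
  next
    fix \<tau> assume st: "\<tau> \<in> stopping_times T M F"
    then have tau: "stopping_time F \<tau>" and leT: "AE \<omega> in M. \<tau> \<omega> \<le> T" by (auto simp: stopping_times_def)
    let ?G = "pre_sigma \<tau>" and ?X = "\<lambda>\<omega>. tail_integral T \<phi> (\<tau> \<omega>) \<omega>"
    let ?I = "\<lambda>\<omega>. if \<tau> \<omega> \<le> T then ennreal (I (\<tau> \<omega>) \<omega>) else 0"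
    interpret G: finite_measure_subalgebra M ?G by (rule finite_subalg[OF subalg_pre_sigma[OF tau]])
    have X: "?X \<in> borel_measurable M"
      using measurable_tail[OF joint stopping_time_measurable[OF tau], of "\<lambda>x. x"] by simp
    have "progressive T F (\<lambda>t \<omega>. ennreal (I t \<omega>))"
      using I_opt by (intro optional_progressive) (auto simp: optional_def case_prod_beta')
    then have I: "?I \<in> borel_measurable ?G" using tau by (rule progressive_stopped)
    then have IM: "?I \<in> borel_measurable M" by (rule measurable_from_subalg[OF G.subalg])
    have "AE \<omega> in M. ?X \<omega> + ?I \<omega> = \<xi> \<omega>"
      using xi_fin leT AE_space
    proof eventually_elim
      case (elim \<omega>)
      then show ?case using tail_integral_split[where \<phi>=\<phi> and \<omega>=\<omega>, OF sec[OF elim(3)] elim(2)] part[OF elim(3,1,2)]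
        by (simp add: \<xi>_def)
    qed
    then have 1: "AE \<omega> in M. nn_cond_exp M ?G (\<lambda>\<omega>. ?X \<omega> + ?I \<omega>) \<omega> = nn_cond_exp M ?G \<xi> \<omega>"
      using X IM xi by (intro G.nn_cond_exp_cong) auto
    have 2: "AE \<omega> in M. nn_cond_exp M ?G ?X \<omega> + nn_cond_exp M ?G ?I \<omega> = nn_cond_exp M ?G (\<lambda>\<omega>. ?X \<omega> + ?I \<omega>) \<omega>"
      using X IM by (rule G.nn_cond_exp_sum)
    have 3: "AE \<omega> in M. ?I \<omega> = nn_cond_exp M ?G ?I \<omega>" using I by (rule G.nn_cond_exp_F_meas)
    have "(\<integral>\<^sup>+ \<omega>. nn_cond_exp M ?G \<xi> \<omega> \<partial>M) = (\<integral>\<^sup>+ \<omega>. \<xi> \<omega> \<partial>M)"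
      using G.nn_cond_exp_intg[of "\<lambda>_. 1" \<xi>] xi by simp
    then have "AE \<omega> in M. nn_cond_exp M ?G \<xi> \<omega> \<noteq> \<infinity>"
      using fin unfolding \<xi>_def by (intro nn_integral_noteq_infinite) (auto simp: less_top)
    then show "AE \<omega> in M. nn_cond_exp M ?G ?X \<omega> = ennreal (enn2real (Z (\<tau> \<omega>) \<omega> - ennreal (I (\<tau> \<omega>) \<omega>)))"
      using 1 2 3 leT Z(2)[OF st]
    proof eventually_elim
      case (elim \<omega>)
      have "Z (\<tau> \<omega>) \<omega> = nn_cond_exp M ?G ?X \<omega> + ennreal (I (\<tau> \<omega>) \<omega>)" using elim by simp
      \<comment> \<open>Finiteness makes truncated subtraction and the passage to reals
        faithful.\<close>
      moreover have "nn_cond_exp M ?G ?X \<omega> \<noteq> \<top>"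
        using elim(1) elim(6) calculation by (auto simp: ennreal_add_eq_top)
      ultimately show ?case by (simp add: ennreal_enn2real_if)
    qed
  qed simp
qed

section \<open>Integration against increasing processes\<close>

definition increasing_process :: "'a process \<Rightarrow> bool" where
  "increasing_process C \<longleftrightarrow> adapted T F C \<and> (AE \<omega> in M. good_path T (\<lambda>t. C t \<omega>))"

text \<open>Hitting times are stopping times only if \<open>hit_le_iff\<close> holds for every
  outcome, whereas paths are good almost surely; bad paths are replaced by 0.\<close>

definition good_version :: "'a process \<Rightarrow> 'a process" where
  "good_version C t \<omega> = (if good_path T (\<lambda>t. C t \<omega>) then C t \<omega> else 0)"

lemma good_path_good_version: "good_path T (\<lambda>t. good_version C t \<omega>)"
proof (cases "good_path T (\<lambda>t. C t \<omega>)")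
  case False
  then show ?thesis
    by (auto simp: good_version_def) (auto simp: good_path_def right_continuous_path_def mono_on_def)
qed (simp add: good_version_def)

context
  fixes C :: "'a process"
  assumes C: "increasing_process C"
begin

lemma good_version_measurable:
  assumes "t \<le> T" shows "good_version C t \<in> borel_measurable (F t)"
proof -
  have "{\<omega> \<in> space (F t). good_path T (\<lambda>t. C t \<omega>)} \<in> sets (F t)"
    using C AE_sets_F[of "\<lambda>\<omega>. good_path T (\<lambda>t. C t \<omega>)" t] by (simp add: increasing_process_def space_F)
  moreover have "C t \<in> borel_measurable (F t)"
    using C assms by (simp add: increasing_process_def adapted_def)
  ultimately show ?thesis unfolding good_version_def by (intro measurable_If) auto
qed

abbreviation (input) "H s \<omega> \<equiv> hit T (\<lambda>t. good_version C t \<omega>) s"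

lemma hit_stopping_time: "stopping_time F (H s)"
proof (rule stopping_timeI)
  fix t
  show "Measurable.pred (F t) (\<lambda>\<omega>. H s \<omega> \<le> t)"
  proof (cases "t < T")
    case True
    have [measurable]: "good_version C t \<in> borel_measurable (F t)"
      using True by (intro good_version_measurable) simp
    have "Measurable.pred (F t) (\<lambda>\<omega>. s \<le> good_version C t \<omega>)" by measurable
    then show ?thesis using hit_le_iff[OF good_path_good_version True] by simp
  next
    case False
    then have "H s \<omega> \<le> t" for \<omega> using hit_le[of T _ s] by (meson not_less order_trans)
    then show ?thesis by simp
  qed
qed

lemma hit_in_stopping_times: "H s \<in> stopping_times T M F"
  using hit_stopping_time hit_le by (simp add: stopping_times_def)

text \<open>Places the set of outcomes that reach level \<open>s\<close> into the sigma-algebra at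
  its hitting time, so that conditional expectations at that time may be inserted under the
  time-changed integral.\<close>

lemma hit_event: "{\<omega> \<in> space M. s \<le> good_version C T \<omega>} \<in> sets (pre_sigma (H s))"
proof (rule sets_pre_sigmaI[OF hit_stopping_time])
  fix t
  have ev: "{\<omega> \<in> space M. s \<le> good_version C u \<omega>} \<in> sets (F u)" if "u \<le> T" for u
    using good_version_measurable[OF that] by (subst space_F[symmetric, of u]) measurable
  show "{\<omega> \<in> {\<omega> \<in> space M. s \<le> good_version C T \<omega>}. H s \<omega> \<le> t} \<in> sets (F t)"
  proof (cases "t < T")
    case True
    have "good_version C t \<omega> \<le> good_version C T \<omega>" for \<omega>
      using good_path_good_version[of C \<omega>] True by (auto simp: good_path_def mono_on_def)
    then have "{\<omega> \<in> {\<omega> \<in> space M. s \<le> good_version C T \<omega>}. H s \<omega> \<le> t} = {\<omega> \<in> space M. s \<le> good_version C t \<omega>}"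
      using hit_le_iff[OF good_path_good_version True] by (auto intro: order_trans)
    then show ?thesis using ev[of t] True by simp
  next
    case False
    then have "H s \<omega> \<le> t" for \<omega> using hit_le[of T _ s] by (meson not_less order_trans)
    moreover have "{\<omega> \<in> space M. s \<le> good_version C T \<omega>} \<in> sets (F t)"
      using ev[of T] sets_F_mono[of T t] False by (meson not_less order_refl subsetD)
    ultimately show ?thesis by simp
  qed
qed

lemma measurable_hit_joint: "(\<lambda>(s, \<omega>). H s \<omega>) \<in> lborel \<Otimes>\<^sub>M M \<rightarrow>\<^sub>M time T"
proof (rule measurable_restrict_space2)
  show "(\<lambda>(s, \<omega>). H s \<omega>) \<in> borel_measurable (lborel \<Otimes>\<^sub>M M)"
  proof (rule borel_measurableI_le)
    fix y
    show "{p \<in> space (lborel \<Otimes>\<^sub>M M). (case p of (s, \<omega>) \<Rightarrow> H s \<omega>) \<le> y} \<in> sets (lborel \<Otimes>\<^sub>M M)"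
    proof (cases "y < T")
      case True
      then have "(\<lambda>p. good_version C y (snd p)) \<in> borel_measurable (lborel \<Otimes>\<^sub>M M)"
        using measurable_F[OF good_version_measurable[of y]] by (intro measurable_compose[OF measurable_snd]) auto
      moreover have "fst \<in> borel_measurable (lborel \<Otimes>\<^sub>M M)"
        using measurable_fst by (simp cong: measurable_cong_sets)
      ultimately have "{p \<in> space (lborel \<Otimes>\<^sub>M M). fst p \<le> good_version C y (snd p)} \<in> sets (lborel \<Otimes>\<^sub>M M)"
        by (intro borel_measurable_le)
      then show ?thesis
        using hit_le_iff[OF good_path_good_version True] by (simp add: case_prod_beta')
    next
      case False
      then have "H s \<omega> \<le> y" for s \<omega> using hit_le[of T _ s] by (meson not_less order_trans)
      then have "{p \<in> space (lborel \<Otimes>\<^sub>M M). (case p of (s, \<omega>) \<Rightarrow> H s \<omega>) \<le> y} = space (lborel \<Otimes>\<^sub>M M)"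
        by auto
      then show ?thesis by (simp only: sets.top)
    qed
  qed
qed (auto simp: hit_le)

text \<open>The change of time \<open>s \<mapsto> inf {t. s \<le> C t}\<close> reduces expectations of integrals against \<open>dC\<close> to
  stopping times, so that no section theorem is needed.\<close>

context
  fixes Z :: "ennreal \<Rightarrow> 'a \<Rightarrow> ennreal"
  assumes Z: "(\<lambda>(t, \<omega>). Z t \<omega>) \<in> borel_measurable (time T \<Otimes>\<^sub>M M)"
begin

lemma measurable_time_change:
  "(\<lambda>(s, \<omega>). Z (H s \<omega>) \<omega> * indicator {0<..good_version C T \<omega>} s) \<in> borel_measurable (lborel \<Otimes>\<^sub>M M)"
proof -
  have "(\<lambda>p. (case p of (s, \<omega>) \<Rightarrow> H s \<omega>, snd p)) \<in> lborel \<Otimes>\<^sub>M M \<rightarrow>\<^sub>M time T \<Otimes>\<^sub>M M"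
    by (intro measurable_Pair measurable_hit_joint measurable_snd)
  from measurable_compose[OF this Z]
  have 1: "(\<lambda>p. Z (H (fst p) (snd p)) (snd p)) \<in> borel_measurable (lborel \<Otimes>\<^sub>M M)"
    by (simp add: case_prod_beta')
  have 2: "(\<lambda>p. good_version C T (snd p)) \<in> borel_measurable (lborel \<Otimes>\<^sub>M M)"
    using measurable_F[OF good_version_measurable[of T]] by (intro measurable_compose[OF measurable_snd]) auto
  have 3: "fst \<in> borel_measurable (lborel \<Otimes>\<^sub>M M)"
    using measurable_fst by (simp cong: measurable_cong_sets)
  have "{p \<in> space (lborel \<Otimes>\<^sub>M M). 0 < fst p} \<inter> {p \<in> space (lborel \<Otimes>\<^sub>M M). fst p \<le> good_version C T (snd p)}
      \<in> sets (lborel \<Otimes>\<^sub>M M)"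
    using 2 3 by (intro sets.Int borel_measurable_le borel_measurable_less) auto
  then have "{p \<in> space (lborel \<Otimes>\<^sub>M M). 0 < fst p \<and> fst p \<le> good_version C T (snd p)} \<in> sets (lborel \<Otimes>\<^sub>M M)"
    by (rule back_subst[of "\<lambda>A. A \<in> _"]) auto
  then have "(\<lambda>p. if 0 < fst p \<and> fst p \<le> good_version C T (snd p) then Z (H (fst p) (snd p)) (snd p) else 0)
      \<in> borel_measurable (lborel \<Otimes>\<^sub>M M)"
    using 1 by (intro measurable_If) auto
  then show ?thesis
    by (rule back_subst[of "\<lambda>f. f \<in> _"]) (auto simp: fun_eq_iff split: split_indicator)
qed

lemma stieltjes_integral_AE:
  "AE \<omega> in M. (\<integral>\<^sup>+ t. Z t \<omega> \<partial>stieltjes T (\<lambda>t. C t \<omega>)) =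
    (\<integral>\<^sup>+ s. Z (H s \<omega>) \<omega> * indicator {0<..good_version C T \<omega>} s \<partial>lborel)"
proof -
  have "AE \<omega> in M. good_path T (\<lambda>t. C t \<omega>)" using C by (simp add: increasing_process_def)
  then show ?thesis
    using AE_space
  proof eventually_elim
    case (elim \<omega>)
    then have "(\<lambda>t. C t \<omega>) = (\<lambda>t. good_version C t \<omega>)" by (simp add: good_version_def)
    then show ?case
      using nn_integral_stieltjes[OF good_path_good_version jointly_section[OF Z elim(2)]] by simp
  qed
qed

lemma stieltjes_integral_measurable:
  "(\<lambda>\<omega>. \<integral>\<^sup>+ t. Z t \<omega> \<partial>stieltjes T (\<lambda>t. C t \<omega>)) \<in> borel_measurable M"
proof (rule measurable_M_AE_cong)
  have "(\<lambda>(\<omega>, s). Z (H s \<omega>) \<omega> * indicator {0<..good_version C T \<omega>} s) \<in> borel_measurable (M \<Otimes>\<^sub>M lborel)"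
    using measurable_time_change by (subst measurable_pair_swap_iff) (simp add: case_prod_beta')
  then show "(\<lambda>\<omega>. \<integral>\<^sup>+ s. Z (H s \<omega>) \<omega> * indicator {0<..good_version C T \<omega>} s \<partial>lborel) \<in> borel_measurable M"
    by (rule lborel.borel_measurable_nn_integral)
  show "AE \<omega> in M. (\<integral>\<^sup>+ s. Z (H s \<omega>) \<omega> * indicator {0<..good_version C T \<omega>} s \<partial>lborel) =
      (\<integral>\<^sup>+ t. Z t \<omega> \<partial>stieltjes T (\<lambda>t. C t \<omega>))"
    using stieltjes_integral_AE by eventually_elim simp
qed

lemma stieltjes_expectation:
  "(\<integral>\<^sup>+ \<omega>. \<integral>\<^sup>+ t. Z t \<omega> \<partial>stieltjes T (\<lambda>t. C t \<omega>) \<partial>M) =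
    (\<integral>\<^sup>+ s. indicator {0<..} s * (\<integral>\<^sup>+ \<omega>\<in>{\<omega> \<in> space M. s \<le> good_version C T \<omega>}. Z (H s \<omega>) \<omega> \<partial>M) \<partial>lborel)"
proof -
  interpret P: pair_sigma_finite lborel M by unfold_locales
  have "(\<integral>\<^sup>+ \<omega>. \<integral>\<^sup>+ t. Z t \<omega> \<partial>stieltjes T (\<lambda>t. C t \<omega>) \<partial>M) =
      (\<integral>\<^sup>+ \<omega>. \<integral>\<^sup>+ s. Z (H s \<omega>) \<omega> * indicator {0<..good_version C T \<omega>} s \<partial>lborel \<partial>M)"
    by (rule nn_integral_cong_AE[OF stieltjes_integral_AE])
  also have "\<dots> = (\<integral>\<^sup>+ s. \<integral>\<^sup>+ \<omega>. Z (H s \<omega>) \<omega> * indicator {0<..good_version C T \<omega>} s \<partial>M \<partial>lborel)"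
    using measurable_time_change by (rule P.Fubini')
  also have "\<dots> = (\<integral>\<^sup>+ s. indicator {0<..} s * (\<integral>\<^sup>+ \<omega>\<in>{\<omega> \<in> space M. s \<le> good_version C T \<omega>}. Z (H s \<omega>) \<omega> \<partial>M) \<partial>lborel)"
  proof (intro nn_integral_cong)
    fix s :: real
    show "(\<integral>\<^sup>+ \<omega>. Z (H s \<omega>) \<omega> * indicator {0<..good_version C T \<omega>} s \<partial>M) =
      indicator {0<..} s * (\<integral>\<^sup>+ \<omega>\<in>{\<omega> \<in> space M. s \<le> good_version C T \<omega>}. Z (H s \<omega>) \<omega> \<partial>M)"
      by (cases "0 < s") (auto intro!: nn_integral_cong split: split_indicator)
  qed
  finally show ?thesis .
qed

end

text \<open>After the time change each level contributes an integral at one stopping time over one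
  event of its sigma-algebra, and the hypothesis compares these level by level.\<close>

lemma stieltjes_expectation_mono:
  assumes Z: "(\<lambda>(t, \<omega>). Z t \<omega>) \<in> borel_measurable (time T \<Otimes>\<^sub>M M)"
    and Z': "(\<lambda>(t, \<omega>). Z' t \<omega>) \<in> borel_measurable (time T \<Otimes>\<^sub>M M)"
    and le: "\<And>\<tau> A. \<tau> \<in> stopping_times T M F \<Longrightarrow> A \<in> sets (pre_sigma \<tau>) \<Longrightarrow>
      (\<integral>\<^sup>+ \<omega>\<in>A. Z (\<tau> \<omega>) \<omega> \<partial>M) \<le> (\<integral>\<^sup>+ \<omega>\<in>A. Z' (\<tau> \<omega>) \<omega> \<partial>M)"
  shows "(\<integral>\<^sup>+ \<omega>. \<integral>\<^sup>+ t. Z t \<omega> \<partial>stieltjes T (\<lambda>t. C t \<omega>) \<partial>M) \<le>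
    (\<integral>\<^sup>+ \<omega>. \<integral>\<^sup>+ t. Z' t \<omega> \<partial>stieltjes T (\<lambda>t. C t \<omega>) \<partial>M)"
  unfolding stieltjes_expectation[OF Z] stieltjes_expectation[OF Z']
  by (rule nn_integral_mono, rule mult_left_mono, rule le[OF hit_in_stopping_times hit_event]) simp

lemma stieltjes_expectation_tail:
  assumes phi: "(\<lambda>(t, \<omega>). \<phi> t \<omega>) \<in> borel_measurable (time T \<Otimes>\<^sub>M M)"
  shows "(\<integral>\<^sup>+ \<omega>. \<integral>\<^sup>+ t. tail_integral T \<phi> t \<omega> \<partial>stieltjes T (\<lambda>t. C t \<omega>) \<partial>M) =
    (\<integral>\<^sup>+ \<omega>. \<integral>\<^sup>+ t. \<phi> t \<omega> * ennreal (C t \<omega>) \<partial>leb T \<partial>M)"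
proof (rule nn_integral_cong_AE)
  have "AE \<omega> in M. good_path T (\<lambda>t. C t \<omega>)" using C by (simp add: increasing_process_def)
  then show "AE \<omega> in M. (\<integral>\<^sup>+ t. tail_integral T \<phi> t \<omega> \<partial>stieltjes T (\<lambda>t. C t \<omega>)) =
      (\<integral>\<^sup>+ t. \<phi> t \<omega> * ennreal (C t \<omega>) \<partial>leb T)"
    using AE_space
  proof eventually_elim
    case (elim \<omega>)
    then show ?case
      unfolding tail_integral_def using stieltjes_fubini[OF elim(1) jointly_section[OF phi elim(2)]] by simp
  qed
qed

end

lemma increasing_process_lincomb:
  assumes "increasing_process C" "increasing_process D" "0 \<le> a" "0 \<le> b"
  shows "increasing_process (\<lambda>t \<omega>. a * C t \<omega> + b * D t \<omega>)"
  unfolding increasing_process_def adapted_def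
proof (intro conjI allI impI)
  show "(\<lambda>\<omega>. a * C t \<omega> + b * D t \<omega>) \<in> borel_measurable (F t)" if "t \<le> T" for t
    using assms that unfolding increasing_process_def adapted_def
    by (intro borel_measurable_add borel_measurable_times) auto
  have "AE \<omega> in M. good_path T (\<lambda>t. C t \<omega>)" "AE \<omega> in M. good_path T (\<lambda>t. D t \<omega>)"
    using assms by (auto simp: increasing_process_def)
  then show "AE \<omega> in M. good_path T (\<lambda>t. a * C t \<omega> + b * D t \<omega>)"
    by eventually_elim (intro good_path_lincomb assms(3,4))
qed

lemma stieltjes_expectation_lincomb:
  assumes C: "increasing_process C" "increasing_process D" and ab: "0 \<le> a" "0 \<le> b"
    and Z: "(\<lambda>(t, \<omega>). Z t \<omega>) \<in> borel_measurable (time T \<Otimes>\<^sub>M M)"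
  shows "(\<integral>\<^sup>+ \<omega>. \<integral>\<^sup>+ t. Z t \<omega> \<partial>stieltjes T (\<lambda>t. a * C t \<omega> + b * D t \<omega>) \<partial>M) =
    ennreal a * (\<integral>\<^sup>+ \<omega>. \<integral>\<^sup>+ t. Z t \<omega> \<partial>stieltjes T (\<lambda>t. C t \<omega>) \<partial>M) +
    ennreal b * (\<integral>\<^sup>+ \<omega>. \<integral>\<^sup>+ t. Z t \<omega> \<partial>stieltjes T (\<lambda>t. D t \<omega>) \<partial>M)"
proof -
  note m = stieltjes_integral_measurable[OF _ Z]
  have good: "AE \<omega> in M. good_path T (\<lambda>t. C t \<omega>)" "AE \<omega> in M. good_path T (\<lambda>t. D t \<omega>)"
    using C by (auto simp: increasing_process_def)
  have "(\<integral>\<^sup>+ \<omega>. \<integral>\<^sup>+ t. Z t \<omega> \<partial>stieltjes T (\<lambda>t. a * C t \<omega> + b * D t \<omega>) \<partial>M) =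
    (\<integral>\<^sup>+ \<omega>. ennreal a * (\<integral>\<^sup>+ t. Z t \<omega> \<partial>stieltjes T (\<lambda>t. C t \<omega>)) +
      ennreal b * (\<integral>\<^sup>+ t. Z t \<omega> \<partial>stieltjes T (\<lambda>t. D t \<omega>)) \<partial>M)"
  proof (intro nn_integral_cong_AE, use good AE_space in eventually_elim)
    case (elim \<omega>)
    show ?case using elim by (intro nn_integral_stieltjes_lincomb jointly_section[OF Z] ab) auto
  qed
  also have "\<dots> = ennreal a * (\<integral>\<^sup>+ \<omega>. \<integral>\<^sup>+ t. Z t \<omega> \<partial>stieltjes T (\<lambda>t. C t \<omega>) \<partial>M) +
    ennreal b * (\<integral>\<^sup>+ \<omega>. \<integral>\<^sup>+ t. Z t \<omega> \<partial>stieltjes T (\<lambda>t. D t \<omega>) \<partial>M)"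
    using m[OF C(1)] m[OF C(2)] by (simp add: nn_integral_add nn_integral_cmult)
  finally show ?thesis .
qed

text \<open>All levels in (0,1] are hit at \<tau> on the event \<open>A\<close>, so
  \<open>dD\<close> is the unit mass at \<tau> there and 0 elsewhere. Testing with \<open>D\<close>
  recovers a statement at the stopping time.\<close>

lemma single_step_process:
  assumes tau: "\<tau> \<in> stopping_times T M F" and A: "A \<in> sets (pre_sigma \<tau>)"
  defines "D \<equiv> \<lambda>t \<omega>. if \<tau> \<omega> \<le> t then indicator A \<omega> else 0 :: real"
  shows "increasing_process D"
    and "(\<lambda>(t, \<omega>). Z t \<omega>) \<in> borel_measurable (time T \<Otimes>\<^sub>M M) \<Longrightarrow>
      (\<integral>\<^sup>+ \<omega>. \<integral>\<^sup>+ t. Z t \<omega> \<partial>stieltjes T (\<lambda>t. D t \<omega>) \<partial>M) = (\<integral>\<^sup>+ \<omega>\<in>A. Z (\<tau> \<omega>) \<omega> \<partial>M)"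
proof -
  have st: "stopping_time F \<tau>" and leT: "AE \<omega> in M. \<tau> \<omega> \<le> T" using tau by (auto simp: stopping_times_def)
  have "optional T M F D" unfolding D_def using st A by (rule optional_step)
  then have "progressive T F D" unfolding optional_def by (rule optional_progressive)
  then have "adapted T F D" by (auto simp: adapted_def intro: progressive_adapted)
  moreover have good: "good_path T (\<lambda>t. D t \<omega>)" for \<omega>
    using cadlag_path_step[of T "\<tau> \<omega>" "indicator A \<omega>"]
    unfolding good_path_def D_def cadlag_path_def by (auto simp: mono_on_def)
  ultimately show "increasing_process D" by (simp add: increasing_process_def)
  assume Z: "(\<lambda>(t, \<omega>). Z t \<omega>) \<in> borel_measurable (time T \<Otimes>\<^sub>M M)"
  show "(\<integral>\<^sup>+ \<omega>. \<integral>\<^sup>+ t. Z t \<omega> \<partial>stieltjes T (\<lambda>t. D t \<omega>) \<partial>M) = (\<integral>\<^sup>+ \<omega>\<in>A. Z (\<tau> \<omega>) \<omega> \<partial>M)"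
  proof (intro nn_integral_cong_AE, use leT AE_space in eventually_elim)
    case (elim \<omega>)
    have "hit T (\<lambda>t. D t \<omega>) s = \<tau> \<omega>" if s: "0 < s" "s \<le> D T \<omega>" for s
    proof (rule antisym)
      have A: "\<omega> \<in> A" using s by (auto simp: D_def split: if_splits split_indicator_asm)
      have s1: "s \<le> 1" using s A elim by (simp add: D_def)
      show "hit T (\<lambda>t. D t \<omega>) s \<le> \<tau> \<omega>"
        using hit_le_iff_final[OF good elim(1) s(2)] s1 A by (simp add: D_def)
      have "s \<le> D (hit T (\<lambda>t. D t \<omega>) s) \<omega>"
        using hit_le_iff_final[OF good hit_le s(2)] by blast
      then show "\<tau> \<omega> \<le> hit T (\<lambda>t. D t \<omega>) s" using s(1) by (auto simp: D_def split: if_splits)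
    qed
    then have "(\<integral>\<^sup>+ t. Z t \<omega> \<partial>stieltjes T (\<lambda>t. D t \<omega>)) = (\<integral>\<^sup>+ s. Z (\<tau> \<omega>) \<omega> * indicator {0<..D T \<omega>} s \<partial>lborel)"
      using nn_integral_stieltjes[OF good jointly_section[OF Z elim(2)]]
      by (auto intro!: nn_integral_cong split: split_indicator)
    also have "\<dots> = Z (\<tau> \<omega>) \<omega> * indicator A \<omega>"
      using elim by (auto simp: nn_integral_cmult_indicator D_def split: split_indicator)
    finally show ?case .
  qed
qed

end

section \<open>The planner's problem\<close>

text \<open>The difference is nonnegative with integral 0; finiteness of the smaller integral
  legitimises the subtraction. This is how integral conditions become pointwise ones.\<close>

lemma nn_integral_le_imp_AE_eq:
  fixes f g :: "'b \<Rightarrow> ennreal"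
  assumes f: "f \<in> borel_measurable N" and g: "g \<in> borel_measurable N"
    and le: "AE z in N. g z \<le> f z" and int: "(\<integral>\<^sup>+ z. f z \<partial>N) \<le> (\<integral>\<^sup>+ z. g z \<partial>N)" "(\<integral>\<^sup>+ z. g z \<partial>N) < \<infinity>"
  shows "AE z in N. f z = g z"
proof -
  have "(\<integral>\<^sup>+ z. f z - g z \<partial>N) = (\<integral>\<^sup>+ z. f z \<partial>N) - (\<integral>\<^sup>+ z. g z \<partial>N)"
    using f g le int by (intro nn_integral_diff) auto
  also have "\<dots> = 0" using int by (simp add: diff_eq_0_iff_ennreal order_le_less_trans)
  finally have "AE z in N. f z - g z = 0" using f g by (subst (asm) nn_integral_0_iff_AE) auto
  moreover have "AE z in N. g z \<noteq> \<infinity>" using nn_integral_noteq_infinite[OF g] int by auto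
  ultimately show ?thesis using le
    by eventually_elim (auto simp: diff_eq_0_iff_ennreal)
qed

locale planner = usual_filtration T M F for T and M :: "'a measure" and F +
  fixes n :: nat and \<psi>x \<psi>c r :: "'a process" and w \<gamma> :: "nat \<Rightarrow> real"
    and u :: "nat \<Rightarrow> real \<times> real \<Rightarrow> real"
  assumes T_pos: "0 < T" and n_pos: "1 \<le> n"
    and w_pos: "\<And>i. i < n \<Longrightarrow> 0 < w i" and gamma_pos: "\<And>i. i < n \<Longrightarrow> 0 < \<gamma> i"
    and U: "assumption_U n T M F \<psi>x \<psi>c r w u" and P: "assumption_P T M F \<psi>x \<psi>c r"
begin

abbreviation "\<mu> \<equiv> M \<Otimes>\<^sub>M leb T"

sublocale leb: sigma_finite_measure "leb T" by (rule sigma_finite_leb)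

sublocale product: pair_sigma_finite M "leb T" by unfold_locales

definition disc :: "ennreal \<Rightarrow> 'a \<Rightarrow> real" where
  "disc t \<omega> = discount (\<lambda>s. r s \<omega>) t"

lemma space_mu: "z \<in> space \<mu> \<Longrightarrow> fst z \<in> space M \<and> snd z \<le> T"
  by (auto simp: space_pair_measure)

lemma joint_mu:
  assumes "(\<lambda>(t, \<omega>). Z t \<omega>) \<in> borel_measurable (time T \<Otimes>\<^sub>M M)"
  shows "(\<lambda>z. Z (snd z) (fst z)) \<in> borel_measurable \<mu>"
  using jointly_swap[of Z, OF assms] by (simp add: case_prod_beta')

lemma iterated_mu:
  assumes "(\<lambda>z. Z (snd z) (fst z)) \<in> borel_measurable \<mu>"
  shows "(\<integral>\<^sup>+ \<omega>. \<integral>\<^sup>+ t. Z t \<omega> \<partial>leb T \<partial>M) = (\<integral>\<^sup>+ z. Z (snd z) (fst z) \<partial>\<mu>)"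
  using leb.nn_integral_fst[OF assms] by simp

lemma AE_mu_time:
  assumes "AE t in leb T. Q t" "{t \<in> {..T}. Q t} \<in> sets (time T)"
  shows "AE z in \<mu>. Q (snd z)"
proof (rule product.AE_pair_measure)
  have "{t \<in> {..T}. Q t} \<in> sets (leb T)" using assms(2) by simp
  then have "snd -` {t \<in> {..T}. Q t} \<inter> space \<mu> \<in> sets \<mu>"
    by (rule measurable_sets[OF measurable_snd])
  then show "{z \<in> space \<mu>. Q (snd z)} \<in> sets \<mu>"
    by (rule back_subst[of "\<lambda>A. A \<in> _"]) (auto simp: space_pair_measure)
qed (use assms(1) in simp)

lemma AE_mu_finite: "AE z in \<mu>. snd z \<noteq> \<infinity>"
proof (rule AE_mu_time[OF AE_leb_finite])
  have "{t \<in> {..T}. t \<noteq> \<infinity>} = (- {\<infinity>}) \<inter> {..T}" by auto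
  then show "{t \<in> {..T}. t \<noteq> \<infinity>} \<in> sets (time T)" using sets_time_Int[of "- {\<infinity>}" T] by simp
qed

lemma AE_mu_iterated: "AE z in \<mu>. Q z \<Longrightarrow> AE \<omega> in M. AE t in leb T. Q (\<omega>, t)"
  by (rule product.AE_pair)

lemma optional_joint: "optional T M F X \<Longrightarrow> (\<lambda>(t, \<omega>). X t \<omega>) \<in> borel_measurable (time T \<Otimes>\<^sub>M M)"
  unfolding optional_def by (intro progressive_jointly optional_progressive)

lemma optional_mu: "optional T M F X \<Longrightarrow> (\<lambda>z. X (snd z) (fst z)) \<in> borel_measurable \<mu>"
  by (intro joint_mu optional_joint)

lemma r_facts:
  shows r_progressive: "progressive T F r" and r_bounded: "\<exists>K. \<forall>t\<le>T. \<forall>\<omega>\<in>space M. r t \<omega> \<le> K"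
proof -
  have "optional T M F r" using P by (simp add: assumption_P_def)
  then show "progressive T F r" unfolding optional_def by (rule optional_progressive)
  show "\<exists>K. \<forall>t\<le>T. \<forall>\<omega>\<in>space M. r t \<omega> \<le> K" using P unfolding assumption_P_def by blast
qed

lemma disc_optional: "optional T M F disc"
proof -
  obtain K where "\<forall>t\<le>T. \<forall>\<omega>\<in>space M. r t \<omega> \<le> K" using r_bounded by blast
  then show ?thesis unfolding disc_def using r_progressive by (intro optional_discount[of _ K]) auto
qed

lemma disc_pos: "t \<le> T \<Longrightarrow> t \<noteq> \<infinity> \<Longrightarrow> \<omega> \<in> space M \<Longrightarrow> 0 < disc t \<omega>"
proof -
  assume *: "t \<le> T" "t \<noteq> \<infinity>" "\<omega> \<in> space M"
  obtain K where "\<forall>t\<le>T. \<forall>\<omega>\<in>space M. r t \<omega> \<le> K" using r_bounded by blast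
  then show ?thesis unfolding disc_def using * by (intro discount_pos[of _ _ K]) auto
qed

lemma disc_nonneg: "0 \<le> disc t \<omega>"
  by (simp add: disc_def discount_bounds)

lemma utility_u: "i < n \<Longrightarrow> utility (u i)"
  using U by (simp add: assumption_U_def)

lemma price_facts:
  assumes "price_process T M F \<psi>"
  shows price_progressive: "progressive T F \<psi>"
    and price_expectation: "t \<le> T \<Longrightarrow> (\<integral>\<^sup>+ \<omega>. ennreal (\<psi> t \<omega>) \<partial>M) \<le> 1"
proof -
  show "progressive T F \<psi>"
    using assms by (intro progressive_right_continuous) (auto simp: price_process_def)
  obtain \<rho> E where *: "exponential_martingale T M F E"
    "\<forall>t\<le>T. AE \<omega> in M. \<psi> t \<omega> = discount (\<lambda>s. \<rho> s \<omega>) t * E t \<omega>"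
    using assms unfolding price_process_def by blast
  assume t: "t \<le> T"
  have E: "integrable M (E t)" "\<And>\<omega>. \<omega> \<in> space M \<Longrightarrow> 0 < E t \<omega>" "(\<integral>\<omega>. E t \<omega> \<partial>M) = 1"
    using *(1) t by (auto simp: exponential_martingale_def martingale_def)
  have "(\<integral>\<^sup>+ \<omega>. ennreal (\<psi> t \<omega>) \<partial>M) \<le> (\<integral>\<^sup>+ \<omega>. ennreal (E t \<omega>) \<partial>M)"
  proof (intro nn_integral_mono_AE, use *(2)[rule_format, OF t] AE_space in eventually_elim)
    case (elim \<omega>)
    \<comment> \<open>The discount factor is at most 1 and the martingale has mean one.\<close>
    have "discount (\<lambda>s. \<rho> s \<omega>) t * E t \<omega> \<le> 1 * E t \<omega>"
      using E(2)[OF elim(2)] by (intro mult_right_mono discount_bounds) auto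
    then show ?case using elim(1) by (intro ennreal_leI) simp
  qed
  also have "\<dots> = ennreal (\<integral>\<omega>. E t \<omega> \<partial>M)"
    using E by (intro nn_integral_eq_integral) (auto intro!: AE_I2 less_imp_le)
  finally show "(\<integral>\<^sup>+ \<omega>. ennreal (\<psi> t \<omega>) \<partial>M) \<le> 1" using E by simp
qed

lemma prices: "price_process T M F \<psi>x" "price_process T M F \<psi>c"
  using P by (auto simp: assumption_P_def)

lemma price_joint:
  "price_process T M F \<psi> \<Longrightarrow> (\<lambda>(t, \<omega>). ennreal (\<psi> t \<omega>)) \<in> borel_measurable (time T \<Otimes>\<^sub>M M)"
  using progressive_jointly[OF price_progressive] unfolding case_prod_beta' by simp

lemmas psi_x_joint = price_joint[OF prices(1)] and psi_c_joint = price_joint[OF prices(2)]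

lemmas psi_x_mu = joint_mu[of "\<lambda>t \<omega>. ennreal (\<psi>x t \<omega>)", OF psi_x_joint]

text \<open>Positivity is assumed at finite times only. The one remaining time is an infinite
  horizon, where the price is 0 almost surely, so a single null set serves all times.\<close>

lemma psi_c_nonneg: "AE \<omega> in M. \<forall>t\<le>T. 0 \<le> \<psi>c t \<omega>"
proof -
  have pos: "0 < \<psi>c t \<omega>" if "t \<le> T" "t \<noteq> \<infinity>" "\<omega> \<in> space M" for t \<omega>
    using prices(2) that by (simp add: price_process_def)
  have "AE \<omega> in M. T = \<infinity> \<longrightarrow> \<psi>c T \<omega> = 0" using P by (auto simp: assumption_P_def)
  then show ?thesis
    using AE_space
  proof eventually_elim
    case (elim \<omega>)
    show ?case
    proof (intro allI impI)
      fix t assume "t \<le> T"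
      then show "0 \<le> \<psi>c t \<omega>"
        using pos[of t \<omega>] elim by (cases "t = \<infinity>") (auto simp: top_unique less_imp_le)
    qed
  qed
qed

section \<open>Costs of plans and their linearity\<close>

definition cost_x :: "'a process \<Rightarrow> ennreal" where
  "cost_x x = (\<integral>\<^sup>+ z. ennreal (\<psi>x (snd z) (fst z)) * ennreal (x (snd z) (fst z)) \<partial>\<mu>)"

definition cost_c :: "'a process \<Rightarrow> ennreal" where
  "cost_c C = (\<integral>\<^sup>+ \<omega>. \<integral>\<^sup>+ t. ennreal (\<psi>c t \<omega>) \<partial>stieltjes T (\<lambda>t. C t \<omega>) \<partial>M)"

lemma plan_facts:
  assumes "contribution_plan T M F x C"
  shows plan_optional_x: "optional T M F x" and plan_optional_c: "optional T M F C"
    and plan_nonneg_x: "\<And>t \<omega>. t \<le> T \<Longrightarrow> \<omega> \<in> space M \<Longrightarrow> 0 \<le> x t \<omega>"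
    and plan_nonneg_c: "\<And>t \<omega>. t \<le> T \<Longrightarrow> \<omega> \<in> space M \<Longrightarrow> 0 \<le> C t \<omega>"
    and plan_increasing: "increasing_process C"
proof -
  show x: "optional T M F x" and C: "optional T M F C"
    and nn: "\<And>t \<omega>. t \<le> T \<Longrightarrow> \<omega> \<in> space M \<Longrightarrow> 0 \<le> x t \<omega>"
      "\<And>t \<omega>. t \<le> T \<Longrightarrow> \<omega> \<in> space M \<Longrightarrow> 0 \<le> C t \<omega>"
    using assms by (auto simp: contribution_plan_def)
  have "progressive T F C" using C unfolding optional_def by (rule optional_progressive)
  then have "adapted T F C" by (auto simp: adapted_def intro: progressive_adapted)
  moreover have "AE \<omega> in M. right_continuous_path T (\<lambda>t. C t \<omega>) \<and> mono_on {..T} (\<lambda>t. C t \<omega>)"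
    using assms by (simp add: contribution_plan_def)
  then have "AE \<omega> in M. good_path T (\<lambda>t. C t \<omega>)"
    using AE_space by eventually_elim (use nn in \<open>auto simp: good_path_def\<close>)
  ultimately show "increasing_process C" by (simp add: increasing_process_def)
qed

lemma planI:
  assumes "optional T M F x" "optional T M F C" "increasing_process C"
    "\<And>t \<omega>. t \<le> T \<Longrightarrow> \<omega> \<in> space M \<Longrightarrow> 0 \<le> x t \<omega>" "\<And>t \<omega>. t \<le> T \<Longrightarrow> \<omega> \<in> space M \<Longrightarrow> 0 \<le> C t \<omega>"
  shows "contribution_plan T M F x C"
  using assms unfolding contribution_plan_def increasing_process_def good_path_def
  by (auto elim: eventually_mono)

lemma cost_x_alt:
  assumes "\<And>t \<omega>. t \<le> T \<Longrightarrow> \<omega> \<in> space M \<Longrightarrow> 0 \<le> x t \<omega>" "optional T M F x"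
  shows "(\<integral>\<^sup>+ \<omega>. \<integral>\<^sup>+ t. ennreal (\<psi>x t \<omega> * x t \<omega>) \<partial>leb T \<partial>M) = cost_x x"
proof -
  have "(\<integral>\<^sup>+ \<omega>. \<integral>\<^sup>+ t. ennreal (\<psi>x t \<omega> * x t \<omega>) \<partial>leb T \<partial>M) =
      (\<integral>\<^sup>+ \<omega>. \<integral>\<^sup>+ t. ennreal (\<psi>x t \<omega>) * ennreal (x t \<omega>) \<partial>leb T \<partial>M)"
    using assms(1) by (intro nn_integral_cong) (simp add: ennreal_mult'')
  also have "\<dots> = cost_x x"
    unfolding cost_x_def using psi_x_mu optional_mu[OF assms(2)]
    by (intro iterated_mu[of "\<lambda>t \<omega>. ennreal (\<psi>x t \<omega>) * ennreal (x t \<omega>)"]) auto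
  finally show ?thesis .
qed

lemma cost_eq:
  assumes p: "contribution_plan T M F x C"
  shows "cost T M \<psi>x \<psi>c x C = cost_x x + cost_c C"
proof -
  have "(\<lambda>(t, \<omega>). ennreal (\<psi>x t \<omega> * x t \<omega>)) \<in> borel_measurable (time T \<Otimes>\<^sub>M M)"
    using progressive_jointly[OF price_progressive[OF prices(1)]] optional_joint[OF plan_optional_x[OF p]]
    unfolding case_prod_beta' by simp
  from measurable_nn_integral_time[OF this]
  have "cost T M \<psi>x \<psi>c x C = (\<integral>\<^sup>+ \<omega>. \<integral>\<^sup>+ t. ennreal (\<psi>x t \<omega> * x t \<omega>) \<partial>leb T \<partial>M) + cost_c C"
    unfolding cost_def cost_c_def
    using stieltjes_integral_measurable[OF plan_increasing[OF p] psi_c_joint]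
    by (intro nn_integral_add) auto
  then show ?thesis using cost_x_alt[of x] plan_nonneg_x[OF p] plan_optional_x[OF p] by simp
qed

lemma plan_lincomb:
  assumes p: "contribution_plan T M F x C" and q: "contribution_plan T M F y D" and ab: "0 \<le> a" "0 \<le> b"
  shows "contribution_plan T M F (\<lambda>t \<omega>. a * x t \<omega> + b * y t \<omega>) (\<lambda>t \<omega>. a * C t \<omega> + b * D t \<omega>)"
proof (rule planI)
  show "increasing_process (\<lambda>t \<omega>. a * C t \<omega> + b * D t \<omega>)"
    using plan_increasing[OF p] plan_increasing[OF q] ab by (rule increasing_process_lincomb)
  show "optional T M F (\<lambda>t \<omega>. a * x t \<omega> + b * y t \<omega>)" "optional T M F (\<lambda>t \<omega>. a * C t \<omega> + b * D t \<omega>)"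
    using plan_optional_x[OF p] plan_optional_x[OF q] plan_optional_c[OF p] plan_optional_c[OF q]
    unfolding optional_def case_prod_beta' by auto
qed (use plan_nonneg_x[OF p] plan_nonneg_x[OF q] plan_nonneg_c[OF p] plan_nonneg_c[OF q] ab in auto)

lemma cost_x_lincomb:
  assumes "optional T M F x" "optional T M F y" and ab: "0 \<le> a" "0 \<le> b"
    and nn: "\<And>t \<omega>. t \<le> T \<Longrightarrow> \<omega> \<in> space M \<Longrightarrow> 0 \<le> x t \<omega>" "\<And>t \<omega>. t \<le> T \<Longrightarrow> \<omega> \<in> space M \<Longrightarrow> 0 \<le> y t \<omega>"
  shows "cost_x (\<lambda>t \<omega>. a * x t \<omega> + b * y t \<omega>) = ennreal a * cost_x x + ennreal b * cost_x y"
proof -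
  have "cost_x (\<lambda>t \<omega>. a * x t \<omega> + b * y t \<omega>) =
    (\<integral>\<^sup>+ z. ennreal a * (ennreal (\<psi>x (snd z) (fst z)) * ennreal (x (snd z) (fst z))) +
      ennreal b * (ennreal (\<psi>x (snd z) (fst z)) * ennreal (y (snd z) (fst z))) \<partial>\<mu>)"
    unfolding cost_x_def
  proof (rule nn_integral_cong)
    fix z assume "z \<in> space \<mu>"
    then have "0 \<le> x (snd z) (fst z)" "0 \<le> y (snd z) (fst z)" using space_mu nn by auto
    then show "ennreal (\<psi>x (snd z) (fst z)) * ennreal (a * x (snd z) (fst z) + b * y (snd z) (fst z)) =
      ennreal a * (ennreal (\<psi>x (snd z) (fst z)) * ennreal (x (snd z) (fst z))) +
      ennreal b * (ennreal (\<psi>x (snd z) (fst z)) * ennreal (y (snd z) (fst z)))"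
      using ab by (simp add: ennreal_plus ennreal_mult' distrib_left ac_simps)
  qed
  also have "\<dots> = ennreal a * cost_x x + ennreal b * cost_x y"
    unfolding cost_x_def using psi_x_mu optional_mu[OF assms(1)] optional_mu[OF assms(2)]
    by (simp add: nn_integral_add nn_integral_cmult)
  finally show ?thesis .
qed

lemma cost_lincomb:
  assumes p: "contribution_plan T M F x C" and q: "contribution_plan T M F y D" and ab: "0 \<le> a" "0 \<le> b"
  shows "cost T M \<psi>x \<psi>c (\<lambda>t \<omega>. a * x t \<omega> + b * y t \<omega>) (\<lambda>t \<omega>. a * C t \<omega> + b * D t \<omega>) =
    ennreal a * cost T M \<psi>x \<psi>c x C + ennreal b * cost T M \<psi>x \<psi>c y D"
proof -
  have "cost_c (\<lambda>t \<omega>. a * C t \<omega> + b * D t \<omega>) = ennreal a * cost_c C + ennreal b * cost_c D"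
    unfolding cost_c_def
    by (rule stieltjes_expectation_lincomb[OF plan_increasing[OF p] plan_increasing[OF q] ab psi_c_joint])
  moreover have "cost_x (\<lambda>t \<omega>. a * x t \<omega> + b * y t \<omega>) = ennreal a * cost_x x + ennreal b * cost_x y"
    using plan_optional_x[OF p] plan_optional_x[OF q] ab plan_nonneg_x[OF p] plan_nonneg_x[OF q]
    by (rule cost_x_lincomb)
  ultimately show ?thesis
    unfolding cost_eq[OF plan_lincomb[OF p q ab]] cost_eq[OF p] cost_eq[OF q]
    by (simp add: distrib_left ac_simps)
qed

lemma increasing_process_zero: "increasing_process (\<lambda>t \<omega>. 0)"
  by (auto simp: increasing_process_def adapted_def good_path_def right_continuous_path_def mono_on_def)

lemma optional_const: "optional T M F (\<lambda>t \<omega>. c)"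
  by (rule optional_deterministic) simp

lemma plan_zero: "contribution_plan T M F (\<lambda>t \<omega>. 0) (\<lambda>t \<omega>. 0)"
  by (intro planI increasing_process_zero optional_const) auto

lemma cost_c_zero: "cost_c (\<lambda>t \<omega>. 0) = 0"
proof -
  have "good_path T (\<lambda>t. 0)" by (auto simp: good_path_def right_continuous_path_def mono_on_def)
  then have "(\<integral>\<^sup>+ t. ennreal (\<psi>c t \<omega>) \<partial>stieltjes T (\<lambda>t. 0)) = 0" if "\<omega> \<in> space M" for \<omega>
    using jointly_section[of "\<lambda>t \<omega>. ennreal (\<psi>c t \<omega>)", OF psi_c_joint that]
    by (subst nn_integral_stieltjes) auto
  then show ?thesis unfolding cost_c_def by (subst nn_integral_cong[of _ _ "\<lambda>_. 0"]) auto
qed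

lemma cost_x_zero: "cost_x (\<lambda>t \<omega>. 0) = 0"
  by (simp add: cost_x_def)

lemma plan_sum:
  fixes k :: nat
  assumes "\<And>i. i < k \<Longrightarrow> contribution_plan T M F (x i) (C i)"
  shows "contribution_plan T M F (\<lambda>t \<omega>. \<Sum>i<k. x i t \<omega>) (\<lambda>t \<omega>. \<Sum>i<k. C i t \<omega>) \<and>
    cost T M \<psi>x \<psi>c (\<lambda>t \<omega>. \<Sum>i<k. x i t \<omega>) (\<lambda>t \<omega>. \<Sum>i<k. C i t \<omega>) = (\<Sum>i<k. cost T M \<psi>x \<psi>c (x i) (C i))"
  using assms
proof (induction k)
  case 0
  show ?case using plan_zero cost_eq[OF plan_zero] cost_x_zero cost_c_zero by simp
next
  case (Suc k)
  have p: "contribution_plan T M F (\<lambda>t \<omega>. \<Sum>i<k. x i t \<omega>) (\<lambda>t \<omega>. \<Sum>i<k. C i t \<omega>)"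
    "contribution_plan T M F (x k) (C k)"
    using Suc by auto
  show ?case
    using plan_lincomb[OF p, of 1 1] cost_lincomb[OF p, of 1 1] Suc by simp
qed

section \<open>Policies of the planner, their total cost and welfare\<close>

definition plans :: "(nat \<Rightarrow> 'a process) \<Rightarrow> (nat \<Rightarrow> 'a process) \<Rightarrow> bool" where
  "plans x C \<longleftrightarrow> (\<forall>i<n. contribution_plan T M F (x i) (C i))"

definition total_cost :: "(nat \<Rightarrow> 'a process) \<Rightarrow> (nat \<Rightarrow> 'a process) \<Rightarrow> ennreal" where
  "total_cost x C = (\<Sum>i<n. cost T M \<psi>x \<psi>c (x i) (C i))"

definition wealth :: real where "wealth = (\<Sum>i<n. w i)"

definition total :: "(nat \<Rightarrow> 'a process) \<Rightarrow> 'a process" where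
  "total C t \<omega> = (\<Sum>j<n. C j t \<omega>)"

lemma wealth_pos: "0 < wealth"
  unfolding wealth_def using n_pos w_pos by (intro sum_pos) (auto simp: lessThan_empty_iff)

lemma planner_set_iff:
  "(x, C) \<in> planner_set n T M F \<psi>x \<psi>c (\<Sum>i<n. w i) \<longleftrightarrow> plans x C \<and> total_cost x C \<le> ennreal wealth"
  by (simp add: planner_set_def plans_def total_cost_def wealth_def)

lemma plans_total:
  assumes "plans x C"
  shows "contribution_plan T M F (total x) (total C)" "total_cost x C = cost T M \<psi>x \<psi>c (total x) (total C)"
  using plan_sum[of n x C] assms unfolding plans_def total_def total_cost_def by auto

text \<open>Contributions enter through their total alone, because \<open>dC\<close> is additive;
  consumption stays separate, one agent at a time.\<close>

lemma total_cost_eq: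
  assumes "plans x C" shows "total_cost x C = (\<Sum>i<n. cost_x (x i)) + cost_c (total C)"
proof -
  have "cost_x (total x) = (\<Sum>i<n. cost_x (x i))"
  proof -
    have nn: "0 \<le> x i (snd z) (fst z)" if "i < n" "z \<in> space \<mu>" for i z
      using plan_nonneg_x[of "x i" "C i" "snd z" "fst z"] assms that space_mu by (auto simp: plans_def)
    have m: "(\<lambda>z. x i (snd z) (fst z)) \<in> borel_measurable \<mu>" if "i < n" for i
      using assms that by (intro optional_mu plan_optional_x[of _ "C i"]) (auto simp: plans_def)
    have "cost_x (total x) = (\<integral>\<^sup>+ z. (\<Sum>i<n. ennreal (\<psi>x (snd z) (fst z)) * ennreal (x i (snd z) (fst z))) \<partial>\<mu>)"
      unfolding cost_x_def total_def using nn
      by (intro nn_integral_cong) (subst sum_ennreal[symmetric], simp_all add: sum_distrib_left)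
    also have "\<dots> = (\<Sum>i<n. cost_x (x i))"
      unfolding cost_x_def using m psi_x_mu by (intro nn_integral_sum) auto
    finally show ?thesis .
  qed
  then show ?thesis using plans_total[OF assms] cost_eq by simp
qed

lemma plans_mu:
  assumes "plans x C"
  shows plans_x_mu: "i < n \<Longrightarrow> (\<lambda>z. x i (snd z) (fst z)) \<in> borel_measurable \<mu>"
    and plans_total_mu: "(\<lambda>z. total C (snd z) (fst z)) \<in> borel_measurable \<mu>"
    and plans_x_nonneg: "i < n \<Longrightarrow> z \<in> space \<mu> \<Longrightarrow> 0 \<le> x i (snd z) (fst z)"
    and plans_total_nonneg: "z \<in> space \<mu> \<Longrightarrow> 0 \<le> total C (snd z) (fst z)"
  using assms plans_total(1)[OF assms] space_mu[of z]
  by (auto simp: plans_def intro: optional_mu plan_optional_x plan_optional_c plan_nonneg_x plan_nonneg_c)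

abbreviation "wgt i z \<equiv> ennreal (\<gamma> i * disc (snd z) (fst z))"

lemma weight_mu: "(\<lambda>z. wgt i z) \<in> borel_measurable \<mu>"
  using optional_mu[OF disc_optional] by auto

lemma weight_pos: "i < n \<Longrightarrow> z \<in> space \<mu> \<Longrightarrow> snd z \<noteq> \<infinity> \<Longrightarrow> 0 < wgt i z"
  using disc_pos[of "snd z" "fst z"] gamma_pos space_mu by simp

lemma welfare_eq:
  assumes p: "plans x C"
  shows "welfare n T M r u \<gamma> x C =
    (\<integral>\<^sup>+ z. (\<Sum>i<n. wgt i z * ennreal (u i (x i (snd z) (fst z), total C (snd z) (fst z)))) \<partial>\<mu>)"
proof -
  have m: "(\<lambda>z. u i (x i (snd z) (fst z), total C (snd z) (fst z))) \<in> borel_measurable \<mu>" if "i < n" for i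
    using that by (intro measurable_utility_compose[OF utility_u] plans_mu[OF p])
  have "ennreal (\<gamma> i) * payoff T M r (u i) (x i) (C i) (\<lambda>t \<omega>. \<Sum>j\<in>{..<n} - {i}. C j t \<omega>) =
      (\<integral>\<^sup>+ z. wgt i z * ennreal (u i (x i (snd z) (fst z), total C (snd z) (fst z))) \<partial>\<mu>)" if i: "i < n" for i
  proof -
    have tot: "C i t \<omega> + (\<Sum>j\<in>{..<n} - {i}. C j t \<omega>) = total C t \<omega>" for t \<omega>
      unfolding total_def using i by (subst (2) sum.remove[of _ i]) auto
    have "payoff T M r (u i) (x i) (C i) (\<lambda>t \<omega>. \<Sum>j\<in>{..<n} - {i}. C j t \<omega>) =
        (\<integral>\<^sup>+ z. ennreal (disc (snd z) (fst z) * u i (x i (snd z) (fst z), total C (snd z) (fst z))) \<partial>\<mu>)"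
      unfolding payoff_def tot disc_def[symmetric] using m[OF i] optional_mu[OF disc_optional]
      by (intro iterated_mu[of "\<lambda>t \<omega>. ennreal (disc t \<omega> * u i (x i t \<omega>, total C t \<omega>))"]) auto
    moreover have "ennreal (\<gamma> i) * (\<integral>\<^sup>+ z. ennreal (disc (snd z) (fst z) * u i (x i (snd z) (fst z), total C (snd z) (fst z))) \<partial>\<mu>)
      = (\<integral>\<^sup>+ z. ennreal (\<gamma> i) * ennreal (disc (snd z) (fst z) * u i (x i (snd z) (fst z), total C (snd z) (fst z))) \<partial>\<mu>)"
      using m[OF i] optional_mu[OF disc_optional] by (intro nn_integral_cmult[symmetric]) auto
    moreover have "ennreal (\<gamma> i) * ennreal (disc t \<omega> * v) = ennreal (\<gamma> i * disc t \<omega>) * ennreal v" for v t \<omega>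
      using gamma_pos[OF i] disc_nonneg[of t \<omega>] by (simp add: ennreal_mult' mult.assoc)
    ultimately show ?thesis by simp
  qed
  then have "welfare n T M r u \<gamma> x C =
      (\<Sum>i<n. \<integral>\<^sup>+ z. wgt i z * ennreal (u i (x i (snd z) (fst z), total C (snd z) (fst z))) \<partial>\<mu>)"
    unfolding welfare_def by (intro sum.cong) auto
  also have "\<dots> = (\<integral>\<^sup>+ z. (\<Sum>i<n. wgt i z * ennreal (u i (x i (snd z) (fst z), total C (snd z) (fst z)))) \<partial>\<mu>)"
    using m weight_mu by (intro nn_integral_sum[symmetric]) auto
  finally show ?thesis .
qed

lemma scaled_cost_x:
  assumes "plans y D"
  shows "(\<integral>\<^sup>+ z. (\<Sum>i<n. ennreal lam * ennreal (\<psi>x (snd z) (fst z)) * ennreal (y i (snd z) (fst z))) \<partial>\<mu>) =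
    ennreal lam * (\<Sum>i<n. cost_x (y i))"
proof -
  let ?f = "\<lambda>i z. ennreal (\<psi>x (snd z) (fst z)) * ennreal (y i (snd z) (fst z))"
  have my: "?f i \<in> borel_measurable \<mu>" if "i < n" for i
    using psi_x_mu plans_x_mu[OF assms that] by (auto intro!: borel_measurable_times_ennreal)
  have "(\<integral>\<^sup>+ z. (\<Sum>i<n. ennreal lam * ennreal (\<psi>x (snd z) (fst z)) * ennreal (y i (snd z) (fst z))) \<partial>\<mu>) =
      (\<integral>\<^sup>+ z. ennreal lam * (\<Sum>i<n. ?f i z) \<partial>\<mu>)"
    by (simp add: sum_distrib_left mult.assoc)
  also have "\<dots> = ennreal lam * (\<integral>\<^sup>+ z. (\<Sum>i<n. ?f i z) \<partial>\<mu>)"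
    using my by (intro nn_integral_cmult) auto
  also have "(\<integral>\<^sup>+ z. (\<Sum>i<n. ?f i z) \<partial>\<mu>) = (\<Sum>i<n. cost_x (y i))"
    unfolding cost_x_def using my by (intro nn_integral_sum) auto
  finally show ?thesis .
qed

lemma scaled_price_joint: "(\<lambda>(t, \<omega>). ennreal (lam * \<psi>c t \<omega>)) \<in> borel_measurable (time T \<Otimes>\<^sub>M M)"
  using progressive_jointly[OF price_progressive[OF prices(2)]] unfolding case_prod_beta' by simp

lemma scaled_cost_c:
  assumes lam: "0 \<le> lam" and D: "increasing_process D"
  shows "(\<integral>\<^sup>+ \<omega>. \<integral>\<^sup>+ t. ennreal (lam * \<psi>c t \<omega>) \<partial>stieltjes T (\<lambda>t. D t \<omega>) \<partial>M) = ennreal lam * cost_c D"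
proof -
  have "(\<integral>\<^sup>+ t. ennreal (lam * \<psi>c t \<omega>) \<partial>stieltjes T (\<lambda>t. D t \<omega>)) =
      ennreal lam * (\<integral>\<^sup>+ t. ennreal (\<psi>c t \<omega>) \<partial>stieltjes T (\<lambda>t. D t \<omega>))" if "\<omega> \<in> space M" for \<omega>
    using lam jointly_section[of "\<lambda>t \<omega>. ennreal (\<psi>c t \<omega>)", OF psi_c_joint that]
    by (simp add: ennreal_mult' nn_integral_cmult measurable_cong_sets[OF sets_stieltjes refl])
  then show ?thesis
    unfolding cost_c_def using stieltjes_integral_measurable[OF D psi_c_joint]
    by (subst nn_integral_cmult[symmetric]) (auto intro!: nn_integral_cong)
qed

end

section \<open>Marginal utilities along a fixed policy\<close>

locale policy = planner T M F n \<psi>x \<psi>c r w \<gamma> u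
  for T and M :: "'a measure" and F n \<psi>x \<psi>c r w \<gamma> u +
  fixes x C :: "nat \<Rightarrow> 'a process"
  assumes plans: "plans x C" and budget: "total_cost x C \<le> ennreal wealth"
    and gradient_zero: "AE (\<omega>, t) in M \<Otimes>\<^sub>M leb T. (\<Sum>j<n. C j t \<omega>) = 0 \<longrightarrow>
           (\<forall>i<n. has_gradient (u i) (x i t \<omega>) 0)"
begin

abbreviation "S \<equiv> total C"

abbreviation "mx i z \<equiv> ennreal_partial_x (u i) (x i (snd z) (fst z)) (S (snd z) (fst z))"
abbreviation "mc i z \<equiv> ennreal_partial_c (u i) (x i (snd z) (fst z)) (S (snd z) (fst z))"
abbreviation "util i z \<equiv> ennreal (u i (x i (snd z) (fst z), S (snd z) (fst z)))"

text \<open>The \<open>ennreal\<close> counterpart of \<open>marginal_density\<close>. It is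
  progressive whether or not the partial derivatives exist as limits, and agrees with
  \<open>marginal_density\<close> almost everywhere under \<open>gradients\<close>.\<close>

definition density :: "ennreal \<Rightarrow> 'a \<Rightarrow> ennreal" where
  "density t \<omega> = (\<Sum>i<n. wgt i (\<omega>, t) * mc i (\<omega>, t))"

definition gradients :: bool where
  "gradients \<longleftrightarrow> (AE z in \<mu>. \<forall>i<n. has_gradient (u i) (x i (snd z) (fst z)) (S (snd z) (fst z)))"

lemma mx_mu: "i < n \<Longrightarrow> (\<lambda>z. mx i z) \<in> borel_measurable \<mu>"
  by (intro measurable_partials(1)[OF utility_u] plans_mu[OF plans])

lemma mc_mu: "i < n \<Longrightarrow> (\<lambda>z. mc i z) \<in> borel_measurable \<mu>"
  by (intro measurable_partials(2)[OF utility_u] plans_mu[OF plans])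

lemma util_mu: "i < n \<Longrightarrow> (\<lambda>z. util i z) \<in> borel_measurable \<mu>"
  using measurable_utility_compose[OF utility_u plans_x_mu[OF plans] plans_total_mu[OF plans]]
    plans_x_nonneg[OF plans] plans_total_nonneg[OF plans] by auto

lemma optional_mx_mc:
  assumes "i < n"
  shows "(\<lambda>(t, \<omega>). mx i (\<omega>, t)) \<in> borel_measurable (optional_sigma T M F)"
    and "(\<lambda>(t, \<omega>). mc i (\<omega>, t)) \<in> borel_measurable (optional_sigma T M F)"
proof -
  have p: "contribution_plan T M F (x i) (C i)" using plans assms by (simp add: plans_def)
  note q = plans_total(1)[OF plans]
  have m: "(\<lambda>p. x i (fst p) (snd p)) \<in> borel_measurable (optional_sigma T M F)"
    "(\<lambda>p. S (fst p) (snd p)) \<in> borel_measurable (optional_sigma T M F)"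
    using plan_optional_x[OF p] plan_optional_c[OF q] unfolding optional_def case_prod_beta' by auto
  have nn: "0 \<le> x i (fst p) (snd p)" "0 \<le> S (fst p) (snd p)" if "p \<in> space (optional_sigma T M F)" for p
    using plan_nonneg_x[OF p] plan_nonneg_c[OF q] that by (auto simp: space_optional_sigma)
  show "(\<lambda>(t, \<omega>). mx i (\<omega>, t)) \<in> borel_measurable (optional_sigma T M F)"
    "(\<lambda>(t, \<omega>). mc i (\<omega>, t)) \<in> borel_measurable (optional_sigma T M F)"
    unfolding case_prod_beta' fst_conv snd_conv
    using measurable_partials[OF utility_u[OF assms] m nn] by auto
qed

lemma density_progressive: "progressive T F density"
proof (rule optional_progressive)
  have d: "(\<lambda>p. disc (fst p) (snd p)) \<in> borel_measurable (optional_sigma T M F)"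
    using disc_optional unfolding optional_def case_prod_beta' .
  have m: "(\<lambda>p. mc i (snd p, fst p)) \<in> borel_measurable (optional_sigma T M F)" if "i < n" for i
    using optional_mx_mc(2)[OF that] unfolding case_prod_beta' .
  show "(\<lambda>(t, \<omega>). density t \<omega>) \<in> borel_measurable (optional_sigma T M F)"
    unfolding density_def case_prod_beta'
  proof (intro borel_measurable_sum)
    fix i assume "i \<in> {..<n}"
    then show "(\<lambda>p. wgt i (snd p, fst p) * mc i (snd p, fst p)) \<in> borel_measurable (optional_sigma T M F)"
      using d m[of i] by (intro borel_measurable_times_ennreal) auto
  qed
qed

lemmas density_joint = progressive_jointly[OF density_progressive]
lemmas density_mu = joint_mu[of density, OF density_joint]

text \<open>Without any public good the gradient is given by hypothesis, and in the open quadrant by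
  smoothness. What remains is the edge of zero consumption with a positive public good, where the
  Inada condition makes the marginal utility infinite.\<close>

lemma gradientsI:
  assumes "\<And>i. i < n \<Longrightarrow> AE z in \<mu>. 0 < S (snd z) (fst z) \<longrightarrow> 0 < x i (snd z) (fst z)"
  shows gradients
proof -
  have "AE z in \<mu>. \<forall>i\<in>{..<n}. 0 < S (snd z) (fst z) \<longrightarrow> 0 < x i (snd z) (fst z)"
    using assms by (intro AE_finite_allI) auto
  moreover have "AE z in \<mu>. S (snd z) (fst z) = 0 \<longrightarrow> (\<forall>i<n. has_gradient (u i) (x i (snd z) (fst z)) 0)"
    using gradient_zero by (simp add: total_def case_prod_beta')
  ultimately have "AE z in \<mu>. \<forall>i<n. has_gradient (u i) (x i (snd z) (fst z)) (S (snd z) (fst z))"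
    using AE_space
  proof eventually_elim
    case (elim z)
    show ?case
    proof (intro allI impI)
      fix i assume i: "i < n"
      show "has_gradient (u i) (x i (snd z) (fst z)) (S (snd z) (fst z))"
      proof (cases "S (snd z) (fst z) = 0")
        case False
        then have "0 < S (snd z) (fst z)" using plans_total_nonneg[OF plans elim(3)] by simp
        then show ?thesis using elim(1) i by (intro interior_gradient(1)[OF utility_u]) auto
      qed (use elim(2) i in auto)
    qed
  qed
  then show ?thesis by (simp add: gradients_def)
qed

lemma marginal_density_AE:
  assumes gradients
  shows "AE \<omega> in M. AE t in leb T. marginal_density n r u \<gamma> x C t \<omega> = density t \<omega>"
proof -
  have "AE z in \<mu>. marginal_density n r u \<gamma> x C (snd z) (fst z) = density (snd z) (fst z)"
    using assms AE_space unfolding gradients_def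
  proof eventually_elim
    case (elim z)
    let ?d = "disc (snd z) (fst z)"
    have pc: "partial_c (u i) (x i (snd z) (fst z)) (S (snd z) (fst z)) = enn2ereal (mc i z)" if "i < n" for i
      using that elim plans_x_nonneg[OF plans that elim(2)] plans_total_nonneg[OF plans elim(2)]
      by (intro partial_c_eq[OF utility_u]) auto
    have "ereal ?d * (\<Sum>i<n. ereal (\<gamma> i) * partial_c (u i) (x i (snd z) (fst z)) (S (snd z) (fst z))) =
        enn2ereal (ennreal ?d) * (\<Sum>i<n. enn2ereal (ennreal (\<gamma> i)) * enn2ereal (mc i z))"
      using pc gamma_pos disc_nonneg[of "snd z" "fst z"] by (simp add: less_imp_le)
    also have "\<dots> = enn2ereal (ennreal ?d * (\<Sum>i<n. ennreal (\<gamma> i) * mc i z))"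
      by (subst times_ennreal.rep_eq, subst sum_enn2ereal[symmetric])
        (simp_all add: times_ennreal.rep_eq)
    finally have "marginal_density n r u \<gamma> x C (snd z) (fst z) = ennreal ?d * (\<Sum>i<n. ennreal (\<gamma> i) * mc i z)"
      unfolding marginal_density_def disc_def[symmetric] total_def[symmetric] by simp
    also have "\<dots> = density (snd z) (fst z)"
      unfolding density_def sum_distrib_left using gamma_pos disc_nonneg[of "snd z" "fst z"]
      by (intro sum.cong) (auto simp: ennreal_mult' less_imp_le ac_simps)
    finally show ?case .
  qed
  from AE_mu_iterated[OF this] show ?thesis by simp
qed

text \<open>Outside one null set the densities agree for almost every time, so their tails agree at
  all times simultaneously; this permits evaluation at random times.\<close>

lemma tail_marginal_AE:
  assumes gradients
  shows "AE \<omega> in M. \<forall>t. tail_integral T (marginal_density n r u \<gamma> x C) t \<omega> = tail_integral T density t \<omega>"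
  using marginal_density_AE[OF assms]
proof eventually_elim
  case (elim \<omega>)
  show ?case
    unfolding tail_integral_def using elim
    by (intro allI nn_integral_cong_AE) (auto elim: eventually_mono)
qed

lemma tail_measurable:
  assumes "stopping_time F \<tau>"
  shows "(\<lambda>\<omega>. tail_integral T density (\<tau> \<omega>) \<omega>) \<in> borel_measurable M"
  using measurable_tail[OF density_joint stopping_time_measurable[OF assms], of "\<lambda>x. x"] by simp

lemma cond_exp_marginal:
  assumes gradients "\<tau> \<in> stopping_times T M F"
  shows "AE \<omega> in M. nn_cond_exp M (pre_sigma \<tau>)
      (\<lambda>\<omega>. tail_integral T (marginal_density n r u \<gamma> x C) (\<tau> \<omega>) \<omega>) \<omega> =
    nn_cond_exp M (pre_sigma \<tau>) (\<lambda>\<omega>. tail_integral T density (\<tau> \<omega>) \<omega>) \<omega>"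
proof -
  have tau: "stopping_time F \<tau>" using assms(2) by (simp add: stopping_times_def)
  interpret G: finite_measure_subalgebra M "pre_sigma \<tau>"
    by (rule finite_subalg[OF subalg_pre_sigma[OF tau]])
  have eq: "AE \<omega> in M. tail_integral T density (\<tau> \<omega>) \<omega> = tail_integral T (marginal_density n r u \<gamma> x C) (\<tau> \<omega>) \<omega>"
    using tail_marginal_AE[OF assms(1)] by eventually_elim simp
  show ?thesis
    using eq tail_measurable[OF tau] measurable_M_AE_cong[OF tail_measurable[OF tau] eq]
    by (intro G.nn_cond_exp_cong) (auto elim: eventually_mono)
qed

section \<open>Tail integrals, flatness and sufficiency of the conditions\<close>

lemma concavity_inequality:
  assumes i: "i < n" and g: "has_gradient (u i) (x i (snd z) (fst z)) (S (snd z) (fst z))"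
    and z: "z \<in> space \<mu>" and yk: "0 \<le> y" "0 \<le> k"
  shows "ennreal (u i (y, k)) + (mx i z * ennreal (x i (snd z) (fst z)) + mc i z * ennreal (S (snd z) (fst z))) \<le>
    util i z + (mx i z * ennreal y + mc i z * ennreal k)"
proof -
  obtain G where "ennreal (u i (y, k)) \<le> G"
    "G + (mx i z * ennreal (x i (snd z) (fst z)) + mc i z * ennreal (S (snd z) (fst z))) =
      util i z + (mx i z * ennreal y + mc i z * ennreal k)"
    using gradient_direction[OF utility_u[OF i] plans_x_nonneg[OF plans i z] plans_total_nonneg[OF plans z] g yk]
    by metis
  then show ?thesis by (metis add_right_mono)
qed

abbreviation "xx y i z \<equiv> ennreal (y i (snd z) (fst z) :: real)"
abbreviation "SS D z \<equiv> ennreal (total D (snd z) (fst z))"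

text \<open>A unit contributed at time \<open>t\<close> earns the density from \<open>t\<close> on;
  this is Fubini in the form of \<open>stieltjes_expectation_tail\<close>.\<close>

lemma tail_total:
  assumes "optional T M F D" "increasing_process D"
  shows "(\<integral>\<^sup>+ z. density (snd z) (fst z) * ennreal (D (snd z) (fst z)) \<partial>\<mu>) =
    (\<integral>\<^sup>+ \<omega>. \<integral>\<^sup>+ t. tail_integral T density t \<omega> \<partial>stieltjes T (\<lambda>t. D t \<omega>) \<partial>M)"
proof -
  have "(\<lambda>z. density (snd z) (fst z) * ennreal (D (snd z) (fst z))) \<in> borel_measurable \<mu>"
    using density_mu optional_mu[OF assms(1)] by (auto intro!: borel_measurable_times_ennreal)
  then show ?thesis
    unfolding stieltjes_expectation_tail[OF assms(2) density_joint]
    by (intro iterated_mu[of "\<lambda>t \<omega>. density t \<omega> * ennreal (D t \<omega>)", symmetric])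
qed

lemma tail_joint: "(\<lambda>(t, \<omega>). tail_integral T density t \<omega>) \<in> borel_measurable (time T \<Otimes>\<^sub>M M)"
proof -
  have "fst \<in> borel_measurable (time T \<Otimes>\<^sub>M M)"
    by (rule measurable_compose[OF measurable_fst]) (rule measurable_restrict_space1, simp)
  from measurable_tail[OF density_joint this measurable_snd] show ?thesis by (simp add: case_prod_beta')
qed

lemma tail_cond_exp_integral:
  assumes tau: "\<tau> \<in> stopping_times T M F" and A: "A \<in> sets (pre_sigma \<tau>)"
  shows "(\<integral>\<^sup>+ \<omega>\<in>A. tail_integral T density (\<tau> \<omega>) \<omega> \<partial>M) =
      (\<integral>\<^sup>+ \<omega>\<in>A. nn_cond_exp M (pre_sigma \<tau>) (\<lambda>\<omega>. tail_integral T density (\<tau> \<omega>) \<omega>) \<omega> \<partial>M)"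
proof -
  have st: "stopping_time F \<tau>" using tau by (simp add: stopping_times_def)
  interpret G: finite_measure_subalgebra M "pre_sigma \<tau>"
    by (rule finite_subalg[OF subalg_pre_sigma[OF st]])
  show ?thesis
    using A tail_measurable[OF st] G.nn_cond_exp_intg[of "indicator A" "\<lambda>\<omega>. tail_integral T density (\<tau> \<omega>) \<omega>"]
    by (simp add: mult.commute)
qed

lemma optional_projection_marginal:
  assumes gradients
  shows "optional_projection T M F (tail_integral T (marginal_density n r u \<gamma> x C)) Y \<longleftrightarrow>
    optional_projection T M F (tail_integral T density) Y"
proof -
  have "(AE \<omega> in M. nn_cond_exp M (pre_sigma \<tau>)
      (\<lambda>\<omega>. tail_integral T (marginal_density n r u \<gamma> x C) (\<tau> \<omega>) \<omega>) \<omega> = f \<omega>) \<longleftrightarrow>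
    (AE \<omega> in M. nn_cond_exp M (pre_sigma \<tau>) (\<lambda>\<omega>. tail_integral T density (\<tau> \<omega>) \<omega>) \<omega> = f \<omega>)"
    if "\<tau> \<in> stopping_times T M F" for \<tau> f
    using cond_exp_marginal[OF assms that] by (auto elim: eventually_elim2)
  then show ?thesis unfolding optional_projection_def by simp
qed

text \<open>At every stopping time the tail and its projection have equal integrals over the events
  of that sigma-algebra, so both comparisons against \<open>dC\<close> hold.\<close>

lemma projection_expectation:
  assumes proj: "optional_projection T M F (tail_integral T density) Y"
  shows "(\<integral>\<^sup>+ \<omega>. \<integral>\<^sup>+ t. ennreal (Y t \<omega>) \<partial>stieltjes T (\<lambda>t. S t \<omega>) \<partial>M) =
    (\<integral>\<^sup>+ z. density (snd z) (fst z) * SS C z \<partial>\<mu>)"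
proof -
  note S = plans_total(1)[OF plans]
  have "optional T M F Y" using proj by (simp add: optional_projection_def)
  then have Y_joint: "(\<lambda>(t, \<omega>). ennreal (Y t \<omega>)) \<in> borel_measurable (time T \<Otimes>\<^sub>M M)"
    using optional_joint[of Y] unfolding case_prod_beta' by simp
  have "(\<integral>\<^sup>+ \<omega>\<in>A. tail_integral T density (\<tau> \<omega>) \<omega> \<partial>M) = (\<integral>\<^sup>+ \<omega>\<in>A. ennreal (Y (\<tau> \<omega>) \<omega>) \<partial>M)"
    if tau: "\<tau> \<in> stopping_times T M F" and A: "A \<in> sets (pre_sigma \<tau>)" for \<tau> A
  proof -
    have "AE \<omega> in M. nn_cond_exp M (pre_sigma \<tau>) (\<lambda>\<omega>. tail_integral T density (\<tau> \<omega>) \<omega>) \<omega> = ennreal (Y (\<tau> \<omega>) \<omega>)"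
      using proj tau by (auto simp: optional_projection_def)
    then show ?thesis
      unfolding tail_cond_exp_integral[OF that]
      by (intro nn_integral_cong_AE) (auto elim!: eventually_mono)
  qed
  then show ?thesis
    unfolding tail_total[OF plan_optional_c[OF S] plan_increasing[OF S]]
    by (intro antisym stieltjes_expectation_mono[OF plan_increasing[OF S]] tail_joint Y_joint) simp_all
qed

text \<open>On one path only the difference is given as integrable. Adding back the finite integral
  of the price recovers the integral of \<open>Y\<close> itself.\<close>

lemma flat_AE:
  assumes lam: "0 \<le> lam" and Y_nonneg: "\<And>t. t \<le> T \<Longrightarrow> 0 \<le> Y t" and psi: "\<And>t. t \<le> T \<Longrightarrow> 0 \<le> p t"
    and p: "p \<in> borel_measurable (time T)" and fin: "(\<integral>\<^sup>+ t. ennreal (lam * p t) \<partial>stieltjes T f) \<noteq> \<infinity>"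
    and int: "integrable (stieltjes T f) (\<lambda>t. Y t - lam * p t)"
  shows "(\<integral>\<^sup>+ t. ennreal (Y t) \<partial>stieltjes T f) =
      ennreal (enn2real (\<integral>\<^sup>+ t. ennreal (lam * p t) \<partial>stieltjes T f) + (\<integral>t. Y t - lam * p t \<partial>stieltjes T f))"
    and "0 \<le> enn2real (\<integral>\<^sup>+ t. ennreal (lam * p t) \<partial>stieltjes T f) + (\<integral>t. Y t - lam * p t \<partial>stieltjes T f)"
proof -
  let ?St = "stieltjes T f"
  have ms: "(\<lambda>t. lam * p t) \<in> borel_measurable ?St"
    using p by (simp add: measurable_cong_sets[OF sets_stieltjes refl])
  have nn: "AE t in ?St. 0 \<le> lam * p t" "AE t in ?St. 0 \<le> Y t"
    using lam psi Y_nonneg by (auto intro!: AE_I2)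
  have i1: "integrable ?St (\<lambda>t. lam * p t)"
    using ms nn(1) fin by (intro integrableI_nonneg) (auto simp: less_top)
  have i2: "integrable ?St (\<lambda>t. Y t)"
    using Bochner_Integration.integrable_add[OF int i1] by simp
  have 1: "(\<integral>\<^sup>+ t. ennreal (lam * p t) \<partial>?St) = ennreal (\<integral>t. lam * p t \<partial>?St)"
    using i1 nn(1) by (rule nn_integral_eq_integral)
  have 2: "(\<integral>\<^sup>+ t. ennreal (Y t) \<partial>?St) = ennreal (\<integral>t. Y t \<partial>?St)"
    using i2 nn(2) by (rule nn_integral_eq_integral)
  have 3: "0 \<le> (\<integral>t. lam * p t \<partial>?St)" "0 \<le> (\<integral>t. Y t \<partial>?St)"
    using integral_nonneg_AE[OF nn(1)] integral_nonneg_AE[OF nn(2)] by simp_all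
  have 4: "(\<integral>t. Y t - lam * p t \<partial>?St) = (\<integral>t. Y t \<partial>?St) - (\<integral>t. lam * p t \<partial>?St)"
    using i1 i2 by simp
  show "(\<integral>\<^sup>+ t. ennreal (Y t) \<partial>?St) =
      ennreal (enn2real (\<integral>\<^sup>+ t. ennreal (lam * p t) \<partial>?St) + (\<integral>t. Y t - lam * p t \<partial>?St))"
    "0 \<le> enn2real (\<integral>\<^sup>+ t. ennreal (lam * p t) \<partial>?St) + (\<integral>t. Y t - lam * p t \<partial>?St)"
    unfolding 1 2 4 using 3 by simp_all
qed

text \<open>The flat-off condition concerns a signed integral. The budget makes the price part
  finite in expectation, so it can be added back pathwise, and the condition becomes an equality of
  nonnegative expectations.\<close>

lemma flatness:
  assumes lam: "0 \<le> lam" and Y_nonneg: "\<And>t \<omega>. t \<le> T \<Longrightarrow> \<omega> \<in> space M \<Longrightarrow> 0 \<le> Y t \<omega>"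
    and int: "AE \<omega> in M. integrable (stieltjes T (\<lambda>t. S t \<omega>)) (\<lambda>t. Y t \<omega> - lam * \<psi>c t \<omega>)"
    and flat: "has_bochner_integral M (\<lambda>\<omega>. \<integral>t. (Y t \<omega> - lam * \<psi>c t \<omega>) \<partial>stieltjes T (\<lambda>t. S t \<omega>)) 0"
    and fin: "cost_c S < \<infinity>"
  shows "(\<integral>\<^sup>+ \<omega>. \<integral>\<^sup>+ t. ennreal (Y t \<omega>) \<partial>stieltjes T (\<lambda>t. S t \<omega>) \<partial>M) = ennreal lam * cost_c S"
proof -
  note incS = plan_increasing[OF plans_total(1)[OF plans]]
  define b where "b \<omega> = (\<integral>\<^sup>+ t. ennreal (lam * \<psi>c t \<omega>) \<partial>stieltjes T (\<lambda>t. S t \<omega>))" for \<omega>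
  define h where "h \<omega> = (\<integral>t. (Y t \<omega> - lam * \<psi>c t \<omega>) \<partial>stieltjes T (\<lambda>t. S t \<omega>))" for \<omega>
  have b: "b \<in> borel_measurable M"
    unfolding b_def by (rule stieltjes_integral_measurable[OF incS scaled_price_joint])
  have b_int: "(\<integral>\<^sup>+ \<omega>. b \<omega> \<partial>M) = ennreal lam * cost_c S"
    unfolding b_def by (rule scaled_cost_c[OF lam incS])
  have b_fin: "(\<integral>\<^sup>+ \<omega>. b \<omega> \<partial>M) < \<infinity>" unfolding b_int using fin by (simp add: ennreal_mult_less_top)
  have b_AE: "AE \<omega> in M. b \<omega> \<noteq> \<infinity>" using nn_integral_noteq_infinite[OF b] b_fin by auto
  have key: "AE \<omega> in M. (\<integral>\<^sup>+ t. ennreal (Y t \<omega>) \<partial>stieltjes T (\<lambda>t. S t \<omega>)) = ennreal (enn2real (b \<omega>) + h \<omega>)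
      \<and> 0 \<le> enn2real (b \<omega>) + h \<omega>"
    using int b_AE psi_c_nonneg AE_space
  proof eventually_elim
    case (elim \<omega>)
    have "(\<lambda>t. \<psi>c t \<omega>) \<in> borel_measurable (time T)"
      using progressive_jointly[OF price_progressive[OF prices(2)]] elim(4) by (rule jointly_section)
    then show ?case
      unfolding b_def h_def
      using flat_AE[of lam "\<lambda>t. Y t \<omega>" "\<lambda>t. \<psi>c t \<omega>" "\<lambda>t. S t \<omega>"] lam Y_nonneg[OF _ elim(4)] elim(1,2,3)
      by (simp add: b_def)
  qed
  have h: "integrable M h" "(\<integral>\<omega>. h \<omega> \<partial>M) = 0"
    using flat unfolding h_def by (auto simp: has_bochner_integral_iff)
  have b_eq: "(\<integral>\<^sup>+ \<omega>. ennreal (enn2real (b \<omega>)) \<partial>M) = (\<integral>\<^sup>+ \<omega>. b \<omega> \<partial>M)"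
    using b_AE by (intro nn_integral_cong_AE) (auto elim!: eventually_mono simp: ennreal_enn2real_if)
  have br: "integrable M (\<lambda>\<omega>. enn2real (b \<omega>))"
    using b b_fin b_eq by (intro integrableI_nonneg) auto
  have "(\<integral>\<^sup>+ \<omega>. \<integral>\<^sup>+ t. ennreal (Y t \<omega>) \<partial>stieltjes T (\<lambda>t. S t \<omega>) \<partial>M) = (\<integral>\<^sup>+ \<omega>. ennreal (enn2real (b \<omega>) + h \<omega>) \<partial>M)"
    using key by (intro nn_integral_cong_AE) (auto elim: eventually_mono)
  also have "\<dots> = ennreal (\<integral>\<omega>. enn2real (b \<omega>) + h \<omega> \<partial>M)"
    using key br h by (intro nn_integral_eq_integral) (auto elim: eventually_mono)
  also have "\<dots> = ennreal (\<integral>\<omega>. enn2real (b \<omega>) \<partial>M)" using br h by simp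
  also have "\<dots> = (\<integral>\<^sup>+ \<omega>. ennreal (enn2real (b \<omega>)) \<partial>M)"
    using br by (intro nn_integral_eq_integral[symmetric]) auto
  finally show ?thesis unfolding b_eq b_int .
qed

lemma pointwise_inequality:
  assumes grad: gradients and p': "plans x' C'"
    and foc: "AE z in \<mu>. \<forall>i\<in>{..<n}. wgt i z * mx i z \<le> p z \<and>
      (0 < x i (snd z) (fst z) \<longrightarrow> wgt i z * mx i z = p z)"
  shows "AE z in \<mu>.
    (\<Sum>i<n. wgt i z * ennreal (u i (x' i (snd z) (fst z), total C' (snd z) (fst z)))) +
      ((\<Sum>i<n. p z * xx x i z) + density (snd z) (fst z) * SS C z) \<le>
    (\<Sum>i<n. wgt i z * util i z) + ((\<Sum>i<n. p z * xx x' i z) + density (snd z) (fst z) * SS C' z)"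
  using foc grad[unfolded gradients_def] AE_space
proof eventually_elim
  case (elim z)
  let ?u' = "\<lambda>i. ennreal (u i (x' i (snd z) (fst z), total C' (snd z) (fst z)))"
  have "wgt i z * ?u' i + (p z * xx x i z + wgt i z * mc i z * SS C z) \<le>
      wgt i z * util i z + (p z * xx x' i z + wgt i z * mc i z * SS C' z)" if i: "i < n" for i
  proof -
    have "wgt i z * (?u' i + (mx i z * xx x i z + mc i z * SS C z)) \<le>
        wgt i z * (util i z + (mx i z * xx x' i z + mc i z * SS C' z))"
      using elim i plans_x_nonneg[OF p' i elim(3)] plans_total_nonneg[OF p' elim(3)]
      by (intro mult_left_mono concavity_inequality) auto
    then have 1: "wgt i z * ?u' i + (wgt i z * mx i z * xx x i z + wgt i z * mc i z * SS C z) \<le>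
        wgt i z * util i z + (wgt i z * mx i z * xx x' i z + wgt i z * mc i z * SS C' z)"
      by (simp only: distrib_left mult.assoc)
    \<comment> \<open>Complementary slackness: either consumption is 0 and both products vanish, or
      the marginal utility equals the price.\<close>
    have 2: "wgt i z * mx i z * xx x i z = p z * xx x i z"
      using elim(1) i plans_x_nonneg[OF plans i elim(3)] by (cases "x i (snd z) (fst z) = 0") auto
    \<comment> \<open>A competitor may consume where the policy does not, so only the inequality is
      available for it.\<close>
    have 3: "wgt i z * mx i z * xx x' i z \<le> p z * xx x' i z"
      using elim(1) i by (intro mult_right_mono) auto
    show ?thesis
      using 1 unfolding 2 by (rule order_trans) (intro add_left_mono add_right_mono 3)
  qed
  then have "(\<Sum>i<n. wgt i z * ?u' i + (p z * xx x i z + wgt i z * mc i z * SS C z)) \<le>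
      (\<Sum>i<n. wgt i z * util i z + (p z * xx x' i z + wgt i z * mc i z * SS C' z))"
    by (intro sum_mono) auto
  then show ?case by (simp add: sum.distrib density_def sum_distrib_right)
qed

text \<open>The conditions give the gradient inequality for concave functions with all terms moved so
  that only nonnegative quantities are integrated.\<close>

lemma sufficiency:
  assumes lam: "0 < lam"
    and budget_eq: "total_cost x C = ennreal wealth"
    and foc_c: "\<And>\<tau>. \<tau> \<in> stopping_times T M F \<Longrightarrow> AE \<omega> in M.
      nn_cond_exp M (pre_sigma \<tau>) (\<lambda>\<omega>. tail_integral T (marginal_density n r u \<gamma> x C) (\<tau> \<omega>) \<omega>) \<omega>
        \<le> ennreal (lam * \<psi>c (\<tau> \<omega>) \<omega>)"
    and proj: "optional_projection T M F (tail_integral T (marginal_density n r u \<gamma> x C)) Y"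
    and int: "AE \<omega> in M. integrable (stieltjes T (\<lambda>t. S t \<omega>)) (\<lambda>t. Y t \<omega> - lam * \<psi>c t \<omega>)"
    and flat: "has_bochner_integral M (\<lambda>\<omega>. \<integral>t. (Y t \<omega> - lam * \<psi>c t \<omega>) \<partial>stieltjes T (\<lambda>t. S t \<omega>)) 0"
    and foc_x: "\<And>i. i < n \<Longrightarrow> AE z in \<mu>.
      ereal (\<gamma> i * disc (snd z) (fst z)) * partial_x (u i) (x i (snd z) (fst z)) (S (snd z) (fst z))
        \<le> ereal (lam * \<psi>x (snd z) (fst z)) \<and>
      (0 < x i (snd z) (fst z) \<longrightarrow>
        ereal (\<gamma> i * disc (snd z) (fst z)) * partial_x (u i) (x i (snd z) (fst z)) (S (snd z) (fst z))
        = ereal (lam * \<psi>x (snd z) (fst z)))"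
    and p': "plans x' C'" and budget': "total_cost x' C' \<le> ennreal wealth"
  shows "welfare n T M r u \<gamma> x' C' \<le> welfare n T M r u \<gamma> x C"
proof -
  \<comment> \<open>With a positive public good and zero consumption the weighted marginal utility
    would be infinite, against the finite price in the first-order condition.\<close>
  have grad: gradients
  proof (rule gradientsI)
    fix i assume i: "i < n"
    show "AE z in \<mu>. 0 < S (snd z) (fst z) \<longrightarrow> 0 < x i (snd z) (fst z)"
      using foc_x[OF i] AE_mu_finite AE_space
    proof eventually_elim
      case (elim z)
      show ?case
      proof
        assume S: "0 < S (snd z) (fst z)"
        have "0 < \<gamma> i * disc (snd z) (fst z)" using weight_pos[OF i elim(3,2)] by simp
        then have "ereal (\<gamma> i * disc (snd z) (fst z)) * \<infinity> = \<infinity>" by (auto simp: zero_less_mult_iff)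
        then have "x i (snd z) (fst z) \<noteq> 0"
          using elim(1) inada_partial_x[OF utility_u[OF i] S] by auto
        then show "0 < x i (snd z) (fst z)" using plans_x_nonneg[OF plans i elim(3)] by simp
      qed
    qed
  qed
  let ?p = "\<lambda>z. ennreal lam * ennreal (\<psi>x (snd z) (fst z))"
  let ?u' = "\<lambda>i z. ennreal (u i (x' i (snd z) (fst z), total C' (snd z) (fst z)))"
  have foc: "AE z in \<mu>. \<forall>i\<in>{..<n}. wgt i z * mx i z \<le> ?p z \<and> (0 < x i (snd z) (fst z) \<longrightarrow> wgt i z * mx i z = ?p z)"
  proof (intro AE_finite_allI)
    fix i assume "i \<in> {..<n}"
    then have i: "i < n" by simp
    show "AE z in \<mu>. wgt i z * mx i z \<le> ?p z \<and> (0 < x i (snd z) (fst z) \<longrightarrow> wgt i z * mx i z = ?p z)"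
      using foc_x[OF i] grad[unfolded gradients_def] AE_space
    proof eventually_elim
      case (elim z)
      have px: "partial_x (u i) (x i (snd z) (fst z)) (S (snd z) (fst z)) = enn2ereal (mx i z)"
        using elim i plans_x_nonneg[OF plans i elim(3)] plans_total_nonneg[OF plans elim(3)]
        by (intro partial_x_eq[OF utility_u]) auto
      have "0 \<le> \<gamma> i * disc (snd z) (fst z)" using gamma_pos[OF i] disc_nonneg[of "snd z" "fst z"] by simp
      then have e: "ereal (\<gamma> i * disc (snd z) (fst z)) * enn2ereal (mx i z) = enn2ereal (wgt i z * mx i z)"
        by (simp add: times_ennreal.rep_eq)
      have "e2ennreal (enn2ereal (wgt i z * mx i z)) \<le> e2ennreal (ereal (lam * \<psi>x (snd z) (fst z)))"
        using elim(1) unfolding px e by (intro e2ennreal_mono) simp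
      moreover have "e2ennreal (enn2ereal (wgt i z * mx i z)) = e2ennreal (ereal (lam * \<psi>x (snd z) (fst z)))"
        if "0 < x i (snd z) (fst z)"
        using elim(1) that unfolding px e by simp
      ultimately show ?case using lam by (simp add: ennreal_mult')
    qed
  qed (simp add: lessThan_def)
  have m: "(\<lambda>z. \<Sum>i<n. wgt i z * ?u' i z) \<in> borel_measurable \<mu>" "(\<lambda>z. \<Sum>i<n. wgt i z * util i z) \<in> borel_measurable \<mu>"
    using measurable_utility_compose[OF utility_u plans_x_mu[OF p'] plans_total_mu[OF p']]
      plans_x_nonneg[OF p'] plans_total_nonneg[OF p'] weight_mu util_mu
    by (auto intro!: borel_measurable_times_ennreal borel_measurable_sum)
  have mx: "(\<lambda>z. \<Sum>i<n. ?p z * xx x i z) \<in> borel_measurable \<mu>" "(\<lambda>z. \<Sum>i<n. ?p z * xx x' i z) \<in> borel_measurable \<mu>"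
    using psi_x_mu plans_x_mu[OF plans] plans_x_mu[OF p']
    by (auto intro!: borel_measurable_times_ennreal borel_measurable_sum)
  have mS: "(\<lambda>z. density (snd z) (fst z) * SS C z) \<in> borel_measurable \<mu>"
    "(\<lambda>z. density (snd z) (fst z) * SS C' z) \<in> borel_measurable \<mu>"
    using density_mu plans_total_mu[OF plans] plans_total_mu[OF p'] by (auto intro!: borel_measurable_times_ennreal)
  note tot' = plans_total(1)[OF p']
  \<comment> \<open>For the competitor's contributions the condition at stopping times gives an
    inequality; for the policy's own, the flat-off condition will give equality.\<close>
  have upper: "(\<integral>\<^sup>+ z. density (snd z) (fst z) * SS C' z \<partial>\<mu>) \<le> ennreal lam * cost_c (total C')"
    unfolding tail_total[OF plan_optional_c[OF tot'] plan_increasing[OF tot']]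
      scaled_cost_c[OF less_imp_le[OF lam] plan_increasing[OF tot'], symmetric]
  proof (rule stieltjes_expectation_mono[OF plan_increasing[OF tot'] tail_joint scaled_price_joint])
    fix \<tau> A assume \<tau>: "\<tau> \<in> stopping_times T M F" "A \<in> sets (pre_sigma \<tau>)"
    have "AE \<omega> in M. nn_cond_exp M (pre_sigma \<tau>) (\<lambda>\<omega>. tail_integral T density (\<tau> \<omega>) \<omega>) \<omega>
        \<le> ennreal (lam * \<psi>c (\<tau> \<omega>) \<omega>)"
      using foc_c[OF \<tau>(1)] cond_exp_marginal[OF grad \<tau>(1)] by eventually_elim simp
    then show "(\<integral>\<^sup>+ \<omega>\<in>A. tail_integral T density (\<tau> \<omega>) \<omega> \<partial>M) \<le> (\<integral>\<^sup>+ \<omega>\<in>A. ennreal (lam * \<psi>c (\<tau> \<omega>) \<omega>) \<partial>M)"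
      unfolding tail_cond_exp_integral[OF \<tau>]
      by (intro nn_integral_mono_AE) (auto elim!: eventually_mono split: split_indicator)
  qed
  have "cost_c S \<le> total_cost x C" unfolding total_cost_eq[OF plans] by (simp add: add_increasing)
  then have "cost_c S \<le> ennreal wealth" unfolding budget_eq .
  then have "cost_c S < \<infinity>" by (simp add: order_le_less_trans)
  moreover have Y: "optional_projection T M F (tail_integral T density) Y"
    using proj optional_projection_marginal[OF grad] by simp
  moreover have "\<And>t \<omega>. t \<le> T \<Longrightarrow> \<omega> \<in> space M \<Longrightarrow> 0 \<le> Y t \<omega>"
    using proj by (simp add: optional_projection_def)
  ultimately have eq: "(\<integral>\<^sup>+ z. density (snd z) (fst z) * SS C z \<partial>\<mu>) = ennreal lam * cost_c S"
    using flatness[OF less_imp_le[OF lam] _ int flat] projection_expectation[OF Y] by simp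
  have "(\<integral>\<^sup>+ z. (\<Sum>i<n. wgt i z * ?u' i z) + ((\<Sum>i<n. ?p z * xx x i z) + density (snd z) (fst z) * SS C z) \<partial>\<mu>) \<le>
    (\<integral>\<^sup>+ z. (\<Sum>i<n. wgt i z * util i z) + ((\<Sum>i<n. ?p z * xx x' i z) + density (snd z) (fst z) * SS C' z) \<partial>\<mu>)"
    by (rule nn_integral_mono_AE[OF pointwise_inequality[OF grad p' foc]])
  moreover have "(\<integral>\<^sup>+ z. (\<Sum>i<n. wgt i z * ?u' i z) + ((\<Sum>i<n. ?p z * xx x i z) + density (snd z) (fst z) * SS C z) \<partial>\<mu>)
    = welfare n T M r u \<gamma> x' C' + (ennreal lam * (\<Sum>i<n. cost_x (x i)) + ennreal lam * cost_c S)"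
    unfolding welfare_eq[OF p'] scaled_cost_x[OF plans, symmetric] eq[symmetric]
    using m mx mS by (simp add: nn_integral_add)
  moreover have "(\<integral>\<^sup>+ z. (\<Sum>i<n. wgt i z * util i z) + ((\<Sum>i<n. ?p z * xx x' i z) + density (snd z) (fst z) * SS C' z) \<partial>\<mu>)
    = welfare n T M r u \<gamma> x C + (ennreal lam * (\<Sum>i<n. cost_x (x' i)) + (\<integral>\<^sup>+ z. density (snd z) (fst z) * SS C' z \<partial>\<mu>))"
    unfolding welfare_eq[OF plans] scaled_cost_x[OF p', symmetric]
    using m mx mS by (simp add: nn_integral_add)
  ultimately have "welfare n T M r u \<gamma> x' C' + ennreal lam * total_cost x C \<le>
      welfare n T M r u \<gamma> x C + (ennreal lam * (\<Sum>i<n. cost_x (x' i)) + (\<integral>\<^sup>+ z. density (snd z) (fst z) * SS C' z \<partial>\<mu>))"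
    unfolding total_cost_eq[OF plans] by (simp add: distrib_left)
  also have "\<dots> \<le> welfare n T M r u \<gamma> x C + (ennreal lam * (\<Sum>i<n. cost_x (x' i)) + ennreal lam * cost_c (total C'))"
    using upper by (intro add_left_mono)
  also have "\<dots> = welfare n T M r u \<gamma> x C + ennreal lam * total_cost x' C'"
    unfolding total_cost_eq[OF p'] by (simp add: distrib_left)
  also have "\<dots> \<le> welfare n T M r u \<gamma> x C + ennreal lam * total_cost x C"
    using budget' budget_eq by (intro add_left_mono mult_left_mono) auto
  \<comment> \<open>Both sides carry the finite amount \<open>ennreal lam * total_cost x C\<close>,
    which cancels.\<close>
  finally show ?thesis
    using budget_eq by (simp add: ennreal_mult_eq_top_iff)
qed

end

section \<open>Necessity of the first-order conditions\<close>

context planner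
begin

text \<open>A strictly positive deterministic consumption rate with finite cost on every horizon. At
  \<infinity> the value is 1, since \<open>enn2real\<close> is 0 there; that time has measure
  zero.\<close>

definition decay :: "ennreal \<Rightarrow> real" where "decay t = exp (- enn2real t)"

lemma decay_measurable: "decay \<in> borel_measurable (time T)"
proof -
  have "(\<lambda>t. t) \<in> borel_measurable (time T)" by (rule measurable_restrict_space1) simp
  then show ?thesis unfolding decay_def by auto
qed

lemma optional_decay: "optional T M F (\<lambda>t \<omega>. a * decay t)"
  using decay_measurable by (intro optional_deterministic) auto

lemma decay_integral: "(\<integral>\<^sup>+ t. ennreal (decay t) \<partial>leb T) \<le> 1"
proof -
  have "(\<integral>\<^sup>+ t. ennreal (decay t) \<partial>leb T) =
      (\<integral>\<^sup>+ s. ennreal (decay (ennreal s)) * indicator {s. 0 \<le> s \<and> ennreal s \<le> T} s \<partial>lborel)"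
    using decay_measurable by (intro nn_integral_leb) auto
  also have "\<dots> \<le> (\<integral>\<^sup>+ s. ennreal (s ^ 0 * exp (- s)) * indicator {0..} s \<partial>lborel)"
    by (intro nn_integral_mono) (auto simp: decay_def split: split_indicator)
  also have "\<dots> = 1" by (subst nn_intergal_power_times_exp_Ici) simp
  finally show ?thesis .
qed

text \<open>Tonelli: the expected price is at most 1 at each time, and the decay has integral at
  most 1.\<close>

lemma cost_decay: "cost_x (\<lambda>t \<omega>. decay t) \<le> 1"
proof -
  have d: "(\<lambda>z. ennreal (decay (snd z))) \<in> borel_measurable \<mu>"
    using optional_mu[OF optional_decay[of 1]] by simp
  have "cost_x (\<lambda>t \<omega>. decay t) = (\<integral>\<^sup>+ t. \<integral>\<^sup>+ \<omega>. ennreal (\<psi>x t \<omega>) * ennreal (decay t) \<partial>M \<partial>leb T)"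
    unfolding cost_x_def using d psi_x_mu
    by (subst product.nn_integral_snd[symmetric]) auto
  also have "\<dots> = (\<integral>\<^sup>+ t. (\<integral>\<^sup>+ \<omega>. ennreal (\<psi>x t \<omega>) \<partial>M) * ennreal (decay t) \<partial>leb T)"
  proof (rule nn_integral_cong)
    fix t assume "t \<in> space (leb T)"
    then have "\<psi>x t \<in> borel_measurable M"
      using progressive_adapted[OF price_progressive[OF prices(1)], of t] by (intro measurable_F) auto
    then show "(\<integral>\<^sup>+ \<omega>. ennreal (\<psi>x t \<omega>) * ennreal (decay t) \<partial>M) = (\<integral>\<^sup>+ \<omega>. ennreal (\<psi>x t \<omega>) \<partial>M) * ennreal (decay t)"
      by (intro nn_integral_multc) auto
  qed
  also have "\<dots> \<le> (\<integral>\<^sup>+ t. 1 * ennreal (decay t) \<partial>leb T)"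
    using price_expectation[OF prices(1)] by (intro nn_integral_mono mult_right_mono) auto
  also have "\<dots> \<le> 1" using decay_integral by simp
  finally show ?thesis .
qed

lemma plansI: "(\<And>i. i < n \<Longrightarrow> contribution_plan T M F (y i) (D i)) \<Longrightarrow> plans y D"
  by (simp add: plans_def)

lemma plans_scale:
  assumes p: "plans y D" and a: "0 \<le> a"
  shows "plans (\<lambda>i t \<omega>. a * y i t \<omega>) (\<lambda>i t \<omega>. a * D i t \<omega>)"
    and "total_cost (\<lambda>i t \<omega>. a * y i t \<omega>) (\<lambda>i t \<omega>. a * D i t \<omega>) = ennreal a * total_cost y D"
    and "i < n \<Longrightarrow> cost T M \<psi>x \<psi>c (\<lambda>t \<omega>. a * y i t \<omega>) (\<lambda>t \<omega>. a * D i t \<omega>) = ennreal a * cost T M \<psi>x \<psi>c (y i) (D i)"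
proof -
  have p': "contribution_plan T M F (y i) (D i)" if "i < n" for i using p that by (simp add: plans_def)
  show "plans (\<lambda>i t \<omega>. a * y i t \<omega>) (\<lambda>i t \<omega>. a * D i t \<omega>)"
    using plan_lincomb[OF p' p' a order_refl] by (intro plansI) simp
  have c: "cost T M \<psi>x \<psi>c (\<lambda>t \<omega>. a * y i t \<omega>) (\<lambda>t \<omega>. a * D i t \<omega>) = ennreal a * cost T M \<psi>x \<psi>c (y i) (D i)"
    if "i < n" for i
    using cost_lincomb[OF p'[OF that] p'[OF that] a order_refl] by simp
  then show "i < n \<Longrightarrow> cost T M \<psi>x \<psi>c (\<lambda>t \<omega>. a * y i t \<omega>) (\<lambda>t \<omega>. a * D i t \<omega>) = ennreal a * cost T M \<psi>x \<psi>c (y i) (D i)" .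
  show "total_cost (\<lambda>i t \<omega>. a * y i t \<omega>) (\<lambda>i t \<omega>. a * D i t \<omega>) = ennreal a * total_cost y D"
    unfolding total_cost_def sum_distrib_left using c by (intro sum.cong) auto
qed

lemma plans_mix:
  assumes p: "plans y D" and q: "plans y' D'" and e: "0 \<le> e" "e \<le> 1"
    and b: "total_cost y D \<le> ennreal wealth" "total_cost y' D' \<le> ennreal wealth"
  shows "plans (\<lambda>i t \<omega>. y i t \<omega> + e * (y' i t \<omega> - y i t \<omega>)) (\<lambda>i t \<omega>. D i t \<omega> + e * (D' i t \<omega> - D i t \<omega>))"
    and "total_cost (\<lambda>i t \<omega>. y i t \<omega> + e * (y' i t \<omega> - y i t \<omega>)) (\<lambda>i t \<omega>. D i t \<omega> + e * (D' i t \<omega> - D i t \<omega>))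
      \<le> ennreal wealth"
proof -
  have p': "contribution_plan T M F (y i) (D i)" "contribution_plan T M F (y' i) (D' i)" if "i < n" for i
    using p q that by (simp_all add: plans_def)
  have e': "0 \<le> 1 - e" using e by simp
  have eq: "(\<lambda>t \<omega>. f t \<omega> + e * (g t \<omega> - f t \<omega>)) = (\<lambda>t \<omega>. (1 - e) * f t \<omega> + e * g t \<omega>)" for f g :: "'a process"
    by (auto simp: fun_eq_iff algebra_simps)
  show "plans (\<lambda>i t \<omega>. y i t \<omega> + e * (y' i t \<omega> - y i t \<omega>)) (\<lambda>i t \<omega>. D i t \<omega> + e * (D' i t \<omega> - D i t \<omega>))"
    unfolding eq using plan_lincomb[OF p' e' e(1)] by (intro plansI) simp
  have "total_cost (\<lambda>i t \<omega>. y i t \<omega> + e * (y' i t \<omega> - y i t \<omega>)) (\<lambda>i t \<omega>. D i t \<omega> + e * (D' i t \<omega> - D i t \<omega>)) =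
      (\<Sum>i<n. ennreal (1 - e) * cost T M \<psi>x \<psi>c (y i) (D i) + ennreal e * cost T M \<psi>x \<psi>c (y' i) (D' i))"
    unfolding total_cost_def eq using cost_lincomb[OF p' e' e(1)] by (intro sum.cong) auto
  also have "\<dots> = ennreal (1 - e) * total_cost y D + ennreal e * total_cost y' D'"
    unfolding total_cost_def by (simp add: sum.distrib sum_distrib_left)
  also have "\<dots> \<le> ennreal (1 - e) * ennreal wealth + ennreal e * ennreal wealth"
    using b by (intro add_mono mult_left_mono) auto
  also have "\<dots> = ennreal wealth"
    using e wealth_pos by (simp flip: ennreal_mult ennreal_plus add: algebra_simps)
  finally show "total_cost (\<lambda>i t \<omega>. y i t \<omega> + e * (y' i t \<omega> - y i t \<omega>)) (\<lambda>i t \<omega>. D i t \<omega> + e * (D' i t \<omega> - D i t \<omega>))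
      \<le> ennreal wealth" .
qed

lemma total_mix:
  "total (\<lambda>i t \<omega>. D i t \<omega> + e * (D' i t \<omega> - D i t \<omega>)) t \<omega> = total D t \<omega> + e * (total D' t \<omega> - total D t \<omega>)"
  unfolding total_def by (simp add: sum.distrib sum_subtractf sum_distrib_left algebra_simps)

lemma total_scale: "total (\<lambda>i t \<omega>. a * D i t \<omega>) t \<omega> = a * total D t \<omega>"
  unfolding total_def by (simp add: sum_distrib_left)

end

section \<open>Finite welfare and the linearised payoff\<close>

context policy
begin

abbreviation "W \<equiv> welfare n T M r u \<gamma> x C"

text \<open>Scaling the policy down makes it individually budget feasible, where the payoffs are
  integrable by assumption; concavity bounds the original payoff.\<close>

lemma welfare_finite: "W < \<infinity>"
proof -
  \<comment> \<open>The smallest individual wealth relative to the total one: after scaling by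
    \<alpha>, even an agent who carries the whole cost stays within its own budget.\<close>
  define \<alpha> where "\<alpha> = Min (w ` {..<n}) / wealth"
  have ne: "w ` {..<n} \<noteq> {}" using n_pos by (auto simp: lessThan_empty_iff)
  have "0 < Min (w ` {..<n})" using ne w_pos by (subst Min_gr_iff) auto
  then have a_pos: "0 < \<alpha>" unfolding \<alpha>_def using wealth_pos by simp
  have a_le: "\<alpha> * wealth \<le> w i" if "i < n" for i
    unfolding \<alpha>_def using that wealth_pos by (auto intro!: Min_le)
  have "\<alpha> * wealth \<le> 1 * wealth"
  proof -
    have "\<alpha> * wealth \<le> w 0" using n_pos by (intro a_le) simp
    also have "\<dots> \<le> wealth"
      unfolding wealth_def using n_pos w_pos by (intro member_le_sum) (auto intro: less_imp_le)
    finally show ?thesis by simp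
  qed
  then have a_1: "\<alpha> \<le> 1" using wealth_pos by (simp only: mult_le_cancel_right_pos)
  let ?y = "\<lambda>i t \<omega>. \<alpha> * x i t \<omega>" and ?D = "\<lambda>i t \<omega>. \<alpha> * C i t \<omega>"
  note sc = plans_scale[OF plans less_imp_le[OF a_pos]]
  have feasible: "\<forall>j<n. (?y j, ?D j) \<in> budget_set T M F \<psi>x \<psi>c (w j)"
  proof (intro allI impI)
    fix j assume j: "j < n"
    have "cost T M \<psi>x \<psi>c (x j) (C j) \<le> total_cost x C"
      unfolding total_cost_def using j by (intro member_le_sum) auto
    then have "ennreal \<alpha> * cost T M \<psi>x \<psi>c (x j) (C j) \<le> ennreal \<alpha> * ennreal wealth"
      using budget by (intro mult_left_mono) auto
    also have "\<dots> \<le> ennreal (w j)"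
      using a_le[OF j] a_pos wealth_pos by (simp flip: ennreal_mult add: ennreal_leI)
    finally show "(?y j, ?D j) \<in> budget_set T M F \<psi>x \<psi>c (w j)"
      using sc(1) sc(3)[OF j] j by (simp add: budget_set_def plans_def)
  qed
  have int: "integrable \<mu> (\<lambda>(\<omega>, t). discount (\<lambda>s. r s \<omega>) t * u i (?y i t \<omega>, \<Sum>j<n. ?D j t \<omega>))" if "i < n" for i
  proof -
    let ?H = "{(\<lambda>(\<omega>, t). discount (\<lambda>s. r s \<omega>) t * u i (y i t \<omega>, \<Sum>j<n. D j t \<omega>)) | y D.
           \<forall>j<n. (y j, D j) \<in> budget_set T M F \<psi>x \<psi>c (w j)}"
    have "uniformly_integrable \<mu> ?H" using U that by (simp add: assumption_U_def)
    then have "\<forall>f\<in>?H. integrable \<mu> f" unfolding uniformly_integrable_def by (rule conjunct1)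
    then show ?thesis by (rule bspec) (intro CollectI exI[of _ ?y] exI[of _ ?D] conjI refl feasible)
  qed
  have "(\<integral>\<^sup>+ z. wgt i z * util i z \<partial>\<mu>) < \<infinity>" if i: "i < n" for i
  proof -
    let ?f = "\<lambda>z. disc (snd z) (fst z) * u i (\<alpha> * x i (snd z) (fst z), \<alpha> * S (snd z) (fst z))"
    have "integrable \<mu> ?f"
      using int[OF i] unfolding disc_def total_def sum_distrib_left case_prod_beta' .
    then have "integrable \<mu> (\<lambda>z. \<gamma> i / \<alpha> * ?f z)" by (rule integrable_mult_right)
    then have "(\<integral>\<^sup>+ z. ennreal (\<gamma> i / \<alpha> * ?f z) \<partial>\<mu>) < \<infinity>"
      using integrableD(2) by (simp add: less_top)
    moreover have "(\<integral>\<^sup>+ z. wgt i z * util i z \<partial>\<mu>) \<le> (\<integral>\<^sup>+ z. ennreal (\<gamma> i / \<alpha> * ?f z) \<partial>\<mu>)"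
    proof (rule nn_integral_mono)
      fix z assume z: "z \<in> space \<mu>"
      note nn = plans_x_nonneg[OF plans i z] plans_total_nonneg[OF plans z]
      have "u i (x i (snd z) (fst z), S (snd z) (fst z)) \<le>
          u i (\<alpha> * x i (snd z) (fst z), \<alpha> * S (snd z) (fst z)) / \<alpha>"
        by (rule utility_scale[OF utility_u[OF i] nn a_pos a_1])
      then have "(\<gamma> i * disc (snd z) (fst z)) * u i (x i (snd z) (fst z), S (snd z) (fst z)) \<le>
          (\<gamma> i * disc (snd z) (fst z)) * (u i (\<alpha> * x i (snd z) (fst z), \<alpha> * S (snd z) (fst z)) / \<alpha>)"
        using gamma_pos[OF i] disc_nonneg by (intro mult_left_mono) auto
      then have "ennreal ((\<gamma> i * disc (snd z) (fst z)) * u i (x i (snd z) (fst z), S (snd z) (fst z))) \<le> ennreal (\<gamma> i / \<alpha> * ?f z)"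
        by (intro ennreal_leI) (simp add: mult.assoc)
      then show "wgt i z * util i z \<le> ennreal (\<gamma> i / \<alpha> * ?f z)"
        using utility_nonneg[OF utility_u[OF i] nn] by (simp add: ennreal_mult'')
    qed
    ultimately show ?thesis by (rule le_less_trans[rotated])
  qed
  then have "(\<Sum>i<n. \<integral>\<^sup>+ z. wgt i z * util i z \<partial>\<mu>) < \<infinity>" by simp
  moreover have "W = (\<Sum>i<n. \<integral>\<^sup>+ z. wgt i z * util i z \<partial>\<mu>)"
    unfolding welfare_eq[OF plans] using weight_mu util_mu by (intro nn_integral_sum) auto
  ultimately show ?thesis by simp
qed

text \<open>The current utility is added to the difference quotient to keep it nonnegative, as
  Fatou's lemma in \<open>ennreal\<close> demands.\<close>

definition quotient :: "(nat \<Rightarrow> 'a process) \<Rightarrow> (nat \<Rightarrow> 'a process) \<Rightarrow> nat \<Rightarrow> nat \<Rightarrow> 'a \<times> ennreal \<Rightarrow> real" where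
  "quotient y D m i z = dir_quotient (u i) (x i (snd z) (fst z)) (S (snd z) (fst z))
    (y i (snd z) (fst z)) (total D (snd z) (fst z)) (1 / real (Suc m)) + u i (x i (snd z) (fst z), S (snd z) (fst z))"

definition marginal_x :: "nat \<Rightarrow> 'a process \<Rightarrow> ennreal" where
  "marginal_x i y = (\<integral>\<^sup>+ z. wgt i z * mx i z * ennreal (y (snd z) (fst z)) \<partial>\<mu>)"

definition marginal_c :: "'a process \<Rightarrow> ennreal" where
  "marginal_c D = (\<integral>\<^sup>+ z. density (snd z) (fst z) * ennreal (D (snd z) (fst z)) \<partial>\<mu>)"

definition gain :: "(nat \<Rightarrow> 'a process) \<Rightarrow> (nat \<Rightarrow> 'a process) \<Rightarrow> ennreal" where
  "gain y D = (\<Sum>i<n. marginal_x i (y i)) + marginal_c (total D)"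

lemma marginal_x_measurable:
  "i < n \<Longrightarrow> optional T M F y \<Longrightarrow> (\<lambda>z. wgt i z * mx i z * ennreal (y (snd z) (fst z))) \<in> borel_measurable \<mu>"
  using weight_mu mx_mu optional_mu by (intro borel_measurable_times_ennreal) auto

lemma marginal_c_measurable:
  "optional T M F D \<Longrightarrow> (\<lambda>z. density (snd z) (fst z) * ennreal (D (snd z) (fst z))) \<in> borel_measurable \<mu>"
  using density_mu optional_mu by (intro borel_measurable_times_ennreal) auto

lemma gain_eq:
  assumes p: "plans y D"
  shows "gain y D = (\<integral>\<^sup>+ z. (\<Sum>i<n. wgt i z * (mx i z * xx y i z + mc i z * SS D z)) \<partial>\<mu>)"
proof -
  have opt: "optional T M F (y i)" if "i < n" for i
    using p that by (intro plan_optional_x[of _ "D i"]) (simp add: plans_def)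
  have "gain y D = (\<integral>\<^sup>+ z. (\<Sum>i<n. wgt i z * mx i z * xx y i z) + density (snd z) (fst z) * SS D z \<partial>\<mu>)"
  proof -
    have m: "(\<lambda>z. wgt i z * mx i z * xx y i z) \<in> borel_measurable \<mu>" if "i \<in> {..<n}" for i
      using marginal_x_measurable[of i] opt that by simp
    have "(\<Sum>i<n. \<integral>\<^sup>+ z. wgt i z * mx i z * xx y i z \<partial>\<mu>) = (\<integral>\<^sup>+ z. (\<Sum>i<n. wgt i z * mx i z * xx y i z) \<partial>\<mu>)"
      by (rule nn_integral_sum[symmetric, OF m])
    moreover have "(\<lambda>z. \<Sum>i<n. wgt i z * mx i z * xx y i z) \<in> borel_measurable \<mu>"
      using m by (rule borel_measurable_sum)
    ultimately show ?thesis
      unfolding gain_def marginal_x_def marginal_c_def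
      using nn_integral_add[OF _ marginal_c_measurable[OF plan_optional_c[OF plans_total(1)[OF p]]]]
      by simp
  qed
  also have "\<dots> = (\<integral>\<^sup>+ z. (\<Sum>i<n. wgt i z * (mx i z * xx y i z + mc i z * SS D z)) \<partial>\<mu>)"
    by (intro nn_integral_cong)
      (simp add: density_def sum_distrib_right sum.distrib[symmetric] distrib_left mult.assoc)
  finally show ?thesis .
qed

lemma gain_scale:
  assumes p: "plans y D" and a: "0 \<le> a"
  shows "gain (\<lambda>i t \<omega>. a * y i t \<omega>) (\<lambda>i t \<omega>. a * D i t \<omega>) = ennreal a * gain y D"
proof -
  have opt: "optional T M F (y i)" if "i < n" for i
    using p that by (intro plan_optional_x[of _ "D i"]) (simp add: plans_def)
  have "marginal_x i (\<lambda>t \<omega>. a * y i t \<omega>) = ennreal a * marginal_x i (y i)" if "i < n" for i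
    unfolding marginal_x_def using a marginal_x_measurable[OF that opt[OF that]]
    by (subst nn_integral_cmult[symmetric]) (auto intro!: nn_integral_cong simp: ennreal_mult' ac_simps)
  moreover have "marginal_c (total (\<lambda>i t \<omega>. a * D i t \<omega>)) = ennreal a * marginal_c (total D)"
    unfolding marginal_c_def total_scale
    using a marginal_c_measurable[OF plan_optional_c[OF plans_total(1)[OF p]]]
    by (subst nn_integral_cmult[symmetric]) (auto intro!: nn_integral_cong simp: ennreal_mult' ac_simps)
  ultimately show ?thesis by (simp add: gain_def distrib_left sum_distrib_left)
qed

lemma quotient_nonneg:
  assumes p: "plans y D" and i: "i < n" and z: "z \<in> space \<mu>"
  shows "0 \<le> quotient y D m i z"
proof -
  have "u i (y i (snd z) (fst z), total D (snd z) (fst z)) \<le> quotient y D m i z"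
    using dir_quotient_ge[OF utility_u[OF i] plans_x_nonneg[OF plans i z] plans_total_nonneg[OF plans z]
      plans_x_nonneg[OF p i z] plans_total_nonneg[OF p z], of "1 / real (Suc m)"]
    by (simp add: quotient_def)
  moreover have "0 \<le> u i (y i (snd z) (fst z), total D (snd z) (fst z))"
    by (rule utility_nonneg[OF utility_u[OF i] plans_x_nonneg[OF p i z] plans_total_nonneg[OF p z]])
  ultimately show ?thesis by simp
qed

lemma quotient_measurable:
  assumes p: "plans y D" and i: "i < n" shows "(\<lambda>z. quotient y D m i z) \<in> borel_measurable \<mu>"
proof -
  note m = plans_x_mu[OF plans i] plans_total_mu[OF plans] plans_x_mu[OF p i] plans_total_mu[OF p]
  note nn = plans_x_nonneg[OF plans i] plans_total_nonneg[OF plans] plans_x_nonneg[OF p i] plans_total_nonneg[OF p]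
  have "(\<lambda>z. u i (x i (snd z) (fst z) + 1 / real (Suc m) * (y i (snd z) (fst z) - x i (snd z) (fst z)),
      S (snd z) (fst z) + 1 / real (Suc m) * (total D (snd z) (fst z) - S (snd z) (fst z)))) \<in> borel_measurable \<mu>"
    using m nn by (intro measurable_utility_compose[OF utility_u[OF i]] convex_combination_nonneg) auto
  moreover have "(\<lambda>z. u i (x i (snd z) (fst z), S (snd z) (fst z))) \<in> borel_measurable \<mu>"
    using m nn by (intro measurable_utility_compose[OF utility_u[OF i]]) auto
  ultimately show ?thesis unfolding quotient_def dir_quotient_def
    by (intro borel_measurable_add borel_measurable_divide borel_measurable_diff borel_measurable_const)
qed

end

section \<open>Variations of an optimal policy\<close>

locale optimal_policy = policy +
  assumes optimal: "\<And>y D. plans y D \<Longrightarrow> total_cost y D \<le> ennreal wealth \<Longrightarrow> welfare n T M r u \<gamma> y D \<le> W"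
begin

text \<open>With step \<open>1 / Suc m\<close>, the shifted quotient plus \<open>m\<close> times the
  current utility is \<open>Suc m\<close> times the utility of the mixed policy. Optimality bounds
  the integral of the latter by \<open>Suc m\<close> times \<open>W\<close>, and \<open>m\<close>
  copies of the finite \<open>W\<close> cancel.\<close>

lemma quotient_integral:
  assumes p: "plans y D" and b: "total_cost y D \<le> ennreal wealth"
  shows "(\<integral>\<^sup>+ z. (\<Sum>i<n. wgt i z * ennreal (quotient y D m i z)) \<partial>\<mu>) \<le> W"
proof -
  define e where "e = 1 / real (Suc m)"
  have e: "0 \<le> e" "e \<le> 1" unfolding e_def by (auto simp: field_simps)
  let ?y = "\<lambda>i t \<omega>. x i t \<omega> + e * (y i t \<omega> - x i t \<omega>)" and ?D = "\<lambda>i t \<omega>. C i t \<omega> + e * (D i t \<omega> - C i t \<omega>)"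
  have mix: "plans ?y ?D" "total_cost ?y ?D \<le> ennreal wealth"
    using plans_mix[OF plans p e budget b] by auto
  let ?q = "\<lambda>z. \<Sum>i<n. wgt i z * ennreal (quotient y D m i z)"
  let ?u = "\<lambda>z. \<Sum>i<n. wgt i z * util i z"
  let ?v = "\<lambda>z. \<Sum>i<n. wgt i z * ennreal (u i (?y i (snd z) (fst z), total ?D (snd z) (fst z)))"
  have mq: "?q \<in> borel_measurable \<mu>" and mu: "?u \<in> borel_measurable \<mu>"
    using quotient_measurable[OF p] weight_mu util_mu
    by (auto intro!: borel_measurable_sum borel_measurable_times_ennreal)
  have mv: "?v \<in> borel_measurable \<mu>"
    using measurable_utility_compose[OF utility_u plans_x_mu[OF mix(1)] plans_total_mu[OF mix(1)]]
      plans_x_nonneg[OF mix(1)] plans_total_nonneg[OF mix(1)] weight_mu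
    by (intro borel_measurable_sum borel_measurable_times_ennreal) auto
  have "?q z + ennreal (real m) * ?u z = ennreal (real (Suc m)) * ?v z" if z: "z \<in> space \<mu>" for z
  proof -
    have "wgt i z * ennreal (quotient y D m i z) + ennreal (real m) * (wgt i z * util i z) =
        ennreal (real (Suc m)) * (wgt i z * ennreal (u i (?y i (snd z) (fst z), total ?D (snd z) (fst z))))" if i: "i < n" for i
    proof -
      let ?U = "u i (x i (snd z) (fst z), S (snd z) (fst z))"
      let ?V = "u i (?y i (snd z) (fst z), total ?D (snd z) (fst z))"
      have nn: "0 \<le> ?U" "0 \<le> ?V"
        using plans_x_nonneg[OF plans i z] plans_total_nonneg[OF plans z]
          plans_x_nonneg[OF mix(1) i z] plans_total_nonneg[OF mix(1) z]
        by (auto intro!: utility_nonneg[OF utility_u[OF i]])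
      have "quotient y D m i z + real m * ?U = real (Suc m) * ?V"
        unfolding quotient_def dir_quotient_def total_mix e_def by (simp add: field_simps)
      moreover have "ennreal (real (Suc m) * ?V) = ennreal (real (Suc m)) * ennreal ?V"
        by (rule ennreal_mult') simp
      moreover have "ennreal (quotient y D m i z + real m * ?U) = ennreal (quotient y D m i z) + ennreal (real m) * ennreal ?U"
        using nn quotient_nonneg[OF p i z, of m] by (simp add: ennreal_mult')
      ultimately have "ennreal (quotient y D m i z) + ennreal (real m) * ennreal ?U = ennreal (real (Suc m)) * ennreal ?V"
        by (simp only:)
      then have "wgt i z * (ennreal (quotient y D m i z) + ennreal (real m) * ennreal ?U) =
          wgt i z * (ennreal (real (Suc m)) * ennreal ?V)" by simp
      then show ?thesis by (simp only: distrib_left mult.left_commute)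
    qed
    then show ?thesis
      unfolding sum_distrib_left sum.distrib[symmetric] by (intro sum.cong) auto
  qed
  then have "(\<integral>\<^sup>+ z. ?q z + ennreal (real m) * ?u z \<partial>\<mu>) = (\<integral>\<^sup>+ z. ennreal (real (Suc m)) * ?v z \<partial>\<mu>)"
    by (intro nn_integral_cong)
  then have "(\<integral>\<^sup>+ z. ?q z \<partial>\<mu>) + ennreal (real m) * W = ennreal (real (Suc m)) * welfare n T M r u \<gamma> ?y ?D"
    unfolding welfare_eq[OF plans] welfare_eq[OF mix(1)] using mq mu mv
    by (simp only: nn_integral_add nn_integral_cmult borel_measurable_times_ennreal borel_measurable_const)
  also have "\<dots> \<le> ennreal (real (Suc m)) * W" using optimal[OF mix] by (intro mult_left_mono) auto
  also have "\<dots> = W + ennreal (real m) * W"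
  proof -
    have "ennreal (real (Suc m)) = 1 + ennreal (real m)" 
      by (simp only: of_nat_Suc ennreal_plus of_nat_0_le_iff zero_le_one ennreal_1)
    then show ?thesis by (simp only: distrib_right mult_1)
  qed
  finally show ?thesis
    using welfare_finite by (cases "W = \<top>") (auto simp: ennreal_mult_eq_top_iff)
qed

lemma fatou_quotient:
  assumes p: "plans y D" and b: "total_cost y D \<le> ennreal wealth"
  shows "(\<integral>\<^sup>+ z. liminf (\<lambda>m. \<Sum>i<n. wgt i z * ennreal (quotient y D m i z)) \<partial>\<mu>) \<le> W"
proof -
  have "(\<integral>\<^sup>+ z. liminf (\<lambda>m. \<Sum>i<n. wgt i z * ennreal (quotient y D m i z)) \<partial>\<mu>) \<le>
      liminf (\<lambda>m. \<integral>\<^sup>+ z. (\<Sum>i<n. wgt i z * ennreal (quotient y D m i z)) \<partial>\<mu>)"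
    using quotient_measurable[OF p] weight_mu
    by (intro nn_integral_liminf borel_measurable_sum borel_measurable_times_ennreal) auto
  also have "\<dots> \<le> limsup (\<lambda>m. \<integral>\<^sup>+ z. (\<Sum>i<n. wgt i z * ennreal (quotient y D m i z)) \<partial>\<mu>)"
    by (rule Liminf_le_Limsup) simp
  also have "\<dots> \<le> W" using quotient_integral[OF p b] by (intro Limsup_bounded) simp
  finally show ?thesis .
qed

lemma positive_plan:
  obtains a where "0 < a" "plans (\<lambda>i t \<omega>. a * decay t) (\<lambda>i t \<omega>. 0)"
    "total_cost (\<lambda>i t \<omega>. a * decay t) (\<lambda>i t \<omega>. 0) \<le> ennreal wealth"
proof -
  \<comment> \<open>Each agent's decaying consumption then costs at most an equal share of the total
    wealth.\<close>
  define a where "a = wealth / real n"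
  have a: "0 < a" unfolding a_def using wealth_pos n_pos by simp
  have p: "contribution_plan T M F (\<lambda>t \<omega>. a * decay t) (\<lambda>t \<omega>. 0)"
    using a by (intro planI optional_decay optional_const increasing_process_zero) (auto simp: decay_def)
  have "cost_x (\<lambda>t \<omega>. a * decay t) = ennreal a * cost_x (\<lambda>t \<omega>. decay t)"
    using cost_x_lincomb[of "\<lambda>t \<omega>. decay t" "\<lambda>t \<omega>. 0" a 0] a optional_decay[of 1] optional_const[of 0]
    by (simp add: decay_def)
  also have "\<dots> \<le> ennreal a * 1" using cost_decay by (intro mult_left_mono) auto
  finally have c: "cost T M \<psi>x \<psi>c (\<lambda>t \<omega>. a * decay t) (\<lambda>t \<omega>. 0) \<le> ennreal a"
    unfolding cost_eq[OF p] cost_c_zero by simp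
  have "total_cost (\<lambda>i t \<omega>. a * decay t) (\<lambda>i t \<omega>. 0) \<le> (\<Sum>i<n. ennreal a)"
    unfolding total_cost_def using c by (intro sum_mono)
  also have "\<dots> = ennreal wealth"
    using a n_pos unfolding a_def by (simp add: ennreal_of_nat_eq_real_of_nat flip: ennreal_mult)
  finally have "total_cost (\<lambda>i t \<omega>. a * decay t) (\<lambda>i t \<omega>. 0) \<le> ennreal wealth" .
  moreover have "plans (\<lambda>i t \<omega>. a * decay t) (\<lambda>i t \<omega>. 0)" using p by (intro plansI)
  ultimately show ?thesis using that a by blast
qed

text \<open>Moving towards a strictly positive consumption plan has infinite marginal value wherever an
  agent does not consume although the public good is provided.\<close>

lemma gradients: gradients
proof (rule gradientsI)
  obtain a where a: "0 < a" and p: "plans (\<lambda>i t \<omega>. a * decay t) (\<lambda>i t \<omega>. 0)"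
    and b: "total_cost (\<lambda>i t \<omega>. a * decay t) (\<lambda>i t \<omega>. 0) \<le> ennreal wealth"
    by (rule positive_plan)
  let ?q = "\<lambda>m i z. quotient (\<lambda>i t \<omega>. a * decay t) (\<lambda>i t \<omega>. 0) m i z"
  let ?l = "\<lambda>z. liminf (\<lambda>m. \<Sum>i<n. wgt i z * ennreal (?q m i z))"
  have "?l \<in> borel_measurable \<mu>"
    using quotient_measurable[OF p] weight_mu
    by (intro borel_measurable_liminf borel_measurable_sum borel_measurable_times_ennreal) auto
  \<comment> \<open>The Fatou bound by the finite \<open>W\<close> excludes infinite limits of the
    quotients except on a null set.\<close>
  moreover have "(\<integral>\<^sup>+ z. ?l z \<partial>\<mu>) \<noteq> \<infinity>" using fatou_quotient[OF p b] welfare_finite by auto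
  ultimately have fin: "AE z in \<mu>. ?l z \<noteq> \<infinity>" by (rule nn_integral_noteq_infinite)
  fix i assume i: "i < n"
  show "AE z in \<mu>. 0 < S (snd z) (fst z) \<longrightarrow> 0 < x i (snd z) (fst z)"
    using fin AE_mu_finite AE_space
  proof eventually_elim
    case (elim z)
    show ?case
    proof (intro impI, rule ccontr)
      assume S: "0 < S (snd z) (fst z)" and "\<not> 0 < x i (snd z) (fst z)"
      then have x: "x i (snd z) (fst z) = 0" using plans_x_nonneg[OF plans i elim(3)] by simp
      have "(\<lambda>m. ennreal (?q m i z)) \<longlonglongrightarrow> \<infinity>"
        using inada_direction[OF utility_u[OF i] S, of "a * decay (snd z)"] a x
        unfolding quotient_def total_def by (simp add: decay_def)
      moreover have w: "0 < wgt i z" using weight_pos[OF i elim(3,2)] .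
      ultimately have "(\<lambda>m. wgt i z * ennreal (?q m i z)) \<longlonglongrightarrow> wgt i z * \<infinity>"
        by (intro ennreal_tendsto_cmult) auto
      moreover have "c * \<infinity> = \<infinity>" if "0 < c" for c :: ennreal
        using that by (simp add: ennreal_mult_top)
      ultimately have "(\<lambda>m. wgt i z * ennreal (?q m i z)) \<longlonglongrightarrow> \<infinity>"
        using w by metis
      then have "liminf (\<lambda>m. wgt i z * ennreal (?q m i z)) = \<infinity>" by (intro lim_imp_Liminf) auto
      moreover have "liminf (\<lambda>m. wgt i z * ennreal (?q m i z)) \<le> ?l z"
        using i by (intro Liminf_mono always_eventually allI member_le_sum) auto
      ultimately show False using elim(1) by (simp add: top_unique)
    qed
  qed
qed

text \<open>\<open>gradient_direction\<close> turns the limit of the quotients into an identity with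
  both linearised payoffs on separate sides. After integration the limit is at most \<open>W\<close>
  by Fatou, and \<open>W\<close>, the quantity known to be finite, is cancelled.\<close>

lemma gain_le:
  assumes p: "plans y D" and b: "total_cost y D \<le> ennreal wealth"
  shows "gain y D \<le> gain x C"
proof -
  let ?l = "\<lambda>z. liminf (\<lambda>m. \<Sum>i<n. wgt i z * ennreal (quotient y D m i z))"
  have ml: "?l \<in> borel_measurable \<mu>"
    using quotient_measurable[OF p] weight_mu
    by (intro borel_measurable_liminf borel_measurable_sum borel_measurable_times_ennreal) auto
  let ?g = "\<lambda>y D z. \<Sum>i<n. wgt i z * (mx i z * xx y i z + mc i z * SS D z)"
  have mg: "?g y D \<in> borel_measurable \<mu>" if "plans y D" for y D
    using weight_mu mx_mu mc_mu plans_x_mu[OF that] plans_total_mu[OF that]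
    by (auto intro!: borel_measurable_sum borel_measurable_times_ennreal borel_measurable_add)
  have mu: "(\<lambda>z. \<Sum>i<n. wgt i z * util i z) \<in> borel_measurable \<mu>"
    using weight_mu util_mu by (auto intro!: borel_measurable_sum borel_measurable_times_ennreal)
  have "AE z in \<mu>. ?l z + ?g x C z = (\<Sum>i<n. wgt i z * util i z) + ?g y D z"
    using gradients[unfolded gradients_def] AE_space
  proof eventually_elim
    case (elim z)
    have "\<exists>G. (\<lambda>m. ennreal (quotient y D m i z)) \<longlonglongrightarrow> G \<and>
        G + (mx i z * xx x i z + mc i z * SS C z) = util i z + (mx i z * xx y i z + mc i z * SS D z)" if i: "i < n" for i
    proof -
      have "has_gradient (u i) (x i (snd z) (fst z)) (S (snd z) (fst z))" using elim i by simp
      then obtain G where "(\<lambda>m. ennreal (quotient y D m i z)) \<longlonglongrightarrow> G"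
        "ennreal (u i (y i (snd z) (fst z), total D (snd z) (fst z))) \<le> G"
        "G + (mx i z * xx x i z + mc i z * SS C z) = util i z + (mx i z * xx y i z + mc i z * SS D z)"
        unfolding quotient_def
        by (rule gradient_direction[OF utility_u[OF i] plans_x_nonneg[OF plans i elim(2)] plans_total_nonneg[OF plans elim(2)]
          _ plans_x_nonneg[OF p i elim(2)] plans_total_nonneg[OF p elim(2)]])
      then show ?thesis by blast
    qed
    then obtain G where G: "\<And>i. i < n \<Longrightarrow> (\<lambda>m. ennreal (quotient y D m i z)) \<longlonglongrightarrow> G i"
      "\<And>i. i < n \<Longrightarrow> G i + (mx i z * xx x i z + mc i z * SS C z) = util i z + (mx i z * xx y i z + mc i z * SS D z)"
      by meson
    have "(\<lambda>m. \<Sum>i<n. wgt i z * ennreal (quotient y D m i z)) \<longlonglongrightarrow> (\<Sum>i<n. wgt i z * G i)"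
      using G(1) by (intro tendsto_sum ennreal_tendsto_cmult) auto
    then have "?l z = (\<Sum>i<n. wgt i z * G i)" by (intro lim_imp_Liminf) auto
    then have "?l z + ?g x C z = (\<Sum>i<n. wgt i z * (G i + (mx i z * xx x i z + mc i z * SS C z)))"
      by (simp only: distrib_left sum.distrib)
    also have "\<dots> = (\<Sum>i<n. wgt i z * (util i z + (mx i z * xx y i z + mc i z * SS D z)))"
      using G(2) by (intro sum.cong) auto
    also have "\<dots> = (\<Sum>i<n. wgt i z * util i z) + ?g y D z" by (simp only: distrib_left sum.distrib)
    finally show ?case .
  qed
  then have "(\<integral>\<^sup>+ z. ?l z + ?g x C z \<partial>\<mu>) = (\<integral>\<^sup>+ z. (\<Sum>i<n. wgt i z * util i z) + ?g y D z \<partial>\<mu>)"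
    by (rule nn_integral_cong_AE)
  then have "(\<integral>\<^sup>+ z. ?l z \<partial>\<mu>) + gain x C = W + gain y D"
    unfolding gain_eq[OF p] gain_eq[OF plans] welfare_eq[OF plans]
    by (simp only: nn_integral_add ml mg[OF p] mg[OF plans] mu)
  then have "W + gain y D = (\<integral>\<^sup>+ z. ?l z \<partial>\<mu>) + gain x C" by (rule sym)
  also have "\<dots> \<le> W + gain x C" using fatou_quotient[OF p b] by (rule add_right_mono)
  finally show ?thesis using welfare_finite by (cases "W = \<top>") auto
qed

lemma gain_finite: "gain x C < \<infinity>"
proof -
  have "gain x C \<le> W"
    unfolding gain_eq[OF plans] welfare_eq[OF plans]
  proof (intro nn_integral_mono_AE, use gradients[unfolded gradients_def] AE_space in eventually_elim)
    case (elim z)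
    show ?case
      using elim plans_x_nonneg[OF plans _ elim(2)] plans_total_nonneg[OF plans elim(2)]
      by (intro sum_mono mult_left_mono gradient_le_utility[OF utility_u]) auto
  qed
  then show ?thesis using welfare_finite by (rule le_less_trans)
qed

lemma gain_pos: "0 < gain x C"
proof -
  obtain a where a: "0 < a" and p: "plans (\<lambda>i t \<omega>. a * decay t) (\<lambda>i t \<omega>. 0)"
    and b: "total_cost (\<lambda>i t \<omega>. a * decay t) (\<lambda>i t \<omega>. 0) \<le> ennreal wealth"
    by (rule positive_plan)
  have n: "0 < n" using n_pos by simp
  have "marginal_x 0 (\<lambda>t \<omega>. a * decay t) \<noteq> 0"
  proof
    assume "marginal_x 0 (\<lambda>t \<omega>. a * decay t) = 0"
    then have "AE z in \<mu>. wgt 0 z * mx 0 z * ennreal (a * decay (snd z)) = 0"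
      unfolding marginal_x_def using marginal_x_measurable[OF n optional_decay[of a]]
      by (subst (asm) nn_integral_0_iff_AE) auto
    then have "AE z in \<mu>. False"
      using AE_mu_finite AE_space
    proof eventually_elim
      case (elim z)
      have "0 < mx 0 z"
        by (rule partial_x_pos[OF utility_u[OF n] plans_x_nonneg[OF plans n elim(3)] plans_total_nonneg[OF plans elim(3)]])
      then show ?case using elim weight_pos[OF n elim(3,2)] a by (auto simp: decay_def mult_eq_0_iff)
    qed
    \<comment> \<open>Impossible for a probability space times a nondegenerate horizon.\<close>
    then have "emeasure \<mu> (space \<mu>) = 0"
      using emeasure_eq_0_AE[of "\<lambda>_. True" \<mu>] by simp
    moreover have "emeasure \<mu> (space \<mu>) = emeasure M (space M) * emeasure (leb T) {..T}"
      unfolding space_pair_measure space_leb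
      by (rule leb.emeasure_pair_measure_Times) (use sets.top[of "leb T"] in auto)
    ultimately show False using emeasure_leb_pos[OF T_pos] emeasure_space_1 by simp
  qed
  moreover have "marginal_x 0 (\<lambda>t \<omega>. a * decay t) \<le> gain (\<lambda>i t \<omega>. a * decay t) (\<lambda>i t \<omega>. 0)"
  proof -
    have "marginal_x 0 (\<lambda>t \<omega>. a * decay t) \<le> (\<Sum>i<n. marginal_x i (\<lambda>t \<omega>. a * decay t))"
      using n by (intro member_le_sum) auto
    also have "\<dots> \<le> gain (\<lambda>i t \<omega>. a * decay t) (\<lambda>i t \<omega>. 0)" unfolding gain_def by (simp add: add_increasing2)
    finally show ?thesis .
  qed
  ultimately show ?thesis using gain_le[OF p b] by (metis not_gr_zero le_zero_eq)
qed

section \<open>The Lagrange multiplier and the binding budget\<close>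

definition multiplier :: real where "multiplier = enn2real (gain x C) / wealth"

text \<open>The divisor in \<open>multiplier\<close> is the wealth and not the cost of the policy:
  that the two coincide is a consequence, drawn in \<open>budget_binding\<close>.\<close>

lemma gain_multiplier: "gain x C = ennreal (multiplier * wealth)"
  unfolding multiplier_def using wealth_pos gain_finite by (simp add: ennreal_enn2real_if)

lemma multiplier_pos: "0 < multiplier"
  using gain_pos wealth_pos gain_multiplier by (auto simp: zero_less_mult_iff)

text \<open>By homogeneity, optimality among the affordable plans for the linearised problem bounds the gain
  of every plan by the multiplier times its cost.\<close>

lemma gain_le_cost:
  assumes p: "plans y D"
  shows "gain y D \<le> ennreal multiplier * total_cost y D"
proof (cases "total_cost y D")
  case top
  then show ?thesis using multiplier_pos by (simp add: ennreal_mult_top)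
next
  case (real \<kappa>)
  have scaled: "ennreal a * gain y D \<le> ennreal (multiplier * wealth)" if "0 \<le> a" "a * \<kappa> \<le> wealth" for a
  proof -
    have "total_cost (\<lambda>i t \<omega>. a * y i t \<omega>) (\<lambda>i t \<omega>. a * D i t \<omega>) \<le> ennreal wealth"
      unfolding plans_scale(2)[OF p that(1)] real(2) using that real(1)
      by (simp flip: ennreal_mult add: ennreal_leI)
    from gain_le[OF plans_scale(1)[OF p that(1)] this] show ?thesis
      unfolding gain_scale[OF p that(1)] gain_multiplier .
  qed
  \<comment> \<open>Some positive multiple of the plan is affordable, which already makes its
    linearised payoff finite.\<close>
  have "\<exists>a0>0. a0 * \<kappa> \<le> wealth"
  proof (cases "\<kappa> = 0")
    case True
    then show ?thesis using wealth_pos by (intro exI[of _ 1]) auto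
  next
    case False
    then show ?thesis using wealth_pos real(1) by (intro exI[of _ "wealth / \<kappa>"]) auto
  qed
  then obtain a0 where a0: "0 < a0" "a0 * \<kappa> \<le> wealth" by blast
  have "gain y D \<noteq> \<top>" using scaled[OF less_imp_le[OF a0(1)] a0(2)] a0 by (auto simp: ennreal_mult_top top_unique)
  then obtain g where g: "gain y D = ennreal g" "0 \<le> g" by (cases "gain y D") auto
  have s: "a * g \<le> multiplier * wealth" if "0 \<le> a" "a * \<kappa> \<le> wealth" for a
  proof -
    have "ennreal (a * g) \<le> ennreal (multiplier * wealth)" using scaled[OF that] that g by (simp add: ennreal_mult)
    then show ?thesis using multiplier_pos wealth_pos by (subst (asm) ennreal_le_iff) auto
  qed
  have "g \<le> multiplier * \<kappa>"
  proof (cases "\<kappa> = 0")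
    case True
    have "g \<le> 0"
    proof (rule ccontr)
      assume "\<not> g \<le> 0"
      then have "0 < g" by simp
      \<comment> \<open>A plan of zero cost is affordable at every scale; this scale would push its
        payoff beyond the bound.\<close>
      have "(multiplier * wealth + 1) / g * g \<le> multiplier * wealth"
        using True \<open>0 < g\<close> wealth_pos multiplier_pos by (intro s) auto
      then show False using \<open>0 < g\<close> by simp
    qed
    then show ?thesis using True by simp
  next
    case False
    then have "0 < \<kappa>" using real(1) by simp
    then have "wealth / \<kappa> * g \<le> multiplier * wealth" using wealth_pos by (intro s) auto
    then show ?thesis using \<open>0 < \<kappa>\<close> wealth_pos by (simp add: field_simps)
  qed
  then show ?thesis
    unfolding g real(2) using multiplier_pos real(1) by (simp flip: ennreal_mult add: ennreal_leI)
qed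

text \<open>The bound \<open>gain_le_cost\<close> applied to the policy itself; the positive finite
  multiplier is divided out.\<close>

lemma budget_binding: "total_cost x C = ennreal wealth"
proof (rule antisym[OF budget])
  have "ennreal multiplier * ennreal wealth \<le> ennreal multiplier * total_cost x C"
    using gain_le_cost[OF plans] multiplier_pos wealth_pos unfolding gain_multiplier by (simp add: ennreal_mult)
  then show "ennreal wealth \<le> total_cost x C"
    using multiplier_pos by (simp add: ennreal_mult_le_mult_iff)
qed

text \<open>Tests the linear bound with the plan in which agent \<open>i\<close> consumes
  \<open>y\<close> and nobody else does or contributes anything.\<close>

lemma marginal_x_le:
  assumes i: "i < n" and y: "optional T M F y" "\<And>t \<omega>. t \<le> T \<Longrightarrow> \<omega> \<in> space M \<Longrightarrow> 0 \<le> y t \<omega>"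
  shows "marginal_x i y \<le> ennreal multiplier * cost_x y"
proof -
  let ?y = "\<lambda>j. if j = i then y else (\<lambda>t \<omega>. 0)"
  have p: "contribution_plan T M F y (\<lambda>t \<omega>. 0)"
    using y by (intro planI optional_const increasing_process_zero) auto
  have ps: "plans ?y (\<lambda>j t \<omega>. 0)" using p plan_zero by (intro plansI) auto
  have "total (\<lambda>j t \<omega>. 0) = (\<lambda>t \<omega>. 0)" by (simp add: total_def fun_eq_iff)
  then have "total_cost ?y (\<lambda>j t \<omega>. 0) = (\<Sum>j<n. cost_x (?y j))"
    unfolding total_cost_eq[OF ps] by (simp add: cost_c_zero)
  also have "\<dots> = (\<Sum>j<n. if j = i then cost_x y else 0)"
    by (intro sum.cong) (auto simp: cost_x_zero)
  also have "\<dots> = cost_x y" using i by simp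
  finally have c: "total_cost ?y (\<lambda>j t \<omega>. 0) = cost_x y" .
  have "marginal_x i (?y i) \<le> (\<Sum>j<n. marginal_x j (?y j))" using i by (intro member_le_sum) auto
  also have "\<dots> \<le> gain ?y (\<lambda>j t \<omega>. 0)" unfolding gain_def by (simp add: add_increasing2)
  also have "\<dots> \<le> ennreal multiplier * cost_x y" using gain_le_cost[OF ps] unfolding c .
  finally show ?thesis by simp
qed

text \<open>Payoffs depend on contributions through the total alone, so it suffices to let one
  agent, number 0, make them all.\<close>

lemma marginal_c_le:
  assumes D: "optional T M F D" "increasing_process D" "\<And>t \<omega>. t \<le> T \<Longrightarrow> \<omega> \<in> space M \<Longrightarrow> 0 \<le> D t \<omega>"
  shows "marginal_c D \<le> ennreal multiplier * cost_c D"
proof -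
  let ?D = "\<lambda>j. if j = 0 then D else (\<lambda>t \<omega>. 0)"
  have p: "contribution_plan T M F (\<lambda>t \<omega>. 0) D"
    using D by (intro planI optional_const) auto
  have ps: "plans (\<lambda>j t \<omega>. 0) ?D" using p plan_zero by (intro plansI) auto
  have tot: "total ?D = D"
  proof (intro ext)
    fix t \<omega>
    have "total ?D t \<omega> = (\<Sum>j<n. if j = 0 then D t \<omega> else 0)" unfolding total_def by (intro sum.cong) auto
    then show "total ?D t \<omega> = D t \<omega>" using n_pos by simp
  qed
  have "marginal_c D \<le> gain (\<lambda>j t \<omega>. 0) ?D" unfolding gain_def tot by (simp add: add_increasing)
  also have "\<dots> \<le> ennreal multiplier * cost_c D"
    using gain_le_cost[OF ps] unfolding total_cost_eq[OF ps] tot by (simp add: cost_x_zero)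
  finally show ?thesis .
qed

text \<open>Every component satisfies an inequality and the finite sums agree, since the budget
  binds; hence no component can be strict.\<close>

lemma marginal_eq:
  shows marginal_x_eq: "\<And>i. i < n \<Longrightarrow> marginal_x i (x i) = ennreal multiplier * cost_x (x i)"
    and marginal_c_eq: "marginal_c S = ennreal multiplier * cost_c S"
    and cost_x_finite: "\<And>i. i < n \<Longrightarrow> cost_x (x i) < \<infinity>" and cost_c_finite: "cost_c S < \<infinity>"
proof -
  have p: "contribution_plan T M F (x i) (C i)" if "i < n" for i using plans that by (simp add: plans_def)
  note tot = plans_total(1)[OF plans]
  have fin: "(\<Sum>i<n. cost_x (x i)) + cost_c S = ennreal wealth"
    using budget_binding unfolding total_cost_eq[OF plans] .
  show cf: "cost_c S < \<infinity>"
  proof -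
    have "cost_c S \<le> (\<Sum>i<n. cost_x (x i)) + cost_c S" by (simp add: add_increasing)
    then show ?thesis unfolding fin by (simp add: order_le_less_trans)
  qed
  show xf: "cost_x (x i) < \<infinity>" if "i < n" for i
  proof -
    have "cost_x (x i) \<le> (\<Sum>i<n. cost_x (x i))" using that by (intro member_le_sum) auto
    also have "\<dots> \<le> (\<Sum>i<n. cost_x (x i)) + cost_c S" by (simp add: add_increasing2)
    finally show ?thesis unfolding fin by (simp add: order_le_less_trans)
  qed
  have lx: "marginal_x i (x i) \<le> ennreal multiplier * cost_x (x i)" if "i < n" for i
    using plan_optional_x[OF p] plan_nonneg_x[OF p] that by (intro marginal_x_le) auto
  have lc: "marginal_c S \<le> ennreal multiplier * cost_c S"
    using plan_optional_c[OF tot] plan_increasing[OF tot] plan_nonneg_c[OF tot] by (intro marginal_c_le) auto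
  have sum_eq: "(\<Sum>i<n. marginal_x i (x i)) + marginal_c S =
      (\<Sum>i<n. ennreal multiplier * cost_x (x i)) + ennreal multiplier * cost_c S"
  proof -
    have "(\<Sum>i<n. marginal_x i (x i)) + marginal_c S = ennreal multiplier * total_cost x C"
      using gain_multiplier budget_binding multiplier_pos wealth_pos by (simp add: gain_def ennreal_mult)
    then show ?thesis unfolding total_cost_eq[OF plans] by (simp add: distrib_left sum_distrib_left)
  qed
  have ms: "(\<Sum>i<n. marginal_x i (x i)) \<le> (\<Sum>i<n. ennreal multiplier * cost_x (x i))"
    using lx by (intro sum_mono) auto
  have nf: "cost_c S \<noteq> \<top>" "\<And>i. i < n \<Longrightarrow> cost_x (x i) \<noteq> \<top>" using cf xf by (auto simp: less_top)
  have rf: "(\<Sum>i<n. ennreal multiplier * cost_x (x i)) \<noteq> \<top>" "ennreal multiplier * cost_c S \<noteq> \<top>"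
    using nf by (auto simp: ennreal_mult_eq_top_iff)
  have aux: "a = c \<and> b = d" if "a \<le> c" "b \<le> d" "a + b = c + d" "c \<noteq> \<top>" "d \<noteq> \<top>" for a b c d :: ennreal
  proof -
    have "c + d \<le> a + d" using that(3) add_left_mono[OF that(2), of a] by simp
    then have "c \<le> a" using that(5) by (simp add: add.commute[of _ d])
    moreover have "c + d \<le> c + b" using that(3) add_right_mono[OF that(1), of b] by simp
    then have "d \<le> b" using that(4) by simp
    ultimately show ?thesis using that by (simp add: antisym)
  qed
  have both: "(\<Sum>i<n. marginal_x i (x i)) = (\<Sum>i<n. ennreal multiplier * cost_x (x i))"
    "marginal_c S = ennreal multiplier * cost_c S"
    using aux[OF ms lc sum_eq rf] by auto
  then show "marginal_c S = ennreal multiplier * cost_c S" by simp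
  fix i assume i: "i < n"
  have rest: "(\<Sum>j\<in>{..<n} - {i}. marginal_x j (x j)) \<le> (\<Sum>j\<in>{..<n} - {i}. ennreal multiplier * cost_x (x j))"
    using lx by (intro sum_mono) auto
  have rest_fin: "ennreal multiplier * cost_x (x i) \<noteq> \<top>" "(\<Sum>j\<in>{..<n} - {i}. ennreal multiplier * cost_x (x j)) \<noteq> \<top>"
    using nf i by (auto simp: ennreal_mult_eq_top_iff)
  have "marginal_x i (x i) + (\<Sum>j\<in>{..<n} - {i}. marginal_x j (x j)) =
      ennreal multiplier * cost_x (x i) + (\<Sum>j\<in>{..<n} - {i}. ennreal multiplier * cost_x (x j))"
    using both(1) i by (simp add: sum.remove[of "{..<n}" i])
  from aux[OF lx[OF i] rest this rest_fin] show "marginal_x i (x i) = ennreal multiplier * cost_x (x i)" by simp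
qed

text \<open>The test plan consumes exactly where the inequality fails. For this plan to be optional
  the price is replaced by its optional almost-everywhere version, and the factor
  \<open>decay\<close> keeps the cost finite.\<close>

lemma first_order_x_le:
  assumes i: "i < n"
  shows "AE z in \<mu>. wgt i z * mx i z \<le> ennreal multiplier * ennreal (\<psi>x (snd z) (fst z))"
proof -
  have "adapted T F \<psi>x" "\<forall>\<omega>\<in>space M. right_continuous_path T (\<lambda>t. \<psi>x t \<omega>)"
    using prices(1) by (auto simp: price_process_def)
  then obtain p where p: "optional T M F p" "\<And>\<omega>. \<omega> \<in> space M \<Longrightarrow> AE t in leb T. p t \<omega> = \<psi>x t \<omega>"
    using right_continuous_AE_optional[of \<psi>x] by blast
  have mpx: "(\<lambda>z. p (snd z) (fst z)) \<in> borel_measurable \<mu>" "(\<lambda>z. \<psi>x (snd z) (fst z)) \<in> borel_measurable \<mu>"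
    using optional_mu[OF p(1)] joint_mu[of \<psi>x, OF progressive_jointly[OF price_progressive[OF prices(1)]]] by auto
  have p_eq: "AE z in \<mu>. p (snd z) (fst z) = \<psi>x (snd z) (fst z)"
  proof (rule product.AE_pair_measure)
    show "{z \<in> space \<mu>. p (snd z) (fst z) = \<psi>x (snd z) (fst z)} \<in> sets \<mu>" using mpx by measurable
    show "AE \<omega> in M. AE t in leb T. p (snd (\<omega>, t)) (fst (\<omega>, t)) = \<psi>x (snd (\<omega>, t)) (fst (\<omega>, t))"
      by (rule AE_I2) (simp add: p(2))
  qed
  let ?B = "\<lambda>t \<omega>. ennreal multiplier * ennreal (p t \<omega>) < wgt i (\<omega>, t) * mx i (\<omega>, t)"
  define y where "y t \<omega> = (if ?B t \<omega> then decay t else 0)" for t \<omega>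
  have y_opt: "optional T M F y"
  proof -
    let ?O = "optional_sigma T M F"
    have "(\<lambda>q. p (fst q) (snd q)) \<in> borel_measurable ?O" "(\<lambda>q. disc (fst q) (snd q)) \<in> borel_measurable ?O"
      "(\<lambda>q. mx i (snd q, fst q)) \<in> borel_measurable ?O" "(\<lambda>q. decay (fst q)) \<in> borel_measurable ?O"
      using p(1) disc_optional optional_mx_mc(1)[OF i] optional_decay[of 1] unfolding optional_def case_prod_beta' by auto
    note m = this
    have "{q \<in> space ?O. ?B (fst q) (snd q)} \<in> sets ?O"
      using m(1-3) by (intro borel_measurable_less borel_measurable_times_ennreal) auto
    then show ?thesis
      unfolding optional_def case_prod_beta' y_def using m(4) by (intro measurable_If) auto
  qed
  have y_nn: "0 \<le> y t \<omega>" for t \<omega> by (simp add: y_def decay_def)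
  have le: "marginal_x i y \<le> ennreal multiplier * cost_x y"
    using y_opt y_nn by (intro marginal_x_le i) auto
  have "cost_x y \<le> cost_x (\<lambda>t \<omega>. decay t)"
    unfolding cost_x_def by (intro nn_integral_mono mult_left_mono ennreal_leI) (auto simp: y_def decay_def)
  then have fin: "cost_x y < \<infinity>" using cost_decay by (simp add: le_less_trans[OF order_trans])
  let ?f = "\<lambda>z. wgt i z * mx i z * ennreal (y (snd z) (fst z))"
  let ?g = "\<lambda>z. ennreal multiplier * (ennreal (\<psi>x (snd z) (fst z)) * ennreal (y (snd z) (fst z)))"
  have mg: "(\<lambda>z. ennreal (\<psi>x (snd z) (fst z)) * ennreal (y (snd z) (fst z))) \<in> borel_measurable \<mu>"
    using psi_x_mu optional_mu[OF y_opt] by auto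
  have g_int: "(\<integral>\<^sup>+ z. ?g z \<partial>\<mu>) = ennreal multiplier * cost_x y"
    unfolding cost_x_def using mg by (intro nn_integral_cmult) auto
  have "AE z in \<mu>. ?f z = ?g z"
  proof (rule nn_integral_le_imp_AE_eq)
    show "?f \<in> borel_measurable \<mu>" by (rule marginal_x_measurable[OF i y_opt])
    show "?g \<in> borel_measurable \<mu>" using mg by auto
    show "(\<integral>\<^sup>+ z. ?f z \<partial>\<mu>) \<le> (\<integral>\<^sup>+ z. ?g z \<partial>\<mu>)" unfolding g_int using le by (simp add: marginal_x_def)
    show "(\<integral>\<^sup>+ z. ?g z \<partial>\<mu>) < \<infinity>" unfolding g_int using fin by (simp add: ennreal_mult_less_top)
    show "AE z in \<mu>. ?g z \<le> ?f z"
      using p_eq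
    proof eventually_elim
      case (elim z)
      show ?case
      proof (cases "?B (snd z) (fst z)")
        case True
        then have "ennreal multiplier * ennreal (\<psi>x (snd z) (fst z)) \<le> wgt i z * mx i z"
          using elim by (simp add: less_imp_le)
        then show ?thesis by (simp add: mult.assoc[symmetric] mult_right_mono)
      qed (simp add: y_def)
    qed
  qed
  then show ?thesis
    using p_eq
  proof eventually_elim
    case (elim z)
    show ?case
    proof (rule ccontr)
      assume "\<not> ?thesis"
      then have less: "ennreal multiplier * ennreal (\<psi>x (snd z) (fst z)) < wgt i z * mx i z" by simp
      then have "y (snd z) (fst z) = decay (snd z)" using elim by (simp add: y_def)
      \<comment> \<open>On the set of violation the test consumption is positive and finite, so it
        cancels and leaves equality, contradicting the strict inequality.\<close>
      then have "ennreal (y (snd z) (fst z)) \<noteq> 0" "ennreal (y (snd z) (fst z)) \<noteq> \<top>" by (auto simp: decay_def)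
      moreover have "ennreal (y (snd z) (fst z)) * (wgt i z * mx i z) =
          ennreal (y (snd z) (fst z)) * (ennreal multiplier * ennreal (\<psi>x (snd z) (fst z)))"
        using elim(1) by (simp add: ac_simps)
      ultimately have "wgt i z * mx i z = ennreal multiplier * ennreal (\<psi>x (snd z) (fst z))"
        by (simp only: ennreal_mult_cancel_left) simp
      then show False using less by simp
    qed
  qed
qed

text \<open>The pointwise inequality, weighted by consumption, integrates to an equality by
  \<open>marginal_x_eq\<close>; it is therefore an equality almost everywhere, and positive
  consumption cancels.\<close>

lemma first_order_x_eq:
  assumes i: "i < n"
  shows "AE z in \<mu>. 0 < x i (snd z) (fst z) \<longrightarrow>
    wgt i z * mx i z = ennreal multiplier * ennreal (\<psi>x (snd z) (fst z))"
proof -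
  have p: "optional T M F (x i)" using plans i by (intro plan_optional_x[of _ "C i"]) (simp add: plans_def)
  let ?f = "\<lambda>z. ennreal multiplier * (ennreal (\<psi>x (snd z) (fst z)) * xx x i z)"
  let ?g = "\<lambda>z. wgt i z * mx i z * xx x i z"
  have mf: "(\<lambda>z. ennreal (\<psi>x (snd z) (fst z)) * xx x i z) \<in> borel_measurable \<mu>"
    using psi_x_mu optional_mu[OF p] by auto
  have f_int: "(\<integral>\<^sup>+ z. ?f z \<partial>\<mu>) = ennreal multiplier * cost_x (x i)"
    unfolding cost_x_def using mf by (intro nn_integral_cmult) auto
  have g_int: "(\<integral>\<^sup>+ z. ?g z \<partial>\<mu>) = ennreal multiplier * cost_x (x i)"
    using marginal_x_eq[OF i] by (simp add: marginal_x_def)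
  have "AE z in \<mu>. ?f z = ?g z"
  proof (rule nn_integral_le_imp_AE_eq)
    show "?f \<in> borel_measurable \<mu>" using mf by auto
    show "?g \<in> borel_measurable \<mu>" by (rule marginal_x_measurable[OF i p])
    show "(\<integral>\<^sup>+ z. ?f z \<partial>\<mu>) \<le> (\<integral>\<^sup>+ z. ?g z \<partial>\<mu>)" unfolding f_int g_int ..
    show "(\<integral>\<^sup>+ z. ?g z \<partial>\<mu>) < \<infinity>" unfolding g_int using cost_x_finite[OF i] by (simp add: ennreal_mult_less_top)
    show "AE z in \<mu>. ?g z \<le> ?f z"
      using first_order_x_le[OF i] by eventually_elim (simp add: mult.assoc[symmetric] mult_right_mono)
  qed
  then show ?thesis
  proof eventually_elim
    case (elim z)
    show ?case
    proof
      assume "0 < x i (snd z) (fst z)"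
      then have "xx x i z \<noteq> 0" "xx x i z \<noteq> \<top>" by auto
      moreover have "xx x i z * (wgt i z * mx i z) = xx x i z * (ennreal multiplier * ennreal (\<psi>x (snd z) (fst z)))"
        using elim by (simp add: ac_simps)
      ultimately show "wgt i z * mx i z = ennreal multiplier * ennreal (\<psi>x (snd z) (fst z))"
        by (simp only: ennreal_mult_cancel_left) simp
    qed
  qed
qed

text \<open>Tests the linear bound with a unit contributed at \<tau> on the event
  \<open>A\<close>.\<close>

lemma tail_le:
  assumes tau: "\<tau> \<in> stopping_times T M F" and A: "A \<in> sets (pre_sigma \<tau>)"
  shows "(\<integral>\<^sup>+ \<omega>\<in>A. tail_integral T density (\<tau> \<omega>) \<omega> \<partial>M) \<le> (\<integral>\<^sup>+ \<omega>\<in>A. ennreal (multiplier * \<psi>c (\<tau> \<omega>) \<omega>) \<partial>M)"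
proof -
  let ?D = "\<lambda>t \<omega>. if \<tau> \<omega> \<le> t then indicator A \<omega> else 0 :: real"
  have st: "stopping_time F \<tau>" using tau by (simp add: stopping_times_def)
  have D: "optional T M F ?D" "increasing_process ?D"
    using optional_step[OF st A] single_step_process(1)[OF tau A] by auto
  have "(\<integral>\<^sup>+ \<omega>\<in>A. tail_integral T density (\<tau> \<omega>) \<omega> \<partial>M) = marginal_c ?D"
    unfolding marginal_c_def tail_total[OF D] by (rule single_step_process(2)[OF tau A tail_joint, symmetric])
  also have "\<dots> \<le> ennreal multiplier * cost_c ?D" using D by (intro marginal_c_le) auto
  also have "\<dots> = (\<integral>\<^sup>+ \<omega>\<in>A. ennreal (multiplier * \<psi>c (\<tau> \<omega>) \<omega>) \<partial>M)"
    unfolding scaled_cost_c[OF less_imp_le[OF multiplier_pos] D(2), symmetric]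
    by (rule single_step_process(2)[OF tau A scaled_price_joint])
  finally show ?thesis .
qed

text \<open>The case of \<tau> = 0 and the sure event: the whole tail is worth at most the
  multiplier times the initial expected price. This is the integrability behind the optional
  projection.\<close>

lemma density_integral_finite: "(\<integral>\<^sup>+ \<omega>. \<integral>\<^sup>+ t. density t \<omega> \<partial>leb T \<partial>M) < \<infinity>"
proof -
  have tau: "(\<lambda>\<omega>. 0) \<in> stopping_times T M F" by (simp add: stopping_times_def stopping_time_const)
  have A: "space M \<in> sets (pre_sigma (\<lambda>\<omega>. 0))" using sets.top[of "pre_sigma (\<lambda>\<omega>. 0)"] by (simp add: space_pre_sigma)
  have "(\<integral>\<^sup>+ \<omega>. \<integral>\<^sup>+ t. density t \<omega> \<partial>leb T \<partial>M) = (\<integral>\<^sup>+ \<omega>\<in>space M. tail_integral T density 0 \<omega> \<partial>M)"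
    by (intro nn_integral_cong) (simp add: tail_integral_def)
  also have "\<dots> \<le> (\<integral>\<^sup>+ \<omega>\<in>space M. ennreal (multiplier * \<psi>c 0 \<omega>) \<partial>M)" by (rule tail_le[OF tau A])
  also have "\<dots> = ennreal multiplier * (\<integral>\<^sup>+ \<omega>. ennreal (\<psi>c 0 \<omega>) \<partial>M)"
  proof -
    have "\<psi>c 0 \<in> borel_measurable M"
      using progressive_adapted[OF price_progressive[OF prices(2)], of 0] by (intro measurable_F) auto
    then show ?thesis using multiplier_pos
      by (subst nn_integral_cmult[symmetric]) (auto intro!: nn_integral_cong simp: ennreal_mult')
  qed
  also have "\<dots> \<le> ennreal multiplier * 1" using price_expectation[OF prices(2), of 0] by (intro mult_left_mono) auto
  finally show ?thesis by (auto intro: order_le_less_trans)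
qed

text \<open>The event of violation lies in the sigma-algebra at \<tau>, so \<open>tail_le\<close>
  applies on it; with finite integrals it can only be a null event.\<close>

lemma first_order_c:
  assumes tau: "\<tau> \<in> stopping_times T M F"
  shows "AE \<omega> in M. nn_cond_exp M (pre_sigma \<tau>) (\<lambda>\<omega>. tail_integral T density (\<tau> \<omega>) \<omega>) \<omega>
    \<le> ennreal (multiplier * \<psi>c (\<tau> \<omega>) \<omega>)"
proof -
  have st: "stopping_time F \<tau>" and leT: "AE \<omega> in M. \<tau> \<omega> \<le> T" using tau by (auto simp: stopping_times_def)
  let ?G = "pre_sigma \<tau>"
  define c where "c = nn_cond_exp M ?G (\<lambda>\<omega>. tail_integral T density (\<tau> \<omega>) \<omega>)"
  \<comment> \<open>Since \<tau> exceeds \<open>T\<close> on a null event at most, the value 0 there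
    secures measurability at \<tau> without changing the bound.\<close>
  define g where "g \<omega> = (if \<tau> \<omega> \<le> T then ennreal (multiplier * \<psi>c (\<tau> \<omega>) \<omega>) else 0)" for \<omega>
  have sub: "subalgebra M ?G" by (rule subalg_pre_sigma[OF st])
  have "progressive T F (\<lambda>t \<omega>. ennreal (multiplier * \<psi>c t \<omega>))"
    using price_progressive[OF prices(2)] unfolding progressive_def case_prod_beta' by auto
  then have g: "g \<in> borel_measurable ?G" unfolding g_def using st by (rule progressive_stopped)
  have c: "c \<in> borel_measurable ?G" unfolding c_def by simp
  have M: "c \<in> borel_measurable M" "g \<in> borel_measurable M" using c g sub by (auto intro: measurable_from_subalg)
  define B where "B = {\<omega> \<in> space M. g \<omega> < c \<omega>}"
  have "{\<omega> \<in> space ?G. g \<omega> < c \<omega>} \<in> sets ?G" using g c by (rule borel_measurable_less)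
  then have B: "B \<in> sets ?G" unfolding B_def by (simp add: space_pre_sigma)
  then have BM: "B \<in> sets M" using sub by (auto simp: subalgebra_def)
  have g_eq: "AE \<omega> in M. g \<omega> = ennreal (multiplier * \<psi>c (\<tau> \<omega>) \<omega>)"
    using leT by eventually_elim (simp add: g_def)
  have cB: "(\<integral>\<^sup>+ \<omega>\<in>B. c \<omega> \<partial>M) = (\<integral>\<^sup>+ \<omega>\<in>B. tail_integral T density (\<tau> \<omega>) \<omega> \<partial>M)"
    unfolding c_def by (rule tail_cond_exp_integral[OF tau B, symmetric])
  have "(\<integral>\<^sup>+ \<omega>\<in>B. c \<omega> \<partial>M) \<le> (\<integral>\<^sup>+ \<omega>\<in>B. g \<omega> \<partial>M)"
  proof -
    have "(\<integral>\<^sup>+ \<omega>\<in>B. ennreal (multiplier * \<psi>c (\<tau> \<omega>) \<omega>) \<partial>M) = (\<integral>\<^sup>+ \<omega>\<in>B. g \<omega> \<partial>M)"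
      using g_eq by (intro nn_integral_cong_AE) (auto elim!: eventually_mono)
    then show ?thesis unfolding cB using tail_le[OF tau B] by simp
  qed
  moreover have "(\<integral>\<^sup>+ \<omega>\<in>B. g \<omega> \<partial>M) < \<infinity>"
  proof -
    have "(\<integral>\<^sup>+ \<omega>\<in>B. g \<omega> \<partial>M) \<le> (\<integral>\<^sup>+ \<omega>\<in>B. c \<omega> \<partial>M)"
      by (intro nn_integral_mono) (auto simp: B_def split: split_indicator)
    also have "\<dots> \<le> (\<integral>\<^sup>+ \<omega>. \<integral>\<^sup>+ t. density t \<omega> \<partial>leb T \<partial>M)"
      unfolding cB tail_integral_def
      by (intro nn_integral_mono) (auto intro!: nn_integral_mono split: split_indicator)
    finally show ?thesis using density_integral_finite by (rule le_less_trans)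
  qed
  ultimately have "AE \<omega> in M. c \<omega> * indicator B \<omega> = g \<omega> * indicator B \<omega>"
    using M BM by (intro nn_integral_le_imp_AE_eq) (auto intro!: AE_I2 simp: B_def split: split_indicator)
  then show ?thesis
    using g_eq AE_space
  proof eventually_elim
    case (elim \<omega>)
    have "c \<omega> \<le> g \<omega>"
    proof (rule ccontr)
      assume "\<not> ?thesis"
      then show False using elim by (auto simp: B_def)
    qed
    then show ?case using elim unfolding c_def by simp
  qed
qed

text \<open>By \<open>marginal_c_eq\<close> the projection and the scaled price have the same finite
  expected integral against \<open>dC\<close>. Both pathwise integrals are then finite almost
  surely, and their difference is integrable with mean 0.\<close>

lemma flat_off_condition:
  obtains Y where "optional_projection T M F (tail_integral T density) Y"
    "AE \<omega> in M. integrable (stieltjes T (\<lambda>t. S t \<omega>)) (\<lambda>t. Y t \<omega> - multiplier * \<psi>c t \<omega>)"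
    "has_bochner_integral M (\<lambda>\<omega>. \<integral>t. (Y t \<omega> - multiplier * \<psi>c t \<omega>) \<partial>stieltjes T (\<lambda>t. S t \<omega>)) 0"
proof -
  obtain Y where Y: "optional_projection T M F (tail_integral T density) Y"
    using optional_projection_tail[OF density_progressive density_integral_finite] .
  note incS = plan_increasing[OF plans_total(1)[OF plans]]
  have opt: "optional T M F Y" and Y_nonneg: "\<And>t \<omega>. t \<le> T \<Longrightarrow> \<omega> \<in> space M \<Longrightarrow> 0 \<le> Y t \<omega>"
    using Y by (auto simp: optional_projection_def)
  have Y_joint: "(\<lambda>(t, \<omega>). ennreal (Y t \<omega>)) \<in> borel_measurable (time T \<Otimes>\<^sub>M M)"
    using optional_joint[OF opt] unfolding case_prod_beta' by simp
  define a where "a \<omega> = (\<integral>\<^sup>+ t. ennreal (Y t \<omega>) \<partial>stieltjes T (\<lambda>t. S t \<omega>))" for \<omega>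
  define b where "b \<omega> = (\<integral>\<^sup>+ t. ennreal (multiplier * \<psi>c t \<omega>) \<partial>stieltjes T (\<lambda>t. S t \<omega>))" for \<omega>
  have a: "a \<in> borel_measurable M" unfolding a_def by (rule stieltjes_integral_measurable[OF incS Y_joint])
  have b: "b \<in> borel_measurable M" unfolding b_def by (rule stieltjes_integral_measurable[OF incS scaled_price_joint])
  have a_int: "(\<integral>\<^sup>+ \<omega>. a \<omega> \<partial>M) = ennreal multiplier * cost_c S"
    unfolding a_def projection_expectation[OF Y] using marginal_c_eq unfolding marginal_c_def .
  have b_int: "(\<integral>\<^sup>+ \<omega>. b \<omega> \<partial>M) = ennreal multiplier * cost_c S"
    unfolding b_def by (rule scaled_cost_c[OF less_imp_le[OF multiplier_pos] incS])
  have fin: "ennreal multiplier * cost_c S < \<infinity>" using cost_c_finite by (simp add: ennreal_mult_less_top)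
  have a_AE: "AE \<omega> in M. a \<omega> \<noteq> \<infinity>" using nn_integral_noteq_infinite[OF a] a_int fin by auto
  have b_AE: "AE \<omega> in M. b \<omega> \<noteq> \<infinity>" using nn_integral_noteq_infinite[OF b] b_int fin by auto
  have key: "AE \<omega> in M. integrable (stieltjes T (\<lambda>t. S t \<omega>)) (\<lambda>t. Y t \<omega> - multiplier * \<psi>c t \<omega>) \<and>
      (\<integral>t. (Y t \<omega> - multiplier * \<psi>c t \<omega>) \<partial>stieltjes T (\<lambda>t. S t \<omega>)) = enn2real (a \<omega>) - enn2real (b \<omega>)"
    using a_AE b_AE psi_c_nonneg AE_space
  proof eventually_elim
    case (elim \<omega>)
    let ?St = "stieltjes T (\<lambda>t. S t \<omega>)"
    have m: "(\<lambda>t. multiplier * \<psi>c t \<omega>) \<in> borel_measurable ?St" "(\<lambda>t. Y t \<omega>) \<in> borel_measurable ?St"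
      using jointly_section[OF progressive_jointly[OF price_progressive[OF prices(2)]] elim(4)]
        jointly_section[OF optional_joint[OF opt] elim(4)]
      by (simp_all add: measurable_cong_sets[OF sets_stieltjes refl])
    have nn: "AE t in ?St. 0 \<le> multiplier * \<psi>c t \<omega>" "AE t in ?St. 0 \<le> Y t \<omega>"
      using elim(3) less_imp_le[OF multiplier_pos] Y_nonneg[OF _ elim(4)] by (auto intro!: AE_I2 mult_nonneg_nonneg)
    have i: "integrable ?St (\<lambda>t. multiplier * \<psi>c t \<omega>)" "integrable ?St (\<lambda>t. Y t \<omega>)"
      using integrableI_nonneg[OF m(1) nn(1)] integrableI_nonneg[OF m(2) nn(2)] elim(1,2)
      unfolding a_def b_def by (simp_all only: infinity_ennreal_def less_top)
    have "(\<integral>t. Y t \<omega> \<partial>?St) = enn2real (a \<omega>)" "(\<integral>t. multiplier * \<psi>c t \<omega> \<partial>?St) = enn2real (b \<omega>)"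
      unfolding a_def b_def
      by (rule integral_eq_nn_integral[OF m(2) nn(2)], rule integral_eq_nn_integral[OF m(1) nn(1)])
    then show ?case
      using Bochner_Integration.integrable_diff[OF i(2,1)] Bochner_Integration.integral_diff[OF i(2,1)] by simp
  qed
  have real: "(\<integral>\<^sup>+ \<omega>. ennreal (enn2real (f \<omega>)) \<partial>M) = (\<integral>\<^sup>+ \<omega>. f \<omega> \<partial>M)" if "AE \<omega> in M. f \<omega> \<noteq> \<infinity>" for f
    using that by (intro nn_integral_cong_AE) (auto elim!: eventually_mono simp: ennreal_enn2real_if)
  have ia: "integrable M (\<lambda>\<omega>. enn2real (a \<omega>))"
    using a fin real[OF a_AE] a_int by (intro integrableI_nonneg) auto
  have ib: "integrable M (\<lambda>\<omega>. enn2real (b \<omega>))"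
    using b fin real[OF b_AE] b_int by (intro integrableI_nonneg) auto
  have "(\<integral>\<omega>. enn2real (a \<omega>) \<partial>M) = (\<integral>\<omega>. enn2real (b \<omega>) \<partial>M)"
    using real[OF a_AE] real[OF b_AE] a_int b_int a b by (simp add: integral_eq_nn_integral)
  then have hb: "has_bochner_integral M (\<lambda>\<omega>. enn2real (a \<omega>) - enn2real (b \<omega>)) 0"
    using ia ib by (simp add: has_bochner_integral_iff)
  have h_eq: "AE \<omega> in M. enn2real (a \<omega>) - enn2real (b \<omega>) =
      (\<integral>t. (Y t \<omega> - multiplier * \<psi>c t \<omega>) \<partial>stieltjes T (\<lambda>t. S t \<omega>))"
    using key by eventually_elim simp
  have m1: "(\<lambda>\<omega>. enn2real (a \<omega>) - enn2real (b \<omega>)) \<in> borel_measurable M" using a b by auto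
  have "has_bochner_integral M (\<lambda>\<omega>. \<integral>t. (Y t \<omega> - multiplier * \<psi>c t \<omega>) \<partial>stieltjes T (\<lambda>t. S t \<omega>)) 0"
    using has_bochner_integral_cong_AE[OF m1 measurable_M_AE_cong[OF m1 h_eq] h_eq] hb by simp
  moreover have "AE \<omega> in M. integrable (stieltjes T (\<lambda>t. S t \<omega>)) (\<lambda>t. Y t \<omega> - multiplier * \<psi>c t \<omega>)"
    using key by eventually_elim simp
  ultimately show ?thesis using that Y by blast
qed

end

context optimal_policy
begin

lemma first_order_x:
  assumes i: "i < n"
  shows "AE z in \<mu>.
    ereal (\<gamma> i * disc (snd z) (fst z)) * partial_x (u i) (x i (snd z) (fst z)) (S (snd z) (fst z))
      \<le> ereal (multiplier * \<psi>x (snd z) (fst z)) \<and>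
    (0 < x i (snd z) (fst z) \<longrightarrow>
      ereal (\<gamma> i * disc (snd z) (fst z)) * partial_x (u i) (x i (snd z) (fst z)) (S (snd z) (fst z))
      = ereal (multiplier * \<psi>x (snd z) (fst z)))"
  using first_order_x_le[OF i] first_order_x_eq[OF i] gradients[unfolded gradients_def] AE_mu_finite AE_space
proof eventually_elim
  case (elim z)
  have px: "partial_x (u i) (x i (snd z) (fst z)) (S (snd z) (fst z)) = enn2ereal (mx i z)"
    using elim i plans_x_nonneg[OF plans i elim(5)] plans_total_nonneg[OF plans elim(5)]
    by (intro partial_x_eq[OF utility_u]) auto
  have "0 \<le> \<gamma> i * disc (snd z) (fst z)" using gamma_pos[OF i] disc_nonneg[of "snd z" "fst z"] by simp
  then have e: "ereal (\<gamma> i * disc (snd z) (fst z)) * enn2ereal (mx i z) = enn2ereal (wgt i z * mx i z)"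
    by (simp add: times_ennreal.rep_eq)
  \<comment> \<open>Nonnegativity of the price is what allows passing from \<open>ennreal\<close>,
    where negative reals become 0, back to \<open>ereal\<close>; times equal to \<infinity> have
    been discarded.\<close>
  have "0 < \<psi>x (snd z) (fst z)"
    using prices(1) elim(4) space_mu[OF elim(5)] by (simp add: price_process_def)
  then have "0 \<le> multiplier * \<psi>x (snd z) (fst z)" "0 \<le> \<psi>x (snd z) (fst z)" using multiplier_pos by auto
  then have p: "ereal (multiplier * \<psi>x (snd z) (fst z)) =
      enn2ereal (ennreal multiplier * ennreal (\<psi>x (snd z) (fst z)))"
    using multiplier_pos by (simp add: ennreal_mult[symmetric])
  show ?case
    unfolding px e p less_eq_ennreal.rep_eq[symmetric] using elim(1,2) by simp
qed

end

theorem proposition3p3: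
  fixes T :: ennreal and n :: nat
    and M :: "'a measure" and F :: "ennreal \<Rightarrow> 'a measure"
    and \<psi>x \<psi>c r :: "'a process"
    and w \<gamma> :: "nat \<Rightarrow> real"
    and u :: "nat \<Rightarrow> real \<times> real \<Rightarrow> real"
    and x C :: "nat \<Rightarrow> 'a process"
  assumes "0 < T" and "1 \<le> n"
    and "usual_conditions T M F"
    and "\<forall>i<n. 0 < w i"
    and "\<forall>i<n. 0 < \<gamma> i" and "(\<Sum>i<n. \<gamma> i) = 1"
    and "assumption_U n T M F \<psi>x \<psi>c r w u"
    and "assumption_P T M F \<psi>x \<psi>c r"
    and "(x, C) \<in> planner_set n T M F \<psi>x \<psi>c (\<Sum>i<n. w i)"
    and "AE (\<omega>, t) in M \<Otimes>\<^sub>M leb T. (\<Sum>j<n. C j t \<omega>) = 0 \<longrightarrow>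
           (\<forall>i<n. has_gradient (u i) (x i t \<omega>) 0)"
  shows "welfare n T M r u \<gamma> x C =
           (SUP (x', C') \<in> planner_set n T M F \<psi>x \<psi>c (\<Sum>i<n. w i). welfare n T M r u \<gamma> x' C')
    \<longleftrightarrow>
    (\<exists>lam>0.
       cost T M \<psi>x \<psi>c (\<lambda>t \<omega>. \<Sum>i<n. x i t \<omega>) (\<lambda>t \<omega>. \<Sum>i<n. C i t \<omega>) = ennreal (\<Sum>i<n. w i) \<and>
       (\<forall>\<tau>\<in>stopping_times T M F. AE \<omega> in M.
          nn_cond_exp M (filtration.pre_sigma (space M) F \<tau>)
            (\<lambda>\<omega>. tail_integral T (marginal_density n r u \<gamma> x C) (\<tau> \<omega>) \<omega>) \<omega>
          \<le> ennreal (lam * \<psi>c (\<tau> \<omega>) \<omega>)) \<and>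
       (\<exists>Y. optional_projection T M F (tail_integral T (marginal_density n r u \<gamma> x C)) Y \<and>
          (AE \<omega> in M. integrable (stieltjes T (\<lambda>t. \<Sum>i<n. C i t \<omega>)) (\<lambda>t. Y t \<omega> - lam * \<psi>c t \<omega>)) \<and>
          has_bochner_integral M
            (\<lambda>\<omega>. \<integral>t. (Y t \<omega> - lam * \<psi>c t \<omega>) \<partial>stieltjes T (\<lambda>t. \<Sum>i<n. C i t \<omega>)) 0) \<and>
       (\<forall>i<n. AE (\<omega>, t) in M \<Otimes>\<^sub>M leb T.
          ereal (\<gamma> i * discount (\<lambda>s. r s \<omega>) t) * partial_x (u i) (x i t \<omega>) (\<Sum>j<n. C j t \<omega>)
            \<le> ereal (lam * \<psi>x t \<omega>) \<and>
          (0 < x i t \<omega> \<longrightarrow>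
             ereal (\<gamma> i * discount (\<lambda>s. r s \<omega>) t) * partial_x (u i) (x i t \<omega>) (\<Sum>j<n. C j t \<omega>)
               = ereal (lam * \<psi>x t \<omega>))))"
proof -
  interpret planner T M F n \<psi>x \<psi>c r w \<gamma> u
    by unfold_locales (use assms in auto)
  interpret policy T M F n \<psi>x \<psi>c r w \<gamma> u x C
    using assms(9,10) unfolding planner_set_iff by unfold_locales auto
  let ?A = "planner_set n T M F \<psi>x \<psi>c (\<Sum>i<n. w i)"
  have S: "(\<lambda>t \<omega>. \<Sum>i<n. C i t \<omega>) = S" "(\<lambda>t \<omega>. \<Sum>i<n. x i t \<omega>) = total x"
    by (simp_all add: total_def fun_eq_iff)
  \<comment> \<open>As the policy is itself admissible, attaining the supremum means that no
    admissible competitor has larger welfare; this is the form used by \<open>optimal_policy\<close>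
    and by \<open>sufficiency\<close>.\<close>
  have optimal_iff: "W = (SUP (x', C') \<in> ?A. welfare n T M r u \<gamma> x' C') \<longleftrightarrow>
      (\<forall>y D. plans y D \<longrightarrow> total_cost y D \<le> ennreal wealth \<longrightarrow> welfare n T M r u \<gamma> y D \<le> W)"
  proof
    assume eq: "W = (SUP (x', C') \<in> ?A. welfare n T M r u \<gamma> x' C')"
    show "\<forall>y D. plans y D \<longrightarrow> total_cost y D \<le> ennreal wealth \<longrightarrow> welfare n T M r u \<gamma> y D \<le> W"
    proof (intro allI impI)
      fix y D assume "plans y D" "total_cost y D \<le> ennreal wealth"
      then have "(y, D) \<in> ?A" by (simp add: planner_set_iff)
      then show "welfare n T M r u \<gamma> y D \<le> W" unfolding eq by (rule SUP_upper2) simp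
    qed
  next
    assume "\<forall>y D. plans y D \<longrightarrow> total_cost y D \<le> ennreal wealth \<longrightarrow> welfare n T M r u \<gamma> y D \<le> W"
    then have "(SUP (x', C') \<in> ?A. welfare n T M r u \<gamma> x' C') \<le> W"
      by (intro SUP_least) (auto simp: planner_set_iff)
    moreover have "W \<le> (SUP (x', C') \<in> ?A. welfare n T M r u \<gamma> x' C')"
      by (rule SUP_upper2[OF assms(9)]) simp
    ultimately show "W = (SUP (x', C') \<in> ?A. welfare n T M r u \<gamma> x' C')" by (rule antisym[rotated])
  qed
  show ?thesis
    unfolding optimal_iff
    unfolding S total_def[symmetric] disc_def[symmetric] wealth_def[symmetric] case_prod_beta' plans_total(2)[OF plans, symmetric]
  proof (intro iffI; (elim exE conjE)?)
    assume opt: "\<forall>y D. plans y D \<longrightarrow> total_cost y D \<le> ennreal wealth \<longrightarrow> welfare n T M r u \<gamma> y D \<le> W"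
    interpret optimal_policy T M F n \<psi>x \<psi>c r w \<gamma> u x C
      using opt by unfold_locales blast
    obtain Y where Y: "optional_projection T M F (tail_integral T density) Y"
      "AE \<omega> in M. integrable (stieltjes T (\<lambda>t. S t \<omega>)) (\<lambda>t. Y t \<omega> - multiplier * \<psi>c t \<omega>)"
      "has_bochner_integral M (\<lambda>\<omega>. \<integral>t. (Y t \<omega> - multiplier * \<psi>c t \<omega>) \<partial>stieltjes T (\<lambda>t. S t \<omega>)) 0"
      by (rule flat_off_condition)
    have c: "AE \<omega> in M. nn_cond_exp M (pre_sigma \<tau>)
        (\<lambda>\<omega>. tail_integral T (marginal_density n r u \<gamma> x C) (\<tau> \<omega>) \<omega>) \<omega> \<le> ennreal (multiplier * \<psi>c (\<tau> \<omega>) \<omega>)"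
      if "\<tau> \<in> stopping_times T M F" for \<tau>
      using first_order_c[OF that] cond_exp_marginal[OF gradients that] by eventually_elim simp
    show "\<exists>lam>0. total_cost x C = ennreal wealth \<and>
       (\<forall>\<tau>\<in>stopping_times T M F. AE \<omega> in M.
          nn_cond_exp M (pre_sigma \<tau>)
            (\<lambda>\<omega>. tail_integral T (marginal_density n r u \<gamma> x C) (\<tau> \<omega>) \<omega>) \<omega>
          \<le> ennreal (lam * \<psi>c (\<tau> \<omega>) \<omega>)) \<and>
       (\<exists>Y. optional_projection T M F (tail_integral T (marginal_density n r u \<gamma> x C)) Y \<and>
          (AE \<omega> in M. integrable (stieltjes T (\<lambda>t. S t \<omega>)) (\<lambda>t. Y t \<omega> - lam * \<psi>c t \<omega>)) \<and>
          has_bochner_integral M (\<lambda>\<omega>. \<integral>t. (Y t \<omega> - lam * \<psi>c t \<omega>) \<partial>stieltjes T (\<lambda>t. S t \<omega>)) 0) \<and>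
       (\<forall>i<n. AE z in \<mu>.
          ereal (\<gamma> i * disc (snd z) (fst z)) * partial_x (u i) (x i (snd z) (fst z)) (S (snd z) (fst z))
            \<le> ereal (lam * \<psi>x (snd z) (fst z)) \<and>
          (0 < x i (snd z) (fst z) \<longrightarrow>
             ereal (\<gamma> i * disc (snd z) (fst z)) * partial_x (u i) (x i (snd z) (fst z)) (S (snd z) (fst z))
               = ereal (lam * \<psi>x (snd z) (fst z))))"
      using multiplier_pos budget_binding c Y first_order_x
      unfolding optional_projection_marginal[OF gradients] by (intro exI[of _ multiplier]) blast
  next
    fix lam Y
    assume conditions: "0 < lam" "total_cost x C = ennreal wealth"
      "\<forall>\<tau>\<in>stopping_times T M F. AE \<omega> in M.
          nn_cond_exp M (pre_sigma \<tau>)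
            (\<lambda>\<omega>. tail_integral T (marginal_density n r u \<gamma> x C) (\<tau> \<omega>) \<omega>) \<omega>
          \<le> ennreal (lam * \<psi>c (\<tau> \<omega>) \<omega>)"
      "optional_projection T M F (tail_integral T (marginal_density n r u \<gamma> x C)) Y"
      "AE \<omega> in M. integrable (stieltjes T (\<lambda>t. S t \<omega>)) (\<lambda>t. Y t \<omega> - lam * \<psi>c t \<omega>)"
      "has_bochner_integral M (\<lambda>\<omega>. \<integral>t. (Y t \<omega> - lam * \<psi>c t \<omega>) \<partial>stieltjes T (\<lambda>t. S t \<omega>)) 0"
      "\<forall>i<n. AE z in \<mu>.
          ereal (\<gamma> i * disc (snd z) (fst z)) * partial_x (u i) (x i (snd z) (fst z)) (S (snd z) (fst z))
            \<le> ereal (lam * \<psi>x (snd z) (fst z)) \<and>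
          (0 < x i (snd z) (fst z) \<longrightarrow>
             ereal (\<gamma> i * disc (snd z) (fst z)) * partial_x (u i) (x i (snd z) (fst z)) (S (snd z) (fst z))
               = ereal (lam * \<psi>x (snd z) (fst z)))"
    show "\<forall>y D. plans y D \<longrightarrow> total_cost y D \<le> ennreal wealth \<longrightarrow> welfare n T M r u \<gamma> y D \<le> W"
      using sufficiency[OF conditions(1,2) conditions(3)[rule_format] conditions(4,5,6) conditions(7)[rule_format]] by blast
  qed
qed

end
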